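(* Assume the following. (1) There exist $\alpha\in(0,1/2)$ and a measurable function $V:\mathsf X\to[1,\infty)$ with $\sup_{x\in\mathsf X_0}V(x)<\infty$ such that for every compact subset $\mathsf K$ of $\Theta$: there are $b,c\in(0,\infty)$ (depending on $\mathsf K$) with $P_\theta V(x)\le V(x)-cV^{1-\alpha}(x)+b$ for all $(x,\theta)\in\mathsf X\times\mathsf K$; and for any $\beta'\in[0,1-\alpha]$ and $\kappa'\in[0,\alpha^{-1}(1-\beta')-1]$ there is a finite constant $C=C(V,\kappa',\beta',\mathsf K)$ such that $(n+1)^{\kappa'}\|P_\theta^n(x,\cdot)-\pi(\cdot)\|_{V^{\beta'}}\le C\,V^{\beta'+\alpha\kappa'}(x)$ for all $n\ge 0$ and $(x,\theta)\in\mathsf X\times\mathsf K$. (2) $\check{\mathbb P}(\sup_{n\ge0}\nu_n<\infty)=1$, and there exists a $\Theta$-valued random variable $\theta_\star$ such that, with $\check{\mathbb P}$-probability one, $\{\theta_n,n\ge0\}$ remains in a (sample-path dependent) compact subset of $\Theta$ and $\lim_{n\to\infty}D_{\beta'}(\theta_n,\theta_\star)=0$ for any $\beta'\in[0,1-\alpha]$. (3) $\beta\in[0,\tfrac12-\alpha)$, $f\in\mathcal L_{V^\beta}$ with $\pi(f)=0$; $\kappa>1$ and $\delta\in(0,1)$ satisfy $2\beta+\alpha(\kappa+\delta)<1-\alpha$; $\rho\in(\tfrac12,\tfrac1{2-\delta}]$; and $\{a_n,n\ge0\}$ is a sequence of numbers in $(0,1/2]$ with $a_n\propto n^{-\rho}$.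 (4) For any $(x,\theta,b,l)\in\mathsf X_0\times\Theta_0\times[0,1-\alpha]\times\mathbb N$, $$\mathbb E^{(l)}_{x,\theta}\Big[\sum_{k\ge1}\mathbf 1_{\{\tau_{\mathsf K_l}>k\}}\,k^{-1+\rho(2-\delta)}D_b(\tilde\theta_k,\tilde\theta_{k-1})V^{2\beta+\alpha(\kappa+\delta)}(\tilde X_k)\Big]<\infty.$$ (5) $$\lim_{n\to\infty}\frac1n\sum_{k=1}^n\Big(g_{a_n}^2(X_k,\theta_{k-1})-P_{\theta_{k-1}}g_{a_n}^2(X_k,\theta_{k-1})\Big)=0\quad\text{in }\check{\mathbb P}\text{-probability}.$$ Then there exists a nonnegative random variable $\sigma_\star^2(f)$ such that $n^{-1/2}\sum_{k=1}^nf(X_k)$ converges weakly to a random variable $Z$ with characteristic function $\phi(t)=\check{\mathbb E}\big[\exp\big(-\tfrac{\sigma_\star^2(f)}2t^2\big)\big]$. Moreover, $$\sigma_\star^2(f)=\int\pi(dx)\{2f(x)g(x,\theta_\star)-f^2(x)\}\quad\check{\mathbb P}\text{-a.s.}$$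
   Context: Notation. $\mathbb N$ is the set of nonnegative integers. For $V:\mathsf X\to[1,\infty)$ and $f:\mathsf X\to\mathbb R$, $|f|_V=\sup_{\mathsf X}|f|/V$; $\mathcal L_V$ is the set of measurable $f$ with $|f|_V<\infty$; for a signed measure $\mu$, $\|\mu\|_V=\sup_{|g|_V\le1}|\mu(g)|$. $P^n$ denotes the $n$-th iterate of a kernel $P$, and $Pf(x)=\int P(x,dy)f(y)$. Setting. $(\mathsf X,\mathcal X)$ is a measurable space with countably generated $\sigma$-field; $\Theta$ is an open subset of $\mathbb R^q$ with Borel $\sigma$-field $\mathcal B(\Theta)$; $\{P_\theta,\theta\in\Theta\}$ are Markov kernels on $\mathsf X$ with $\theta\mapsto P_\theta(x,A)$ measurable for all $(x,A)$, all having the same invariant probability distribution $\pi$. $\{\mathsf K_n,n\ge0\}$ are nonempty compact subsets of $\Theta$ with $\mathsf K_n\subseteq\mathsf K_{n+1}$. $\mathsf X_0\times\Theta_0$ is a measurable subset of $\mathsf X\times\Theta$ and $\Pi:\mathsf X\times\Theta\to\mathsf X_0\times\Theta_0$ is measurable with $\Pi(x,\theta)=(x,\theta)$ on $\mathsf X_0\times\Theta_0$. Set $\Pi_0=\Pi$ and $\Pi_k(x,\theta)=(x,\theta)$ for $k\ge1$. $\{\bar R(n;\cdot,\cdot),n\ge0\}$ are Markov kernels on $\mathsf X\times\Theta$ with $\bar R(n;(x,\theta),A\times\Theta)=P_\theta(x,A)$ for all $n,x,\theta,A\in\mathcal X$. Adaptive chain. $\{(X_n,\theta_n,\nu_n,\xi_n),n\ge0\}$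 is the Markov chain on $\mathsf X\times\Theta\times\mathbb N\times\mathbb N$ evolving as follows: given $(X_n,\theta_n,\nu_n,\xi_n)$, draw $(X_{n+1},\theta_{n+1})\sim\bar R(\nu_n+\xi_n;\Pi_{\xi_n}(X_n,\theta_n),\cdot)$; if $\theta_{n+1}\in\mathsf K_{\nu_n}$ set $\nu_{n+1}=\nu_n$, $\xi_{n+1}=\xi_n+1$; otherwise set $\nu_{n+1}=\nu_n+1$, $\xi_{n+1}=0$. Its initial state is $(x_0,\theta_0,0,0)$ for a fixed $(x_0,\theta_0)\in\mathsf X_0\times\Theta_0$; $\check{\mathbb P},\check{\mathbb E}$ are the corresponding probability and expectation. Re-projection free process. For $l\in\mathbb N$, $\mathbb P^{(l)}_{x,\theta}$ and $\mathbb E^{(l)}_{x,\theta}$ are the distribution and expectation of the nonhomogeneous Markov chain $\{(\tilde X_n,\tilde\theta_n),n\ge0\}$ started at $(x,\theta)$ whose transition kernel from time $n$ to $n+1$ is $\bar R(l+n;\cdot,\cdot)$. For compact $\mathsf K\subset\Theta$, $\tau_{\mathsf K}=\inf\{k\ge1:\tilde\theta_k\notin\mathsf K\}$ ($\inf\emptyset=\infty$). Pseudo-metric (depending on $V$): for $\beta\in[0,1]$, $D_\beta(\theta,\theta')=\sup_{|f|_{V^\beta}\le1}\sup_{x\in\mathsf X}|P_\theta f(x)-P_{\theta'}f(x)|/V^\beta(x)$. Resolvents: for $a\in[0,1/2]$, $g_a(x,\theta)=\sum_{j\ge0}(1-a)^{j+1}P_\theta^jf(x)$ and $g=g_0$;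 $P_\theta g_a^2(x,\theta)$ means $\int P_\theta(x,dz)g_a^2(z,\theta)$. *)

theory Defs
  imports "HOL-Probability.Probability"
begin

section \<open>Weighted norms and iterated kernels\<close>

text \<open>
  A Markov kernel on a measurable space \<open>S\<close> is an element of
  \<open>measurable S (prob_algebra S)\<close>; its value at \<open>x\<close> is the probability measure \<open>P(x, dy)\<close>.
  Suprema of nonnegative quantities are taken in \<open>ennreal\<close>, so that they may be infinite.
\<close>

definition countably_generated :: "'a measure \<Rightarrow> bool" where
  "countably_generated S \<longleftrightarrow>
     (\<exists>G. countable G \<and> G \<subseteq> Pow (space S) \<and> sets S = sigma_sets (space S) G)"

definition wnorm :: "'a measure \<Rightarrow> ('a \<Rightarrow> real) \<Rightarrow> ('a \<Rightarrow> real) \<Rightarrow> ennreal" where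
  "wnorm S W f = (SUP x\<in>space S. ennreal (\<bar>f x\<bar> / W x))"

definition LW :: "'a measure \<Rightarrow> ('a \<Rightarrow> real) \<Rightarrow> ('a \<Rightarrow> real) set" where
  "LW S W = {f \<in> borel_measurable S. wnorm S W f < \<infinity>}"

text \<open>
  The \<open>W\<close>-norm of the signed measure \<open>\<mu> - \<nu>\<close>.  This is meaningful when \<open>W\<close> is integrable
  under both \<open>\<mu>\<close> and \<open>\<nu>\<close> (a non-integrable function has Bochner integral 0).
\<close>

definition wdist :: "'a measure \<Rightarrow> ('a \<Rightarrow> real) \<Rightarrow> 'a measure \<Rightarrow> 'a measure \<Rightarrow> ennreal" where
  "wdist S W \<mu> \<nu> =
     (SUP g\<in>{g \<in> borel_measurable S. wnorm S W g \<le> 1}.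
        ennreal \<bar>(\<integral>y. g y \<partial>\<mu>) - (\<integral>y. g y \<partial>\<nu>)\<bar>)"

primrec kernel_pow :: "'a measure \<Rightarrow> ('a \<Rightarrow> 'a measure) \<Rightarrow> nat \<Rightarrow> 'a \<Rightarrow> 'a measure" where
  "kernel_pow S Q 0 = return S"
| "kernel_pow S Q (Suc n) = (\<lambda>x. bind (Q x) (kernel_pow S Q n))"

definition kernel_D ::
  "'a measure \<Rightarrow> ('p \<Rightarrow> 'a \<Rightarrow> 'a measure) \<Rightarrow> ('a \<Rightarrow> real) \<Rightarrow> real \<Rightarrow> 'p \<Rightarrow> 'p \<Rightarrow> ennreal" where
  "kernel_D S P V \<beta> \<theta> \<theta>' =
     (SUP f\<in>{f \<in> borel_measurable S. wnorm S (\<lambda>x. V x powr \<beta>) f \<le> 1}.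
        SUP x\<in>space S.
          ennreal (\<bar>(\<integral>y. f y \<partial>P \<theta> x) - (\<integral>y. f y \<partial>P \<theta>' x)\<bar> / V x powr \<beta>))"

definition resolvent ::
  "'a measure \<Rightarrow> ('p \<Rightarrow> 'a \<Rightarrow> 'a measure) \<Rightarrow> ('a \<Rightarrow> real) \<Rightarrow> real \<Rightarrow> 'a \<Rightarrow> 'p \<Rightarrow> real" where
  "resolvent S P f a x \<theta> =
     (\<Sum>j. (1 - a) ^ (j + 1) * (\<integral>y. f y \<partial>kernel_pow S (P \<theta>) j x))"


section \<open>Laws of Markov chains\<close>

text \<open>
  The Markov chain on \<open>S\<close> started at \<open>z\<close> whose transition kernel from time \<open>n\<close> to \<open>n + 1\<close> is
  \<open>Q n\<close>.  The library's Ionescu-Tulcea construction takes, for each time \<open>i\<close>, the conditional law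
  of the state at time \<open>i\<close> given the states at the times \<open>0, \<dots>, i - 1\<close>.
\<close>

definition chain_step ::
  "'s measure \<Rightarrow> (nat \<Rightarrow> 's \<Rightarrow> 's measure) \<Rightarrow> 's \<Rightarrow> nat \<Rightarrow> (nat \<Rightarrow> 's) \<Rightarrow> 's measure" where
  "chain_step S Q z i w = (case i of 0 \<Rightarrow> return S z | Suc n \<Rightarrow> Q n (w n))"

definition chain_law ::
  "'s measure \<Rightarrow> (nat \<Rightarrow> 's \<Rightarrow> 's measure) \<Rightarrow> 's \<Rightarrow> (nat \<Rightarrow> 's) measure" where
  "chain_law S Q z =
     projective_family.lim UNIV (Ionescu_Tulcea.CI (chain_step S Q z) (\<lambda>_. S)) (\<lambda>_. S)"

lemma Ionescu_Tulcea_chain_step: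
  assumes Q: "\<And>n. Q n \<in> measurable S (prob_algebra S)" and z: "z \<in> space S"
  shows "Ionescu_Tulcea (chain_step S Q z) (\<lambda>_. S)"
proof (rule Ionescu_Tulcea.intro)
  have Q': "Q n \<in> measurable S (subprob_algebra S)" for n
    using Q by (rule measurable_prob_algebraD)
  show "chain_step S Q z i \<in> measurable (PiM {0..<i} (\<lambda>_. S)) (subprob_algebra S)" for i
  proof (cases i)
    case 0
    have "return S z \<in> space (subprob_algebra S)"
      using measurable_space[OF return_measurable z] .
    then show ?thesis using 0 by (simp add: chain_step_def[abs_def])
  next
    case (Suc n)
    have "(\<lambda>w. Q n (w n)) \<in> measurable (PiM {0..<Suc n} (\<lambda>_. S)) (subprob_algebra S)"
      by (rule measurable_compose[where g="Q n", OF _ Q']) (rule measurable_component_singleton, simp)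
    then show ?thesis using Suc by (simp add: chain_step_def[abs_def])
  qed
  fix i :: nat and w assume w: "w \<in> space (PiM {0..<i} (\<lambda>_. S))"
  show "prob_space (chain_step S Q z i w)"
  proof (cases i)
    case 0
    then show ?thesis using prob_space_return[OF z] by (simp add: chain_step_def)
  next
    case (Suc n)
    with w have "w n \<in> space S" by (auto simp: space_PiM PiE_iff)
    with measurable_space[OF Q, of "w n" n] have "prob_space (Q n (w n))"
      by (simp add: space_prob_algebra)
    then show ?thesis using Suc by (simp add: chain_step_def)
  qed
qed

lemma
  assumes "\<And>n. Q n \<in> measurable S (prob_algebra S)" and "z \<in> space S"
  shows prob_space_chain_law: "prob_space (chain_law S Q z)"
    and sets_chain_law: "sets (chain_law S Q z) = sets (PiM UNIV (\<lambda>_. S))"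
    and emeasure_chain_law:
      "\<And>n A. A \<in> sets (PiM {0..<n} (\<lambda>_. S)) \<Longrightarrow>
         emeasure (chain_law S Q z) (prod_emb UNIV (\<lambda>_. S) {0..<n} A)
         = emeasure (Ionescu_Tulcea.C (chain_step S Q z) (\<lambda>_. S) 0 n (\<lambda>_. undefined)) A"
proof -
  interpret Ionescu_Tulcea "chain_step S Q z" "\<lambda>_. S"
    by (rule Ionescu_Tulcea_chain_step) fact+
  show "sets (chain_law S Q z) = sets (PiM UNIV (\<lambda>_. S))"
    unfolding chain_law_def by simp
  show *: "emeasure (chain_law S Q z) (prod_emb UNIV (\<lambda>_. S) {0..<n} A)
      = emeasure (C 0 n (\<lambda>_. undefined)) A" if "A \<in> sets (PiM {0..<n} (\<lambda>_. S))" for n A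
    unfolding chain_law_def using that
    by (simp add: lim emeasure_CI[of "{0..<n}" n] prod_emb_id sets.sets_into_space[OF that, unfolded space_PiM])
  show "prob_space (chain_law S Q z)"
  proof
    have "emeasure (chain_law S Q z) (prod_emb UNIV (\<lambda>_. S) {0..<0} (space (PiM {0..<0} (\<lambda>_. S))))
        = emeasure (C 0 0 (\<lambda>_. undefined)) (space (PiM {0..<0} (\<lambda>_. S)))"
      by (rule *) auto
    also have "\<dots> = 1"
      using prob_space.emeasure_space_1[OF prob_space_C[of "\<lambda>_. undefined" 0 0]]
      by (simp add: space_PiM)
    finally show "emeasure (chain_law S Q z) (space (chain_law S Q z)) = 1"
      by (simp add: chain_law_def prod_emb_def space_PiM PF.space_lim restrict_def)
  qed
qed

definition is_markov_chain ::
  "'w measure \<Rightarrow> 's measure \<Rightarrow> (nat \<Rightarrow> 's \<Rightarrow> 's measure) \<Rightarrow> 's \<Rightarrow> (nat \<Rightarrow> 'w \<Rightarrow> 's) \<Rightarrow> bool" where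
  "is_markov_chain M S Q z Z \<longleftrightarrow>
     (\<forall>n. Z n \<in> measurable M S) \<and>
     distr M (PiM UNIV (\<lambda>_. S)) (\<lambda>\<omega> n. Z n \<omega>) = chain_law S Q z"

definition exit_time :: "'p set \<Rightarrow> (nat \<Rightarrow> 'a \<times> 'p) \<Rightarrow> enat" where
  "exit_time C w = (INF k\<in>{k. 1 \<le> k \<and> snd (w k) \<notin> C}. enat k)"


section \<open>The adaptive chain with re-projections\<close>

definition param_space :: "'p::topological_space set \<Rightarrow> 'p measure" where
  "param_space \<Theta> = restrict_space borel \<Theta>"

definition adaptive_space ::
  "'a measure \<Rightarrow> 'p::topological_space set \<Rightarrow> ('a \<times> 'p \<times> nat \<times> nat) measure" where
  "adaptive_space S \<Theta> =
     S \<Otimes>\<^sub>M (param_space \<Theta> \<Otimes>\<^sub>M (count_space UNIV \<Otimes>\<^sub>M count_space UNIV))"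

definition adaptive_kernel ::
  "'a measure \<Rightarrow> 'p::topological_space set \<Rightarrow> (nat \<Rightarrow> 'p set) \<Rightarrow> ('a \<times> 'p \<Rightarrow> 'a \<times> 'p) \<Rightarrow>
   (nat \<Rightarrow> 'a \<times> 'p \<Rightarrow> ('a \<times> 'p) measure) \<Rightarrow>
   'a \<times> 'p \<times> nat \<times> nat \<Rightarrow> ('a \<times> 'p \<times> nat \<times> nat) measure" where
  "adaptive_kernel S \<Theta> K proj R = (\<lambda>(x, \<theta>, \<nu>, \<xi>).
     distr (R (\<nu> + \<xi>) (if \<xi> = 0 then proj (x, \<theta>) else (x, \<theta>))) (adaptive_space S \<Theta>)
       (\<lambda>(x', \<theta>'). if \<theta>' \<in> K \<nu> then (x', \<theta>', \<nu>, \<xi> + 1) else (x', \<theta>', \<nu> + 1, 0)))"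

lemma measurable_adaptive_kernel:
  assumes K: "\<And>n. K n \<subseteq> \<Theta>" "\<And>n. closed (K n)"
    and proj: "proj \<in> measurable (S \<Otimes>\<^sub>M param_space \<Theta>)
      (restrict_space (S \<Otimes>\<^sub>M param_space \<Theta>) (X0 \<times> \<Theta>0))"
    and R: "\<And>n. R n \<in> measurable (S \<Otimes>\<^sub>M param_space \<Theta>)
      (prob_algebra (S \<Otimes>\<^sub>M param_space \<Theta>))"
  shows "adaptive_kernel S \<Theta> K proj R
    \<in> measurable (adaptive_space S \<Theta>) (prob_algebra (adaptive_space S \<Theta>))"
proof -
  let ?N = "S \<Otimes>\<^sub>M param_space \<Theta>"
  have [measurable]: "proj \<in> measurable ?N ?N"
    using proj by (simp add: measurable_restrict_space2_iff)
  have [measurable]: "K n \<in> sets (param_space \<Theta>)" for n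
    using K[of n] borel_closed unfolding param_space_def by (auto simp: sets_restrict_space image_iff)
  note [measurable] = R
  have *: "(\<lambda>z. R (\<nu> + \<xi>) (if \<xi> = 0 then proj z else z)) \<in> measurable ?N (prob_algebra ?N)" for \<nu> \<xi>
    by (cases "\<xi> = 0") simp_all
  have [measurable]: "(\<lambda>(x', \<theta>'). if \<theta>' \<in> K \<nu> then (x', \<theta>', \<nu>, \<xi> + 1) else (x', \<theta>', \<nu> + 1, 0))
      \<in> measurable ?N (adaptive_space S \<Theta>)" for \<nu> \<xi> :: nat
    unfolding adaptive_space_def by measurable
  have **: "(\<lambda>z. distr (R (\<nu> + \<xi>) (if \<xi> = 0 then proj z else z)) (adaptive_space S \<Theta>)
       (\<lambda>(x', \<theta>'). if \<theta>' \<in> K \<nu> then (x', \<theta>', \<nu>, \<xi> + 1) else (x', \<theta>', \<nu> + 1, 0)))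
      \<in> measurable ?N (prob_algebra (adaptive_space S \<Theta>))" for \<nu> \<xi>
    by (rule measurable_distr_prob_space2[OF *]) measurable
  have "(\<lambda>y. (\<lambda>(\<nu>, \<xi>) y. distr (R (\<nu> + \<xi>) (if \<xi> = 0 then proj (fst y, fst (snd y)) else (fst y, fst (snd y)))) (adaptive_space S \<Theta>)
       (\<lambda>(x', \<theta>'). if \<theta>' \<in> K \<nu> then (x', \<theta>', \<nu>, \<xi> + 1) else (x', \<theta>', \<nu> + 1, 0)))
         (snd (snd y)) y)
      \<in> measurable (adaptive_space S \<Theta>) (prob_algebra (adaptive_space S \<Theta>))"
  proof (rule measurable_compose_countable)
    have "(\<lambda>y. snd (snd y)) \<in> measurable (adaptive_space S \<Theta>) (count_space UNIV \<Otimes>\<^sub>M count_space UNIV)"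
      unfolding adaptive_space_def by measurable
    then show "(\<lambda>y. snd (snd y)) \<in> measurable (adaptive_space S \<Theta>) (count_space (UNIV :: (nat \<times> nat) set))"
      by (simp add: pair_measure_countable)
    have "(\<lambda>y. (fst y, fst (snd y))) \<in> measurable (adaptive_space S \<Theta>) ?N"
      unfolding adaptive_space_def by measurable
    from measurable_compose[OF this **]
    show "(\<lambda>(\<nu>, \<xi>) y. distr (R (\<nu> + \<xi>) (if \<xi> = 0 then proj (fst y, fst (snd y)) else (fst y, fst (snd y)))) (adaptive_space S \<Theta>)
       (\<lambda>(x', \<theta>'). if \<theta>' \<in> K \<nu> then (x', \<theta>', \<nu>, \<xi> + 1) else (x', \<theta>', \<nu> + 1, 0))) i
      \<in> measurable (adaptive_space S \<Theta>) (prob_algebra (adaptive_space S \<Theta>))" for i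
      by (cases i) simp
  qed
  then show ?thesis
    by (simp add: adaptive_kernel_def split_beta')
qed

end

theory Submission
  imports Defs
begin

text \<open>
 The process is localized. On events \<open>E\<close> whose probability can be made arbitrarily close to one, the
 parameters stay in one compact set \<open>C\<close> from the start, no re-projection takes place after a fixed
 time \<open>m\<close>, and \<open>V (X m)\<close> is bounded. From time \<open>m\<close> on, as long as this holds, the state moves by the
 kernel of its current parameter, with drift and ergodicity constants that depend on \<open>C\<close> only. A
 central limit theorem whose error is controlled by \<open>1 - prob E\<close> on each such event gives the
 theorem, because the characteristic functions of the normalized sums then converge, to that of a
 Gaussian mixture.

 On \<open>E\<close> the sum is compared with a martingale. With \<open>a\<^sub>n\<close> of order \<open>n\<close> to the power \<open>-\<rho>\<close>, the
 resolvent \<open>g\<close> of \<open>f\<close> solves \<open>f = g / (1 - a\<^sub>n) - P g\<close>. Hence \<open>\<Sum>f\<close> is a sum of martingale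
 differences \<open>D\<^sub>k = g(X\<^sub>k\<^sub>+\<^sub>1, \<theta>\<^sub>k) - P g(X\<^sub>k, \<theta>\<^sub>k)\<close>, up to a boundary term, a term of order
 \<open>a\<^sub>n \<Sum>\<bar>g\<bar>\<close>, which is \<open>o(\<surd>n)\<close> because \<open>\<rho> > 1/2\<close>, and the changes
 \<open>g(X\<^sub>k\<^sub>+\<^sub>1, \<theta>\<^sub>k\<^sub>+\<^sub>1) - g(X\<^sub>k\<^sub>+\<^sub>1, \<theta>\<^sub>k)\<close>. The latter are bounded by a power of \<open>1 / a\<^sub>n\<close> times
 \<open>D\<^sub>b(\<theta>\<^sub>k\<^sub>+\<^sub>1, \<theta>\<^sub>k)\<close> (\<open>resolvent_parameter_change\<close>), and diminishing adaptation makes their sum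
 \<open>o(\<surd>n)\<close> (\<open>martingale_approximation_null\<close>).

 The differences satisfy \<open>\<Sum>D\<^sub>k\<^sup>2 / n \<rightarrow> \<sigma>\<^sup>2(\<theta>\<^sub>\<star>)\<close> in probability on \<open>E\<close> (\<open>quadratic_variation_null\<close>).
 Indeed \<open>D\<^sub>k\<^sup>2 = g\<^sup>2 - (P g)\<^sup>2 - 2 (P g) D\<^sub>k\<close> telescopes, up to parameter changes and terms with a
 factor \<open>a\<^sub>n\<close>, to averages of \<open>2 f g / (1 - a\<^sub>n) - f\<^sup>2\<close> and to the martingale \<open>\<Sum>(P g) D\<^sub>k\<close>. The
 averages converge by a law of large numbers along the adapted parameters (\<open>lln_bounded\<close>,
 \<open>hh_average_null\<close>). The martingale is \<open>o(n)\<close> by a stopping argument in which its own identity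
 bounds the energy \<open>\<Sum>D\<^sub>k\<^sup>2\<close> (\<open>stopped_energy\<close>, \<open>cross_term_null\<close>). The maximum of \<open>V\<close> up to time \<open>n\<close>
 has moments of every order \<open>s < 1\<close> of size \<open>n\<close> to the power \<open>s\<close>, by the maximal inequality for the
 drift; this makes the jumps negligible, and McLeish's product method (\<open>mcleish_clt_on_event\<close>)
 applies.

 Diminishing adaptation is given for the re-projection free process. The excursion of the adaptive
 chain after its last re-projection is such a process, started in \<open>X0 \<times> \<Theta>0\<close> and killed when the
 parameter leaves a set \<open>K l\<close>; \<open>killed_cost\<close> expresses the expected cost of both by the same
 recursion (\<open>diminishing_adaptation_series\<close>). Since \<open>kernel_D\<close> is a supremum over an uncountable
 family, it may fail to be measurable in the parameters; what is transferred is the almost sure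
 finiteness of the series for every measurable function below \<open>kernel_D\<close>.
\<close>

text \<open>
 Most estimates are chains of inequalities between integrals of products; these input forms, among
 them the analogue of \<open>LINT\<close> for the nonnegative integral, keep them readable. \<open>SP\<close> is the space of
 the pairs of a state and a parameter.
\<close>

syntax "_NNI" :: "pttrn \<Rightarrow> 'a measure \<Rightarrow> ennreal \<Rightarrow> ennreal" ("(3NNI (1_)/|(_)./ _)" [0,110,60] 60)
translations "NNI x|M. f" => "CONST nn_integral M (\<lambda>x. f)"

notation (input) LIMSEQ ("((_)/ ----> (_))" [60, 60] 60)

abbreviation (input) eventually_seq (binder "EV " 10) where "eventually_seq A \<equiv> eventually A sequentially"

abbreviation (input) ind where "ind \<equiv> indicator"

abbreviation (input) meas where "meas \<equiv> borel_measurable"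

abbreviation (input) cor where "cor \<equiv> complex_of_real"

abbreviation (input) SP where "SP S \<Theta> \<equiv> S \<Otimes>\<^sub>M param_space \<Theta>"

section \<open>Convergence to zero in probability\<close>

text \<open>
 One \<open>eps\<close> for the threshold and for the probability: equivalent to convergence to zero in
 probability, with a single eventual inequality to prove.
\<close>

definition (in prob_space) null_in_prob :: "(nat => 'a => real) => bool" where
 "null_in_prob Y \<longleftrightarrow> (\<forall>eps>0. EV n. prob {w : space M. eps < \<bar>Y n w\<bar>} <= eps)"

context prob_space begin

lemma null_in_probI:
 "(!!eps. 0 < eps ==> EV n. prob {w : space M. eps < \<bar>Y n w\<bar>} <= eps) ==> null_in_prob Y"
 by (simp add: null_in_prob_def)

lemma null_in_probD:
 "null_in_prob Y ==> 0 < eps ==> EV n. prob {w : space M. eps < \<bar>Y n w\<bar>} <= eps"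
 by (simp add: null_in_prob_def)

lemma null_in_prob_add:
 assumes [measurable]: "!!n. Y n : meas M" "!!n. Y' n : meas M"
  and Y: "null_in_prob Y" "null_in_prob Y'"
 shows "null_in_prob (%n w. Y n w + Y' n w)"
proof (rule null_in_probI)
 fix eps :: real assume e: "0 < eps"
 from null_in_probD[OF Y(1), of "eps/2"] null_in_probD[OF Y(2), of "eps/2"] e
 have "EV n. prob {w : space M. eps/2 < \<bar>Y n w\<bar>} <= eps/2
   \<and> prob {w : space M. eps/2 < \<bar>Y' n w\<bar>} <= eps/2" by (auto intro: eventually_conj)
 then show "EV n. prob {w : space M. eps < \<bar>Y n w + Y' n w\<bar>} <= eps"
 proof (rule eventually_mono)
  fix n assume *: "prob {w : space M. eps/2 < \<bar>Y n w\<bar>} <= eps/2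
   \<and> prob {w : space M. eps/2 < \<bar>Y' n w\<bar>} <= eps/2"
  have "prob {w : space M. eps < \<bar>Y n w + Y' n w\<bar>} <=
   prob ({w : space M. eps/2 < \<bar>Y n w\<bar>} \<union> {w : space M. eps/2 < \<bar>Y' n w\<bar>})"
   by (intro finite_measure_mono) auto
  also have "... <= prob {w : space M. eps/2 < \<bar>Y n w\<bar>} + prob {w : space M. eps/2 < \<bar>Y' n w\<bar>}"
   by (rule measure_Un_le) auto
  finally show "prob {w : space M. eps < \<bar>Y n w + Y' n w\<bar>} <= eps" using * by simp
 qed
qed

lemma null_in_prob_dominated:
 assumes [measurable]: "!!n. Y n : meas M"
  and Y: "null_in_prob Y" and c: "0 < c"
  and le: "EV n. AE w in M. \<bar>Y' n w\<bar> <= c * \<bar>Y n w\<bar>"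
 shows "null_in_prob Y'"
proof (rule null_in_probI)
 fix eps :: real assume e: "0 < eps"
 define \<eta> where "\<eta> = min eps (eps / c)"
 have \<eta>: "0 < \<eta>" "\<eta> <= eps" "c * \<eta> <= eps" using e c by (auto simp: \<eta>_def min_def field_simps)
 from null_in_probD[OF Y \<eta>(1)] le
 show "EV n. prob {w : space M. eps < \<bar>Y' n w\<bar>} <= eps"
 proof eventually_elim
  case (elim n)
  have "prob {w : space M. eps < \<bar>Y' n w\<bar>} <= prob {w : space M. \<eta> < \<bar>Y n w\<bar>}"
  proof (rule finite_measure_mono_AE)
   show "AE x in M. x : {w : space M. eps < \<bar>Y' n w\<bar>} --> x : {w : space M. \<eta> < \<bar>Y n w\<bar>}"
    using elim(2)
   proof eventually_elim
    case (elim x)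
    { assume "eps < \<bar>Y' n x\<bar>" "\<bar>Y n x\<bar> <= \<eta>"
     then have "\<bar>Y' n x\<bar> <= c * \<eta>" using elim c by (meson mult_left_mono order.trans less_imp_le)
     with \<open>eps < \<bar>Y' n x\<bar>\<close> \<eta> have False by simp }
    then show ?case by force
   qed
  qed measurable
  with elim \<eta> show ?case by linarith
 qed
qed

lemma null_in_prob_cmult:
 assumes [measurable]: "!!n. Y n : meas M" and "null_in_prob Y"
 shows "null_in_prob (%n w. c * Y n w)"
 by (rule null_in_prob_dominated[OF assms, of "\<bar>c\<bar> + 1"]) (auto simp: abs_mult intro!: mult_right_mono always_eventually AE_I2)

lemma null_in_prob_L1:
 assumes [measurable]: "!!n. Y n : meas M"
  and le: "!!n. (NNI w|M. ennreal \<bar>Y n w\<bar>) <= ennreal (c n)" and c: "c ----> 0"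
 shows "null_in_prob Y"
proof (rule null_in_probI)
 fix eps :: real assume e: "0 < eps"
 have "EV n. c n < eps * eps" using c e by (auto intro: order_tendstoD)
 then show "EV n. prob {w : space M. eps < \<bar>Y n w\<bar>} <= eps"
 proof eventually_elim
  case (elim n)
  have "emeasure M {w : space M. eps < \<bar>Y n w\<bar>} <= emeasure M {w : space M. 1 <= ennreal (1/eps) * ennreal \<bar>Y n w\<bar>}"
   using e by (intro emeasure_mono) (auto simp: ennreal_mult[symmetric] field_simps simp flip: ennreal_1)
  also have "... <= ennreal (1/eps) * (NNI w|M. ennreal \<bar>Y n w\<bar> * ind (space M) w)"
   using nn_integral_Markov_inequality[of "%w. ennreal \<bar>Y n w\<bar>" "space M" M "ennreal (1/eps)"] by simp
  also have "(NNI w|M. ennreal \<bar>Y n w\<bar> * ind (space M) w) = (NNI w|M. ennreal \<bar>Y n w\<bar>)"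
   by (intro nn_integral_cong) auto
  also have "ennreal (1/eps) * ... <= ennreal (1/eps) * ennreal (eps * eps)"
   using elim by (intro mult_left_mono order.trans[OF le] ennreal_leI) auto
  also have "... = ennreal eps" using e by (simp add: ennreal_mult[symmetric])
  finally show ?case using e by (simp add: emeasure_eq_measure)
 qed
qed

lemma prob_tendsto_0_if_eventually_not:
 assumes [measurable]: "!!n. A n : events" and ae: "AE w in M. EV n. w \<notin> A n"
 shows "(%n. prob (A n)) ----> 0"
proof -
 have "(%n. LINT w|M. ind (A n) w) ----> (\<integral>w. 0 \<partial>M :: real)"
 proof (rule integral_dominated_convergence[where w="%_. 1"])
  show "AE x in M. (%n. ind (A n) x) ----> (0::real)"
   using ae by eventually_elim (rule tendsto_eventually, auto elim: eventually_mono)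
 qed auto
 then show ?thesis by simp
qed

lemma null_in_prob_AE:
 assumes [measurable]: "!!n. Y n : meas M" and ae: "AE w in M. (%n. Y n w) ----> 0"
 shows "null_in_prob Y"
proof (rule null_in_probI)
 fix eps :: real assume e: "0 < eps"
 have "(%n. prob {w : space M. eps < \<bar>Y n w\<bar>}) ----> 0"
 proof (rule prob_tendsto_0_if_eventually_not)
  show "AE w in M. EV n. w \<notin> {w : space M. eps < \<bar>Y n w\<bar>}"
   using ae
  proof eventually_elim
   case (elim w)
   from tendstoD[OF elim e] show ?case by eventually_elim (auto simp: dist_real_def)
  qed
 qed measurable
 then have "EV n. prob {w : space M. eps < \<bar>Y n w\<bar>} < eps"
  by (rule order_tendstoD) (rule e)
 then show "EV n. prob {w : space M. eps < \<bar>Y n w\<bar>} <= eps"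
  by (auto elim: eventually_mono)
qed

lemma null_in_prob_of_square:
 assumes "null_in_prob (%n w. (Y n w)^2)" and [measurable]: "!!n. Y n : meas M"
 shows "null_in_prob Y"
proof (rule null_in_probI)
 fix eps :: real assume e: "0 < eps"
 define \<eta> where "\<eta> = min eps (eps\<^sup>2)"
 have \<eta>: "0 < \<eta>" "\<eta> <= eps" "\<eta> <= eps\<^sup>2" using e by (auto simp: \<eta>_def)
 from null_in_probD[OF assms(1) \<eta>(1)]
 show "EV n. prob {w : space M. eps < \<bar>Y n w\<bar>} <= eps"
 proof eventually_elim
  case (elim n)
  have "prob {w : space M. eps < \<bar>Y n w\<bar>} <= prob {w : space M. \<eta> < \<bar>(Y n w)^2\<bar>}"
  proof (intro finite_measure_mono subsetI)
   fix w assume "w : {w : space M. eps < \<bar>Y n w\<bar>}"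
   moreover then have "eps\<^sup>2 < \<bar>Y n w\<bar>\<^sup>2" using e by (intro power_strict_mono) auto
   ultimately show "w : {w : space M. \<eta> < \<bar>(Y n w)^2\<bar>}" using \<eta> by auto
  qed measurable
  with elim \<eta> show ?case by linarith
 qed
qed

end

section \<open>A central limit theorem for martingale differences with a random variance\<close>

text \<open>
 That the conditional expectation of \<open>d\<close> given \<open>F\<close> vanishes, in the form in which the Markov
 property provides it.
\<close>

definition centred :: "'a measure => 'a measure => ('a => real) => bool" where
 "centred M F d \<longleftrightarrow> integrable M d \<and> (\<forall>A\<in>sets F. (LINT w|M. ind A w * d w) = 0)"

lemma (in prob_space) centred_mult:
 assumes sub: "subalgebra M F" and d: "centred M F d" and Y: "Y : meas F"
  and int: "integrable M (%w. Y w * d w)"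
 shows "(LINT w|M. Y w * d w) = 0"
proof -
 interpret finite_measure_subalgebra M F
  by unfold_locales (rule sub)
 have [measurable]: "integrable M d" using d by (simp add: centred_def)
 have z: "AE w in M. real_cond_exp M F d w = 0"
  by (rule real_cond_exp_charact) (use d in \<open>auto simp: centred_def set_lebesgue_integral_def\<close>)
 have "(LINT w|M. Y w * d w) = (LINT w|M. Y w * real_cond_exp M F d w)"
  by (rule real_cond_exp_intg(2)[symmetric]) (use int Y d in \<open>auto simp: centred_def\<close>)
 also have "... = (LINT w|M. 0)" 
  by (rule integral_cong_AE) (use z Y measurable_from_subalg[OF sub Y] in auto)
 finally show ?thesis by simp
qed

text \<open>
 Taylor expansion: \<open>exp(ix)\<close> and \<open>(1 + ix) exp(-x\<^sup>2/2)\<close> agree up to the second order.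
\<close>

lemma iexp_approx_gaussian:
 fixes x :: real assumes x: "\<bar>x\<bar> <= 1"
 shows "norm ((1 + \<i> * x) * exp (- x\<^sup>2 / 2) - exp (\<i> * cor x)) <= \<bar>x\<bar> ^ 3"
proof -
 define y where "y = x^2 / 2"
 have y: "0 <= y" "y <= 1/2" using x by (auto simp: y_def abs_square_le_1)
 have l: "1 - y <= exp (- y)" using exp_ge_add_one_self[of "-y"] by simp
 have u: "exp (- y) <= 1 - y + y^2 / 2"
 proof -
  have "1 + y + y^2 / 2 <= exp y" by (rule exp_lower_Taylor_quadratic) (rule y)
  then have "(1 + y + y^2 / 2) * (1 - y + y^2/2) <= exp y * (1 - y + y^2/2)"
   using y by (intro mult_right_mono) auto
  moreover have "(1 + y + y^2 / 2) * (1 - y + y^2/2) = 1 + y^4/4" by (simp add: power2_eq_square power4_eq_xxxx field_simps)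
  moreover have "0 <= y^4" by simp
  ultimately have "1 <= exp y * (1 - y + y^2/2)" by linarith
  then show ?thesis by (simp add: exp_minus field_simps)
 qed
 define r where "r = exp (-y) - (1 - y)"
 have r: "0 <= r" "r <= x^4 / 8" using l u by (auto simp: r_def y_def power2_eq_square power4_eq_xxxx)
 have a: "norm (exp (\<i> * cor x) - (\<Sum>k\<le>2. (\<i> * x)^k / fact k)) <= \<bar>x\<bar> ^ 3 / 6"
  using iexp_approx1[of x 2] by (simp add: fact_numeral eval_nat_numeral)
 have s: "(\<Sum>k\<le>2. (\<i> * cor x)^k / fact k) = 1 + \<i> * x - cor y"
  proof -
  have "(\<i> * cor x) * (\<i> * cor x) = - (cor x * cor x)"
   by (simp add: complex_eq_iff)
  then show ?thesis by (simp add: y_def eval_nat_numeral)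
 qed
 have "(1 + \<i> * x) * cor (exp (- x\<^sup>2 / 2)) - exp (\<i> * cor x)
   = - (exp (\<i> * cor x) - (\<Sum>k\<le>2. (\<i> * x)^k / fact k)) + (1 + \<i> * x) * cor r - \<i> * cor (x * y)"
  unfolding s r_def by (simp add: y_def algebra_simps)
 also have "norm ... <= \<bar>x\<bar>^3/6 + norm ((1 + \<i> * x) * cor r) + norm (\<i> * cor (x * y))"
  using a by (intro norm_triangle_le norm_triangle_le_diff add_mono) (auto simp: norm_minus_commute)
 also have "norm ((1 + \<i> * x) * cor r) <= 2 * r"
 proof -
  have "norm (1 + \<i> * cor x) <= 2" using norm_triangle_ineq[of 1 "\<i> * cor x"] x by (simp add: norm_mult)
  then show ?thesis using r by (simp add: norm_mult mult_right_mono)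
 qed
 also have "norm (\<i> * cor (x * y)) = \<bar>x\<bar>^3 / 2"
  using y by (simp add: norm_mult abs_mult y_def power2_eq_square power3_eq_cube)
 finally have "norm ((1 + \<i> * x) * cor (exp (- x\<^sup>2 / 2)) - exp (\<i> * cor x)) <= \<bar>x\<bar>^3/6 + 2 * r + \<bar>x\<bar>^3 / 2"
  by simp
 moreover have "x^4 <= \<bar>x\<bar>^3"
 proof -
  have "x^4 = \<bar>x\<bar>^3 * \<bar>x\<bar>" by (simp add: power3_eq_cube power4_eq_xxxx abs_mult[symmetric])
  then show ?thesis using x by (simp add: mult_left_le)
 qed
 ultimately show ?thesis using r by (simp add: exp_of_real)
qed

text \<open>
 All factors have modulus at most one, so that the errors of the factors add up.
\<close>

lemma prod_iexp_approx:
 fixes x :: "nat => real"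
 assumes x: "!!j. j : J ==> \<bar>x j\<bar> <= r" and r: "\<bar>t\<bar> * r <= 1"
 shows "norm ((\<Prod>j\<in>J. 1 + \<i> * (t * x j)) * exp (- t\<^sup>2 * (\<Sum>j\<in>J. (x j)^2) / 2)
   - exp (\<i> * (t * (\<Sum>j\<in>J. x j)))) <= \<bar>t\<bar>^3 * r * (\<Sum>j\<in>J. (x j)^2)"
proof (cases "finite J")
 case fin: True
 have small: "\<bar>t * x j\<bar> <= 1" if "j : J" for j
  using mult_left_mono[OF x[OF that], of "\<bar>t\<bar>"] r by (simp add: abs_mult)
 let ?z = "%j. (1 + \<i> * cor (t * x j)) * exp (- (t * x j)\<^sup>2 / 2)"
 let ?w = "%j. exp (\<i> * cor (t * x j))"
 have z1: "norm (?z j) <= 1" if "j : J" for j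
 proof -
  have "(norm (1 + \<i> * cor (t * x j)))^2 = 1 + (t * x j)^2" by (simp add: cmod_def)
  also have "... <= exp ((t * x j)^2)" by simp
  also have "... = (exp ((t * x j)^2 / 2))^2" by (simp add: exp_double[symmetric])
  finally have "norm (1 + \<i> * cor (t * x j)) <= exp ((t * x j)^2 / 2)"
   by (rule power2_le_imp_le) simp
  then have "norm (1 + \<i> * cor (t * x j)) * exp (- ((t * x j)^2 / 2)) <= 1"
   by (simp add: exp_minus field_simps)
  then show ?thesis by (simp only: norm_mult norm_of_real abs_exp_cancel minus_divide_left)
 qed
 have "(\<Prod>j\<in>J. 1 + \<i> * cor (t * x j)) * exp (- t\<^sup>2 * (\<Sum>j\<in>J. (x j)^2) / 2) = (\<Prod>j\<in>J. ?z j)"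
 proof -
  have "- t\<^sup>2 * (\<Sum>j\<in>J. (x j)^2) / 2 = (\<Sum>j\<in>J. - (t * x j)\<^sup>2 / 2)"
   by (simp add: sum_distrib_left sum_divide_distrib sum_negf[symmetric] power_mult_distrib)
  then show ?thesis by (simp add: prod.distrib exp_sum fin)
 qed
 moreover have "exp (\<i> * cor (t * (\<Sum>j\<in>J. x j))) = (\<Prod>j\<in>J. ?w j)"
  by (simp add: exp_sum[symmetric] fin sum_distrib_left)
 ultimately have "norm ((\<Prod>j\<in>J. 1 + \<i> * cor (t * x j)) * exp (- t\<^sup>2 * (\<Sum>j\<in>J. (x j)^2) / 2)
   - exp (\<i> * cor (t * (\<Sum>j\<in>J. x j)))) = norm ((\<Prod>j\<in>J. ?z j) - (\<Prod>j\<in>J. ?w j))" by simp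
 also have "... <= (\<Sum>j\<in>J. norm (?z j - ?w j))"
  using z1 by (rule norm_prod_diff) auto
 also have "... <= (\<Sum>j\<in>J. \<bar>t\<bar>^3 * r * (x j)^2)"
 proof (rule sum_mono)
  fix j assume j: "j : J"
  have "norm (?z j - ?w j) <= \<bar>t * x j\<bar>^3" using iexp_approx_gaussian[OF small[OF j]] by simp
  also have "... = \<bar>t\<bar>^3 * (\<bar>x j\<bar> * \<bar>x j\<bar>\<^sup>2)"
   by (simp only: abs_mult power_mult_distrib power3_eq_cube power2_eq_square mult_ac)
  also have "... = \<bar>t\<bar>^3 * (\<bar>x j\<bar> * (x j)^2)" by simp
  also have "... <= \<bar>t\<bar>^3 * (r * (x j)^2)" using x[OF j] by (intro mult_left_mono mult_right_mono) auto
  finally show "norm (?z j - ?w j) <= \<bar>t\<bar>^3 * r * (x j)^2" by simp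
 qed
 finally show ?thesis by (simp add: sum_distrib_left)
qed simp

lemma prod_one_plus_le_exp:
 fixes x :: "'b => real" assumes "!!j. j : J ==> 0 <= x j"
 shows "(\<Prod>j\<in>J. 1 + x j) <= exp (\<Sum>j\<in>J. x j)"
proof (cases "finite J")
 case True
 have "(\<Prod>j\<in>J. 1 + x j) <= (\<Prod>j\<in>J. exp (x j))"
  using assms by (intro prod_mono) (auto intro: add_nonneg_nonneg)
 then show ?thesis by (simp add: exp_sum True)
qed simp

lemma norm_prod_one_plus_i:
 fixes x :: "'b => real"
 shows "(norm (\<Prod>j\<in>J. 1 + \<i> * cor (t * x j)))^2 = (\<Prod>j\<in>J. 1 + t^2 * (x j)^2)"
proof -
 have "(norm (1 + \<i> * cor (t * x j)))^2 = 1 + t^2 * (x j)^2" for j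
  by (simp add: cmod_def power_mult_distrib)
 then show ?thesis by (simp add: prod_norm[symmetric] prod_power_distrib)
qed

context prob_space begin

lemma subalgebra_sets_mono:
 assumes sub: "!!k. subalgebra M (F k)" and mono: "!!k. sets (F k) \<subseteq> sets (F (Suc k))"
 shows "m <= n ==> f : measurable (F m) N ==> f : measurable (F n) N"
proof -
 assume mn: "m <= n" and f: "f : measurable (F m) N"
 have "subalgebra (F n) (F m)"
  using lift_Suc_mono_le[of "%k. sets (F k)", OF mono mn] sub
  by (auto simp: subalgebra_def)
 then show ?thesis using f by (rule measurable_from_subalg)
qed

text \<open>
 Given the past, a factor \<open>1 + itd\<^sub>j\<close> has conditional mean one, and \<open>B j\<close> belongs to the past of
 \<open>d\<^sub>j\<close>; so the product integrates to its weight \<open>exp(-t\<^sup>2U/2)\<close>, which is known at time \<open>m\<close>. Its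
 squared modulus is at most \<open>exp(t\<^sup>2 \<Sum>d\<^sub>j\<^sup>2)\<close> over the indices before the sum of squares exceeds
 \<open>U + h\<close>, where the weight cancels \<open>exp(t\<^sup>2U)\<close>, times one factor \<open>1 + t\<^sup>2R\<close> for the increment that
 overshoots.
\<close>

lemma mcleish_product:
 fixes d :: "nat => 'a => real" and U R :: "'a => real" and h t :: real
 assumes sub: "!!k. subalgebra M (F k)" and mono: "!!k. sets (F k) \<subseteq> sets (F (Suc k))"
  and adapted: "!!k. d k : meas (F (Suc k))"
  and cent: "!!k. centred M (F k) (d k)"
  and U: "U : meas (F m)" and mn: "m <= n"
  and R: "!!k w. k < n ==> (d k w)^2 <= R w" and R0: "!!w. 0 <= R w"
 defines "B \<equiv> %k. {w : space M. (\<Sum>j=m..<k. (d j w)^2) <= U w + h}"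
 defines "W \<equiv> %k w. (\<Prod>j=m..<k. 1 + \<i> * cor (t * (ind (B j) w * d j w))) * cor (exp (- t\<^sup>2 * U w / 2))"
 shows mcleish_W_measurable: "W n : meas M"
  and mcleish_W_bound: "!!w. w : space M ==> 0 <= U w ==> 0 <= h ==> (norm (W n w))^2 <= exp (t^2 * h) * (1 + t^2 * R w)"
  and mcleish_W_integral: "(!!w. w : space M ==> 0 <= U w) ==> 0 <= h ==>
     integrable M (W n) \<and> (LINT w|M. W n w) = cor (LINT w|M. exp (- t\<^sup>2 * U w / 2))"
proof -
 note Fmono = subalgebra_sets_mono[where F=F, OF sub mono]
 have Fmeas: "f : meas (F k) ==> f : meas M" for f :: "'a => real" and k
  using measurable_from_subalg[OF sub] .
 have spF: "space (F k) = space M" for k using sub[of k] by (simp add: subalgebra_def)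
 have dF: "j < k ==> d j : meas (F k)" for j k
  by (rule Fmono[OF _ adapted]) simp
 have UF: "m <= k ==> U : meas (F k)" for k by (rule Fmono[OF _ U])
 have BF: "m <= k ==> B k : sets (F k)" for k
 proof -
  assume k: "m <= k"
  note [measurable] = UF[OF k]
  have [measurable]: "j : {m..<k} ==> d j : meas (F k)" for j using dF by auto
  show ?thesis unfolding B_def spF[of k, symmetric] by measurable
 qed
 have BM: "m <= k ==> B k : sets M" for k using BF sub[of k] by (auto simp: subalgebra_def)
 have Bdec: "B (Suc k) \<subseteq> B k" for k
 proof (cases "m <= k")
  case True then show ?thesis by (auto simp: B_def intro: order_trans[rotated])
 qed (auto simp: B_def)
 have Bdec': "j <= k ==> B k \<subseteq> B j" for j k
  using lift_Suc_antimono_le[of B, OF Bdec] .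
 let ?d = "%j w. ind (B j) w * d j w"
 have W_meas: "m <= k ==> W k : meas (F k)" for k
 proof -
  assume k: "m <= k"
  have [measurable]: "?d j : meas (F k)" if "j : {m..<k}" for j
  proof -
   have "B j : sets (F j)" using that by (intro BF) auto
   then have "ind (B j) : meas (F j)" by (rule borel_measurable_indicator)
   then have [measurable]: "(ind (B j) :: 'a => real) : meas (F k)"
    by (rule Fmono[rotated]) (use that in auto)
   have [measurable]: "d j : meas (F k)" using that by (intro dF) auto
   show ?thesis by measurable
  qed
  note [measurable] = UF[OF k]
  show ?thesis unfolding W_def by measurable
 qed
 then show WnM: "W n : meas M" using mn measurable_from_subalg[OF sub] by blast
 have normW: "(norm (W k w))^2 = (\<Prod>j=m..<k. 1 + t^2 * (?d j w)^2) * exp (- t\<^sup>2 * U w)" for k w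
 proof -
  have "(exp (- t\<^sup>2 * U w / 2))^2 = exp (- t\<^sup>2 * U w)" by (simp add: exp_double[symmetric])
  then show ?thesis unfolding W_def norm_mult power_mult_distrib norm_prod_one_plus_i by simp
 qed
 have onB: "(norm (W k w))^2 <= exp (t^2 * h)" if "m <= k" "w : B k" for k w
 proof -
  have "(\<Prod>j=m..<k. 1 + t^2 * (?d j w)^2) <= exp (\<Sum>j=m..<k. t\<^sup>2 * (?d j w)^2)"
   by (rule prod_one_plus_le_exp) simp
  also have "(\<Sum>j=m..<k. t\<^sup>2 * (?d j w)^2) = t^2 * (\<Sum>j=m..<k. (d j w)^2)"
   unfolding sum_distrib_left
  proof (rule sum.cong)
   fix j assume "j : {m..<k}"
   then have "w : B j" using Bdec'[of j k] that by auto
   then show "t^2 * (ind (B j) w * d j w)^2 = t^2 * (d j w)^2" by simp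
  qed simp
  also have "exp ... <= exp (t^2 * (U w + h))"
   using that by (auto simp: B_def intro!: mult_left_mono)
  finally have "(norm (W k w))^2 <= exp (t^2 * (U w + h)) * exp (- t\<^sup>2 * U w)"
   unfolding normW by (rule mult_right_mono) simp
  then show ?thesis by (simp add: exp_add[symmetric] algebra_simps)
 qed
 have WB: "(norm (W k w))^2 <= exp (t^2 * h) * (1 + t^2 * R w)"
  if "w : space M" "0 <= U w" "0 <= h" "m <= k" "k <= n" for k w
  using \<open>m <= k\<close> \<open>k <= n\<close>
 proof (induction k rule: dec_induct)
  case base
  have "(norm (W m w))^2 <= 1" using that by (simp add: normW)
  moreover have "1 <= exp (t^2 * h)" using that by simp
  moreover have "1 <= 1 + t^2 * R w" using R0[of w] by simp
  ultimately show ?case using mult_mono[of 1 "exp (t^2 * h)" 1 "1 + t^2 * R w"] by linarith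
 next
  case (step k)
  show ?case
  proof (cases "w : B k")
   case True
   have "(norm (W (Suc k) w))^2 = (norm (W k w))^2 * (1 + t^2 * (d k w)^2)"
    using step True unfolding normW by simp
   also have "... <= exp (t^2 * h) * (1 + t^2 * R w)"
    using onB[OF _ True] step R[of k w] by (intro mult_mono add_left_mono mult_left_mono) auto
   finally show ?thesis .
  next
   case False
   then have "(norm (W (Suc k) w))^2 = (norm (W k w))^2"
    using step unfolding normW by simp
   with step show ?thesis by simp
  qed
 qed
 then show "!!w. w : space M ==> 0 <= U w ==> 0 <= h ==> (norm (W n w))^2 <= exp (t^2 * h) * (1 + t^2 * R w)"
  using mn by auto
 assume U0: "!!w. w : space M ==> 0 <= U w" and h: "0 <= h"
 have "integrable M (W k) \<and> (LINT w|M. W k w) = cor (LINT w|M. exp (- t\<^sup>2 * U w / 2))" if "m <= k" for k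
  using that
 proof (induction k rule: dec_induct)
  case base
  have [measurable]: "U : meas M" by (rule Fmeas[OF U])
  have W: "W m = (%w. cor (exp (- t\<^sup>2 * U w / 2)))" by (simp add: W_def)
  have "integrable M (%w. exp (- t\<^sup>2 * U w / 2))"
   by (rule integrable_const_bound[of _ 1]) (use U0 in auto)
  then show ?case unfolding W by (auto simp del: of_real_exp)
 next
  case (step k)
  have mk: "m <= k" using step by simp
  let ?Y = "%w. W k w * ind (B k) w"
  have YF: "?Y : meas (F k)"
   using W_meas[OF mk] BF[OF mk] by measurable
  have YM: "?Y : meas M" by (rule measurable_from_subalg[OF sub YF])
  have Yb: "norm (?Y w) <= exp (t^2 * h)" for w
  proof (cases "w : B k")
   case True
   have "(norm (W k w))^2 <= (exp (t^2 * h))^2"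
   proof -
    have "exp (t^2 * h) <= (exp (t^2 * h))^2" using h by (simp add: power2_eq_square)
    with onB[OF mk True] show ?thesis by linarith
   qed
   then have "norm (W k w) <= exp (t^2 * h)" by (rule power2_le_imp_le) simp
   with True show ?thesis by simp
  qed simp
  have di: "integrable M (d k)" using cent by (simp add: centred_def)
  then have dM: "d k : meas M" by auto
  have int: "integrable M (%w. ?Y w * cor (d k w))"
  proof (rule Bochner_Integration.integrable_bound)
   show "integrable M (%w. exp (t^2 * h) * \<bar>d k w\<bar>)" using di by auto
   show "(%w. ?Y w * cor (d k w)) : meas M" using YM dM by measurable
   show "AE w in M. norm (?Y w * cor (d k w)) <= norm (exp (t^2 * h) * \<bar>d k w\<bar>)"
    using Yb by (auto simp: norm_mult intro!: AE_I2 mult_right_mono simp del: mult_indicator_subset)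
  qed
  have Re0: "(LINT w|M. Re (?Y w) * d k w) = 0"
  proof (rule centred_mult[OF sub cent])
   show "(%w. Re (?Y w)) : meas (F k)" using YF by measurable
   show "integrable M (%w. Re (?Y w) * d k w)"
    using integrable_Re[OF int] by simp
  qed
  have Im0: "(LINT w|M. Im (?Y w) * d k w) = 0"
  proof (rule centred_mult[OF sub cent])
   show "(%w. Im (?Y w)) : meas (F k)" using YF by measurable
   show "integrable M (%w. Im (?Y w) * d k w)"
    using integrable_Im[OF int] by simp
  qed
  have z: "(LINT w|M. ?Y w * cor (d k w)) = 0"
  proof (rule complex_eqI)
   show "Re (LINT w|M. ?Y w * cor (d k w)) = Re 0"
    using Re0 integral_Re[OF int] by simp
   show "Im (LINT w|M. ?Y w * cor (d k w)) = Im 0"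
    using Im0 integral_Im[OF int] by simp
  qed
  have WS: "W (Suc k) = (%w. W k w + \<i> * cor t * (?Y w * cor (d k w)))"
   using mk by (auto simp: W_def algebra_simps fun_eq_iff indicator_def)
  show ?case unfolding WS using step int z by simp
 qed
 then show "integrable M (W n) \<and> (LINT w|M. W n w) = cor (LINT w|M. exp (- t\<^sup>2 * U w / 2))"
  using mn by blast
qed

end

lemma abs_exp_minus_diff_le:
 fixes x y :: real assumes "0 <= x" "0 <= y"
 shows "\<bar>exp (- x) - exp (- y)\<bar> <= \<bar>x - y\<bar>"
proof -
 have *: "exp (- x) - exp (- y) <= y - x" if "0 <= x" "x <= y" for x y :: real
 proof -
  have "exp (- x) - exp (- y) = exp (- x) * (1 - exp (- (y - x)))"
   by (simp add: algebra_simps exp_add[symmetric])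
  also have "... <= 1 * (y - x)"
  proof (rule mult_mono)
   show "1 - exp (- (y - x)) <= y - x" using exp_ge_add_one_self[of "- (y - x)"] by linarith
  qed (use that in auto)
  finally show ?thesis by simp
 qed
 show ?thesis using *[of x y] *[of y x] assms by (cases "x <= y") auto
qed

lemma abs_exp_minus_one_le:
 fixes y :: real assumes "\<bar>y\<bar> <= b"
 shows "\<bar>exp y - 1\<bar> <= exp b - 1"
proof (cases "0 <= y")
 case False
 have "1 - exp y <= - y" using exp_ge_add_one_self[of y] by linarith
 also have "... <= exp (- y) - 1" using exp_ge_add_one_self[of "-y"] by linarith
 also have "... <= exp b - 1" using assms by simp
 finally show ?thesis using False by simp
qed (use assms in auto)

lemma norm_iexp_diff_le:
 "norm (exp (\<i> * cor a) - exp (\<i> * cor b)) <= \<bar>a - b\<bar>"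
proof -
 have "exp (\<i> * cor a) - exp (\<i> * cor b)
  = exp (\<i> * cor b) * (exp (\<i> * cor (a - b)) - 1)"
  by (simp add: algebra_simps exp_add[symmetric])
 also have "norm ... = norm (exp (\<i> * cor (a - b)) - 1)" by (simp add: norm_mult)
 also have "... <= \<bar>a - b\<bar>" using iexp_approx1[of "a - b" 0] by simp
 finally show ?thesis .
qed

text \<open>
 The bound for a good outcome: the first \<open>m\<close> terms are small, the other ones have nearly the
 prescribed sum of squares \<open>u\<close>, and \<open>u\<close> is close to the limit \<open>s\<close>.
\<close>

lemma mcleish_pointwise:
 fixes x :: "nat => real"
 assumes xr: "!!k. k < n ==> \<bar>x k\<bar> <= r" and mn: "m <= n" and r: "\<bar>t\<bar> * r <= 1" "0 <= r"
  and Q: "\<bar>(\<Sum>j=m..<n. (x j)^2) - u\<bar> <= 3 * \<delta>" "(\<Sum>j=m..<n. (x j)^2) <= C" and us: "\<bar>u - s\<bar> <= \<delta>" "0 <= u" "0 <= s"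
 shows "norm (exp (\<i> * cor (t * (\<Sum>k<n. x k))) - (\<Prod>j=m..<n. 1 + \<i> * cor (t * x j)) * cor (exp (- t\<^sup>2 * u / 2)))
   + \<bar>exp (- t\<^sup>2 * u / 2) - exp (- t\<^sup>2 * s / 2)\<bar>
  <= \<bar>t\<bar> * (m * r) + \<bar>t\<bar>^3 * r * C + (exp (3 * t^2 * \<delta> / 2) - 1) + t^2 * \<delta> / 2"
proof -
 let ?Q = "\<Sum>j=m..<n. (x j)^2" and ?T = "\<Prod>j=m..<n. 1 + \<i> * cor (t * x j)"
 have split: "(\<Sum>k<n. x k) = (\<Sum>k<m. x k) + (\<Sum>k=m..<n. x k)"
  using mn by (metis lessThan_atLeast0 sum.atLeastLessThan_concat zero_le)
 have "\<bar>\<Sum>k<m. x k\<bar> <= (\<Sum>k<m. \<bar>x k\<bar>)" by (rule sum_abs)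
 also have "... <= m * r" using xr mn sum_bounded_above[of "{..<m}" "%k. \<bar>x k\<bar>" r] by auto
 finally have a: "norm (exp (\<i> * cor (t * (\<Sum>k<n. x k))) - exp (\<i> * cor (t * (\<Sum>k=m..<n. x k)))) <= \<bar>t\<bar> * (m * r)"
  using norm_iexp_diff_le[of "t * (\<Sum>k<n. x k)" "t * (\<Sum>k=m..<n. x k)"] mult_left_mono[of "\<bar>\<Sum>k<m. x k\<bar>" "m * r" "\<bar>t\<bar>"]
  by (simp add: split algebra_simps abs_mult del: of_real_mult of_real_add of_real_sum)
 have b: "norm (?T * cor (exp (- t\<^sup>2 * ?Q / 2)) - exp (\<i> * cor (t * (\<Sum>k=m..<n. x k)))) <= \<bar>t\<bar>^3 * r * C"
 proof -
  have "norm (?T * cor (exp (- t\<^sup>2 * ?Q / 2)) - exp (\<i> * cor (t * (\<Sum>k=m..<n. x k)))) <= \<bar>t\<bar>^3 * r * ?Q"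
   using prod_iexp_approx[of "{m..<n}" x r t] xr r by auto
  also have "... <= \<bar>t\<bar>^3 * r * C" using Q r by (intro mult_left_mono) auto
  finally show ?thesis .
 qed
 have c: "norm (?T * cor (exp (- t\<^sup>2 * u / 2)) - ?T * cor (exp (- t\<^sup>2 * ?Q / 2))) <= exp (3 * t^2 * \<delta> / 2) - 1"
 proof -
  have "(norm ?T)^2 <= exp (t^2 * ?Q)"
   unfolding norm_prod_one_plus_i sum_distrib_left by (rule prod_one_plus_le_exp) simp
  also have "... = (exp (t^2 * ?Q / 2))^2" by (simp add: exp_double[symmetric])
  finally have T: "norm ?T <= exp (t^2 * ?Q / 2)" by (rule power2_le_imp_le) simp
  have "?T * cor (exp (- t\<^sup>2 * u / 2)) - ?T * cor (exp (- t\<^sup>2 * ?Q / 2))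
    = ?T * cor (exp (- t\<^sup>2 * ?Q / 2) * (exp (t^2 * (?Q - u) / 2) - 1))"
  proof -
   have "exp (- t\<^sup>2 * u / 2) = exp (- t\<^sup>2 * ?Q / 2) * exp (t^2 * (?Q - u) / 2)"
    by (simp add: exp_add[symmetric] algebra_simps add_divide_distrib[symmetric] diff_divide_distrib)
   then show ?thesis by (simp add: algebra_simps)
  qed
  also have "norm ... = norm ?T * exp (- t\<^sup>2 * ?Q / 2) * \<bar>exp (t^2 * (?Q - u) / 2) - 1\<bar>"
   by (simp only: norm_mult norm_of_real abs_mult abs_exp_cancel mult_ac)
  also have "... <= 1 * (exp (3 * t^2 * \<delta> / 2) - 1)"
  proof (rule mult_mono)
   have "norm ?T * exp (- t\<^sup>2 * ?Q / 2) <= exp (t^2 * ?Q / 2) * exp (- t\<^sup>2 * ?Q / 2)"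
    using T by (rule mult_right_mono) simp
   then show "norm ?T * exp (- t\<^sup>2 * ?Q / 2) <= 1" by (simp add: exp_add[symmetric])
   have "\<bar>t\<^sup>2 * (?Q - u) / 2\<bar> <= 3 * t^2 * \<delta> / 2"
    using mult_left_mono[OF Q(1), of "t^2"] by (simp add: abs_mult)
   then show "\<bar>exp (t^2 * (?Q - u) / 2) - 1\<bar> <= exp (3 * t^2 * \<delta> / 2) - 1"
    by (rule abs_exp_minus_one_le)
  qed auto
  finally show ?thesis by simp
 qed
 have d: "\<bar>exp (- t\<^sup>2 * u / 2) - exp (- t\<^sup>2 * s / 2)\<bar> <= t\<^sup>2 * \<delta> / 2"
 proof -
  have "\<bar>exp (- t\<^sup>2 * u / 2) - exp (- t\<^sup>2 * s / 2)\<bar> <= \<bar>t\<^sup>2 * u / 2 - t^2 * s / 2\<bar>"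
   using abs_exp_minus_diff_le[of "t^2 * u / 2" "t^2 * s / 2"] us by simp
  also have "... = t^2 * \<bar>u - s\<bar> / 2" by (simp add: right_diff_distrib[symmetric] diff_divide_distrib[symmetric] abs_mult)
  also have "... <= t\<^sup>2 * \<delta> / 2" using us by (auto intro: mult_left_mono)
  finally show ?thesis .
 qed
 let ?e = "exp (\<i> * cor (t * (\<Sum>k<n. x k)))" and ?e' = "exp (\<i> * cor (t * (\<Sum>k=m..<n. x k)))"
 have "norm (?e - ?T * cor (exp (- t\<^sup>2 * u / 2))) <= norm (?e - ?e') + norm (?T * cor (exp (- t\<^sup>2 * ?Q / 2)) - ?e') + norm (?T * cor (exp (- t\<^sup>2 * u / 2)) - ?T * cor (exp (- t\<^sup>2 * ?Q / 2)))"
  by (smt (verit) norm_triangle_ineq4 norm_minus_commute norm_triangle_ineq diff_add_cancel add_diff_eq diff_diff_eq2)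
 then show ?thesis using a b c d by linarith
qed

context prob_space begin

text \<open>
 The limit \<open>s2\<close> is random and depends on the whole future, while the product method needs a weight
 known at a finite time. The sum of squares \<open>Q m\<close> of the \<open>m\<close>-th row, which is known at time \<open>m\<close>,
 serves as weight: for \<open>m\<close> large it is close to \<open>s2\<close> on most of \<open>E\<close>. The first \<open>m\<close> terms of the
 later rows are negligible. The remaining event has probability about \<open>1 - prob E\<close>; the products are
 bounded in square mean only, whence the square root in the error.
\<close>

theorem mcleish_clt_on_event:
 fixes d :: "nat => nat => 'a => real" and R :: "nat => 'a => real" and s2 :: "'a => real" and t :: real
 assumes sub: "!!k. subalgebra M (F k)" and mono: "!!k. sets (F k) \<subseteq> sets (F (Suc k))"
  and adapted: "!!n k. d n k : meas (F (Suc k))"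
  and cent: "!!n k. centred M (F k) (d n k)"
  and R: "!!n k w. k < n ==> (d n k w)^2 <= R n w" and R0: "!!n w. 0 <= R n w"
  and Rm[measurable]: "!!n. R n : meas M"
  and Rint: "!!n. (NNI w|M. ennreal (R n w)) <= ennreal (c n)" and c: "c ----> 0"
  and E[measurable]: "E : events" and s2[measurable]: "s2 : meas M"
  and s2_nonneg: "!!w. w : space M ==> 0 <= s2 w"
  and qv: "null_in_prob (%n w. ((\<Sum>k<n. (d n k w)^2) - s2 w) * ind E w)"
  and eps: "0 < eps"
 shows "EV n. norm ((LINT w|M. exp (\<i> * cor (t * (\<Sum>k<n. d n k w))))
   - cor (LINT w|M. exp (- t\<^sup>2 * s2 w / 2))) <= 4 * sqrt (1 - prob E) + eps"
proof -
 have dM[measurable]: "d n k : meas M" for n k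
  by (rule measurable_from_subalg[OF sub adapted])
 let ?Q = "%n w. \<Sum>k<n. (d n k w)^2"
 \<comment> \<open>\<phi> collects the errors that vanish with \<delta>: the exceptional probabilities 4 * \<delta>, under a square root, and the distance \<delta> of the sums of squares\<close>
 define \<phi> where "\<phi> \<delta> = 8 * sqrt \<delta> + t^2 * \<delta> / 2 + (exp (3 * t^2 * \<delta> / 2) - 1)" for \<delta>
 obtain \<delta> where \<delta>: "0 < \<delta>" "\<phi> \<delta> <= eps / 2" "exp (t^2 * (3 * \<delta>)) <= 2"
 proof -
  have "(\<phi> \<longlongrightarrow> \<phi> 0) (at_right 0)"
   unfolding \<phi>_def by (auto intro!: tendsto_eq_intros)
  moreover have phi0: "\<phi> 0 = 0" by (simp add: \<phi>_def)
  ultimately have "(\<phi> \<longlongrightarrow> 0) (at_right 0)" by simp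
  then have "\<forall>\<^sub>F \<delta> in at_right 0. \<phi> \<delta> < eps / 2" by (rule order_tendstoD) (use eps in simp)
  moreover have "((%\<delta>. exp (t^2 * (3 * \<delta>))) \<longlongrightarrow> exp (t^2 * (3 * 0))) (at_right 0)" by (auto intro!: tendsto_eq_intros)
  then have "\<forall>\<^sub>F \<delta> in at_right 0. exp (t^2 * (3 * \<delta>)) < 2" by (rule order_tendstoD) simp
  moreover have "\<forall>\<^sub>F \<delta>::real in at_right 0. 0 < \<delta>" by (simp add: eventually_at_right_less)
  ultimately have "\<forall>\<^sub>F \<delta> in at_right 0. \<phi> \<delta> < eps / 2 \<and> exp (t^2 * (3 * \<delta>)) < 2 \<and> 0 < \<delta>"
   by eventually_elim auto
  then obtain \<delta> where "\<phi> \<delta> < eps / 2 \<and> exp (t^2 * (3 * \<delta>)) < 2 \<and> 0 < \<delta>"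
   using eventually_happens'[OF trivial_limit_at_right_real] by blast
  then show ?thesis by (intro that[of \<delta>]) auto
 qed
 have "(%C. prob {w : space M. real C < s2 w}) ----> 0"
 proof (rule prob_tendsto_0_if_eventually_not)
  show "AE w in M. EV C. w \<notin> {w : space M. real C < s2 w}"
  proof (rule AE_I2)
   fix w
   obtain N :: nat where "s2 w <= N" using real_arch_simple by blast
   then show "EV C. w \<notin> {w : space M. real C < s2 w}"
    by (intro eventually_sequentiallyI[of N]) auto
  qed
 qed measurable
 then have "EV C. prob {w : space M. real C < s2 w} < \<delta>"
  using \<delta> by (auto intro: order_tendstoD)
 then obtain C0 :: nat where C0: "prob {w : space M. real C0 < s2 w} < \<delta>"
  using eventually_happens'[OF trivial_limit_sequentially] by blast
 from null_in_probD[OF qv \<delta>(1)] obtain m where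
  qvm: "!!n. m <= n ==> prob {w : space M. \<delta> < \<bar>(?Q n w - s2 w) * ind E w\<bar>} <= \<delta>"
  by (auto simp: eventually_sequentially)
 obtain r :: real where r: "0 < r" "\<bar>t\<bar> * (real m * r) + \<bar>t\<bar>^3 * r * (real C0 + \<delta>) <= eps / 2" "real m * r^2 <= \<delta>" "\<bar>t\<bar> * r <= 1"
 proof -
  have "((%r::real. \<bar>t\<bar> * (real m * r) + \<bar>t\<bar>^3 * r * (real C0 + \<delta>)) \<longlongrightarrow> \<bar>t\<bar> * (real m * 0) + \<bar>t\<bar>^3 * 0 * (real C0 + \<delta>)) (at_right 0)"
   by (intro tendsto_intros)
  then have "\<forall>\<^sub>F r::real in at_right 0. \<bar>t\<bar> * (real m * r) + \<bar>t\<bar>^3 * r * (real C0 + \<delta>) < eps / 2"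
   by (rule order_tendstoD) (use eps in simp)
  moreover have "((%r::real. real m * r^2) \<longlongrightarrow> real m * 0\<^sup>2) (at_right (0::real))" by (auto intro!: tendsto_eq_intros)
  then have "\<forall>\<^sub>F r::real in at_right 0. real m * r^2 < \<delta>" by (rule order_tendstoD) (use \<delta> in simp)
  moreover have "((%r. \<bar>t\<bar> * r) \<longlongrightarrow> \<bar>t\<bar> * 0) (at_right (0::real))" by (auto intro!: tendsto_eq_intros)
  then have "\<forall>\<^sub>F r::real in at_right 0. \<bar>t\<bar> * r < 1" by (rule order_tendstoD) simp
  moreover have "\<forall>\<^sub>F r::real in at_right 0. 0 < r" by (simp add: eventually_at_right_less)
  ultimately have "\<forall>\<^sub>F r::real in at_right 0. \<bar>t\<bar> * (real m * r) + \<bar>t\<bar>^3 * r * (real C0 + \<delta>) < eps / 2 \<and>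
    real m * r^2 < \<delta> \<and> \<bar>t\<bar> * r < 1 \<and> 0 < r" by eventually_elim auto
  from eventually_happens'[OF trivial_limit_at_right_real this] show ?thesis
   by (metis that less_imp_le)
 qed
 have Rp: "null_in_prob R"
  by (rule null_in_prob_L1[OF _ _ c]) (use Rint R0 in auto)
 have evR: "EV n. prob {w : space M. r\<^sup>2 < R n w} <= \<delta>"
 proof -
  have "0 < min \<delta> (r^2)" using \<delta> r by simp
  from null_in_probD[OF Rp this] show ?thesis
  proof eventually_elim
   case (elim n)
   have "prob {w : space M. r\<^sup>2 < R n w} <= prob {w : space M. min \<delta> (r^2) < \<bar>R n w\<bar>}"
    by (intro finite_measure_mono) auto
   with elim show ?case by linarith
  qed
 qed
 have "(%n. t\<^sup>2 * c n) ----> t\<^sup>2 * 0" by (intro tendsto_intros c)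
 then have evc: "EV n. t\<^sup>2 * c n < 1/2" by (rule order_tendstoD) simp
 define p where "p = (1 - prob E) + 4 * \<delta>"
 have p: "0 < p" using \<delta> by (simp add: p_def add_nonneg_pos)
 define B where "B n k = {w : space M. (\<Sum>j=m..<k. (d n j w)^2) <= ?Q m w + 3 * \<delta>}" for n k
 define W where "W n k w = (\<Prod>j=m..<k. 1 + \<i> * cor (t * (ind (B n j) w * d n j w))) * cor (exp (- t\<^sup>2 * ?Q m w / 2))" for n k w
 have UF: "?Q m : meas (F m)"
 proof -
  have [measurable]: "k : {..<m} ==> d m k : meas (F m)" for k
   by (rule subalgebra_sets_mono[where F=F and m="Suc k", OF sub mono]) (auto intro: adapted)
  show ?thesis by measurable
 qed
 from eventually_ge_at_top[of m] evR evc
 show ?thesis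
 proof eventually_elim
  case (elim n)
  note prod = mcleish_product[where d="d n" and F=F and U="?Q m" and R="R n" and h="3*\<delta>" and t=t and m=m and n=n,
    OF sub mono adapted cent UF \<open>m <= n\<close> R[of _ n] R0, folded B_def, folded W_def]
  have Wm[measurable]: "W n n : meas M" by (rule prod(1))
  have W2: "(norm (W n n w))^2 <= exp (t^2 * (3*\<delta>)) * (1 + t^2 * R n w)" if "w : space M" for w
   using that \<delta> by (intro prod(2)) (auto intro: sum_nonneg)
  have W3: "integrable M (W n n)" "(LINT w|M. W n n w) = cor (LINT w|M. exp (- t\<^sup>2 * ?Q m w / 2))"
  proof -
   have "integrable M (W n n) \<and> (LINT w|M. W n n w) = cor (LINT w|M. exp (- t\<^sup>2 * ?Q m w / 2))"
    by (rule prod(3)) (use \<delta> in \<open>auto intro: sum_nonneg\<close>)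
   then show "integrable M (W n n)" "(LINT w|M. W n n w) = cor (LINT w|M. exp (- t\<^sup>2 * ?Q m w / 2))"
    by blast+
  qed
  define bad where "bad = (space M - E) \<union> {w : space M. \<delta> < \<bar>(?Q n w - s2 w) * ind E w\<bar>}
    \<union> {w : space M. \<delta> < \<bar>(?Q m w - s2 w) * ind E w\<bar>} \<union> {w : space M. real C0 < s2 w} \<union> {w : space M. r\<^sup>2 < R n w}"
  have [measurable]: "bad : events" unfolding bad_def by measurable
  have pbad: "prob bad <= p"
  proof -
   have "prob bad <= prob (space M - E) + prob {w : space M. \<delta> < \<bar>(?Q n w - s2 w) * ind E w\<bar>}
    + prob {w : space M. \<delta> < \<bar>(?Q m w - s2 w) * ind E w\<bar>} + prob {w : space M. real C0 < s2 w} + prob {w : space M. r\<^sup>2 < R n w}"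
    unfolding bad_def by (intro measure_Un_le[THEN order_trans] add_mono order_refl) measurable
   then show ?thesis using qvm[OF \<open>m <= n\<close>] qvm[OF order_refl] C0 elim prob_compl[OF E] by (simp add: p_def)
  qed
  let ?e = "%w. exp (\<i> * cor (t * (\<Sum>k<n. d n k w)))"
  let ?u = "%w. exp (- t\<^sup>2 * ?Q m w / 2)" and ?s = "%w. exp (- t\<^sup>2 * s2 w / 2)"
  let ?A = "eps / 2 + (exp (3 * t^2 * \<delta> / 2) - 1) + t^2 * \<delta> / 2"
  have A0: "0 <= ?A" using eps \<delta> by simp
  have good: "norm (?e w - W n n w) + \<bar>?u w - ?s w\<bar> <= ?A" if w: "w : space M" "w \<notin> bad" for w
  proof -
   have e: "w : E" and q: "\<bar>?Q n w - s2 w\<bar> <= \<delta>" "\<bar>?Q m w - s2 w\<bar> <= \<delta>" "s2 w <= C0" "R n w <= r\<^sup>2"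
    using w by (auto simp: bad_def not_less)
   have dr: "\<bar>d n k w\<bar> <= r" if "k < n" for k
    using R[OF that, of w] q(4) r(1) by (intro power2_le_imp_le[of "\<bar>d n k w\<bar>" r]) auto
   have split: "?Q n w = (\<Sum>k<m. (d n k w)^2) + (\<Sum>k=m..<n. (d n k w)^2)"
    using \<open>m <= n\<close> by (metis lessThan_atLeast0 sum.atLeastLessThan_concat zero_le)
   have "(\<Sum>k<m. (d n k w)^2) <= (\<Sum>k<m. r\<^sup>2)"
    using R[of _ n w] q(4) \<open>m <= n\<close> by (intro sum_mono) (meson lessThan_iff order_trans order.strict_trans2)
   then have first: "(\<Sum>k<m. (d n k w)^2) <= \<delta>" using r by simp
   have first0: "0 <= (\<Sum>k<m. (d n k w)^2)" by (rule sum_nonneg) simp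
   have inB: "w : B n j" if "j < n" for j
   proof -
    have "(\<Sum>j=m..<j. (d n j w)^2) <= (\<Sum>k=m..<n. (d n k w)^2)"
     using that by (intro sum_mono2) auto
    also have "... <= ?Q m w + 3 * \<delta>" using split first first0 q \<delta> by linarith
    finally show ?thesis using w by (simp add: B_def)
   qed
   have Weq: "W n n w = (\<Prod>j=m..<n. 1 + \<i> * cor (t * d n j w)) * cor (exp (- t\<^sup>2 * ?Q m w / 2))"
    unfolding W_def using inB by (intro arg_cong2[where f="(*)"] prod.cong) auto
   have "norm (?e w - W n n w) + \<bar>?u w - ?s w\<bar> <= \<bar>t\<bar> * (real m * r) + \<bar>t\<bar>^3 * r * (real C0 + \<delta>) + (exp (3 * t^2 * \<delta> / 2) - 1) + t^2 * \<delta> / 2"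
    unfolding Weq
   proof (rule mcleish_pointwise)
    show "\<bar>(\<Sum>j = m..<n. (d n j w)^2) - ?Q m w\<bar> <= 3 * \<delta>"
     using split first first0 q \<delta> by linarith
    show "(\<Sum>j = m..<n. (d n j w)^2) <= real C0 + \<delta>" using split first0 q by linarith
   qed (use dr r q \<open>m <= n\<close> s2_nonneg w in \<open>auto intro: sum_nonneg\<close>)
   then show ?thesis using r by linarith
  qed
  have u01: "0 <= ?u w" "?u w <= 1" for w by (auto intro!: sum_nonneg mult_nonneg_nonneg)
  have s01: "0 <= ?s w" "?s w <= 1" if "w : space M" for w using s2_nonneg[OF that] by auto
  have all: "norm (?e w - W n n w) + \<bar>?u w - ?s w\<bar> <= ?A + (2 + 1 / (2 * sqrt p)) * ind bad w + sqrt p * (1 + t^2 * R n w)"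
   if w: "w : space M" for w
  proof (cases "w : bad")
   case False
   then show ?thesis using good[OF w False] R0[of n w] p by simp (smt (verit) mult_nonneg_nonneg real_sqrt_gt_0_iff zero_le_power2)
  next
   case True
   have "norm (?e w - W n n w) <= 1 + norm (W n n w)"
    using norm_triangle_ineq4[of "?e w" "W n n w"] by simp
   moreover have "norm (W n n w) <= 1 / (2 * sqrt p) + sqrt p * (1 + t^2 * R n w)"
   proof -
    have "0 <= (sqrt p * norm (W n n w) - 1)^2" by simp
    then have "2 * (sqrt p * norm (W n n w)) <= 1 + p * (norm (W n n w))^2"
     using p by (simp add: power2_diff power_mult_distrib)
    also have "(norm (W n n w))^2 <= 2 * (1 + t^2 * R n w)"
     using W2[OF w] mult_right_mono[OF \<delta>(3), of "1 + t^2 * R n w"] R0[of n w] by simp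
    finally have *: "2 * (sqrt p * norm (W n n w)) <= 1 + p * (2 * (1 + t^2 * R n w))" using p by simp
    have "norm (W n n w) = (2 * (sqrt p * norm (W n n w))) / (2 * sqrt p)" using p by simp
    also have "... <= (1 + p * (2 * (1 + t^2 * R n w))) / (2 * sqrt p)"
     using * p by (intro divide_right_mono) auto
    also have "... = 1 / (2 * sqrt p) + sqrt p * (1 + t^2 * R n w)"
    proof -
     have "p * (2 * y) / (2 * sqrt p) = (p / sqrt p) * y" for y by simp
     note this[of "1 + t^2 * R n w"]
     also have "p / sqrt p = sqrt p" using p by (simp add: real_div_sqrt)
     finally have "p * (2 * (1 + t^2 * R n w)) / (2 * sqrt p) = sqrt p * (1 + t^2 * R n w)" .
     then show ?thesis by (simp add: add_divide_distrib)
    qed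
    finally show ?thesis .
   qed
   moreover have "\<bar>?u w - ?s w\<bar> <= 1" using u01[of w] s01[OF w] by linarith
   ultimately show ?thesis using True A0 by simp
  qed
  have Ri: "integrable M (R n)"
  proof (rule integrableI_nonneg)
   show "(NNI w|M. ennreal (R n w)) < \<infinity>" using Rint[of n] by (metis ennreal_less_top infinity_ennreal_def order.strict_trans1)
  qed (use R0 in auto)
  have c0: "(LINT w|M. R n w) <= max 0 (c n)"
  proof -
   have "ennreal (LINT w|M. R n w) = (NNI w|M. ennreal (R n w))"
    by (rule nn_integral_eq_integral[symmetric]) (use Ri R0 in auto)
   also have "... <= ennreal (max 0 (c n))" using Rint[of n] by (auto simp: max_def ennreal_neg split: if_splits)
   finally show ?thesis by (subst (asm) ennreal_le_iff) auto
  qed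
  have bi: "integrable M (indicat_real bad)"
   by (rule integrable_real_indicator) (auto simp: emeasure_eq_measure)
  have ei: "integrable M ?e" by (rule integrable_const_bound[of _ 1]) auto
  have ui: "integrable M ?u" by (rule integrable_const_bound[of _ 1]) (use u01 in auto)
  have si: "integrable M ?s" by (rule integrable_const_bound[of _ 1]) (use s01 in auto)
  have "norm ((LINT w|M. ?e w) - cor (LINT w|M. ?s w))
    = norm ((LINT w|M. (?e w - W n n w) + cor (?u w - ?s w)))"
   using ei ui si W3 by (simp del: of_real_exp add: of_real_diff)
  also have "... <= (LINT w|M. norm ((?e w - W n n w) + cor (?u w - ?s w)))"
   by (rule integral_norm_bound)
  also have "... <= (LINT w|M. ?A + (2 + 1 / (2 * sqrt p)) * ind bad w + sqrt p * (1 + t^2 * R n w))"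
  proof (rule integral_mono)
   show "integrable M (%w. norm ((?e w - W n n w) + cor (?u w - ?s w)))"
    using ei ui si W3 by (intro integrable_norm Bochner_Integration.integrable_add Bochner_Integration.integrable_diff integrable_of_real)
   show "integrable M (%w. ?A + (2 + 1 / (2 * sqrt p)) * ind bad w + sqrt p * (1 + t^2 * R n w))"
    by (intro Bochner_Integration.integrable_add integrable_mult_right integrable_const bi Ri)
   fix w assume "w : space M"
   from all[OF this] show "norm ((?e w - W n n w) + cor (?u w - ?s w)) <= ?A + (2 + 1 / (2 * sqrt p)) * ind bad w + sqrt p * (1 + t^2 * R n w)"
    by (intro order_trans[OF norm_triangle_ineq]) (simp only: norm_of_real)
  qed
  also have "... = ?A + (2 + 1 / (2 * sqrt p)) * prob bad + sqrt p * (1 + t^2 * (LINT w|M. R n w))"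
   using Ri bi by (simp add: prob_space)
  also have "... <= ?A + 4 * sqrt p"
  proof -
   have "2 * prob bad <= 2 * sqrt p"
    using pbad prob_le_1[of bad] p real_sqrt_le_mono[OF pbad] sqrt_le_D
    by (smt (verit) measure_nonneg real_sqrt_le_iff real_sqrt_mult_self mult_left_le mult_mono real_sqrt_one real_sqrt_ge_0_iff)
   moreover have "prob bad / (2 * sqrt p) <= sqrt p / 2"
    using pbad p divide_right_mono[OF pbad, of "2 * sqrt p"] real_div_sqrt[of p] by simp
   moreover have "sqrt p * (1 + t^2 * (LINT w|M. R n w)) <= sqrt p * (3/2)"
   proof (rule mult_left_mono)
    have "t^2 * (LINT w|M. R n w) <= t\<^sup>2 * max 0 (c n)" using c0 by (rule mult_left_mono) simp
    then show "1 + t^2 * (LINT w|M. R n w) <= 3/2" using elim by (auto simp: max_def split: if_splits)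
   qed (use p in simp)
   ultimately show ?thesis by (simp add: distrib_right)
  qed
  also have "... <= 4 * sqrt (1 - prob E) + eps"
  proof -
   have "sqrt p <= sqrt (1 - prob E) + sqrt (4 * \<delta>)"
    unfolding p_def using \<delta> by (intro sqrt_add_le_add_sqrt) auto
   then show ?thesis using \<delta>(2) by (simp add: \<phi>_def real_sqrt_mult)
  qed
  finally show ?case .
 qed
qed

end

section \<open>The kernels: weighted ergodicity, resolvents and Poisson equations\<close>

lemma enn2real_integral:
 assumes f: "f : meas M" and fin: "(NNI x|M. f x) < \<infinity>"
 shows "integrable M (%x. enn2real (f x))" and "(LINT x|M. enn2real (f x)) = enn2real (NNI x|M. f x)"
proof -
 have [measurable]: "f : meas M" by fact
 have ae: "AE x in M. ennreal (enn2real (f x)) = f x"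
  using nn_integral_PInf_AE[OF f] fin by (auto simp: less_top elim!: eventually_mono)
 then have eq: "(NNI x|M. ennreal (enn2real (f x))) = (NNI x|M. f x)" by (rule nn_integral_cong_AE)
 show "integrable M (%x. enn2real (f x))"
  by (rule integrableI_nonneg) (use eq fin in auto)
 show "(LINT x|M. enn2real (f x)) = enn2real (NNI x|M. f x)"
  by (subst integral_eq_nn_integral) (use eq in auto)
qed

lemma bind_integral_real:
 fixes u :: "'b => real"
 assumes N[measurable]: "N : measurable M (subprob_algebra B)" and u[measurable]: "u : meas B"
  and int: "(NNI x|M. (NNI y|N x. ennreal \<bar>u y\<bar>)) < \<infinity>" and ne: "space M \<noteq> {}"
 shows "integrable (M \<bind> N) u" and "(LINT y|(M \<bind> N). u y) = (LINT x|M. (LINT y|N x. u y))"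
proof -
 have sb: "sets (M \<bind> N) = sets B" using N ne by (intro sets_bind sets_kernel[OF N]) auto
 have uM[measurable]: "u : meas (M \<bind> N)" using u by (simp cong: measurable_cong_sets add: sb)
 have b: "(NNI y|(M \<bind> N). ennreal \<bar>u y\<bar>) < \<infinity>"
  using int by (subst nn_integral_bind[where B=B]) auto
 show I: "integrable (M \<bind> N) u" using b by (intro integrableI_bounded) auto
 define p where "p x = (NNI y|N x. ennreal (u y))" for x
 define q where "q x = (NNI y|N x. ennreal (- u y))" for x
 have [measurable]: "p : meas M" "q : meas M"
  unfolding p_def q_def by (auto intro!: measurable_compose[OF N nn_integral_measurable_subprob_algebra])
 have P: "(NNI y|(M \<bind> N). ennreal (u y)) = (NNI x|M. p x)"
  unfolding p_def by (subst nn_integral_bind[where B=B]) auto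
 have Q: "(NNI y|(M \<bind> N). ennreal (- u y)) = (NNI x|M. q x)"
  unfolding q_def by (subst nn_integral_bind[where B=B]) auto
 have Pf: "(NNI x|M. p x) < \<infinity>" unfolding P[symmetric]
  by (rule order.strict_trans1[OF _ b]) (auto intro!: nn_integral_mono ennreal_leI)
 have Qf: "(NNI x|M. q x) < \<infinity>" unfolding Q[symmetric]
  by (rule order.strict_trans1[OF _ b]) (auto intro!: nn_integral_mono ennreal_leI)
 have mN: "(%x. NNI y|N x. ennreal \<bar>u y\<bar>) : meas M"
  by (rule measurable_compose[OF N nn_integral_measurable_subprob_algebra]) simp
 have "AE x in M. (NNI y|N x. ennreal \<bar>u y\<bar>) \<noteq> \<infinity>"
  by (rule nn_integral_PInf_AE[OF mN]) (use int in simp)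
 then have ae: "AE x in M. enn2real (p x) - enn2real (q x) = (LINT y|N x. u y)"
  using AE_space
 proof eventually_elim
  case (elim x)
  have [measurable]: "u : meas (N x)"
   using u sets_kernel[OF N elim(2)] by (simp cong: measurable_cong_sets)
  have "integrable (N x) u" using elim by (intro integrableI_bounded) (auto simp: less_top)
  then show ?case unfolding p_def q_def by (simp add: real_lebesgue_integral_def)
 qed
 have "(LINT y|(M \<bind> N). u y) = enn2real (NNI x|M. p x) - enn2real (NNI x|M. q x)"
  unfolding real_lebesgue_integral_def[OF I] P Q ..
 also have "... = (LINT x|M. enn2real (p x) - enn2real (q x))"
  using enn2real_integral[of p M] enn2real_integral[of q M] Pf Qf by simp
 also have "... = (LINT x|M. (LINT y|N x. u y))"
  by (rule integral_cong_AE) (use ae in \<open>auto intro!: measurable_compose[OF N integral_measurable_subprob_algebra]\<close>)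
 finally show "(LINT y|(M \<bind> N). u y) = (LINT x|M. (LINT y|N x. u y))" .
qed

lemma integral_measurable_kernel:
 fixes f :: "'a => 'b => real"
 assumes f[measurable]: "(%(x, y). f x y) : meas (M \<Otimes>\<^sub>M N)"
  and L[measurable]: "L : measurable M (subprob_algebra N)"
 shows "(%x. LINT y|L x. f x y) : meas M"
proof -
 have "(%x. LINT z|distr (L x) (M \<Otimes>\<^sub>M N) (%y. (x, y)). (case z of (x, y) => f x y)) : meas M"
  by (rule measurable_compose[OF measurable_distr2[OF _ L] integral_measurable_subprob_algebra]) (use f in auto)
 then show ?thesis
 proof (rule measurable_cong[THEN iffD1, rotated])
  fix x assume x: "x : space M"
  have "(%y. (x, y)) : measurable (L x) (M \<Otimes>\<^sub>M N)"
   using measurable_Pair1'[OF x, of N] sets_kernel[OF L x] by (simp cong: measurable_cong_sets)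
  then show "(LINT z|distr (L x) (M \<Otimes>\<^sub>M N) (%y. (x, y)). (case z of (x, y) => f x y)) = (LINT y|L x. f x y)"
   using integral_distr[OF _ f, of "%y. (x, y)" "L x"] by simp
 qed
qed

lemma space_param_space [simp]: "space (param_space \<Theta>) = \<Theta>"
 by (simp add: param_space_def space_restrict_space)

locale ergodic_kernels =
 fixes S :: "'a measure" and \<Theta> :: "'p::topological_space set" and P :: "'p => 'a => 'a measure"
  and \<pi> :: "'a measure" and \<alpha> :: real and V :: "'a => real"
 assumes P_joint: "(%z. P (snd z) (fst z)) : measurable (SP S \<Theta>) (prob_algebra S)"
  and prob_pi: "prob_space \<pi>" and sets_pi: "sets \<pi> = sets S"
  and invariant_pi: "!!\<theta>. \<theta> : \<Theta> ==> bind \<pi> (P \<theta>) = \<pi>"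
  and alpha: "0 < \<alpha>" "\<alpha> < 1 / 2"
  and V: "V : meas S" and V_ge_1: "!!x. x : space S ==> 1 <= V x"
  and ergodic: "!!C \<beta>' \<kappa>'. compact C ==> C \<subseteq> \<Theta> ==> \<beta>' : {0..1 - \<alpha>} ==>
   \<kappa>' : {0..(1 - \<beta>') / \<alpha> - 1} ==> \<exists>B. \<forall>n. \<forall>x\<in>space S. \<forall>\<theta>\<in>C.
   ennreal (real (n + 1) powr \<kappa>') *
    wdist S (%y. V y powr \<beta>') (kernel_pow S (P \<theta>) n x) \<pi>
   <= ennreal (B * V x powr (\<beta>' + \<alpha> * \<kappa>'))"
  and Theta_ne: "\<Theta> \<noteq> {}" and S_ne: "space S \<noteq> {}"
begin

declare V[measurable]

abbreviation (input) "Pf \<theta> n u x \<equiv> (LINT y|kernel_pow S (P \<theta>) n x. u y)"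

definition dominated :: "real => real => ('a => real) => bool" where
 "dominated s B u \<longleftrightarrow> u : meas S \<and> 0 < B \<and> (\<forall>x\<in>space S. \<bar>u x\<bar> <= B * V x powr s)"

lemma dominatedD:
 assumes "dominated s B u"
 shows "u : meas S" "0 < B" "x : space S ==> \<bar>u x\<bar> <= B * V x powr s"
 using assms by (auto simp: dominated_def)

lemma V_powr_ge_1: "x : space S ==> 0 <= s ==> 1 <= V x powr s"
 using V_ge_1[of x] by (simp add: ge_one_powr_ge_zero)

lemma V_powr_mono: "x : space S ==> s <= s' ==> V x powr s <= V x powr s'"
 using V_ge_1[of x] by (simp add: powr_mono)

lemma kernel_joint_pow:
 "(%z. kernel_pow S (P (snd z)) n (fst z)) : measurable (SP S \<Theta>) (prob_algebra S)"
proof (induction n)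
 case 0
 have "return S : measurable S (prob_algebra S)" by measurable
 then show ?case by (simp add: measurable_compose[OF measurable_fst])
next
 case (Suc n)
 have "(%ww. (snd ww, snd (fst ww))) : measurable ((SP S \<Theta>) \<Otimes>\<^sub>M S) (SP S \<Theta>)"
  by measurable
 from measurable_compose[OF this Suc]
 show ?case using measurable_bind_prob_space2[OF P_joint, of "%z. kernel_pow S (P (snd z)) n" S]
  by (simp add: split_beta')
qed

lemma kernel_pow: "\<theta> : \<Theta> ==> kernel_pow S (P \<theta>) n : measurable S (prob_algebra S)"
proof -
 assume "\<theta> : \<Theta>"
 then have "(%x. (x, \<theta>)) : measurable S (SP S \<Theta>)" by (intro measurable_Pair2') simp
 from measurable_compose[OF this kernel_joint_pow[of n]] show ?thesis by simp
qed

lemma kernel: "\<theta> : \<Theta> ==> P \<theta> : measurable S (prob_algebra S)"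
proof -
 assume "\<theta> : \<Theta>"
 then have "(%x. (x, \<theta>)) : measurable S (SP S \<Theta>)" by (intro measurable_Pair2') simp
 from measurable_compose[OF this P_joint] show ?thesis by simp
qed

lemma kernel_pow_sub: "\<theta> : \<Theta> ==> kernel_pow S (P \<theta>) n : measurable S (subprob_algebra S)"
 by (intro measurable_prob_algebraD kernel_pow)

lemma kernel_pow_1: "\<theta> : \<Theta> ==> x : space S ==> kernel_pow S (P \<theta>) (Suc 0) x = P \<theta> x"
 using measurable_space[OF kernel, of \<theta> x] by (simp add: space_prob_algebra bind_return'')

lemma
 assumes "\<theta> : \<Theta>" "x : space S"
 shows sets_kernel_pow: "sets (kernel_pow S (P \<theta>) n x) = sets S"
  and prob_kernel_pow: "prob_space (kernel_pow S (P \<theta>) n x)"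
 using measurable_space[OF kernel_pow[OF assms(1)] assms(2), of n] by (auto simp: space_prob_algebra)

lemma
 assumes "\<theta> : \<Theta>" "x : space S"
 shows sets_P: "sets (P \<theta> x) = sets S" and prob_P: "prob_space (P \<theta> x)"
 using measurable_space[OF kernel[OF assms(1)] assms(2)] by (auto simp: space_prob_algebra)

text \<open>
 The function \<open>u / B\<close> is one of the test functions in \<open>wdist\<close>, and \<open>b + \<alpha> * \<kappa>' + \<alpha> \<le> 1\<close> is the
 admissible range of the exponents.
\<close>

lemma weighted_ergodicity:
 assumes C: "compact C" "C \<subseteq> \<Theta>" and bk: "0 <= b" "0 <= \<kappa>'" "b + \<alpha> * \<kappa>' + \<alpha> <= 1"
 shows "\<exists>c>0. \<forall>\<theta>\<in>C. \<forall>x\<in>space S. \<forall>u B n. dominated b B u -->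
  \<bar>Pf \<theta> n u x - (LINT y|\<pi>. u y)\<bar> <= c * B * real (n + 1) powr (- \<kappa>') * V x powr (b + \<alpha> * \<kappa>')"
proof -
 have "0 <= \<alpha> * \<kappa>'" using bk alpha by (intro mult_nonneg_nonneg) auto
 then have "b <= 1 - \<alpha>" using bk by linarith
 then have "b : {0..1 - \<alpha>}" using bk by simp
 moreover have "\<kappa>' : {0..(1 - b) / \<alpha> - 1}"
  using bk alpha by (auto simp: field_simps)
 ultimately obtain D where D: "!!n x \<theta>. x : space S ==> \<theta> : C ==> ennreal (real (n + 1) powr \<kappa>') *
    wdist S (%y. V y powr b) (kernel_pow S (P \<theta>) n x) \<pi>
   <= ennreal (D * V x powr (b + \<alpha> * \<kappa>'))" using ergodic[OF C] by blast
 have "\<bar>Pf \<theta> n u x - (LINT y|\<pi>. u y)\<bar> <= max 1 D * B * real (n + 1) powr (- \<kappa>') * V x powr (b + \<alpha> * \<kappa>')"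
  if x: "x : space S" and th: "\<theta> : C" and u: "dominated b B u" for \<theta> x u B n
 proof -
  note [measurable] = dominatedD(1)[OF u] and B = dominatedD(2)[OF u]
  let ?g = "%y. u y / B"
  have "wnorm S (%y. V y powr b) ?g <= 1"
   unfolding wnorm_def
  proof (rule SUP_least)
   fix y assume y: "y : space S"
   have "\<bar>?g y\<bar> / V y powr b <= 1"
    using dominatedD(3)[OF u y] B V_ge_1[OF y] by (simp add: abs_mult field_simps)
   then show "ennreal (\<bar>?g y\<bar> / V y powr b) <= 1" by (simp add: ennreal_le_1)
  qed
  then have "ennreal \<bar>(LINT y|kernel_pow S (P \<theta>) n x. ?g y) - (LINT y|\<pi>. ?g y)\<bar> <= wdist S (%y. V y powr b) (kernel_pow S (P \<theta>) n x) \<pi>"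
   unfolding wdist_def by (intro SUP_upper) auto
  moreover have "(LINT y|kernel_pow S (P \<theta>) n x. ?g y) - (LINT y|\<pi>. ?g y) = (Pf \<theta> n u x - (LINT y|\<pi>. u y)) / B"
   by (simp add: diff_divide_distrib)
  ultimately have "ennreal (real (n + 1) powr \<kappa>') * ennreal (\<bar>Pf \<theta> n u x - (LINT y|\<pi>. u y)\<bar> / B) <= ennreal (D * V x powr (b + \<alpha> * \<kappa>'))"
   using B by (intro order_trans[OF mult_left_mono D[OF x th]]) (auto simp: abs_divide)
  also have "... <= ennreal (max 1 D * V x powr (b + \<alpha> * \<kappa>'))" by (intro ennreal_leI mult_right_mono) auto
  finally have "real (n + 1) powr \<kappa>' * (\<bar>Pf \<theta> n u x - (LINT y|\<pi>. u y)\<bar> / B) <= max 1 D * V x powr (b + \<alpha> * \<kappa>')"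
   using B by (subst (asm) ennreal_mult[symmetric]) (auto simp: ennreal_le_iff)
  then show ?thesis using B by (simp add: powr_minus field_simps)
 qed
 then show ?thesis by (intro exI[of _ "max 1 D"]) auto
qed

lemma trunc_dominated: "0 <= s ==> dominated s 1 (%x. min (V x powr s) (real N))"
 unfolding dominated_def by (auto simp: min_def)

text \<open>
 The Bochner integral of a nonintegrable function is zero, so that \<open>wdist\<close> says nothing about a
 power of \<open>V\<close> before its integrability is known. Bounds for the truncations, which are integrable,
 pass to the power itself by monotone convergence.
\<close>

lemma nn_integral_V_trunc:
 assumes sM: "sets M = sets S" and M: "prob_space M" and s: "0 <= s"
  and le: "!!N::nat. (LINT y|M. min (V y powr s) (real N)) <= c"
 shows "(NNI y|M. ennreal (V y powr s)) <= ennreal c"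
proof -
 interpret M: prob_space M by fact
 have [measurable]: "V : meas M" using V sM by (simp cong: measurable_cong_sets)
 have "(NNI y|M. ennreal (V y powr s)) = (NNI y|M. (SUP N::nat. ennreal (min (V y powr s) (real N))))"
 proof (rule nn_integral_cong)
  fix y
  show "ennreal (V y powr s) = (SUP N::nat. ennreal (min (V y powr s) (real N)))"
  proof (rule antisym)
   obtain N :: nat where "V y powr s <= N" using real_arch_simple by blast
   then have "ennreal (V y powr s) = ennreal (min (V y powr s) (real N))" by simp
   also have "... <= (SUP N::nat. ennreal (min (V y powr s) (real N)))" by (rule SUP_upper) simp
   finally show "ennreal (V y powr s) <= (SUP N::nat. ennreal (min (V y powr s) (real N)))" .
  qed (auto intro!: SUP_least ennreal_leI)
 qed
 also have "... = (SUP N::nat. (NNI y|M. ennreal (min (V y powr s) (real N))))"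
  by (rule nn_integral_monotone_convergence_SUP) (auto simp: incseq_def le_fun_def intro!: ennreal_leI)
 also have "... <= ennreal c"
 proof (rule SUP_least)
  fix N :: nat
  have "integrable M (%y. min (V y powr s) (real N))"
   by (rule M.integrable_const_bound[of _ "real N"]) auto
  then have "(NNI y|M. ennreal (min (V y powr s) (real N))) = ennreal (LINT y|M. min (V y powr s) (real N))"
   by (rule nn_integral_eq_integral) simp
  also have "... <= ennreal c" by (rule ennreal_leI[OF le])
  finally show "(NNI y|M. ennreal (min (V y powr s) (real N))) <= ennreal c" .
 qed
 finally show ?thesis .
qed

lemma kernel_pow_moment:
 assumes C: "compact C" "C \<subseteq> \<Theta>" and s: "0 <= s" "s <= 1 - \<alpha>"
 shows "\<exists>c>0. (\<forall>\<theta>\<in>C. \<forall>x\<in>space S. (\<forall>n. (NNI y|kernel_pow S (P \<theta>) n x. ennreal (V y powr s)) <= ennreal (c * V x powr s))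
   \<and> (NNI y|\<pi>. ennreal (V y powr s)) <= ennreal (c * V x powr s))"
proof -
 obtain c where c: "c > 0" "!!\<theta> x u B n. \<theta>\<in>C ==> x\<in>space S ==> dominated s B u ==>
  \<bar>Pf \<theta> n u x - (LINT y|\<pi>. u y)\<bar> <= c * B * real (n + 1) powr (- 0) * V x powr (s + \<alpha> * 0)"
  using weighted_ergodicity[OF C s(1), of 0] s by auto
 have pi: "(LINT y|\<pi>. min (V y powr s) (real N)) <= (1 + c) * V x powr s" if "\<theta>\<in>C" "x\<in>space S" for \<theta> x N
 proof -
  have "Pf \<theta> 0 (%y. min (V y powr s) (real N)) x = min (V x powr s) (real N)"
   using that by (simp add: integral_return)
  then show ?thesis using c(2)[OF that trunc_dominated[OF s(1), of N], of 0] by (simp add: algebra_simps)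
 qed
 have P: "Pf \<theta> n (%y. min (V y powr s) (real N)) x <= (1 + 2 * c) * V x powr s" if "\<theta>\<in>C" "x\<in>space S" for \<theta> x N n
  using c(2)[OF that trunc_dominated[OF s(1), of N], of n] pi[OF that, of N] by (simp add: algebra_simps)
 have "(NNI y|kernel_pow S (P \<theta>) n x. ennreal (V y powr s)) <= ennreal ((1 + 2 * c) * V x powr s)
   \<and> (NNI y|\<pi>. ennreal (V y powr s)) <= ennreal ((1 + 2 * c) * V x powr s)" if "\<theta>\<in>C" "x\<in>space S" for \<theta> x n
 proof
  show "(NNI y|kernel_pow S (P \<theta>) n x. ennreal (V y powr s)) <= ennreal ((1 + 2 * c) * V x powr s)"
   using that C by (intro nn_integral_V_trunc sets_kernel_pow prob_kernel_pow s(1) P[OF that]) auto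
  have "(NNI y|\<pi>. ennreal (V y powr s)) <= ennreal ((1 + c) * V x powr s)"
   by (intro nn_integral_V_trunc prob_pi sets_pi s(1) pi[OF that])
  also have "... <= ennreal ((1 + 2 * c) * V x powr s)" using c by (intro ennreal_leI mult_right_mono) auto
  finally show "(NNI y|\<pi>. ennreal (V y powr s)) <= ennreal ((1 + 2 * c) * V x powr s)" .
 qed
 then show ?thesis using c(1) by (intro exI[of _ "1 + 2 * c"]) auto
qed

lemma pi_moment:
 assumes s: "0 <= s" "s <= 1 - \<alpha>"
 shows "(NNI y|\<pi>. ennreal (V y powr s)) < \<infinity>"
proof -
 obtain \<theta> x where tx: "\<theta> : \<Theta>" "x : space S" using Theta_ne S_ne by blast
 then obtain c where "(NNI y|\<pi>. ennreal (V y powr s)) <= ennreal (c * V x powr s)"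
  using kernel_pow_moment[of "{\<theta>}" s] s by auto
 then show ?thesis by (rule order.strict_trans1) simp
qed

lemma dominated_nn:
 assumes u: "dominated s B u" and sM: "sets M = sets S"
 shows "(NNI y|M. ennreal \<bar>u y\<bar>) <= ennreal B * (NNI y|M. ennreal (V y powr s))"
proof -
 have [measurable]: "V : meas M" using V sM by (simp cong: measurable_cong_sets)
 have "(NNI y|M. ennreal \<bar>u y\<bar>) <= (NNI y|M. ennreal B * ennreal (V y powr s))"
  using dominatedD[OF u] sets_eq_imp_space_eq[OF sM]
  by (intro nn_integral_mono) (auto simp: ennreal_mult[symmetric] intro!: ennreal_leI)
 also have "... = ennreal B * (NNI y|M. ennreal (V y powr s))" by (rule nn_integral_cmult) simp
 finally show ?thesis .
qed

lemma dominated_integrable: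
 assumes u: "dominated s B u" and sM: "sets M = sets S"
  and fin: "(NNI y|M. ennreal (V y powr s)) <= ennreal c"
 shows "integrable M u" and "\<bar>\<integral>y. u y \<partial>M\<bar> <= B * max 0 c" and "(LINT y|M. \<bar>u y\<bar>) <= B * max 0 c"
proof -
 have [measurable]: "u : meas M" using dominatedD(1)[OF u] sM by (simp cong: measurable_cong_sets)
 have "(NNI y|M. ennreal \<bar>u y\<bar>) <= ennreal B * ennreal c"
  by (rule order_trans[OF dominated_nn[OF u sM] mult_left_mono[OF fin]]) simp
 also have "... = ennreal (B * max 0 c)" using dominatedD(2)[OF u] by (simp add: ennreal_mult'[symmetric] max_def ennreal_neg mult_nonneg_nonpos)
 finally have b: "(NNI y|M. ennreal \<bar>u y\<bar>) <= ennreal (B * max 0 c)" .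
 then show i: "integrable M u" by (intro integrableI_bounded) (auto simp: less_top[symmetric] top_unique)
 have "ennreal (LINT y|M. \<bar>u y\<bar>) = (NNI y|M. ennreal \<bar>u y\<bar>)"
  using i by (intro nn_integral_eq_integral[symmetric]) auto
 with b have "ennreal (LINT y|M. \<bar>u y\<bar>) <= ennreal (B * max 0 c)" by simp
 then show c: "(LINT y|M. \<bar>u y\<bar>) <= B * max 0 c" using dominatedD(2)[OF u] by (subst (asm) ennreal_le_iff) auto
 show "\<bar>\<integral>y. u y \<partial>M\<bar> <= B * max 0 c" using integral_abs_bound[of M u] c by linarith
qed

lemma dominated_integrable_pi: "dominated s B u ==> 0 <= s ==> s <= 1 - \<alpha> ==> integrable \<pi> u"
 using dominated_integrable(1)[OF _ sets_pi, of s B u "enn2real (NNI y|\<pi>. ennreal (V y powr s))"] pi_moment[of s]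
 by (simp add: less_top)

lemma kernel_pow_dominated:
 assumes C: "compact C" "C \<subseteq> \<Theta>" and s: "0 <= s" "s <= 1 - \<alpha>"
 shows "\<exists>c>0. \<forall>\<theta>\<in>C. \<forall>u B n. dominated s B u --> dominated s (c * B) (Pf \<theta> n u) \<and>
   (\<forall>x\<in>space S. integrable (kernel_pow S (P \<theta>) n x) u \<and> (NNI y|kernel_pow S (P \<theta>) n x. ennreal \<bar>u y\<bar>) <= ennreal (c * B * V x powr s))"
proof -
 obtain c where c: "c > 0" "!!\<theta> x n. \<theta>\<in>C ==> x\<in>space S ==> (NNI y|kernel_pow S (P \<theta>) n x. ennreal (V y powr s)) <= ennreal (c * V x powr s)"
  using kernel_pow_moment[OF C s] by blast
 have "dominated s (c * B) (Pf \<theta> n u)" if "\<theta> : C" "dominated s B u" for \<theta> u B n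
  unfolding dominated_def
 proof (intro conjI ballI)
  have "\<theta> : \<Theta>" using that C by auto
  show "Pf \<theta> n u : meas S"
   by (rule measurable_compose[OF kernel_pow_sub[OF \<open>\<theta> : \<Theta>\<close>] integral_measurable_subprob_algebra]) (rule dominatedD[OF that(2)])
  show "0 < c * B" using c dominatedD[OF that(2)] by simp
  fix x assume x: "x : space S"
  show "\<bar>Pf \<theta> n u x\<bar> <= c * B * V x powr s"
   using dominated_integrable(2)[OF that(2) sets_kernel_pow[OF \<open>\<theta> : \<Theta>\<close> x] c(2)[OF that(1) x]] c(1) by (simp add: mult_ac)
 qed
 moreover have "integrable (kernel_pow S (P \<theta>) n x) u" "(NNI y|kernel_pow S (P \<theta>) n x. ennreal \<bar>u y\<bar>) <= ennreal (c * B * V x powr s)"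
   if "\<theta> : C" "dominated s B u" "x : space S" for \<theta> u B n x
 proof -
  have th: "\<theta> : \<Theta>" using that C by auto
  show "integrable (kernel_pow S (P \<theta>) n x) u"
   using dominated_integrable(1)[OF that(2) sets_kernel_pow[OF th that(3)] c(2)[OF that(1,3)]] .
  have "(NNI y|kernel_pow S (P \<theta>) n x. ennreal \<bar>u y\<bar>) <= ennreal B * ennreal (c * V x powr s)"
   by (rule order_trans[OF dominated_nn[OF that(2) sets_kernel_pow[OF th that(3)]] mult_left_mono[OF c(2)[OF that(1,3)]]]) simp
  then show "(NNI y|kernel_pow S (P \<theta>) n x. ennreal \<bar>u y\<bar>) <= ennreal (c * B * V x powr s)"
   using c dominatedD(2)[OF that(2)] by (simp add: ennreal_mult'[symmetric] mult_ac)
 qed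
 ultimately show ?thesis using c(1) by (intro exI[of _ c]) auto
qed

lemma kernel_pow_Suc_integral:
 assumes th: "\<theta> : \<Theta>" and x: "x : space S" and s: "0 <= s" "s <= 1 - \<alpha>" and u: "dominated s B u"
 shows "Pf \<theta> (Suc n) u x = (LINT y|P \<theta> x. Pf \<theta> n u y)"
proof -
 obtain c where c: "c > 0" "!!n u B. dominated s B u ==> dominated s (c * B) (Pf \<theta> n u) \<and>
   (\<forall>x\<in>space S. integrable (kernel_pow S (P \<theta>) n x) u \<and> (NNI y|kernel_pow S (P \<theta>) n x. ennreal \<bar>u y\<bar>) <= ennreal (c * B * V x powr s))"
  using kernel_pow_dominated[of "{\<theta>}" s] s th by (metis compact_sing empty_subsetI insert_subset singletonI)
 have N: "kernel_pow S (P \<theta>) n : measurable (P \<theta> x) (subprob_algebra S)"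
  using kernel_pow_sub[OF th] sets_P[OF th x] by (simp cong: measurable_cong_sets)
 have um: "u : meas S" by (rule dominatedD[OF u])
 have "(NNI y|P \<theta> x. (NNI z|kernel_pow S (P \<theta>) n y. ennreal \<bar>u z\<bar>)) = (NNI z|kernel_pow S (P \<theta>) (Suc n) x. ennreal \<bar>u z\<bar>)"
  using um by (simp add: nn_integral_bind[OF _ N])
 also have "... < \<infinity>" using c(2)[OF u, of "Suc n"] x by (auto intro: order.strict_trans1 simp del: kernel_pow.simps)
 finally have f: "(NNI y|P \<theta> x. (NNI z|kernel_pow S (P \<theta>) n y. ennreal \<bar>u z\<bar>)) < \<infinity>" .
 have "space (P \<theta> x) \<noteq> {}" using prob_space.not_empty[OF prob_P[OF th x]] .
 from bind_integral_real(2)[OF N um f this] show ?thesis by simp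
qed

lemma kernel_dominated:
 assumes C: "compact C" "C \<subseteq> \<Theta>" and s: "0 <= s" "s <= 1 - \<alpha>"
 shows "\<exists>c>0. \<forall>\<theta>\<in>C. \<forall>u B. dominated s B u --> dominated s (c * B) (%x. LINT y|P \<theta> x. u y) \<and>
   (\<forall>x\<in>space S. integrable (P \<theta> x) u \<and> (NNI y|P \<theta> x. ennreal \<bar>u y\<bar>) <= ennreal (c * B * V x powr s))"
proof -
 obtain c where c: "c > 0" "!!\<theta> n u B. \<theta> : C ==> dominated s B u ==> dominated s (c * B) (Pf \<theta> n u) \<and>
   (\<forall>x\<in>space S. integrable (kernel_pow S (P \<theta>) n x) u \<and> (NNI y|kernel_pow S (P \<theta>) n x. ennreal \<bar>u y\<bar>) <= ennreal (c * B * V x powr s))"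
  using kernel_pow_dominated[OF C s] by auto
 have "dominated s (c * B) (%x. LINT y|P \<theta> x. u y) \<and>
   (\<forall>x\<in>space S. integrable (P \<theta> x) u \<and> (NNI y|P \<theta> x. ennreal \<bar>u y\<bar>) <= ennreal (c * B * V x powr s))"
  if "\<theta> : C" "dominated s B u" for \<theta> u B
 proof -
  have th: "\<theta> : \<Theta>" using that C by auto
  have "dominated s (c * B) (%x. LINT y|P \<theta> x. u y)"
  proof -
   have "(%x. LINT y|P \<theta> x. u y) : meas S"
    by (rule measurable_compose[OF measurable_prob_algebraD[OF kernel[OF th]] integral_measurable_subprob_algebra]) (rule dominatedD[OF that(2)])
   then show ?thesis using c(2)[OF that, of "Suc 0"] kernel_pow_1[OF th] by (simp add: dominated_def del: kernel_pow.simps)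
  qed
  then show ?thesis using c(2)[OF that, of "Suc 0"] kernel_pow_1[OF th] by (simp del: kernel_pow.simps)
 qed
 then show ?thesis using c(1) by blast
qed

lemma invariant_integral:
 assumes th: "\<theta> : \<Theta>" and s: "0 <= s" "s <= 1 - \<alpha>" and u: "dominated s B u"
 shows "(LINT x|\<pi>. (LINT y|P \<theta> x. u y)) = (LINT y|\<pi>. u y)"
proof -
 have N: "P \<theta> : measurable \<pi> (subprob_algebra S)"
  using measurable_prob_algebraD[OF kernel[OF th]] sets_pi by (simp cong: measurable_cong_sets)
 have um: "u : meas S" by (rule dominatedD[OF u])
 have "(NNI x|\<pi>. (NNI z|P \<theta> x. ennreal \<bar>u z\<bar>)) = (NNI z|\<pi>. ennreal \<bar>u z\<bar>)"
  using um by (subst nn_integral_bind[OF _ N, symmetric]) (auto simp: invariant_pi[OF th])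
 also have "... < \<infinity>" using dominated_integrable_pi[OF u s] by (simp add: integrable_iff_bounded)
 finally have f: "(NNI x|\<pi>. (NNI z|P \<theta> x. ennreal \<bar>u z\<bar>)) < \<infinity>" .
 from bind_integral_real(2)[OF N um f prob_space.not_empty[OF prob_pi]] show ?thesis by (simp add: invariant_pi[OF th])
qed

lemma dominated_add:
 assumes "dominated s B u" "dominated s B' u'" shows "dominated s (B + B') (%x. u x + u' x)"
 unfolding dominated_def
proof (intro conjI ballI)
 fix x assume x: "x : space S"
 show "\<bar>u x + u' x\<bar> <= (B + B') * V x powr s"
  using dominatedD(3)[OF assms(1) x] dominatedD(3)[OF assms(2) x] by (simp add: distrib_right)
qed (use dominatedD[OF assms(1)] dominatedD[OF assms(2)] in auto)

lemma dominated_cmult: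
 assumes "dominated s B u" "c \<noteq> 0" shows "dominated s (\<bar>c\<bar> * B) (%x. c * u x)"
 unfolding dominated_def
proof (intro conjI ballI)
 fix x assume x: "x : space S"
 show "\<bar>c * u x\<bar> <= \<bar>c\<bar> * B * V x powr s"
  using mult_left_mono[OF dominatedD(3)[OF assms(1) x], of "\<bar>c\<bar>"] by (simp add: abs_mult)
qed (use dominatedD[OF assms(1)] assms in auto)

lemma dominated_diff:
 assumes "dominated s B u" "dominated s B' u'" shows "dominated s (B + B') (%x. u x - u' x)"
 using dominated_add[OF assms(1) dominated_cmult[OF assms(2), of "-1"]] by simp

text \<open>
 The terms are at most \<open>A\<close> times those of a convergent series of exponent \<open>\<kappa>' + \<eta>\<close>: with \<open>\<eta> = 0\<close> the
 decay of the kernels suffices and the bound is uniform in \<open>a\<close>; with \<open>\<eta> > 0\<close> a part of the decay is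
 supplied by the geometric weights, at the cost of \<open>A\<close>, of order \<open>a\<close> to the power \<open>-\<eta>\<close>, and the
 exponent of \<open>V\<close> is smaller.
\<close>

lemma resolvent_bound:
 assumes C: "compact C" "C \<subseteq> \<Theta>" and b: "0 <= b" "0 <= \<kappa>'" "b + \<alpha> * \<kappa>' + \<alpha> <= 1" and \<eta>: "1 < \<kappa>' + \<eta>"
 shows "\<exists>c>0. \<forall>\<theta>\<in>C. \<forall>u B a A. dominated b B u --> (LINT y|\<pi>. u y) = 0 --> 0 <= a --> a < 1 --> 0 < A -->
   (\<forall>j. (1 - a) ^ (j + 1) * real (j + 1) powr \<eta> <= A) -->
   dominated (b + \<alpha> * \<kappa>') (c * A * B) (%x. resolvent S P u a x \<theta>) \<and>
   (\<exists>t. summable t \<and> (\<forall>x\<in>space S. \<forall>j. \<bar>(1 - a) ^ (j + 1) * Pf \<theta> j u x\<bar> <= t j * V x powr (b + \<alpha> * \<kappa>')))"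
proof -
 obtain c where c: "c > 0" "!!\<theta> x u B n. \<theta>\<in>C ==> x\<in>space S ==> dominated b B u ==>
  \<bar>Pf \<theta> n u x - (LINT y|\<pi>. u y)\<bar> <= c * B * real (n + 1) powr (- \<kappa>') * V x powr (b + \<alpha> * \<kappa>')"
  using weighted_ergodicity[OF C b] by blast
 define z where "z j = real (j + 1) powr (- (\<kappa>' + \<eta>))" for j
 have zs: "summable z"
 proof -
  have "summable (%j. real j powr (- (\<kappa>' + \<eta>)))" using \<eta> by (simp add: summable_real_powr_iff)
  then show ?thesis unfolding z_def by (subst (asm) summable_Suc_iff[symmetric]) (simp add: add.commute)
 qed
 have z0: "0 <= z j" for j by (simp add: z_def)
 have Z: "0 < suminf z" by (rule suminf_pos2[OF zs z0, of 0]) (simp add: z_def)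
 show ?thesis
 proof (intro exI[of _ "c * suminf z"] conjI ballI allI impI)
  show "0 < c * suminf z" using c Z by simp
  fix \<theta> u B a A assume th: "\<theta> : C" and u: "dominated b B u" "(LINT y|\<pi>. u y) = 0" and a: "0 <= a" "a < 1" and A: "0 < A"
   "\<forall>j. (1 - a) ^ (j + 1) * real (j + 1) powr \<eta> <= A"
  have thT: "\<theta> : \<Theta>" using th C by auto
  have B: "0 < B" by (rule dominatedD[OF u(1)])
  have tm: "\<bar>(1 - a) ^ (j + 1) * Pf \<theta> j u x\<bar> <= (c * A * B * z j) * V x powr (b + \<alpha> * \<kappa>')" if x: "x : space S" for x j
  proof -
   have "(1 - a) ^ (j + 1) = ((1 - a) ^ (j + 1) * real (j + 1) powr \<eta>) * real (j + 1) powr (- \<eta>)"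
    by (simp add: powr_minus)
   also have "... <= A * real (j + 1) powr (- \<eta>)" using A by (intro mult_right_mono) auto
   finally have 1: "(1 - a) ^ (j + 1) <= A * real (j + 1) powr (- \<eta>)" .
   have "\<bar>(1 - a) ^ (j + 1) * Pf \<theta> j u x\<bar> <= (A * real (j + 1) powr (- \<eta>)) * (c * B * real (j + 1) powr (- \<kappa>') * V x powr (b + \<alpha> * \<kappa>'))"
    unfolding abs_mult using 1 c(2)[OF th x u(1), of j] u(2) a A by (intro mult_mono) (auto simp: power_abs)
   also have "... = c * A * B * (real (j + 1) powr (- \<kappa>') * real (j + 1) powr (- \<eta>)) * V x powr (b + \<alpha> * \<kappa>')" by simp
   also have "real (j + 1) powr (- \<kappa>') * real (j + 1) powr (- \<eta>) = z j" by (simp add: z_def powr_add[symmetric])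
   finally show ?thesis .
  qed
  show "\<exists>t. summable t \<and> (\<forall>x\<in>space S. \<forall>j. \<bar>(1 - a) ^ (j + 1) * Pf \<theta> j u x\<bar> <= t j * V x powr (b + \<alpha> * \<kappa>'))"
   using tm zs by (intro exI[of _ "%j. c * A * B * z j"]) (auto intro: summable_mult)
  show "dominated (b + \<alpha> * \<kappa>') (c * suminf z * A * B) (%x. resolvent S P u a x \<theta>)"
   unfolding dominated_def
  proof (intro conjI ballI)
   show "0 < c * suminf z * A * B" using c Z A B by simp
   have "Pf \<theta> j u : meas S" for j
    by (rule measurable_compose[OF kernel_pow_sub[OF thT] integral_measurable_subprob_algebra]) (rule dominatedD[OF u(1)])
   then show "(%x. resolvent S P u a x \<theta>) : meas S" unfolding resolvent_def by measurable
   fix x assume x: "x : space S"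
   have sm: "summable (%j. (c * A * B * z j) * V x powr (b + \<alpha> * \<kappa>'))"
    using zs by (intro summable_mult2 summable_mult)
   have sn: "summable (%j. norm ((1 - a) ^ (j + 1) * Pf \<theta> j u x))"
    by (rule summable_comparison_test'[OF sm, of 0]) (use tm[OF x] in simp)
   have "\<bar>resolvent S P u a x \<theta>\<bar> <= (\<Sum>j. norm ((1 - a) ^ (j + 1) * Pf \<theta> j u x))"
    unfolding resolvent_def using summable_norm[OF sn] by simp
   also have "... <= (\<Sum>j. (c * A * B * z j) * V x powr (b + \<alpha> * \<kappa>'))"
    by (rule suminf_le[OF _ sn sm]) (use tm[OF x] in simp)
   also have "... = c * suminf z * A * B * V x powr (b + \<alpha> * \<kappa>')"
    unfolding suminf_mult2[OF summable_mult[OF zs], symmetric] suminf_mult[OF zs] by (simp add: mult_ac)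
   finally show "\<bar>resolvent S P u a x \<theta>\<bar> <= c * suminf z * A * B * V x powr (b + \<alpha> * \<kappa>')" .
  qed
 qed
qed

text \<open>
 The conclusion of the preceding lemma, with \<open>s\<close> in place of \<open>b + \<alpha> * \<kappa>'\<close>, as a predicate, so that
 its constant can be obtained without repeating it.
\<close>

definition resolvent_bd :: "'p set => real => real => real => real => bool" where
 "resolvent_bd C b s \<eta> c \<longleftrightarrow> c > 0 \<and> (\<forall>\<theta>\<in>C. \<forall>u B a A. dominated b B u --> (LINT y|\<pi>. u y) = 0 --> 0 <= a --> a < 1 --> 0 < A -->
   (\<forall>j. (1 - a) ^ (j + 1) * real (j + 1) powr \<eta> <= A) -->
   dominated s (c * A * B) (%x. resolvent S P u a x \<theta>) \<and>
   (\<exists>t. summable t \<and> (\<forall>x\<in>space S. \<forall>j. \<bar>(1 - a) ^ (j + 1) * Pf \<theta> j u x\<bar> <= t j * V x powr s)))"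

lemma resolvent_bdD:
 assumes r: "resolvent_bd C b s \<eta> c"
 shows "c > 0" and "\<theta> : C ==> dominated b B u ==> (LINT y|\<pi>. u y) = 0 ==> 0 <= a ==> a < 1 ==> 0 < A ==>
   (!!j. (1 - a) ^ (j + 1) * real (j + 1) powr \<eta> <= A) ==> dominated s (c * A * B) (%x. resolvent S P u a x \<theta>)"
 and "\<theta> : C ==> dominated b B u ==> (LINT y|\<pi>. u y) = 0 ==> 0 <= a ==> a < 1 ==> 0 < A ==>
   (!!j. (1 - a) ^ (j + 1) * real (j + 1) powr \<eta> <= A) ==>
   \<exists>t. summable t \<and> (\<forall>x\<in>space S. \<forall>j. \<bar>(1 - a) ^ (j + 1) * Pf \<theta> j u x\<bar> <= t j * V x powr s)"
proof -
 note * = r[unfolded resolvent_bd_def, THEN conjunct2, rule_format]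
 show "c > 0" using r by (simp add: resolvent_bd_def)
 show "\<theta> : C ==> dominated b B u ==> (LINT y|\<pi>. u y) = 0 ==> 0 <= a ==> a < 1 ==> 0 < A ==>
   (!!j. (1 - a) ^ (j + 1) * real (j + 1) powr \<eta> <= A) ==> dominated s (c * A * B) (%x. resolvent S P u a x \<theta>)"
  by (rule conjunct1[OF *])
 show "\<theta> : C ==> dominated b B u ==> (LINT y|\<pi>. u y) = 0 ==> 0 <= a ==> a < 1 ==> 0 < A ==>
   (!!j. (1 - a) ^ (j + 1) * real (j + 1) powr \<eta> <= A) ==>
   \<exists>t. summable t \<and> (\<forall>x\<in>space S. \<forall>j. \<bar>(1 - a) ^ (j + 1) * Pf \<theta> j u x\<bar> <= t j * V x powr s)"
  by (rule conjunct2[OF *])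
qed

lemma resolvent_bd_exists:
 assumes C: "compact C" "C \<subseteq> \<Theta>" and b: "0 <= b" "0 <= \<kappa>'" "b + \<alpha> * \<kappa>' + \<alpha> <= 1" and \<eta>: "1 < \<kappa>' + \<eta>"
 obtains c where "resolvent_bd C b (b + \<alpha> * \<kappa>') \<eta> c"
 using resolvent_bound[OF C b \<eta>, folded resolvent_bd_def] by (elim exE) (rule that)

text \<open>
 Applying the kernel to the series shifts the index by one; \<open>t\<close> dominates the interchange.
\<close>

lemma resolvent_poisson:
 assumes th: "\<theta> : \<Theta>" and b: "0 <= b" "b <= s" "s <= 1 - \<alpha>" and u: "dominated b B u" and a: "0 <= a" "a < 1"
  and t: "summable t" "!!x j. x : space S ==> \<bar>(1 - a) ^ (j + 1) * Pf \<theta> j u x\<bar> <= t j * V x powr s"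
  and x: "x : space S"
 shows "(LINT y|P \<theta> x. resolvent S P u a y \<theta>) = resolvent S P u a x \<theta> / (1 - a) - u x"
proof -
 let ?g = "%j y. (1 - a) ^ (j + 1) * Pf \<theta> j u y"
 have um: "u : meas S" by (rule dominatedD[OF u])
 have Pm: "Pf \<theta> j u : meas S" for j
  by (rule measurable_compose[OF kernel_pow_sub[OF th] integral_measurable_subprob_algebra[OF um]])
 have t0: "0 <= t j" for j
 proof -
  have "0 <= t j * V x powr s" using t(2)[OF x, of j] by linarith
  moreover have "0 < V x powr s" using V_ge_1[OF x] by simp
  ultimately show ?thesis by (simp add: zero_le_mult_iff)
 qed
 have sP: "sets (P \<theta> x) = sets S" "space (P \<theta> x) = space S" using sets_P[OF th x] sets_eq_imp_space_eq by auto
 have gm: "?g j : meas (P \<theta> x)" for j using Pm[of j] sP by (simp cong: measurable_cong_sets)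
 obtain c where c: "c > 0" "!!u B. dominated s B u ==>
   integrable (P \<theta> x) u \<and> (NNI y|P \<theta> x. ennreal \<bar>u y\<bar>) <= ennreal (c * B * V x powr s)"
  using kernel_dominated[of "{\<theta>}" s] b th x by auto
 have gd: "dominated s (t j + e) (?g j)" if "0 < e" for j e
  unfolding dominated_def
 proof (intro conjI ballI)
  fix y assume y: "y : space S"
  have "t j * V y powr s <= (t j + e) * V y powr s" using that by (intro mult_right_mono) auto
  with t(2)[OF y, of j] show "\<bar>?g j y\<bar> <= (t j + e) * V y powr s" by linarith
 qed (use Pm t0 that in \<open>auto intro: add_nonneg_pos\<close>)
 have gi: "integrable (P \<theta> x) (?g j)" for j using c(2)[OF gd[of 1]] by simp
 have gb: "(LINT y|P \<theta> x. norm (?g j y)) <= c * (t j + (1/2)^j) * V x powr s" for j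
 proof -
  have "ennreal (LINT y|P \<theta> x. norm (?g j y)) = (NNI y|P \<theta> x. ennreal \<bar>?g j y\<bar>)"
   using gi[of j] by (subst nn_integral_eq_integral) auto
  also have "... <= ennreal (c * (t j + (1/2)^j) * V x powr s)" using c(2)[OF gd[of "(1/2)^j" j]] by simp
  finally show ?thesis using c(1) t0[of j] by (subst (asm) ennreal_le_iff) auto
 qed
 have sumgb: "summable (%j. c * (t j + (1/2)^j) * V x powr s)"
  by (intro summable_mult2 summable_mult summable_add t summable_geometric) simp
 have S1: "(LINT y|P \<theta> x. (\<Sum>j. ?g j y)) = (\<Sum>j. (LINT y|P \<theta> x. ?g j y))"
 proof (rule integral_suminf[OF gi])
  show "AE y in P \<theta> x. summable (%j. norm (?g j y))"
  proof (rule AE_I2)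
   fix y assume "y : space (P \<theta> x)"
   then have y: "y : space S" using sP by simp
   have "summable (%j. t j * V y powr s)" by (rule summable_mult2[OF t(1)])
   then show "summable (%j. norm (?g j y))"
    by (rule summable_comparison_test'[where N=0]) (use t(2)[OF y] in simp)
  qed
  show "summable (%j. LINT y|P \<theta> x. norm (?g j y))"
   by (rule summable_comparison_test'[OF sumgb, of 0]) (use gb in simp)
 qed
 have step: "(LINT y|P \<theta> x. ?g j y) = ?g (Suc j) x / (1 - a)" for j
  using kernel_pow_Suc_integral[OF th x b(1) _ u, of j] b a by (simp del: kernel_pow.simps)
 have sg: "summable (%j. ?g j x)"
  by (rule summable_comparison_test'[OF summable_mult2[OF t(1), of "V x powr s"], of 0]) (use t(2)[OF x] in simp)
 have "(LINT y|P \<theta> x. resolvent S P u a y \<theta>) = (\<Sum>j. ?g (Suc j) x / (1 - a))"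
  unfolding resolvent_def S1 step ..
 also have "... = (\<Sum>j. ?g (Suc j) x) / (1 - a)"
  using sg by (intro suminf_divide) (subst summable_Suc_iff, simp)
 also have "(\<Sum>j. ?g (Suc j) x) = resolvent S P u a x \<theta> - ?g 0 x"
  unfolding resolvent_def using suminf_split_head[OF sg] by simp
 also have "?g 0 x = (1 - a) * u x" using um x by (simp add: integral_return)
 finally show ?thesis using a by (simp add: diff_divide_distrib)
qed

text \<open>
 Iterating the equation \<open>n\<close> times leaves the factor \<open>(1 - a) ^ n\<close> in front of a bounded quantity.
\<close>

lemma resolvent_unique:
 assumes C: "\<theta> : \<Theta>" and s: "0 <= s" "s <= 1 - \<alpha>" and D: "dominated s B D" and ww: "dominated s B' ww" and a: "0 < a" "a < 1"
  and eq: "!!x. x : space S ==> D x = (1 - a) * (ww x + (LINT y|P \<theta> x. D y))" and x: "x : space S"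
 shows "D x = resolvent S P ww a x \<theta>"
proof -
 obtain c where c: "c > 0" "!!n u B. dominated s B u ==> dominated s (c * B) (Pf \<theta> n u) \<and>
   (\<forall>x\<in>space S. integrable (kernel_pow S (P \<theta>) n x) u)"
  using kernel_pow_dominated[of "{\<theta>}" s] s C by (metis compact_sing empty_subsetI insert_subset singletonI)
 have th: "\<theta> : \<Theta>" by fact
 obtain c' where c': "c' > 0" "!!u B. dominated s B u ==> dominated s (c' * B) (%x. LINT y|P \<theta> x. u y)"
  using kernel_dominated[of "{\<theta>}" s] s th by (metis compact_sing empty_subsetI insert_subset singletonI)
 have step: "Pf \<theta> n D x = (1 - a) * (Pf \<theta> n ww x + Pf \<theta> (Suc n) D x)" if x: "x : space S" for n x
 proof -
  have sp: "space (kernel_pow S (P \<theta>) n x) = space S" using sets_kernel_pow[OF th x] sets_eq_imp_space_eq by blast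
  have "Pf \<theta> n D x = (LINT z|kernel_pow S (P \<theta>) n x. (1 - a) * (ww z + (LINT y|P \<theta> z. D y)))"
   by (rule Bochner_Integration.integral_cong) (use eq sp in auto)
  also have "... = (1 - a) * (Pf \<theta> n ww x + Pf \<theta> n (%z. LINT y|P \<theta> z. D y) x)"
   using c(2)[OF ww] c(2)[OF c'(2)[OF D]] x by simp
  also have "Pf \<theta> n (%z. LINT y|P \<theta> z. D y) x = Pf \<theta> (Suc n) D x"
   using x
  proof (induction n arbitrary: x)
   case 0
   have "(%z. LINT y|P \<theta> z. D y) : meas S" using dominatedD(1)[OF c'(2)[OF D]] .
   with 0 show ?case using kernel_pow_1[OF th 0] by (simp add: integral_return del: kernel_pow.simps(2))
  next
   case (Suc n)
   have "Pf \<theta> (Suc n) (%z. LINT y|P \<theta> z. D y) x = (LINT y|P \<theta> x. Pf \<theta> n (%z. LINT y|P \<theta> z. D y) y)"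
    by (rule kernel_pow_Suc_integral[OF th Suc.prems s c'(2)[OF D]])
   also have "... = (LINT y|P \<theta> x. Pf \<theta> (Suc n) D y)"
    using Suc.IH sets_eq_imp_space_eq[OF sets_P[OF th Suc.prems]]
     by (intro Bochner_Integration.integral_cong[OF refl]) blast
   also have "... = Pf \<theta> (Suc (Suc n)) D x"
    by (rule kernel_pow_Suc_integral[OF th Suc.prems s D, symmetric])
   finally show ?case .
  qed
  finally show ?thesis .
 qed
 have part: "D x = (\<Sum>j<n. (1 - a) ^ (j + 1) * Pf \<theta> j ww x) + (1 - a) ^ n * Pf \<theta> n D x" for n
 proof (induction n)
  case 0
  show ?case using dominatedD(1)[OF D] x by (simp add: integral_return)
 next
  case (Suc n)
  then show ?case using step[OF x, of n] by (simp add: algebra_simps del: kernel_pow.simps)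
 qed
 have "(%n. (1 - a) ^ n * Pf \<theta> n D x) ----> 0"
 proof (rule Lim_null_comparison)
  have "(%n. (1 - a) ^ n) ----> 0" using a by (intro LIMSEQ_realpow_zero) auto
  then show "(%n. (1 - a) ^ n * (c * B * V x powr s)) ----> 0" by (rule tendsto_mult_left_zero)
  have "\<bar>Pf \<theta> n D x\<bar> <= c * B * V x powr s" for n
   using c(2)[OF D, of n] x by (auto simp: dominated_def)
  then show "EV n. norm ((1 - a) ^ n * Pf \<theta> n D x) <= (1 - a) ^ n * (c * B * V x powr s)"
   using a by (intro always_eventually allI) (auto simp: abs_mult power_abs mult.assoc[symmetric] intro!: mult_left_mono)
 qed
 then have "(%n. D x - (1 - a) ^ n * Pf \<theta> n D x) ----> D x - 0" by (intro tendsto_intros)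
 moreover have "(%n. D x - (1 - a) ^ n * Pf \<theta> n D x) = (%n. \<Sum>j<n. (1 - a) ^ (j + 1) * Pf \<theta> j ww x)"
  using part by (auto simp: fun_eq_iff algebra_simps)
 ultimately have "(%j. (1 - a) ^ (j + 1) * Pf \<theta> j ww x) sums D x" by (simp add: sums_def)
 then show ?thesis unfolding resolvent_def by (simp add: sums_iff)
qed

lemma kernel_D_bound:
 assumes u: "dominated b B u" and x: "x : space S"
 shows "ennreal \<bar>(LINT y|P \<theta> x. u y) - (LINT y|P \<theta>' x. u y)\<bar> <= ennreal B * kernel_D S P V b \<theta> \<theta>' * ennreal (V x powr b)"
proof -
 have B: "0 < B" and [measurable]: "u : meas S" using dominatedD[OF u] by auto
 let ?g = "%y. u y / B"
 have Vp: "0 < V x powr b" using V_ge_1[OF x] by simp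
 have ww: "wnorm S (%y. V y powr b) ?g <= 1"
  unfolding wnorm_def
 proof (rule SUP_least)
  fix y assume y: "y : space S"
  have "\<bar>?g y\<bar> / V y powr b <= 1"
   using dominatedD(3)[OF u y] B V_ge_1[OF y] by (simp add: abs_mult field_simps)
  then show "ennreal (\<bar>?g y\<bar> / V y powr b) <= 1" by (simp add: ennreal_le_1)
 qed
 have "ennreal (\<bar>(LINT y|P \<theta> x. ?g y) - (LINT y|P \<theta>' x. ?g y)\<bar> / V x powr b) <= kernel_D S P V b \<theta> \<theta>'"
  unfolding kernel_D_def
  by (rule order_trans[OF SUP_upper[OF x] SUP_upper[of ?g]]) (use ww in auto)
 moreover have "(LINT y|P \<theta> x. ?g y) - (LINT y|P \<theta>' x. ?g y) = ((LINT y|P \<theta> x. u y) - (LINT y|P \<theta>' x. u y)) / B"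
  by (simp add: diff_divide_distrib)
 ultimately have *: "ennreal (\<bar>(LINT y|P \<theta> x. u y) - (LINT y|P \<theta>' x. u y)\<bar> / B / V x powr b) <= kernel_D S P V b \<theta> \<theta>'"
  using B by (simp add: abs_divide)
 have "ennreal \<bar>(LINT y|P \<theta> x. u y) - (LINT y|P \<theta>' x. u y)\<bar>
   = ennreal B * ennreal (\<bar>(LINT y|P \<theta> x. u y) - (LINT y|P \<theta>' x. u y)\<bar> / B / V x powr b) * ennreal (V x powr b)"
  using B Vp by (simp add: ennreal_mult'[symmetric])
 also have "... <= ennreal B * kernel_D S P V b \<theta> \<theta>' * ennreal (V x powr b)"
  by (intro mult_right_mono mult_left_mono *) auto
 finally show ?thesis .
qed

lemma power_le_powr_minus:
 assumes a: "0 < a" "a < 1" and \<eta>: "0 <= \<eta>" "\<eta> <= 1"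
 shows "(1 - a) ^ (j + 1) * real (j + 1) powr \<eta> <= a powr (- \<eta>)"
proof -
 let ?n = "real (j + 1)"
 have "(1 - a) ^ (j + 1) <= exp (- a) ^ (j + 1)"
  using a exp_ge_add_one_self[of "- a"] by (intro power_mono) auto
 also have "... = exp (- (a * ?n))" by (subst exp_of_nat_mult[symmetric]) (simp add: algebra_simps)
 finally have 1: "(1 - a) ^ (j + 1) <= exp (- (a * ?n))" .
 have 2: "(a * ?n) powr \<eta> <= exp (a * ?n)"
 proof (cases "a * ?n <= 1")
  case True
  then have "(a * ?n) powr \<eta> <= 1" using a \<eta> by (intro powr_le1) auto
  also have "... <= exp (a * ?n)" using a by simp
  finally show ?thesis .
 next
  case False
  then have "(a * ?n) powr \<eta> <= (a * ?n) powr 1" using \<eta> by (intro powr_mono) auto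
  also have "... = a * ?n" using a by simp
  also have "... <= exp (a * ?n)" using exp_ge_add_one_self[of "a * ?n"] by linarith
  finally show ?thesis .
 qed
 have "(1 - a) ^ (j + 1) * ?n powr \<eta> = (1 - a) ^ (j + 1) * ((a * ?n) powr \<eta> * a powr (- \<eta>))"
  using a by (simp add: powr_mult powr_minus)
 also have "... <= exp (- (a * ?n)) * (exp (a * ?n) * a powr (- \<eta>))"
  using 1 2 a by (intro mult_mono) auto
 also have "... = a powr (- \<eta>)" by (simp add: exp_minus)
 finally show ?thesis .
qed

lemma one_minus_power_le_powr:
 assumes a: "0 < a" "a < 1" and \<eta>: "0 <= \<eta>" "\<eta> <= 1"
 shows "1 - (1 - a) ^ (j + 1) <= a powr \<eta> * real (j + 1) powr \<eta>"
proof (cases "a * real (j + 1) <= 1")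
 case True
 have "1 - (1 - a) ^ (j + 1) <= real (j + 1) * a"
  using Bernoulli_inequality[of "-a" "j + 1"] a by simp
 also have "... = (a * real (j + 1)) powr 1" using a by simp
 also have "... <= (a * real (j + 1)) powr \<eta>" using a \<eta> True by (intro powr_mono') auto
 finally show ?thesis using a by (simp add: powr_mult)
next
 case False
 have "1 - (1 - a) ^ (j + 1) <= 1" using a by simp
 also have "1 <= (a * real (j + 1)) powr \<eta>" using False \<eta> by (intro ge_one_powr_ge_zero) auto
 finally show ?thesis using a by (simp add: powr_mult)
qed

lemma resolvent_joint_measurable:
 assumes h: "(%z. h (fst z) (snd z)) : meas (SP S \<Theta>)"
 shows "(%z. resolvent S P (%y. h y (snd z)) a (fst z) (snd z)) : meas (SP S \<Theta>)"
proof -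
 have "(%ww. (snd ww, snd (fst ww))) : measurable ((SP S \<Theta>) \<Otimes>\<^sub>M S) (SP S \<Theta>)"
  by measurable
 from measurable_compose[OF this h]
 have "(%(z, y). h y (snd z)) : meas ((SP S \<Theta>) \<Otimes>\<^sub>M S)"
  by (simp add: split_beta')
 from integral_measurable_kernel[OF this measurable_prob_algebraD[OF kernel_joint_pow]]
 have [measurable]: "(%z. Pf (snd z) j (%y. h y (snd z)) (fst z)) : meas (SP S \<Theta>)" for j .
 show ?thesis unfolding resolvent_def by measurable
qed

text \<open>
 Termwise, \<open>1 - (1 - a) ^ (j + 1)\<close> is at most a power \<open>\<eta>\<close> of \<open>a * (j + 1)\<close>; the loss in \<open>j\<close> is
 covered by the decay of the kernels.
\<close>

lemma resolvent_near_zero: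
 assumes C: "compact C" "C \<subseteq> \<Theta>" and b: "0 <= b" "b + \<alpha> * \<kappa>' + \<alpha> <= 1" and \<eta>: "1 < \<kappa>' - \<eta>" "0 <= \<eta>" "\<eta> <= 1"
 shows "\<exists>c>0. \<forall>\<theta>\<in>C. \<forall>u B a. dominated b B u --> (LINT y|\<pi>. u y) = 0 --> 0 < a --> a < 1 -->
  (\<forall>x\<in>space S. \<bar>resolvent S P u 0 x \<theta> - resolvent S P u a x \<theta>\<bar> <= c * a powr \<eta> * B * V x powr (b + \<alpha> * \<kappa>'))"
proof -
 have \<kappa>0: "0 <= \<kappa>'" using \<eta> by simp
 obtain c where c: "c > 0" "!!\<theta> x u B n. \<theta>\<in>C ==> x\<in>space S ==> dominated b B u ==>
  \<bar>Pf \<theta> n u x - (LINT y|\<pi>. u y)\<bar> <= c * B * real (n + 1) powr (- \<kappa>') * V x powr (b + \<alpha> * \<kappa>')"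
  using weighted_ergodicity[OF C b(1) \<kappa>0 b(2)] by blast
 define z where "z j = real (j + 1) powr (- (\<kappa>' - \<eta>))" for j
 have zs: "summable z"
 proof -
  have "summable (%j. real j powr (- (\<kappa>' - \<eta>)))" using \<eta> by (simp add: summable_real_powr_iff)
  then show ?thesis unfolding z_def by (subst (asm) summable_Suc_iff[symmetric]) (simp add: add.commute)
 qed
 have Z: "0 < suminf z" by (rule suminf_pos2[OF zs, of 0]) (simp_all add: z_def)
 have zs': "summable (%j. real (j + 1) powr (- \<kappa>'))"
  by (rule summable_comparison_test'[OF zs, of 0]) (use \<eta> in \<open>auto simp: z_def intro!: powr_mono\<close>)
 have "\<bar>resolvent S P u 0 x \<theta> - resolvent S P u a x \<theta>\<bar> <= c * suminf z * a powr \<eta> * B * V x powr (b + \<alpha> * \<kappa>')"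
  if th: "\<theta> : C" and u: "dominated b B u" "(LINT y|\<pi>. u y) = 0" and a: "0 < a" "a < 1" and x: "x : space S" for \<theta> u B a x
 proof -
  let ?W = "V x powr (b + \<alpha> * \<kappa>')"
  have B: "0 < B" by (rule dominatedD[OF u(1)])
  have p: "\<bar>Pf \<theta> j u x\<bar> <= c * B * real (j + 1) powr (- \<kappa>') * ?W" for j
   using c(2)[OF th x u(1), of j] u(2) by simp
  have s': "summable (%j. c * B * real (j + 1) powr (- \<kappa>') * ?W)"
   by (intro summable_mult2 summable_mult zs')
  have su: "summable (%j. Pf \<theta> j u x)"
   by (rule summable_comparison_test'[OF s', of 0]) (use p in simp)
  have p': "\<bar>(1 - a) ^ (j + 1) * Pf \<theta> j u x\<bar> <= c * B * real (j + 1) powr (- \<kappa>') * ?W" for j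
  proof -
   have "\<bar>(1 - a) ^ (j + 1) * Pf \<theta> j u x\<bar> <= 1 * \<bar>Pf \<theta> j u x\<bar>"
    unfolding abs_mult using a by (intro mult_right_mono) (auto simp: power_abs intro!: power_le_one mult_le_one)
   with p[of j] show ?thesis by linarith
  qed
  have sa: "summable (%j. (1 - a) ^ (j + 1) * Pf \<theta> j u x)"
   by (rule summable_comparison_test'[OF s', of 0]) (use p' in simp)
  have d: "\<bar>(1 - (1 - a) ^ (j + 1)) * Pf \<theta> j u x\<bar> <= c * a powr \<eta> * B * ?W * z j" for j
  proof -
   have "0 <= 1 - (1 - a) ^ (j + 1)" using power_le_one[of "1 - a" "j + 1"] a by simp
   then have "\<bar>(1 - (1 - a) ^ (j + 1)) * Pf \<theta> j u x\<bar> <= (a powr \<eta> * real (j + 1) powr \<eta>) * (c * B * real (j + 1) powr (- \<kappa>') * ?W)"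
    unfolding abs_mult using one_minus_power_le_powr[OF a \<eta>(2,3), of j] p[of j] by (intro mult_mono) auto
   also have "... = c * a powr \<eta> * B * ?W * (real (j + 1) powr \<eta> * real (j + 1) powr (- \<kappa>'))" by simp
   also have "real (j + 1) powr \<eta> * real (j + 1) powr (- \<kappa>') = z j" by (simp add: z_def powr_add[symmetric])
   finally show ?thesis .
  qed
  have sz: "summable (%j. c * a powr \<eta> * B * ?W * z j)" by (rule summable_mult[OF zs])
  have sd: "summable (%j. norm ((1 - (1 - a) ^ (j + 1)) * Pf \<theta> j u x))"
   by (rule summable_comparison_test'[OF sz, of 0]) (use d in simp)
  have "resolvent S P u 0 x \<theta> - resolvent S P u a x \<theta> = (\<Sum>j. (1 - (1 - a) ^ (j + 1)) * Pf \<theta> j u x)"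
   unfolding resolvent_def using suminf_diff[OF su sa] by (simp add: left_diff_distrib)
  also have "\<bar>...\<bar> <= (\<Sum>j. norm ((1 - (1 - a) ^ (j + 1)) * Pf \<theta> j u x))"
   using summable_norm[OF sd] by simp
  also have "... <= (\<Sum>j. c * a powr \<eta> * B * ?W * z j)"
   by (rule suminf_le[OF _ sd sz]) (use d in simp)
  also have "... = c * suminf z * a powr \<eta> * B * ?W" unfolding suminf_mult[OF zs] by (simp add: mult_ac)
  finally show ?thesis .
 qed
 then show ?thesis using c(1) Z by (intro exI[of _ "c * suminf z"]) auto
qed

text \<open>
 By the two Poisson equations, the difference of the resolvents for \<open>\<theta>\<close> and \<open>\<theta>'\<close> solves the equation
 for \<open>\<theta>\<close> with right-hand side \<open>(P \<theta> - P \<theta>') g'\<close>, where \<open>g'\<close> is the resolvent for \<open>\<theta>'\<close>. Hence it is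
 the resolvent of this function, which is small by the definition of \<open>kernel_D\<close> and has \<open>\<pi>\<close>-mean
 zero because \<open>\<pi>\<close> is invariant for both kernels. Each of the two resolvents may draw on the
 geometric weights.
\<close>

lemma resolvent_parameter_change:
 assumes C: "compact C" "C \<subseteq> \<Theta>" and b: "0 <= b" "0 <= \<kappa>1" "0 <= \<kappa>2" "b + \<alpha> * (\<kappa>1 + \<kappa>2) + \<alpha> <= 1"
  and \<eta>: "1 < \<kappa>1 + \<eta>1" "1 < \<kappa>2 + \<eta>2"
 shows "\<exists>c>0. \<forall>\<theta>\<in>C. \<forall>\<theta>'\<in>C. \<forall>u B a A1 A2. dominated b B u --> (LINT y|\<pi>. u y) = 0 --> 0 < a --> a < 1 --> 0 < A1 --> 0 < A2 -->
   (\<forall>j. (1 - a) ^ (j + 1) * real (j + 1) powr \<eta>1 <= A1) --> (\<forall>j. (1 - a) ^ (j + 1) * real (j + 1) powr \<eta>2 <= A2) -->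
   (\<forall>x\<in>space S. ennreal \<bar>resolvent S P u a x \<theta> - resolvent S P u a x \<theta>'\<bar> <=
    ennreal (c * A1 * A2 * B) * kernel_D S P V (b + \<alpha> * \<kappa>1) \<theta> \<theta>' * ennreal (V x powr (b + \<alpha> * (\<kappa>1 + \<kappa>2))))"
proof -
 have ak: "0 <= \<alpha> * \<kappa>1" "0 <= \<alpha> * \<kappa>2" using b alpha by auto
 define s where "s = b + \<alpha> * \<kappa>1"
 have s: "0 <= s" "b <= s" "s <= 1 - \<alpha>" "b + \<alpha> * \<kappa>1 + \<alpha> <= 1" "s + \<alpha> * \<kappa>2 + \<alpha> <= 1" "s + \<alpha> * \<kappa>2 = b + \<alpha> * (\<kappa>1 + \<kappa>2)"
  using b ak by (auto simp: s_def algebra_simps)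
 obtain c1 where c1r: "resolvent_bd C b s \<eta>1 c1"
  unfolding s_def by (rule resolvent_bd_exists[OF C b(1,2) s(4) \<eta>(1)])
 note c1 = resolvent_bdD[OF c1r]
 obtain c2 where c2r: "resolvent_bd C s (s + \<alpha> * \<kappa>2) \<eta>2 c2"
  by (rule resolvent_bd_exists[OF C s(1) b(3) s(5) \<eta>(2)])
 note c2 = resolvent_bdD[OF c2r]
 have main: "ennreal \<bar>resolvent S P u a x \<theta> - resolvent S P u a x \<theta>'\<bar> <=
    ennreal (c1 * c2 * A1 * A2 * B) * kernel_D S P V s \<theta> \<theta>' * ennreal (V x powr (s + \<alpha> * \<kappa>2))"
  if th: "\<theta> : C" "\<theta>' : C" and u: "dominated b B u" "(LINT y|\<pi>. u y) = 0" and a: "0 < a" "a < 1" and A: "0 < A1" "0 < A2"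
   and A1: "!!j. (1 - a) ^ (j + 1) * real (j + 1) powr \<eta>1 <= A1" and A2: "!!j. (1 - a) ^ (j + 1) * real (j + 1) powr \<eta>2 <= A2"
   and x: "x : space S"
  for \<theta> \<theta>' u B a A1 A2 x
 proof (cases "kernel_D S P V s \<theta> \<theta>' = \<infinity>")
  case True
  have k: "0 < c1 * c2 * A1 * A2 * B" using c1 c2 A dominatedD(2)[OF u(1)] by simp
  have v: "0 < V x powr (s + \<alpha> * \<kappa>2)" using V_ge_1[OF x] by simp
  have "ennreal k * d * ennreal v = \<top>" if "0 < k" "0 < v" "d = \<infinity>" for k v d
   using that by (simp add: ennreal_mult_top ennreal_top_mult)
  from this[OF k v True] show ?thesis by (simp only: top_greatest)
 next
  case False
  define \<delta> where "\<delta> = enn2real (kernel_D S P V s \<theta> \<theta>')"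
  have \<delta>: "kernel_D S P V s \<theta> \<theta>' = ennreal \<delta>" "0 <= \<delta>" using False by (auto simp: \<delta>_def less_top)
  have thT: "\<theta> : \<Theta>" "\<theta>' : \<Theta>" using th C by auto
  have B: "0 < B" by (rule dominatedD[OF u(1)])
  let ?g = "%x. resolvent S P u a x \<theta>" and ?g' = "%x. resolvent S P u a x \<theta>'"
  let ?B = "c1 * A1 * B"
  have a0: "0 <= a" using a by simp
  note R = c1(3)[OF th(1) u a0 a(2) A(1) A1] c1(3)[OF th(2) u a0 a(2) A(1) A1]
  note g = c1(2)[OF th(1) u a0 a(2) A(1) A1] c1(2)[OF th(2) u a0 a(2) A(1) A1]
  have poisson: "(LINT y|P \<theta> x. ?g y) = ?g x / (1 - a) - u x" "(LINT y|P \<theta>' x. ?g' y) = ?g' x / (1 - a) - u x"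
   if "x : space S" for x
  proof -
   from R(1) obtain t where "summable t" "!!x j. x : space S ==> \<bar>(1 - a) ^ (j + 1) * Pf \<theta> j u x\<bar> <= t j * V x powr s" by blast
   from resolvent_poisson[OF thT(1) b(1) s(2,3) u(1) a0 a(2) this that] show "(LINT y|P \<theta> x. ?g y) = ?g x / (1 - a) - u x" .
   from R(2) obtain t where "summable t" "!!x j. x : space S ==> \<bar>(1 - a) ^ (j + 1) * Pf \<theta>' j u x\<bar> <= t j * V x powr s" by blast
   from resolvent_poisson[OF thT(2) b(1) s(2,3) u(1) a0 a(2) this that] show "(LINT y|P \<theta>' x. ?g' y) = ?g' x / (1 - a) - u x" .
  qed
  define ww where "ww x = (LINT y|P \<theta> x. ?g' y) - (LINT y|P \<theta>' x. ?g' y)" for x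
  obtain ck where ck: "ck > 0" "!!\<theta> u B. \<theta> : C ==> dominated s B u ==> dominated s (ck * B) (%x. LINT y|P \<theta> x. u y) \<and>
   (\<forall>x\<in>space S. integrable (P \<theta> x) u)"
   using kernel_dominated[OF C s(1,3)] by metis
  have wd0: "dominated s (ck * ?B + ck * ?B) ww"
   unfolding ww_def using ck(2)[OF th(1) g(2)] ck(2)[OF th(2) g(2)] by (intro dominated_diff) auto
  \<comment> \<open>the constants of dominated functions are positive, while \<delta> may be zero\<close>
  have wD: "dominated s (?B * (\<delta> + e)) ww" if e: "0 < e" for e
   unfolding dominated_def
  proof (intro conjI ballI)
   show "ww : meas S" by (rule dominatedD[OF wd0])
   show "0 < ?B * (\<delta> + e)" using dominatedD(2)[OF g(1)] \<delta> e by (simp add: add_nonneg_pos)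
   fix y assume y: "y : space S"
   have "ennreal \<bar>ww y\<bar> <= ennreal ?B * ennreal \<delta> * ennreal (V y powr s)"
    unfolding ww_def using kernel_D_bound[OF g(2) y, of \<theta> \<theta>'] \<delta> by simp
   then have "\<bar>ww y\<bar> <= ?B * \<delta> * V y powr s"
    using \<delta> dominatedD(2)[OF g(1)] by (simp add: ennreal_mult[symmetric])
   also have "... <= ?B * (\<delta> + e) * V y powr s" using e dominatedD(2)[OF g(1)] by (intro mult_right_mono mult_left_mono) auto
   finally show "\<bar>ww y\<bar> <= ?B * (\<delta> + e) * V y powr s" .
  qed
  have wpi: "(LINT y|\<pi>. ww y) = 0"
  proof -
   have "integrable \<pi> (%x. LINT y|P \<theta> x. ?g' y)" "integrable \<pi> (%x. LINT y|P \<theta>' x. ?g' y)"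
    using ck(2)[OF th(1) g(2)] ck(2)[OF th(2) g(2)] s by (auto intro: dominated_integrable_pi)
   then show ?thesis unfolding ww_def using invariant_integral[OF thT(1) s(1,3) g(2)] invariant_integral[OF thT(2) s(1,3) g(2)] by simp
  qed
  have eq: "?g x - ?g' x = (1 - a) * (ww x + (LINT y|P \<theta> x. ?g y - ?g' y))" if "x : space S" for x
  proof -
   have "(LINT y|P \<theta> x. ?g y - ?g' y) = (LINT y|P \<theta> x. ?g y) - (LINT y|P \<theta> x. ?g' y)"
    using ck(2)[OF th(1) g(1)] ck(2)[OF th(1) g(2)] that by (intro Bochner_Integration.integral_diff) auto
   then have "ww x + (LINT y|P \<theta> x. ?g y - ?g' y) = (?g x - ?g' x) / (1 - a)"
    unfolding ww_def using poisson[OF that] by (simp add: diff_divide_distrib)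
   then show ?thesis using a by simp
  qed
  have D: "?g x - ?g' x = resolvent S P ww a x \<theta>"
   by (rule resolvent_unique[OF thT(1) s(1,3) dominated_diff[OF g] wd0 a eq x])
  have "\<bar>?g x - ?g' x\<bar> <= c1 * c2 * A1 * A2 * B * \<delta> * V x powr (s + \<alpha> * \<kappa>2)"
  proof (rule field_le_epsilon)
   fix e :: real assume e: "0 < e"
   let ?K = "c1 * c2 * A1 * A2 * B * V x powr (s + \<alpha> * \<kappa>2)"
   have K: "0 < ?K" using c1 c2 A B V_ge_1[OF x] by simp
   have "dominated (s + \<alpha> * \<kappa>2) (c2 * A2 * (?B * (\<delta> + e / ?K))) (%x. resolvent S P ww a x \<theta>)"
    using e K by (intro c2(2) th wD wpi a0 a A A2) auto
   from dominatedD(3)[OF this x] have "\<bar>?g x - ?g' x\<bar> <= c2 * A2 * (?B * (\<delta> + e / ?K)) * V x powr (s + \<alpha> * \<kappa>2)"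
    unfolding D .
   also have "... = ?K * (\<delta> + e / ?K)" by (simp add: mult_ac)
   also have "... = ?K * \<delta> + e"
   proof -
    have "k * (\<delta> + e / k) = k * \<delta> + e" if "0 < k" for k using that by (simp add: distrib_left)
    from this[OF K] show ?thesis .
   qed
   finally show "\<bar>?g x - ?g' x\<bar> <= c1 * c2 * A1 * A2 * B * \<delta> * V x powr (s + \<alpha> * \<kappa>2) + e" by (simp add: mult_ac)
  qed
  then show ?thesis unfolding \<delta>(1) using \<delta>(2) c1 c2 A B by (simp add: ennreal_mult[symmetric])
 qed
 show ?thesis
 proof (intro exI[of _ "c1 * c2"] conjI ballI allI impI)
  show "0 < c1 * c2" using c1 c2 by simp
 qed (use main in \<open>auto simp: s_def distrib_left add.assoc mult.assoc\<close>)
qed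

end

section \<open>Second moments of martingales and weak-type bounds\<close>

context prob_space begin

text \<open>
 The decomposition may depend on the accuracy: its first part tends to zero, its second part only
 has to be small.
\<close>

lemma null_in_prob_split:
 assumes split: "!!eps. 0 < eps ==> \<exists>Z Z'. (\<forall>n. Z n : meas M) \<and> (\<forall>n. Z' n : meas M) \<and>
   null_in_prob Z \<and> (EV n. prob {w : space M. eps < \<bar>Z' n w\<bar>} <= eps) \<and>
   (EV n. AE w in M. \<bar>Y n w\<bar> <= \<bar>Z n w\<bar> + \<bar>Z' n w\<bar>)"
 shows "null_in_prob Y"
proof (rule null_in_probI)
 fix eps :: real assume e: "0 < eps"
 then obtain Z Z' where [measurable]: "!!n. Z n : meas M" "!!n. Z' n : meas M"
  and Z: "null_in_prob Z" and Z': "EV n. prob {w : space M. eps / 2 < \<bar>Z' n w\<bar>} <= eps / 2"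
  and le: "EV n. AE w in M. \<bar>Y n w\<bar> <= \<bar>Z n w\<bar> + \<bar>Z' n w\<bar>"
  using split[OF half_gt_zero[OF e]] by blast
 from null_in_probD[OF Z, of "eps / 2"] e have "EV n. prob {w : space M. eps / 2 < \<bar>Z n w\<bar>} <= eps / 2" by simp
 from this Z' le show "EV n. prob {w : space M. eps < \<bar>Y n w\<bar>} <= eps"
 proof eventually_elim
  case (elim n)
  have "prob {w : space M. eps < \<bar>Y n w\<bar>} <= prob ({w : space M. eps / 2 < \<bar>Z n w\<bar>} \<union> {w : space M. eps / 2 < \<bar>Z' n w\<bar>})"
  proof (rule finite_measure_mono_AE)
   show "AE x in M. x : {w : space M. eps < \<bar>Y n w\<bar>} --> x : {w : space M. eps / 2 < \<bar>Z n w\<bar>} \<union> {w : space M. eps / 2 < \<bar>Z' n w\<bar>}"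
    using elim(3) by eventually_elim auto
  qed measurable
  also have "... <= prob {w : space M. eps / 2 < \<bar>Z n w\<bar>} + prob {w : space M. eps / 2 < \<bar>Z' n w\<bar>}"
   by (rule measure_Un_le) auto
  finally show ?case using elim by linarith
 qed
qed

lemma prob_le_of_nn_integral:
 assumes [measurable]: "Y : meas M" and le: "(NNI w|M. ennreal \<bar>Y w\<bar>) <= ennreal c" and l: "0 < l" and c: "0 <= c"
 shows "prob {w : space M. l < \<bar>Y w\<bar>} <= c / l"
proof -
 have "emeasure M {w : space M. l < \<bar>Y w\<bar>} <= emeasure M {w : space M. 1 <= ennreal (1/l) * ennreal \<bar>Y w\<bar>}"
  using l by (intro emeasure_mono) (auto simp: ennreal_mult[symmetric] field_simps simp flip: ennreal_1)
 also have "... <= ennreal (1/l) * (NNI w|M. ennreal \<bar>Y w\<bar> * ind (space M) w)"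
  using nn_integral_Markov_inequality[of "%w. ennreal \<bar>Y w\<bar>" "space M" M "ennreal (1/l)"] by simp
 also have "(NNI w|M. ennreal \<bar>Y w\<bar> * ind (space M) w) = (NNI w|M. ennreal \<bar>Y w\<bar>)"
  by (intro nn_integral_cong) auto
 also have "ennreal (1/l) * ... <= ennreal (1/l) * ennreal c"
  by (intro mult_left_mono le) auto
 also have "... = ennreal (c / l)" using l c by (simp add: ennreal_mult[symmetric])
 finally show ?thesis using l c by (simp add: emeasure_eq_measure)
qed

text \<open>
 Martingale differences are orthogonal.
\<close>

lemma centred_sum_second_moment:
 fixes d :: "nat => 'a => real"
 assumes sub: "!!k. subalgebra M (F k)" and mono: "!!k. sets (F k) \<subseteq> sets (F (Suc k))"
  and ad: "!!k. d k : meas (F (Suc k))" and cent: "!!k. centred M (F k) (d k)"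
  and B: "!!k. k < n ==> (NNI w|M. ennreal ((d k w)^2)) <= ennreal (B k)" "!!k. 0 <= B k"
 shows "(NNI w|M. ennreal ((\<Sum>k<n. d k w)^2)) <= ennreal (\<Sum>k<n. B k)"
proof -
 have dM[measurable]: "d k : meas M" for k by (rule measurable_from_subalg[OF sub ad])
 have sq: "integrable M (%w. (d k w)^2)" if "k < n" for k
 proof (rule integrableI_nonneg)
  show "(NNI w|M. ennreal ((d k w)^2)) < \<infinity>" using B(1)[OF that] by (rule order.strict_trans1) simp
 qed auto
 have dB: "(LINT w|M. (d k w)^2) <= B k" if "k < n" for k
 proof -
  have "ennreal (LINT w|M. (d k w)^2) = (NNI w|M. ennreal ((d k w)^2))"
   by (rule nn_integral_eq_integral[symmetric]) (use sq[OF that] in auto)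
  also note B(1)[OF that]
  finally show ?thesis using B(2) by (simp add: ennreal_le_iff)
 qed
 have "integrable M (%w. (\<Sum>k<m. d k w)^2) \<and> (LINT w|M. (\<Sum>k<m. d k w)^2) <= (\<Sum>k<m. B k)" if "m <= n" for m
  using that
 proof (induction m)
  case (Suc m)
  then have mn: "m < n" and IH: "integrable M (%w. (\<Sum>k<m. d k w)^2)" "(LINT w|M. (\<Sum>k<m. d k w)^2) <= (\<Sum>k<m. B k)" by auto
  let ?S = "%w. \<Sum>k<m. d k w"
  have int: "integrable M (%w. ?S w * d m w)"
  proof (rule Bochner_Integration.integrable_bound)
   show "integrable M (%w. (?S w)^2 + (d m w)^2)" using IH sq[OF mn] by auto
   show "AE w in M. norm (?S w * d m w) <= norm ((?S w)^2 + (d m w)^2)"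
   proof (rule AE_I2)
    fix w
    have "2 * (\<bar>?S w\<bar> * \<bar>d m w\<bar>) <= \<bar>?S w\<bar>\<^sup>2 + \<bar>d m w\<bar>\<^sup>2" using sum_squares_bound[of "\<bar>?S w\<bar>" "\<bar>d m w\<bar>"] by (simp add: mult.assoc)
    moreover have "0 <= \<bar>?S w\<bar> * \<bar>d m w\<bar>" by simp
    ultimately show "norm (?S w * d m w) <= norm ((?S w)^2 + (d m w)^2)"
     unfolding real_norm_def abs_mult by (simp only: power2_abs)
   qed
  qed measurable
  have "?S : meas (F m)"
  proof (rule borel_measurable_sum)
   fix k assume "k : {..<m}"
   then show "d k : meas (F m)"
    by (intro subalgebra_sets_mono[where F=F and m="Suc k" and n=m, OF sub mono _ ad]) auto
  qed
  then have z: "(LINT w|M. ?S w * d m w) = 0" by (rule centred_mult[OF sub cent _ int])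
  have eq: "(%w. (\<Sum>k<Suc m. d k w)^2) = (%w. (?S w)^2 + 2 * (?S w * d m w) + (d m w)^2)"
   by (auto simp: power2_eq_square algebra_simps)
  show ?case unfolding eq using IH sq[OF mn] int z dB[OF mn] by simp
 qed simp
 from this[of n] have I: "integrable M (%w. (\<Sum>k<n. d k w)^2)" "(LINT w|M. (\<Sum>k<n. d k w)^2) <= (\<Sum>k<n. B k)" by auto
 have "(NNI w|M. ennreal ((\<Sum>k<n. d k w)^2)) = ennreal (LINT w|M. (\<Sum>k<n. d k w)^2)"
  by (rule nn_integral_eq_integral) (use I in auto)
 also have "... <= ennreal (\<Sum>k<n. B k)" using I by (intro ennreal_leI)
 finally show ?thesis .
qed

text \<open>
 Summation over the dyadic levels \<open>c * 2 ^ j\<close>.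
\<close>

lemma weak_type_moment:
 fixes Y :: "'a => real"
 assumes [measurable]: "Y : meas M" and Y0: "!!w. 0 <= Y w" and c: "0 < c" and s: "0 < s" "s < 1"
  and weak: "!!l. 0 < l ==> prob {w : space M. l < Y w} <= c / l"
 shows "(NNI w|M. ennreal (Y w powr s)) <= ennreal ((1 + 2 powr s / (1 - 2 powr (s - 1))) * c powr s)"
proof -
 let ?w = "%j::nat. c powr s * 2 powr s * (2 powr s) ^ j"
 let ?A = "%j::nat. {w : space M. c * 2 ^ j < Y w}"
 have pt: "ennreal (Y w powr s) <= ennreal (c powr s) + (\<Sum>j. ennreal (?w j) * ind (?A j) w)" if ww: "w : space M" for w
 proof (cases "Y w <= c")
  case True
  then have "ennreal (Y w powr s) <= ennreal (c powr s)" using Y0 s by (intro ennreal_leI powr_mono2) auto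
  then show ?thesis by (rule order_trans) simp
 next
  case False
  define j where "j = (LEAST j. Y w <= c * 2 ^ Suc j)"
  obtain i :: nat where "Y w / c < 2 ^ i" using real_arch_pow[of 2 "Y w / c"] by auto
  then have "Y w < 2 ^ i * c" using c by (simp add: pos_divide_less_eq)
  also have "... <= c * 2 ^ Suc i" using c by simp
  finally have "Y w <= c * 2 ^ Suc i" by simp
  then have j: "Y w <= c * 2 ^ Suc j" unfolding j_def by (rule LeastI)
  have jl: "c * 2 ^ j < Y w"
  proof (cases j)
   case 0 then show ?thesis using False by simp
  next
   case (Suc i)
   then have "\<not> Y w <= c * 2 ^ Suc i" using not_less_Least[of i "%j. Y w <= c * 2 ^ Suc j"] unfolding j_def by simp
   then show ?thesis using Suc by simp
  qed
  have "Y w powr s <= (c * 2 ^ Suc j) powr s" using j Y0 s by (intro powr_mono2) auto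
  also have "... = ?w j"
  proof -
   have "((2::real) ^ j) powr s = (2 powr s) ^ j"
    by (simp add: powr_power powr_realpow[symmetric] powr_powr mult.commute)
   then show ?thesis using c by (simp add: powr_mult mult_ac)
  qed
  finally have "ennreal (Y w powr s) <= ennreal (?w j) * ind (?A j) w" using jl ww by (auto intro: ennreal_leI)
  also have "... <= (\<Sum>j. ennreal (?w j) * ind (?A j) w)"
  proof -
   have "g j <= suminf g" for g :: "nat => ennreal" using sum_le_suminf[of g "{j}"] by simp
   then show ?thesis .
  qed
  also have "... <= ennreal (c powr s) + (\<Sum>j. ennreal (?w j) * ind (?A j) w)" by simp
  finally show ?thesis .
 qed
 let ?q = "2 powr (s - 1) :: real"
 have q: "0 <= ?q" "?q < 1" using s powr_less_mono[of "s - 1" 0 "2::real"] by auto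
 have "(NNI w|M. ennreal (Y w powr s)) <= (NNI w|M. ennreal (c powr s) + (\<Sum>j. ennreal (?w j) * ind (?A j) w))"
  by (rule nn_integral_mono) (rule pt)
 also have "... = ennreal (c powr s) + (NNI w|M. (\<Sum>j. ennreal (?w j) * ind (?A j) w))"
  by (subst nn_integral_add) (auto simp: emeasure_space_1)
 also have "(NNI w|M. (\<Sum>j. ennreal (?w j) * ind (?A j) w)) = (\<Sum>j. ennreal (?w j) * emeasure M (?A j))"
  by (subst nn_integral_suminf) (auto simp: nn_integral_cmult_indicator)
 also have "... <= (\<Sum>j. ennreal (c powr s * 2 powr s * ?q ^ j))"
 proof (rule suminf_le)
  fix j
  have "emeasure M (?A j) <= ennreal (1 / 2 ^ j)"
   using weak[of "c * 2 ^ j"] c by (simp add: emeasure_eq_measure ennreal_leI)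
  then have "ennreal (?w j) * emeasure M (?A j) <= ennreal (?w j) * ennreal (1 / 2 ^ j)" by (rule mult_left_mono) simp
  also have "... = ennreal (c powr s * 2 powr s * ?q ^ j)"
   by (simp add: ennreal_mult[symmetric] powr_diff power_divide)
  finally show "ennreal (?w j) * emeasure M (?A j) <= ennreal (c powr s * 2 powr s * ?q ^ j)" .
 qed auto
 also have "... = ennreal (c powr s * 2 powr s * (1 / (1 - ?q)))"
 proof (rule suminf_ennreal_eq)
  show "(%j. c powr s * 2 powr s * ?q ^ j) sums (c powr s * 2 powr s * (1 / (1 - ?q)))"
   by (intro sums_mult geometric_sums) (use q in auto)
 qed (use q in auto)
 finally have "(NNI w|M. ennreal (Y w powr s)) <= ennreal (c powr s) + ennreal (c powr s * 2 powr s * (1 / (1 - ?q)))"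
  by (simp add: add_left_mono)
 also have "... = ennreal ((1 + 2 powr s / (1 - 2 powr (s - 1))) * c powr s)"
  using q by (subst ennreal_plus[symmetric]) (auto simp: algebra_simps)
 finally show ?thesis .
qed

end

section \<open>The localized chain: drift, maximal inequality, law of large numbers\<close>

lemma sum_lessThan_split:
 fixes u :: "nat => 'b::comm_monoid_add"
 shows "m <= n ==> (\<Sum>k<n. u k) = (\<Sum>k<m. u k) + (\<Sum>k=m..<n. u k)"
 by (metis lessThan_atLeast0 sum.atLeastLessThan_concat zero_le)

context ergodic_kernels begin

lemma resolvent_bounded:
 assumes th: "\<theta> : \<Theta>" and u: "dominated 0 B u" and r: "0 < r" "r < 1" and x: "x : space S"
 shows "\<bar>resolvent S P u r x \<theta>\<bar> <= B / r"
proof -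
 have V0: "V y powr 0 = 1" if "y : space S" for y using V_ge_1[OF that] by simp
 have B: "0 < B" by (rule dominatedD[OF u])
 have p: "\<bar>Pf \<theta> j u x\<bar> <= B" for j
 proof -
  have sk: "sets (kernel_pow S (P \<theta>) j x) = sets S" by (rule sets_kernel_pow[OF th x])
  have "(NNI y|kernel_pow S (P \<theta>) j x. ennreal (V y powr 0)) = (NNI y|kernel_pow S (P \<theta>) j x. 1)"
   using V0 sets_eq_imp_space_eq[OF sk] by (intro nn_integral_cong) auto
  also have "... = ennreal 1" using prob_space.emeasure_space_1[OF prob_kernel_pow[OF th x]] by simp
  finally show ?thesis using dominated_integrable(2)[OF u sk, of 1] by simp
 qed
 have b: "\<bar>(1 - r) ^ (j + 1) * Pf \<theta> j u x\<bar> <= (1 - r) ^ (j + 1) * B" for j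
  using p[of j] r by (simp add: abs_mult power_abs mult_left_mono del: kernel_pow.simps)
 have g: "(%j. (1 - r) ^ j) sums (1 / r)" using geometric_sums[of "1 - r"] r by simp
 then have sm: "(%j. (1 - r) ^ (j + 1) * B) sums ((1 - r) * (1 / r) * B)"
  using sums_mult2[OF sums_mult[OF g, of "1 - r"], of B] by simp
 then have su: "summable (%j. (1 - r) ^ (j + 1) * B)" by (rule sums_summable)
 have sn: "summable (%j. norm ((1 - r) ^ (j + 1) * Pf \<theta> j u x))"
  by (rule summable_comparison_test'[OF su, of 0]) (use b in simp)
 have "\<bar>resolvent S P u r x \<theta>\<bar> <= (\<Sum>j. norm ((1 - r) ^ (j + 1) * Pf \<theta> j u x))"
  unfolding resolvent_def using summable_norm[OF sn] by simp
 also have "... <= (\<Sum>j. (1 - r) ^ (j + 1) * B)" by (rule suminf_le[OF _ sn su]) (use b in simp)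
 also have "... = (1 - r) * (1 / r) * B" using sm by (simp add: sums_iff)
 also have "... <= B / r" using r B by (simp add: field_simps)
 finally show "\<bar>resolvent S P u r x \<theta>\<bar> <= B / r" .
qed

lemma pi_integral_measurable:
 assumes h: "(%z. h (fst z) (snd z)) : meas (SP S \<Theta>)"
 shows "(%\<theta>. LINT y|\<pi>. (h y \<theta> :: real)) : meas (param_space \<Theta>)"
proof (rule integral_measurable_kernel)
 have "(%ww. (snd ww, fst ww)) : measurable (param_space \<Theta> \<Otimes>\<^sub>M S) (SP S \<Theta>)" by measurable
 from measurable_compose[OF this h] show "(%(\<theta>, y). h y \<theta>) : meas (param_space \<Theta> \<Otimes>\<^sub>M S)"
  by (simp add: split_beta')
 have "\<pi> : space (subprob_algebra S)"
  using prob_pi sets_pi by (simp add: space_subprob_algebra prob_space_imp_subprob_space)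
 then show "(%\<theta>. \<pi>) : measurable (param_space \<Theta>) (subprob_algebra S)" by simp
qed

end

text \<open>
 A process that, before an adapted decreasing sequence of events \<open>G\<close> is left, moves by the kernel of
 its current parameter, which is in a compact set; nothing is known afterwards. On the event \<open>E\<close>
 this never happens, and the parameters converge to \<open>ths\<close> in the pseudo-metrics. The Markov property
 is stated for nonnegative functions, so that no integrability has to be known in advance.
\<close>

locale localized_chain = ergodic_kernels S \<Theta> P \<pi> \<alpha> V + prob_space M
 for S :: "'a measure" and \<Theta> :: "'p::t2_space set" and P \<pi> \<alpha> V and M :: "'w measure" +
 fixes F :: "nat => 'w measure" and X :: "nat => 'w => 'a" and th :: "nat => 'w => 'p" and ths :: "'w => 'p"
  and G :: "nat => 'w set" and E :: "'w set" and K :: "'p set" and L b0 c0 :: real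
 assumes subF: "!!n. subalgebra M (F n)" and monoF: "!!n. sets (F n) \<subseteq> sets (F (Suc n))"
  and X_F: "!!n. X n : measurable (F n) S" and th_F: "!!n. th n : measurable (F n) (param_space \<Theta>)"
  and G_F: "!!n. G n : sets (F n)" and G_dec: "!!n. G (Suc n) \<subseteq> G n"
  and G_K: "!!n w. w : G n ==> th n w : K" and L: "0 < L" and V0: "!!w. w : G 0 ==> V (X 0 w) <= L"
  and K: "compact K" "K \<subseteq> \<Theta>"
  and markov: "!!n A h. A : sets (F n) ==> A \<subseteq> G n ==> h : meas ((SP S \<Theta>) \<Otimes>\<^sub>M S) ==>
    (NNI w|M. ind A w * h ((X n w, th n w), X (Suc n) w))
    = (NNI w|M. ind A w * (NNI y|P (th n w) (X n w). h ((X n w, th n w), y)))"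
  and drift0: "0 < b0" "0 < c0" and drift: "!!x \<theta>. x : space S ==> \<theta> : K ==>
   (NNI y|P \<theta> x. ennreal (V y)) <= ennreal (V x - c0 * V x powr (1 - \<alpha>) + b0)"
  and E[measurable]: "E : sets M" and E_G: "!!n. E \<subseteq> G n" and E_ths: "!!w. w : E ==> ths w : K"
  and ths[measurable]: "ths : measurable M (param_space \<Theta>)"
  and conv: "AE w in M. w : E --> (\<forall>\<beta>'\<in>{0..1 - \<alpha>}. (%n. kernel_D S P V \<beta>' (th n w) (ths w)) ----> 0)"
begin

lemma F_M: "f : measurable (F n) N ==> f : measurable M N"
 by (rule measurable_from_subalg[OF subF])

lemma F_mono: "m <= n ==> f : measurable (F m) N ==> f : measurable (F n) N"
 by (rule subalgebra_sets_mono[where F=F, OF subF monoF])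

lemma X_M[measurable]: "X n : measurable M S" by (rule F_M[OF X_F])
lemma th_M[measurable]: "th n : measurable M (param_space \<Theta>)" by (rule F_M[OF th_F])

lemma sets_F_M: "A : sets (F n) ==> A : sets M" using subF[of n] by (auto simp: subalgebra_def)
lemma sets_F_mono: "m <= n ==> A : sets (F m) ==> A : sets (F n)"
 using lift_Suc_mono_le[of "%k. sets (F k)", OF monoF] by blast
lemma G_M[measurable]: "G n : sets M" by (rule sets_F_M[OF G_F])
lemma G_antimono: "m <= n ==> G n \<subseteq> G m" using lift_Suc_antimono_le[of G, OF G_dec] .

lemma X_space: "w : space M ==> X n w : space S" using measurable_space[OF X_M] .
lemma th_space: "w : space M ==> th n w : \<Theta>" using measurable_space[OF th_M, of w] by simp
lemma ths_space: "w : space M ==> ths w : \<Theta>" using measurable_space[OF ths, of w] by simp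

lemma XthF: "(%w. (X n w, th n w)) : measurable (F n) (SP S \<Theta>)"
 by (rule measurable_Pair[OF X_F th_F])

lemma kernel_F: "(%w. P (th n w) (X n w)) : measurable (F n) (prob_algebra S)"
 using measurable_compose[OF XthF P_joint] by simp

lemma kernel_M: "(%w. P (th n w) (X n w)) : measurable M (subprob_algebra S)"
 by (rule measurable_prob_algebraD[OF F_M[OF kernel_F]])

lemma V_X_F: "(%w. V (X n w)) : meas (F n)"
 by (rule measurable_compose[OF X_F V])

lemma step_V:
 assumes A: "A : sets (F n)" "A \<subseteq> G n"
 shows "(NNI w|M. ind A w * ennreal (V (X (Suc n) w)))
   + ennreal c0 * (NNI w|M. ind A w * ennreal (V (X n w) powr (1 - \<alpha>)))
  <= (NNI w|M. ind A w * ennreal (V (X n w))) + ennreal b0"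
proof -
 have [measurable]: "A : sets M" by (rule sets_F_M[OF A(1)])
 have e: "(NNI w|M. ind A w * ennreal (V (X (Suc n) w))) = (NNI w|M. ind A w * (NNI y|P (th n w) (X n w). ennreal (V y)))"
  using markov[OF A, of "%z. ennreal (V (snd z))"] by simp
 have m: "(%w. NNI y|P (th n w) (X n w). ennreal (V y)) : meas M"
  by (rule measurable_compose[OF kernel_M nn_integral_measurable_subprob_algebra]) simp
 have "(NNI w|M. ind A w * (NNI y|P (th n w) (X n w). ennreal (V y)))
   + ennreal c0 * (NNI w|M. ind A w * ennreal (V (X n w) powr (1 - \<alpha>)))
   = (NNI w|M. ind A w * (NNI y|P (th n w) (X n w). ennreal (V y)) + ennreal c0 * (ind A w * ennreal (V (X n w) powr (1 - \<alpha>))))"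
  using m by (subst nn_integral_add) (auto simp: nn_integral_cmult)
 also have "... <= (NNI w|M. ind A w * ennreal (V (X n w)) + ennreal b0)"
 proof (rule nn_integral_mono)
  fix w assume ww: "w : space M"
  show "ind A w * (NNI y|P (th n w) (X n w). ennreal (V y)) + ennreal c0 * (ind A w * ennreal (V (X n w) powr (1 - \<alpha>)))
    <= ind A w * ennreal (V (X n w)) + ennreal b0"
  proof (cases "w : A")
   case True
   let ?v = "V (X n w)" and ?Q = "P (th n w) (X n w)"
   have K': "th n w : K" using True A G_K by blast
   have x: "X n w : space S" by (rule X_space[OF ww])
   have d: "(NNI y|?Q. ennreal (V y)) <= ennreal (?v - c0 * ?v powr (1 - \<alpha>) + b0)" by (rule drift[OF x K'])
   have "1 = (NNI y|?Q. 1)" using prob_space.emeasure_space_1[OF prob_P[OF th_space[OF ww] x]] by simp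
   also have "... <= (NNI y|?Q. ennreal (V y))"
    using V_ge_1 sets_eq_imp_space_eq[OF sets_P[OF th_space[OF ww] x]] by (intro nn_integral_mono) (auto simp flip: ennreal_1 intro!: ennreal_leI)
   also note d
   finally have "1 <= ?v - c0 * ?v powr (1 - \<alpha>) + b0" by (simp only: ennreal_ge_1)
   then have "ennreal (?v - c0 * ?v powr (1 - \<alpha>) + b0) + ennreal c0 * ennreal (?v powr (1 - \<alpha>)) = ennreal ?v + ennreal b0"
    using drift0 V_ge_1[OF x] by (simp add: ennreal_mult[symmetric] ennreal_plus[symmetric] del: ennreal_plus)
   then show ?thesis using True d by (simp add: add_right_mono) (metis add_right_mono)
  qed simp
 qed
 also have "... = (NNI w|M. ind A w * ennreal (V (X n w))) + ennreal b0"
  by (subst nn_integral_add) (auto simp: emeasure_space_1)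
 finally show ?thesis unfolding e .
qed

lemma moment_sum_V:
 "(NNI w|M. ind (G n) w * ennreal (V (X (Suc n) w)))
   + ennreal c0 * (\<Sum>k\<le>n. \<integral>\<^sup>+w. ind (G k) w * ennreal (V (X k w) powr (1 - \<alpha>)) \<partial>M) <= ennreal (L + b0 * real (Suc n))"
proof (induction n)
 case 0
 have "(NNI w|M. ind (G 0) w * ennreal (V (X 0 w))) <= (NNI w|M. ennreal L)"
  using V0 by (intro nn_integral_mono) (auto simp: indicator_def intro!: ennreal_leI)
 also have "... = ennreal L" by (simp add: emeasure_space_1)
 finally have "(NNI w|M. ind (G 0) w * ennreal (V (X 0 w))) + ennreal b0 <= ennreal L + ennreal b0" by (rule add_right_mono)
 then have "(NNI w|M. ind (G 0) w * ennreal (V (X 0 w))) + ennreal b0 <= ennreal (L + b0 * real (Suc 0))"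
  using L drift0 by simp
 then show ?case using order_trans[OF step_V[OF G_F order_refl, of 0]] by simp
next
 case (Suc n)
 let ?S = "%n. \<Sum>k\<le>n. \<integral>\<^sup>+w. ind (G k) w * ennreal (V (X k w) powr (1 - \<alpha>)) \<partial>M"
 have "(NNI w|M. ind (G (Suc n)) w * ennreal (V (X (Suc n) w))) <= (NNI w|M. ind (G n) w * ennreal (V (X (Suc n) w)))"
  using G_dec[of n] by (intro nn_integral_mono mult_right_mono) (auto simp: indicator_def)
 note * = order_trans[OF step_V[OF G_F order_refl, of "Suc n"] add_right_mono[OF this, of "ennreal b0"]]
 have "(NNI w|M. ind (G (Suc n)) w * ennreal (V (X (Suc (Suc n)) w))) + ennreal c0 * ?S (Suc n)
  = ((NNI w|M. ind (G (Suc n)) w * ennreal (V (X (Suc (Suc n)) w))) + ennreal c0 * (NNI w|M. ind (G (Suc n)) w * ennreal (V (X (Suc n) w) powr (1 - \<alpha>)))) + ennreal c0 * ?S n"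
  by (simp add: distrib_left add_ac)
 also have "... <= ((NNI w|M. ind (G n) w * ennreal (V (X (Suc n) w))) + ennreal b0) + ennreal c0 * ?S n"
  by (rule add_right_mono[OF *])
 also have "... = ((NNI w|M. ind (G n) w * ennreal (V (X (Suc n) w))) + ennreal c0 * ?S n) + ennreal b0"
  by (simp add: add_ac)
 also have "... <= ennreal (L + b0 * real (Suc n)) + ennreal b0" by (rule add_right_mono[OF Suc])
 also have "... = ennreal (L + b0 * real (Suc (Suc n)))"
  using L drift0 by (subst ennreal_plus[symmetric]) (auto simp: algebra_simps)
 finally show ?case .
qed

text \<open>
 The drift bounds the averages of this power of \<open>V\<close> only, and only before localization is lost.
\<close>

definition avgV :: "nat => 'w => real" where
 "avgV n w = (1 / real n) * (\<Sum>k<n. ind (G k) w * V (X k w) powr (1 - \<alpha>))"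

lemma avgV_measurable[measurable]: "avgV n : meas M"
 unfolding avgV_def by measurable

lemma avgV_nonneg: "0 <= avgV n w"
 unfolding avgV_def by (intro mult_nonneg_nonneg sum_nonneg) auto

definition CV :: real where "CV = (L + b0) / c0"

lemma CV_pos: "0 < CV" using L drift0 by (simp add: CV_def)

lemma avgV_moment: "(NNI w|M. ennreal (avgV n w)) <= ennreal CV"
proof (cases n)
 case 0 then show ?thesis by (simp add: avgV_def)
next
 case (Suc m)
 let ?S = "\<Sum>k\<le>m. \<integral>\<^sup>+w. ind (G k) w * ennreal (V (X k w) powr (1 - \<alpha>)) \<partial>M"
 have "(NNI w|M. ennreal (avgV n w)) = (NNI w|M. ennreal (1 / real n) * (\<Sum>k\<le>m. ind (G k) w * ennreal (V (X k w) powr (1 - \<alpha>))))"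
 proof (rule nn_integral_cong)
  fix w
  have "ennreal (\<Sum>k<n. ind (G k) w * V (X k w) powr (1 - \<alpha>)) = (\<Sum>k\<le>m. ind (G k) w * ennreal (V (X k w) powr (1 - \<alpha>)))"
   unfolding Suc lessThan_Suc_atMost by (subst sum_ennreal[symmetric]) (auto intro!: sum.cong simp: indicator_def)
  then show "ennreal (avgV n w) = ennreal (1 / real n) * (\<Sum>k\<le>m. ind (G k) w * ennreal (V (X k w) powr (1 - \<alpha>)))"
   unfolding avgV_def by (subst ennreal_mult') auto
 qed
 also have "... = ennreal (1 / real n) * (NNI w|M. (\<Sum>k\<le>m. ind (G k) w * ennreal (V (X k w) powr (1 - \<alpha>))))"
  by (rule nn_integral_cmult) measurable
 also have "(NNI w|M. (\<Sum>k\<le>m. ind (G k) w * ennreal (V (X k w) powr (1 - \<alpha>)))) = ?S"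
  by (rule nn_integral_sum) measurable
 also have "ennreal (1 / real n) * ?S = ennreal (1 / (real n * c0)) * (ennreal c0 * ?S)"
  using drift0 by (simp add: mult.assoc[symmetric] ennreal_mult[symmetric])
 also have "... <= ennreal (1 / (real n * c0)) * ennreal (L + b0 * real (Suc m))"
  using moment_sum_V[of m] by (intro mult_left_mono) (auto intro: order_trans[rotated])
 also have "... = ennreal ((L + b0 * real n) / (real n * c0))"
  using L drift0 Suc by (subst ennreal_mult[symmetric]) auto
 also have "... <= ennreal CV"
 proof (rule ennreal_leI)
  have "L + b0 * real n <= (L + b0) * real n" using L Suc by (simp add: distrib_right)
  then have "(L + b0 * real n) / (real n * c0) <= ((L + b0) * real n) / (real n * c0)"
   using drift0 by (intro divide_right_mono) auto
  also have "... = CV" using Suc by (simp add: CV_def)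
  finally show "(L + b0 * real n) / (real n * c0) <= CV" .
 qed
 finally show ?thesis .
qed

text \<open>
 The state at time \<open>k\<close> is governed by the drift if the step leading to it started in \<open>G (k - 1)\<close>;
 for \<open>k = 0\<close> truncated subtraction yields \<open>G 0\<close>, where \<open>V (X 0) \<le> L\<close>.
\<close>

definition maxV :: "nat => 'w => real" where
 "maxV n w = Max ((%k. ind (G (k - 1)) w * V (X k w)) ` {..n})"

lemma maxV_measurable[measurable]: "maxV n : meas M"
 unfolding maxV_def by measurable

lemma maxV_ge: "k <= n ==> w : G (k - 1) ==> V (X k w) <= maxV n w"
 unfolding maxV_def by (rule Max_ge) (auto intro!: image_eqI[of _ _ k])

lemma maxV_nonneg:
 assumes "w : space M" shows "0 <= maxV n w"
proof -
 have "0 <= ind (G (0 - 1)) w * V (X 0 w)" using V_ge_1[OF X_space[OF assms, of 0]] by (auto simp: indicator_def)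
 also have "... <= maxV n w" unfolding maxV_def by (rule Max_ge) (auto intro!: image_eqI[of _ _ 0])
 finally show ?thesis .
qed

text \<open>
 The chain is stopped when \<open>V\<close> exceeds \<open>l\<close>: \<open>A k\<close> means that this has not happened up to time \<open>k\<close>,
 \<open>B k\<close> that it happens at time \<open>k\<close> first. The expected value of \<open>V\<close> of the stopped chain grows by at
 most \<open>b0\<close> in each step.
\<close>

lemma maximal_inequality:
 assumes l: "0 < l"
 shows "prob {w : space M. l < maxV n w} <= (L + b0 * real n) / l"
proof -
 define A where "A k = {w : G k. \<forall>j\<le>k. V (X j w) <= l}" for k
 define B where "B k = {w : (if k = 0 then G 0 else A (k - 1)). l < V (X k w)}" for k
 have AF: "A k : sets (F k)" for k
 proof -
  have [measurable]: "(%w. V (X j w)) : meas (F k)" if "j : {..k}" for j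
   by (rule F_mono[OF _ V_X_F]) (use that in auto)
  have m: "{w : space (F k). \<forall>j\<in>{..k}. V (X j w) <= l} : sets (F k)" by measurable
  have eq: "A k = G k \<inter> {w : space (F k). \<forall>j\<in>{..k}. V (X j w) <= l}"
   using sets.sets_into_space[OF G_F, of k] by (auto simp: A_def)
  show ?thesis unfolding eq by (rule sets.Int[OF G_F m])
 qed
 have AG: "A k \<subseteq> G k" for k by (auto simp: A_def)
 have AM[measurable]: "A k : sets M" for k by (rule sets_F_M[OF AF])
 have BM[measurable]: "B k : sets M" for k
 proof -
  have "B k = (if k = 0 then G 0 else A (k - 1)) \<inter> {w : space M. l < V (X k w)}"
   using sets.sets_into_space[OF G_M, of 0] sets.sets_into_space[OF AM] by (auto simp: B_def)
  then show ?thesis by auto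
 qed
 have st: "(NNI w|M. ind (A k) w * ennreal (V (X (Suc k) w))) <= (NNI w|M. ind (A k) w * ennreal (V (X k w))) + ennreal b0" for k
  by (rule order_trans[OF _ step_V[OF AF AG]]) simp
 have split: "ennreal l * emeasure M (B k) + (NNI w|M. ind (A k) w * ennreal (V (X k w)))
   <= (NNI w|M. ind (if k = 0 then G 0 else A (k - 1)) w * ennreal (V (X k w)))" for k
 proof -
  have "ennreal l * emeasure M (B k) + (NNI w|M. ind (A k) w * ennreal (V (X k w)))
   = (NNI w|M. ennreal l * ind (B k) w + ind (A k) w * ennreal (V (X k w)))"
   by (subst nn_integral_add) (auto simp: nn_integral_cmult_indicator)
  also have "... <= (NNI w|M. ind (if k = 0 then G 0 else A (k - 1)) w * ennreal (V (X k w)))"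
  proof (rule nn_integral_mono)
   fix w assume "w : space M"
   have sub: "A k \<subseteq> (if k = 0 then G 0 else A (k - 1))" using G_dec[of "k - 1"] by (auto simp: A_def)
   show "ennreal l * ind (B k) w + ind (A k) w * ennreal (V (X k w)) <= ind (if k = 0 then G 0 else A (k - 1)) w * ennreal (V (X k w))"
   proof (cases "w : B k")
    case True
    then have "w \<notin> A k" by (auto simp: A_def B_def)
    with True show ?thesis by (auto simp: B_def indicator_def intro!: ennreal_leI split: if_splits)
   next
    case False
    then show ?thesis using sub by (auto simp: indicator_def)
   qed
  qed
  finally show ?thesis .
 qed
 have ind: "ennreal l * (\<Sum>k\<le>n. emeasure M (B k)) + (NNI w|M. ind (A n) w * ennreal (V (X n w))) <= ennreal (L + b0 * real n)"
 proof (induction n)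
  case 0
  have "(NNI w|M. ind (G 0) w * ennreal (V (X 0 w))) <= (NNI w|M. ennreal L)"
   using V0 by (intro nn_integral_mono) (auto simp: indicator_def intro!: ennreal_leI)
  also have "... = ennreal L" by (simp add: emeasure_space_1)
  finally show ?case using split[of 0] by auto
 next
  case (Suc n)
  have "ennreal l * (\<Sum>k\<le>Suc n. emeasure M (B k)) + (NNI w|M. ind (A (Suc n)) w * ennreal (V (X (Suc n) w)))
   = ennreal l * (\<Sum>k\<le>n. emeasure M (B k)) + (ennreal l * emeasure M (B (Suc n)) + (NNI w|M. ind (A (Suc n)) w * ennreal (V (X (Suc n) w))))"
   by (simp add: distrib_left add_ac)
  also have "... <= ennreal l * (\<Sum>k\<le>n. emeasure M (B k)) + ((NNI w|M. ind (A n) w * ennreal (V (X n w))) + ennreal b0)"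
   using order_trans[OF split[of "Suc n"]] st[of n] by (intro add_left_mono) auto
  also have "... = (ennreal l * (\<Sum>k\<le>n. emeasure M (B k)) + (NNI w|M. ind (A n) w * ennreal (V (X n w)))) + ennreal b0"
   by (simp add: add_ac)
  also have "... <= ennreal (L + b0 * real n) + ennreal b0" by (rule add_right_mono[OF Suc])
  also have "... = ennreal (L + b0 * real (Suc n))"
   using L drift0 by (subst ennreal_plus[symmetric]) (auto simp: algebra_simps)
  finally show ?case .
 qed
 have "{w : space M. l < maxV n w} \<subseteq> (\<Union>k\<in>{..n}. B k)"
 proof
  fix w assume "w : {w : space M. l < maxV n w}"
  then have "l < Max ((%k. ind (G (k - 1)) w * V (X k w)) ` {..n})" by (simp add: maxV_def)
  then have "\<exists>k. k <= n \<and> l < ind (G (k - 1)) w * V (X k w)"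
   by (subst (asm) Max_gr_iff) auto
  then obtain k where k: "k <= n \<and> l < ind (G (k - 1)) w * V (X k w)"
   and least: "!!j. j < k ==> \<not> (j <= n \<and> l < ind (G (j - 1)) w * V (X j w))"
   using exists_least_iff[of "%k. k <= n \<and> l < ind (G (k - 1)) w * V (X k w)"] by blast
  have kG: "w : G (k - 1)" "l < V (X k w)" using k l by (cases "w : G (k - 1)"; simp)+
  have "V (X j w) <= l" if "j < k" for j
  proof -
   have "j - 1 <= k - 1" using that by simp
   then have "w : G (j - 1)" using G_antimono kG(1) by blast
   then show ?thesis using least[OF that] that k by auto
  qed
  then have "w : B k" using kG by (auto simp: B_def A_def)
  then show "w : (\<Union>k\<in>{..n}. B k)" using k by blast
 qed
 then have "emeasure M {w : space M. l < maxV n w} <= emeasure M (\<Union>k\<in>{..n}. B k)" by (intro emeasure_mono) auto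
 also have "... <= (\<Sum>k\<le>n. emeasure M (B k))" by (rule emeasure_subadditive_finite) auto
 finally have "ennreal l * emeasure M {w : space M. l < maxV n w} <= ennreal l * (\<Sum>k\<le>n. emeasure M (B k))" by (rule mult_left_mono) simp
 also have "... <= ennreal (L + b0 * real n)" by (rule order_trans[OF _ ind]) simp
 finally have "l * prob {w : space M. l < maxV n w} <= L + b0 * real n"
  using l L drift0 by (simp add: emeasure_eq_measure ennreal_mult[symmetric] del: ennreal_plus)
 then show ?thesis using l by (simp add: field_simps)
qed

lemma maxV_moment:
 assumes s: "0 < s" "s < 1"
 obtains C where "0 < C" "!!n. 1 <= n ==> (NNI w|M. ennreal (maxV n w powr s)) <= ennreal (C * real n powr s)"
proof -
 define C where "C = (1 + 2 powr s / (1 - 2 powr (s - 1))) * (L + b0) powr s"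
 have "2 powr (s - 1) < (1::real)" using s powr_less_mono[of "s - 1" 0 "2::real"] by simp
 then have D: "0 < 1 + 2 powr s / (1 - 2 powr (s - 1)) " by (simp add: add_pos_pos)
 have "(NNI w|M. ennreal (maxV n w powr s)) <= ennreal (C * real n powr s)" if n: "1 <= n" for n
 proof -
  have Lb: "0 < (L + b0) * real n" using L drift0 n by simp
  have "(NNI w|M. ennreal (maxV n w powr s)) = (NNI w|M. ennreal ((max 0 (maxV n w)) powr s))"
   using maxV_nonneg by (intro nn_integral_cong) (auto simp: max_def)
  also have "... <= ennreal ((1 + 2 powr s / (1 - 2 powr (s - 1))) * ((L + b0) * real n) powr s)"
  proof (rule weak_type_moment[OF _ _ Lb s])
   fix l :: real assume l: "0 < l"
   have "{w : space M. l < max 0 (maxV n w)} = {w : space M. l < maxV n w}" using l by auto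
   then have "prob {w : space M. l < max 0 (maxV n w)} <= (L + b0 * real n) / l" using maximal_inequality[OF l, of n] by simp
   also have "... <= ((L + b0) * real n) / l" using n L l by (intro divide_right_mono) (auto simp: distrib_right)
   finally show "prob {w : space M. l < max 0 (maxV n w)} <= ((L + b0) * real n) / l" .
  qed auto
  also have "... = ennreal (C * real n powr s)" using L drift0 by (simp add: C_def powr_mult mult_ac)
  finally show ?thesis .
 qed
 moreover have "0 < C" using D L drift0 by (simp add: C_def)
 ultimately show ?thesis using that by blast
qed

lemma martingale_average_null:
 assumes ad: "!!k. d k : meas (F (Suc k))" and cent: "!!k. centred M (F k) (d k)"
  and B: "!!k w. w : space M ==> \<bar>d k w\<bar> <= B"
 shows "null_in_prob (%n w. (1 / real n) * (\<Sum>k<n. d k w))"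
proof -
 have [measurable]: "d k : meas M" for k by (rule F_M[OF ad])
 have "null_in_prob (%n w. ((1 / real n) * (\<Sum>k<n. d k w))^2)"
 proof (rule null_in_prob_L1)
  fix n
  have "(NNI w|M. ennreal ((\<Sum>k<n. d k w)^2)) <= ennreal (\<Sum>k<n. B\<^sup>2)"
  proof (rule centred_sum_second_moment[where F=F, OF subF monoF ad cent])
   fix k
   have "(NNI w|M. ennreal ((d k w)^2)) <= (NNI w|M. ennreal (B^2))"
    using B[of _ k] by (intro nn_integral_mono ennreal_leI) (metis abs_ge_zero power2_abs power_mono)
   then show "(NNI w|M. ennreal ((d k w)^2)) <= ennreal (B^2)" by (simp add: emeasure_space_1)
  qed simp
  have "(NNI w|M. ennreal \<bar>((1 / real n) * (\<Sum>k<n. d k w))^2\<bar>) = (NNI w|M. ennreal ((1 / real n)^2) * ennreal ((\<Sum>k<n. d k w)^2))"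
   by (intro nn_integral_cong) (simp add: ennreal_mult[symmetric] power_divide)
  also have "... = ennreal ((1 / real n)^2) * (NNI w|M. ennreal ((\<Sum>k<n. d k w)^2))"
   by (rule nn_integral_cmult) measurable
  also have "... <= ennreal ((1 / real n)^2) * ennreal (\<Sum>k<n. B\<^sup>2)" by (rule mult_left_mono) (fact, simp)
  also have "... = ennreal (B^2 * (1 / real n))"
   by (cases "n = 0") (auto simp: ennreal_mult[symmetric] power2_eq_square)
  finally show "(NNI w|M. ennreal \<bar>((1 / real n) * (\<Sum>k<n. d k w))^2\<bar>) <= ennreal (B^2 * (1 / real n))" .
  show "(%n. B\<^sup>2 * (1 / real n)) ----> 0" by (rule tendsto_mult_right_zero) (rule lim_1_over_n)
 qed measurable
 then show ?thesis by (rule null_in_prob_of_square) measurable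
qed

lemma cesaro_null:
 fixes a :: "nat => real" assumes a: "a ----> 0" shows "(%n. (1 / real n) * (\<Sum>k<n. a k)) ----> 0"
proof (rule LIMSEQ_I)
 fix r :: real assume r: "0 < r"
 obtain m where m: "!!k. m <= k ==> \<bar>a k\<bar> < r / 2" using LIMSEQ_D[OF a, of "r / 2"] r by auto
 define c where "c = (\<Sum>k<m. \<bar>a k\<bar>)"
 obtain n0 :: nat where n0: "2 * c / r < real n0" using reals_Archimedean2 by blast
 show "\<exists>no. \<forall>n\<ge>no. norm ((1 / real n) * (\<Sum>k<n. a k) - 0) < r"
 proof (intro exI[of _ "max (Suc m) n0"] allI impI)
  fix n assume n: "max (Suc m) n0 <= n"
  have "\<bar>\<Sum>k<n. a k\<bar> <= (\<Sum>k<n. \<bar>a k\<bar>)" by (rule sum_abs)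
  also have "... = c + (\<Sum>k=m..<n. \<bar>a k\<bar>)" unfolding c_def using n by (intro sum_lessThan_split) simp
  also have "(\<Sum>k=m..<n. \<bar>a k\<bar>) <= (\<Sum>k=m..<n. r / 2)" using m by (intro sum_mono) (auto intro: less_imp_le)
  also have "... <= real n * (r / 2)" using r n by simp
  finally have 1: "\<bar>\<Sum>k<n. a k\<bar> <= c + real n * (r / 2)" by simp
  have "2 * c < real n0 * r" using n0 r by (simp add: pos_divide_less_eq)
  also have "... <= real n * r" using n r by (intro mult_right_mono) auto
  finally have "\<bar>\<Sum>k<n. a k\<bar> < real n * r" using 1 by linarith
  then show "norm ((1 / real n) * (\<Sum>k<n. a k) - 0) < r" using n by (simp add: abs_mult field_simps)
 qed
qed

text \<open>
 Positive and negative part separately, by the Markov property for nonnegative functions.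
\<close>

lemma step_centred:
 fixes g :: "'a => 'p => real"
 assumes g: "(%z. g (fst z) (snd z)) : meas (SP S \<Theta>)"
  and fin: "(NNI w|M. ind (G k) w * ennreal \<bar>g (X (Suc k) w) (th k w)\<bar>) < \<infinity>"
 shows "centred M (F k) (%w. ind (G k) w * (g (X (Suc k) w) (th k w) - (LINT y|P (th k w) (X k w). g y (th k w))))"
proof -
 let ?Y = "%w. g (X (Suc k) w) (th k w)" and ?I = "%w. \<integral>y. g y (th k w) \<partial>P (th k w) (X k w)"
 define J where "J s w = (NNI y|P (th k w) (X k w). ennreal (s * g y (th k w)))" for s w
 have gM: "(%(w, y). g y (th k w)) : meas (M \<Otimes>\<^sub>M S)"
 proof -
  have "(%ww. (snd ww, th k (fst ww))) : measurable (M \<Otimes>\<^sub>M S) (SP S \<Theta>)" by measurable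
  from measurable_compose[OF this g] show ?thesis by (simp add: split_beta')
 qed
 have [measurable]: "?Y : meas M" using measurable_compose[OF measurable_Pair[OF X_M th_M] g] by simp
 have [measurable]: "?I : meas M" by (rule integral_measurable_kernel[OF gM kernel_M])
 have [measurable]: "J s : meas M" for s
  unfolding J_def by (rule nn_integral_measurable_subprob_algebra2[OF _ kernel_M]) (use gM in measurable)
 have law: "(NNI w|M. ind A w * ennreal (s * ?Y w)) = (NNI w|M. ind A w * J s w)"
  if "A : sets (F k)" "A \<subseteq> G k" for A s
 proof -
  have "(%z. (snd z, snd (fst z))) : measurable ((SP S \<Theta>) \<Otimes>\<^sub>M S) (SP S \<Theta>)" by measurable
  from measurable_compose[OF this g] have [measurable]: "(%z. g (snd z) (snd (fst z))) : meas ((SP S \<Theta>) \<Otimes>\<^sub>M S)" by simp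
  have "(%z. ennreal (s * g (snd z) (snd (fst z)))) : meas ((SP S \<Theta>) \<Otimes>\<^sub>M S)" by measurable
  from markov[OF that this] show ?thesis by (simp add: J_def)
 qed
 have lawfin: "(NNI w|M. ind A w * ennreal (s * ?Y w)) < \<infinity>" if "A \<subseteq> G k" "\<bar>s\<bar> = 1" for A s
  by (rule order.strict_trans1[OF nn_integral_mono fin]) (use that in \<open>auto simp: indicator_def abs_if intro!: ennreal_leI split: if_splits\<close>)
 have Jfin: "AE w in M. w : G k --> J s w \<noteq> \<infinity>" if s: "\<bar>s\<bar> = 1" for s
 proof -
  have "AE w in M. ind (G k) w * J s w \<noteq> \<infinity>"
   using lawfin[OF order_refl s] unfolding law[OF G_F order_refl] by (intro nn_integral_PInf_AE) auto
  then show ?thesis by eventually_elim (auto simp: indicator_def)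
 qed
 have I: "AE w in M. w : G k --> ?I w = enn2real (J 1 w) - enn2real (J (- 1) w)"
  using Jfin[of 1, simplified] Jfin[of "- 1", simplified] AE_space
 proof eventually_elim
  case (elim w)
  have "(%y. g y (th k w)) : meas (P (th k w) (X k w))"
   using measurable_compose[OF measurable_Pair1'[OF elim(3)] gM] sets_P[OF th_space[OF elim(3), of k] X_space[OF elim(3), of k]] by (simp cong: measurable_cong_sets)
  then show ?case using elim by (auto simp: J_def real_integrable_def intro!: real_lebesgue_integral_def)
 qed
 have part: "integrable M (%w. ind A w * ?Y w) \<and> integrable M (%w. ind A w * ?I w) \<and>
   (LINT w|M. ind A w * ?Y w) = (LINT w|M. ind A w * ?I w)" if A: "A : sets (F k)" "A \<subseteq> G k" for A
 proof -
  have [measurable]: "A : sets M" by (rule sets_F_M[OF A(1)])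
  have nY: "(NNI w|M. ennreal (s * (ind A w * ?Y w))) = (NNI w|M. ind A w * ennreal (s * ?Y w))" for s
   by (intro nn_integral_cong) (auto simp: indicator_def)
  note nY' = nY[of 1, simplified] nY[of "- 1", simplified] and lf = lawfin[OF A(2), of 1, simplified] lawfin[OF A(2), of "- 1", simplified]
  have iY: "integrable M (%w. ind A w * ?Y w)" using lf by (auto simp: real_integrable_def nY')
  have nJ: "integrable M (%w. ind A w * enn2real (J s w))"
    "(LINT w|M. ind A w * enn2real (J s w)) = enn2real (NNI w|M. ind A w * ennreal (s * ?Y w))" if s: "\<bar>s\<bar> = 1" for s
  proof -
   have eq: "(NNI w|M. ennreal (ind A w * enn2real (J s w))) = (NNI w|M. ind A w * ennreal (s * ?Y w))"
    unfolding law[OF A] by (rule nn_integral_cong_AE) (use Jfin[OF s] in eventually_elim, use A in \<open>auto simp: indicator_def less_top\<close>)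
   show "integrable M (%w. ind A w * enn2real (J s w))"
    by (rule integrableI_nonneg) (use lawfin[OF A(2) s] eq in auto)
   show "(LINT w|M. ind A w * enn2real (J s w)) = enn2real (NNI w|M. ind A w * ennreal (s * ?Y w))"
    unfolding eq[symmetric] by (rule integral_eq_nn_integral) auto
  qed
  have AI: "AE w in M. ind A w * ?I w = ind A w * enn2real (J 1 w) - ind A w * enn2real (J (- 1) w)"
   using I by eventually_elim (use A in \<open>auto simp: indicator_def\<close>)
  have iJ: "integrable M (%w. ind A w * enn2real (J 1 w) - ind A w * enn2real (J (- 1) w))"
   by (intro Bochner_Integration.integrable_diff nJ) auto
  have "integrable M (%w. ind A w * ?I w)"
   by (rule integrable_cong_AE_imp[OF iJ]) (use AI in \<open>auto elim: eventually_mono\<close>)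
  moreover have "(LINT w|M. ind A w * ?I w) = (LINT w|M. ind A w * ?Y w)"
  proof -
   have "(LINT w|M. ind A w * ?I w) = (LINT w|M. ind A w * enn2real (J 1 w) - ind A w * enn2real (J (- 1) w))"
    by (rule integral_cong_AE) (use AI in auto)
   also have "... = (LINT w|M. ind A w * ?Y w)"
    using real_lebesgue_integral_def[OF iY] by (simp add: Bochner_Integration.integral_diff nJ nY')
   finally show ?thesis .
  qed
  ultimately show ?thesis using iY by simp
 qed
 show ?thesis
  unfolding centred_def
 proof (intro conjI ballI)
  show "integrable M (%w. ind (G k) w * (?Y w - ?I w))" using part[OF G_F order_refl] by (simp add: right_diff_distrib)
  fix A assume A: "A : sets (F k)"
  have "(%w. indicat_real A w * (indicat_real (G k) w * (?Y w - ?I w))) = (%w. indicat_real (A \<inter> G k) w * ?Y w - indicat_real (A \<inter> G k) w * ?I w)"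
   by (auto simp: fun_eq_iff indicator_def)
  then show "(LINT w|M. indicat_real A w * (indicat_real (G k) w * (?Y w - ?I w))) = 0"
   using part[of "A \<inter> G k"] A G_F[of k] by simp
 qed
qed

text \<open>
 Let \<open>u = h - \<pi>(h)\<close> and \<open>g\<close> the resolvent of \<open>u\<close> with a fixed small weight \<open>r\<close>. By the Poisson
 equation, \<open>u = g - P g + r / (1 - r) * g\<close>. The sum of \<open>g - P g\<close> along the path is a bounded
 martingale, up to boundary terms and changes of the parameter. The changes tend to zero along each
 path in \<open>E\<close> because \<open>g\<close> is continuous in the parameter: it is the fixed point of a contraction of
 factor \<open>1 - r\<close> in the supremum norm, so that no rate of convergence is used. The last term is at
 most \<open>q r\<close> times a power of \<open>V\<close>, with \<open>q r \<rightarrow> 0\<close> as \<open>r \<rightarrow> 0\<close> since a decay of order 1/2 makes \<open>g\<close> of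
 smaller order than \<open>1 / r\<close>; its average is controlled by \<open>avgV\<close>.
\<close>

lemma lln_bounded:
 fixes h :: "'a => 'p => real"
 assumes h: "(%z. h (fst z) (snd z)) : meas (SP S \<Theta>)"
  and H: "0 < H" "!!x \<theta>. x : space S ==> \<theta> : K ==> \<bar>h x \<theta>\<bar> <= H"
  and b: "b : {0..1 - \<alpha>}" and Hc: "0 < Hc"
  and cont: "!!x \<theta> \<theta>'. x : space S ==> \<theta> : K ==> \<theta>' : K ==> ennreal \<bar>h x \<theta> - h x \<theta>'\<bar> <= ennreal Hc * kernel_D S P V b \<theta> \<theta>'"
 shows "null_in_prob (%n w. ((1 / real n) * (\<Sum>k<n. h (X k w) (th k w)) - (LINT y|\<pi>. h y (ths w))) * ind E w)"
proof (rule null_in_prob_split)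
 fix eps :: real assume e: "0 < eps"
 interpret \<pi>: prob_space \<pi> by (rule prob_pi)
 have s\<pi>: "space \<pi> = space S" by (rule sets_eq_imp_space_eq[OF sets_pi])
 have EK: "th k w : K" if "w : E" for k w using E_G G_K that by blast
 have V0: "V y powr 0 = 1" if "y : space S" for y using V_ge_1[OF that] by simp
 define \<pi>h where "\<pi>h \<theta> = (LINT y|\<pi>. h y \<theta>)" for \<theta>
 have [measurable]: "\<pi>h : meas (param_space \<Theta>)" unfolding \<pi>h_def by (rule pi_integral_measurable[OF h])
 define u where "u \<theta> y = h y \<theta> - \<pi>h \<theta>" for \<theta> y
 have um: "(%z. u (snd z) (fst z)) : meas (SP S \<Theta>)" unfolding u_def using h by measurable
 have sec: "(%x. (x, \<theta>)) : measurable S (SP S \<Theta>)" if "\<theta> : K" for \<theta>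
  using that K by (intro measurable_Pair2') auto
 have hi: "integrable \<pi> (%y. h y \<theta>)" if "\<theta> : K" for \<theta>
  by (rule \<pi>.integrable_const_bound[of _ H])
    (use measurable_compose[OF sec[OF that] h] H that s\<pi> sets_pi in \<open>auto cong: measurable_cong_sets\<close>)
 have \<pi>h_diff: "\<bar>\<pi>h \<theta> - c\<bar> <= q" if "\<theta> : K" "!!y. y : space S ==> \<bar>h y \<theta> - v y\<bar> <= q" "integrable \<pi> v" "c = (LINT y|\<pi>. v y)" for \<theta> c q v
 proof -
  have "\<bar>\<pi>h \<theta> - c\<bar> = \<bar>\<integral>y. h y \<theta> - v y \<partial>\<pi>\<bar>" unfolding \<pi>h_def that(4) using hi[OF that(1)] that(3) by simp
  also have "... <= (LINT y|\<pi>. \<bar>h y \<theta> - v y\<bar>)" by (rule integral_abs_bound)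
  also have "... <= (LINT y|\<pi>. q)" using hi[OF that(1)] that s\<pi> by (intro integral_mono) auto
  finally show ?thesis by (simp add: \<pi>.prob_space)
 qed
 have \<pi>hH: "\<bar>\<pi>h \<theta>\<bar> <= H" if "\<theta> : K" for \<theta> using \<pi>h_diff[OF that, of "%_. 0" H 0] H(2) that by simp
 have ud: "dominated 0 (2 * H) (u \<theta>)" if "\<theta> : K" for \<theta>
  unfolding dominated_def
 proof (intro conjI ballI)
  show "u \<theta> : meas S" using measurable_compose[OF sec[OF that] um] by simp
  fix x assume x: "x : space S"
  show "\<bar>u \<theta> x\<bar> <= 2 * H * V x powr 0" using H(2)[OF x that] \<pi>hH[OF that] V0[OF x] by (simp add: u_def)
 qed (use H in simp)
 have u\<pi>: "(LINT y|\<pi>. u \<theta> y) = 0" if "\<theta> : K" for \<theta>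
  unfolding u_def using hi[OF that] by (simp add: \<pi>.prob_space \<pi>h_def)
 have "(0::real) + \<alpha> * (1/2) + \<alpha> <= 1" using alpha by simp
 then obtain c1 where "resolvent_bd K 0 (0 + \<alpha> * (1/2)) (3/4) c1"
  by (rule resolvent_bd_exists[OF K, of 0 "1/2" "3/4", rotated 2]) auto
 note c1 = resolvent_bdD[OF this]
 define q where "q r = 4 * H * c1 * r powr (1/4)" for r
 obtain r where r: "0 < r" "r <= 1/2" "q r * CV <= eps\<^sup>2"
 proof -
  have "((%r::real. r powr (1/4)) \<longlongrightarrow> 0) (at_right 0)"
   by (rule tendsto_zero_powrI[OF tendsto_ident_at tendsto_const]) (auto simp: eventually_at_filter)
  then have "((%r. q r * CV) \<longlongrightarrow> (4 * H * c1 * 0) * CV) (at_right 0)"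
   unfolding q_def by (intro tendsto_intros)
  then have "\<forall>\<^sub>F r in at_right 0. q r * CV < eps\<^sup>2" by (rule order_tendstoD) (use e in simp)
  moreover have "\<forall>\<^sub>F r::real in at_right 0. r < 1/2" by (rule order_tendstoD(2)[OF tendsto_ident_at]) simp
  moreover have "\<forall>\<^sub>F r::real in at_right 0. 0 < r" by (simp add: eventually_at_right_less)
  ultimately have "\<forall>\<^sub>F r in at_right 0. q r * CV < eps\<^sup>2 \<and> r < 1/2 \<and> 0 < r" by eventually_elim auto
  from eventually_happens'[OF trivial_limit_at_right_real this] show ?thesis using that by (metis less_imp_le)
 qed
 have r1: "r < 1" using r by simp
 define g where "g x \<theta> = resolvent S P (u \<theta>) r x \<theta>" for x \<theta>
 have gm: "(%z. g (fst z) (snd z)) : meas (SP S \<Theta>)"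
  unfolding g_def by (rule resolvent_joint_measurable[of "%y \<theta>. u \<theta> y", OF um])
 define B where "B = 2 * H / r"
 have B: "0 < B" using H r by (simp add: B_def)
 have gB: "\<bar>g x \<theta>\<bar> <= B" if "x : space S" "\<theta> : K" for x \<theta>
  unfolding g_def B_def using resolvent_bounded[OF _ ud[OF that(2)] r(1) r1 that(1)] that K by auto
 have gd: "dominated 0 B (%x. g x \<theta>)" if "\<theta> : K" for \<theta>
  unfolding dominated_def using measurable_compose[OF sec[OF that] gm] gB[OF _ that] V0 B by auto
 have pw: "(1 - r) ^ (j + 1) * real (j + 1) powr (3/4) <= r powr (- (3/4))" for j by (rule power_le_powr_minus) (use r r1 in auto)
 have gw: "2 * r * \<bar>g x \<theta>\<bar> <= q r * V x powr (1 - \<alpha>)" if x: "x : space S" and t: "\<theta> : K" for x \<theta>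
 proof -
  have "dominated (0 + \<alpha> * (1/2)) (c1 * r powr (- (3/4)) * (2 * H)) (%x. g x \<theta>)"
   unfolding g_def using r r1 by (intro c1(2)[OF t ud[OF t] u\<pi>[OF t]] pw) auto
  from dominatedD(3)[OF this x] have "\<bar>g x \<theta>\<bar> <= c1 * r powr (- (3/4)) * (2 * H) * V x powr (\<alpha>/2)" by simp
  also have "... <= c1 * r powr (- (3/4)) * (2 * H) * V x powr (1 - \<alpha>)"
   using c1(1) H alpha by (intro mult_left_mono V_powr_mono[OF x]) auto
  finally have "2 * r * \<bar>g x \<theta>\<bar> <= 2 * r * (c1 * r powr (- (3/4)) * (2 * H) * V x powr (1 - \<alpha>))"
   using r by (intro mult_left_mono) auto
  also have "... = 4 * H * c1 * (r powr 1 * r powr (- (3/4))) * V x powr (1 - \<alpha>)" using r by simp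
  also have "r powr 1 * r powr (- (3/4)) = r powr (1/4)" using r by (subst powr_add[symmetric]) simp
  finally show ?thesis by (simp add: q_def)
 qed
 have poisson: "(LINT y|P \<theta> x. g y \<theta>) = g x \<theta> / (1 - r) - u \<theta> x" if x: "x : space S" and t: "\<theta> : K" for x \<theta>
 proof -
  have "\<exists>t. summable t \<and> (\<forall>x\<in>space S. \<forall>j. \<bar>(1 - r) ^ (j + 1) * Pf \<theta> j (u \<theta>) x\<bar> <= t j * V x powr (0 + \<alpha> * (1/2)))"
   by (rule c1(3)[OF t ud[OF t] u\<pi>[OF t] _ r1 _ pw]) (use r in auto)
  then obtain s where s: "summable s" "!!x j. x : space S ==> \<bar>(1 - r) ^ (j + 1) * Pf \<theta> j (u \<theta>) x\<bar> <= s j * V x powr (0 + \<alpha> * (1/2))" by blast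
  show ?thesis unfolding g_def by (rule resolvent_poisson[OF _ _ _ _ ud[OF t] _ r1 s x]) (use t K alpha r in auto)
 qed
 have g_cont: "\<bar>g x \<theta> - g x \<theta>'\<bar> <= (B + 2) * \<eta> / r" if t: "\<theta> : K" "\<theta>' : K" and x: "x : space S" and \<eta>: "0 <= \<eta>"
   and hd: "!!y. y : space S ==> \<bar>h y \<theta> - h y \<theta>'\<bar> <= \<eta>" and D: "kernel_D S P V 0 \<theta> \<theta>' <= ennreal \<eta>" for \<theta> \<theta>' x \<eta>
 proof -
  define s where "s = (SUP y\<in>space S. \<bar>g y \<theta> - g y \<theta>'\<bar>)"
  have "\<bar>g y \<theta> - g y \<theta>'\<bar> <= 2 * B" if "y : space S" for y using gB[OF that t(1)] gB[OF that t(2)] by linarith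
  then have bdd: "bdd_above ((%y. \<bar>g y \<theta> - g y \<theta>'\<bar>) ` space S)" by (auto intro!: bdd_aboveI)
  have le_s: "\<bar>g y \<theta> - g y \<theta>'\<bar> <= s" if "y : space S" for y unfolding s_def by (rule cSUP_upper[OF that bdd])
  have step: "\<bar>g y \<theta> - g y \<theta>'\<bar> / (1 - r) <= s + (B + 2) * \<eta>" if y: "y : space S" for y
  proof -
   have T: "\<theta> : \<Theta>" using t K by auto
   interpret Q: prob_space "P \<theta> y" by (rule prob_P[OF T y])
   have sQ: "sets (P \<theta> y) = sets S" "space (P \<theta> y) = space S" using sets_P[OF T y] sets_eq_imp_space_eq by auto
   have gi: "integrable (P \<theta> y) (%z. g z \<theta>'')" if "\<theta>'' : K" for \<theta>''
    by (rule Q.integrable_const_bound[of _ B])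
      (use dominatedD(1)[OF gd[OF that]] gB[OF _ that] sQ in \<open>auto cong: measurable_cong_sets\<close>)
   have 1: "\<bar>(LINT z|P \<theta> y. g z \<theta>) - (LINT z|P \<theta> y. g z \<theta>')\<bar> <= s"
   proof -
    have "\<bar>(LINT z|P \<theta> y. g z \<theta>) - (LINT z|P \<theta> y. g z \<theta>')\<bar> <= (LINT z|P \<theta> y. \<bar>g z \<theta> - g z \<theta>'\<bar>)"
     using integral_abs_bound[of "P \<theta> y" "%z. g z \<theta> - g z \<theta>'"] gi t by simp
    also have "... <= (LINT z|P \<theta> y. s)" using gi t le_s sQ by (intro integral_mono) auto
    finally show ?thesis by (simp add: Q.prob_space)
   qed
   have "ennreal \<bar>(LINT z|P \<theta> y. g z \<theta>') - (LINT z|P \<theta>' y. g z \<theta>')\<bar> <= ennreal B * kernel_D S P V 0 \<theta> \<theta>' * ennreal (V y powr 0)"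
    by (rule kernel_D_bound[OF gd[OF t(2)] y])
   also have "... <= ennreal B * ennreal \<eta> * 1" using D V0[OF y] by (intro mult_mono) auto
   finally have 2: "\<bar>(LINT z|P \<theta> y. g z \<theta>') - (LINT z|P \<theta>' y. g z \<theta>')\<bar> <= B * \<eta>" using \<eta> B by (simp add: ennreal_mult[symmetric])
   have 3: "\<bar>\<pi>h \<theta> - \<pi>h \<theta>'\<bar> <= \<eta>" by (rule \<pi>h_diff[OF t(1) hd hi[OF t(2)]]) (auto simp: \<pi>h_def)
   have "(g y \<theta> - g y \<theta>') / (1 - r) = ((LINT z|P \<theta> y. g z \<theta>) - (LINT z|P \<theta> y. g z \<theta>')) + ((LINT z|P \<theta> y. g z \<theta>') - (LINT z|P \<theta>' y. g z \<theta>'))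
     + (h y \<theta> - h y \<theta>') - (\<pi>h \<theta> - \<pi>h \<theta>')"
    using poisson[OF y t(1)] poisson[OF y t(2)] by (simp add: u_def diff_divide_distrib)
   then have "\<bar>(g y \<theta> - g y \<theta>') / (1 - r)\<bar> <= s + B * \<eta> + \<eta> + \<eta>" using 1 2 3 hd[OF y] by linarith
   then show ?thesis using r1 by (simp add: abs_divide distrib_right)
  qed
  have "s <= (1 - r) * (s + (B + 2) * \<eta>)"
   unfolding s_def by (rule cSUP_least[OF S_ne]) (use step r1 in \<open>simp add: s_def pos_divide_le_eq mult.commute\<close>)
  then have "r * s <= (1 - r) * ((B + 2) * \<eta>)" by (simp add: algebra_simps)
  also have "... <= 1 * ((B + 2) * \<eta>)" using r B \<eta> by (intro mult_right_mono) auto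
  finally have "s <= (B + 2) * \<eta> / r" using r by (simp add: pos_le_divide_eq mult.commute)
  then show ?thesis using le_s[OF x] by linarith
 qed
 have gX[measurable]: "(%w. g (X j w) (th k w)) : meas M" for j k
  using measurable_compose[OF measurable_Pair[OF X_M th_M] gm] by simp
 define d where "d k w = ind (G k) w * (g (X (Suc k) w) (th k w) - (LINT y|P (th k w) (X k w). g y (th k w)))" for k w
 have dC: "centred M (F k) (d k)" for k
  unfolding d_def
 proof (rule step_centred[OF gm])
  have "(NNI w|M. ind (G k) w * ennreal \<bar>g (X (Suc k) w) (th k w)\<bar>) <= (NNI w|M. ennreal B)"
   using gB G_K X_space by (intro nn_integral_mono) (auto simp: indicator_def intro!: ennreal_leI)
  also have "... < \<infinity>" by (simp add: emeasure_space_1)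
  finally show "(NNI w|M. ind (G k) w * ennreal \<bar>g (X (Suc k) w) (th k w)\<bar>) < \<infinity>" .
 qed
 have dF: "d k : meas (F (Suc k))" for k
 proof -
  have [measurable]: "th k : measurable (F (Suc k)) (param_space \<Theta>)" "G k : sets (F (Suc k))" by (rule F_mono[OF _ th_F] sets_F_mono[OF _ G_F], simp)+
  have kF: "(%w. P (th k w) (X k w)) : measurable (F (Suc k)) (subprob_algebra S)" by (rule F_mono[OF _ measurable_prob_algebraD[OF kernel_F]]) simp
  have "(%ww. (snd ww, th k (fst ww))) : measurable (F (Suc k) \<Otimes>\<^sub>M S) (SP S \<Theta>)" by measurable
  from measurable_compose[OF this gm] have "(%(w, y). g y (th k w)) : meas (F (Suc k) \<Otimes>\<^sub>M S)" by (simp add: split_beta')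
  then have [measurable]: "(%w. LINT y|P (th k w) (X k w). g y (th k w)) : meas (F (Suc k))" by (rule integral_measurable_kernel[OF _ kF])
  have "(%w. (X (Suc k) w, th k w)) : measurable (F (Suc k)) (SP S \<Theta>)" by (rule measurable_Pair[OF X_F]) measurable
  from measurable_compose[OF this gm] have [measurable]: "(%w. g (X (Suc k) w) (th k w)) : meas (F (Suc k))" by simp
  show ?thesis unfolding d_def by measurable
 qed
 have dB: "\<bar>d k w\<bar> <= 4 * B + 2 * H" if ww: "w : space M" for k w
 proof (cases "w : G k")
  case True
  note x = X_space[OF ww] and t = G_K[OF True]
  have 1: "\<bar>g (X k w) (th k w) / (1 - r)\<bar> <= B / (1 / 2)" using gB[OF x t, of k] r B unfolding abs_divide by (intro frac_le) auto
  have 2: "\<bar>u (th k w) (X k w)\<bar> <= 2 * H" using dominatedD(3)[OF ud[OF t] x, of k] V0[OF x] by simp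
  have "d k w = g (X (Suc k) w) (th k w) - (g (X k w) (th k w) / (1 - r) - u (th k w) (X k w))"
   using True by (simp add: d_def poisson[OF x t])
  moreover have "\<bar>p - (p' - p'')\<bar> <= \<bar>p\<bar> + \<bar>p'\<bar> + \<bar>p''\<bar>" for p p' p'' :: real by linarith
  ultimately have "\<bar>d k w\<bar> <= \<bar>g (X (Suc k) w) (th k w)\<bar> + \<bar>g (X k w) (th k w) / (1 - r)\<bar> + \<bar>u (th k w) (X k w)\<bar>" by (simp only:)
  also have "... <= B + B / (1 / 2) + 2 * H" by (intro add_mono gB x t 1 2)
  finally show ?thesis using B by simp
 qed (use B H in \<open>simp add: d_def\<close>)
 define a where "a k w = ind E w * (\<bar>g (X (Suc k) w) (th (Suc k) w) - g (X (Suc k) w) (th k w)\<bar> + \<bar>\<pi>h (th k w) - \<pi>h (ths w)\<bar>)" for k w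
 have [measurable]: "a k : meas M" "d k : meas M" for k unfolding a_def by (measurable, rule F_M[OF dF])
 have a0: "AE w in M. (%k. a k w) ----> 0"
  using conv AE_space
 proof eventually_elim
  case (elim w)
  show ?case
  proof (cases "w : E")
   case True
   note tK = EK[OF True] and sK = E_ths[OF True]
   show ?thesis
   proof (rule LIMSEQ_I)
    fix l :: real assume l: "0 < l"
    define c where "c = 2 * ((B + 2) / r) + 1"
    have c: "0 < c" using B r by (simp add: c_def add_nonneg_pos)
    define \<eta> where "\<eta> = l / (2 * c)"
    have \<eta>: "0 < \<eta>" "c * \<eta> < l" using l c by (auto simp: \<eta>_def)
    have "EV m. kernel_D S P V b (th m w) (ths w) < ennreal (\<eta> / Hc) \<and> kernel_D S P V 0 (th m w) (ths w) < ennreal \<eta>"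
     using elim True b alpha \<eta> Hc by (intro eventually_conj order_tendstoD(2)[of _ 0]) auto
    then obtain m where m: "!!k. m <= k ==> kernel_D S P V b (th k w) (ths w) <= ennreal (\<eta> / Hc)" "!!k. m <= k ==> kernel_D S P V 0 (th k w) (ths w) <= ennreal \<eta>"
     by (auto simp: eventually_sequentially intro: less_imp_le)
    have hd: "\<bar>h y (th k w) - h y (ths w)\<bar> <= \<eta>" if "m <= k" "y : space S" for k y
    proof -
     have "ennreal \<bar>h y (th k w) - h y (ths w)\<bar> <= ennreal Hc * ennreal (\<eta> / Hc)"
      by (rule order_trans[OF cont[OF that(2) tK sK] mult_left_mono[OF m(1)[OF that(1)]]]) simp
     then show ?thesis using \<eta> Hc by (simp add: ennreal_mult[symmetric])
    qed
    have "norm (a k w - 0) < l" if k: "m <= k" for k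
    proof -
     have gk: "\<bar>g (X (Suc k) w) (th i w) - g (X (Suc k) w) (ths w)\<bar> <= (B + 2) * \<eta> / r" if "m <= i" for i
      using \<eta> by (intro g_cont[OF tK sK X_space[OF elim(2)] _ hd[OF that] m(2)[OF that]]) auto
     have "\<bar>\<pi>h (th k w) - \<pi>h (ths w)\<bar> <= \<eta>" by (rule \<pi>h_diff[OF tK hd[OF k] hi[OF sK]]) (auto simp: \<pi>h_def)
     then have "a k w <= 2 * ((B + 2) * \<eta> / r) + \<eta>" using gk[of k] gk[of "Suc k"] k True by (simp add: a_def)
     also have "... = c * \<eta>" by (simp add: c_def algebra_simps)
     also note \<eta>(2)
     finally show ?thesis by (simp add: a_def)
    qed
    then show "\<exists>no. \<forall>k\<ge>no. norm (a k w - 0) < l" by blast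
   qed
  qed (simp add: a_def)
 qed
 define Z where "Z n w = 2 * B * (1 / real n) + (\<bar>(1 / real n) * (\<Sum>k<n. d k w)\<bar> + (1 / real n) * (\<Sum>k<n. a k w))" for n w
 define Z' where "Z' n w = q r * avgV n w" for n w
 have q0: "0 <= q r" using H c1(1) by (simp add: q_def)
 show "\<exists>Z Z'. (\<forall>n. Z n : meas M) \<and> (\<forall>n. Z' n : meas M) \<and>
   null_in_prob Z \<and> (EV n. prob {w : space M. eps < \<bar>Z' n w\<bar>} <= eps) \<and>
   (EV n. AE w in M. \<bar>((1 / real n) * (\<Sum>k<n. h (X k w) (th k w)) - (LINT y|\<pi>. h y (ths w))) * ind E w\<bar> <= \<bar>Z n w\<bar> + \<bar>Z' n w\<bar>)"
 proof (rule exI[of _ Z], rule exI[of _ Z'], intro conjI allI)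
  show "Z n : meas M" "Z' n : meas M" for n unfolding Z_def Z'_def by measurable
  show "null_in_prob Z" unfolding Z_def
  proof (intro null_in_prob_add)
   have "(%n. 2 * B * (1 / real n)) ----> 0" by (rule tendsto_mult_right_zero) (rule lim_1_over_n)
   then show "null_in_prob (%n w. 2 * B * (1 / real n))" by (intro null_in_prob_AE) auto
   show "null_in_prob (%n w. \<bar>(1 / real n) * (\<Sum>k<n. d k w)\<bar>)"
    using martingale_average_null[OF dF dC dB] by (simp add: null_in_prob_def)
   show "null_in_prob (%n w. (1 / real n) * (\<Sum>k<n. a k w))"
    by (rule null_in_prob_AE, measurable) (rule AE_mp[OF a0], rule AE_I2, blast intro: cesaro_null)
  qed measurable
  show "EV n. prob {w : space M. eps < \<bar>Z' n w\<bar>} <= eps"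
  proof (rule always_eventually, rule allI)
   fix n
   have "(NNI w|M. ennreal \<bar>Z' n w\<bar>) = (NNI w|M. ennreal (q r) * ennreal (avgV n w))"
    using q0 avgV_nonneg by (intro nn_integral_cong) (simp add: Z'_def ennreal_mult[symmetric])
   also have "... = ennreal (q r) * (NNI w|M. ennreal (avgV n w))" by (rule nn_integral_cmult) measurable
   also have "... <= ennreal (q r) * ennreal CV" by (intro mult_left_mono avgV_moment) auto
   also have "... <= ennreal (eps\<^sup>2)" using q0 CV_pos r(3) by (simp add: ennreal_mult[symmetric] ennreal_leI)
   finally have "prob {w : space M. eps < \<bar>Z' n w\<bar>} <= eps\<^sup>2 / eps"
    by (intro prob_le_of_nn_integral e) (auto simp: Z'_def)
   then show "prob {w : space M. eps < \<bar>Z' n w\<bar>} <= eps" using e by (simp add: power2_eq_square)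
  qed
  show "EV n. AE w in M. \<bar>((1 / real n) * (\<Sum>k<n. h (X k w) (th k w)) - (LINT y|\<pi>. h y (ths w))) * ind E w\<bar> <= \<bar>Z n w\<bar> + \<bar>Z' n w\<bar>"
  proof (rule eventually_sequentiallyI[of 1], rule AE_I2)
   fix n w assume n: "1 <= (n::nat)" and ww: "w : space M"
   show "\<bar>((1 / real n) * (\<Sum>k<n. h (X k w) (th k w)) - (LINT y|\<pi>. h y (ths w))) * ind E w\<bar> <= \<bar>Z n w\<bar> + \<bar>Z' n w\<bar>"
   proof (cases "w : E")
    case True
    note tK = EK[OF True] and x = X_space[OF ww]
    let ?g = "%k. g (X k w) (th k w)" and ?v = "%k. ind (G k) w * V (X k w) powr (1 - \<alpha>)"
    have pt: "\<bar>(h (X k w) (th k w) - \<pi>h (ths w)) - d k w + (?g (Suc k) - ?g k)\<bar> <= a k w + q r * ?v k" for k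
    proof -
     have G: "w : G k" using True E_G by blast
     have "r / (1 - r) <= 2 * r" using r by (simp add: field_simps)
     then have "r / (1 - r) * \<bar>?g k\<bar> <= 2 * r * \<bar>?g k\<bar>" by (rule mult_right_mono) simp
     moreover have "\<bar>r / (1 - r) * ?g k\<bar> = r / (1 - r) * \<bar>?g k\<bar>" using r r1 by (simp add: abs_mult)
     ultimately have rg: "\<bar>r / (1 - r) * ?g k\<bar> <= q r * ?v k" using gw[OF x tK, of k k] G by simp
     have q: "?g k / (1 - r) = ?g k + r / (1 - r) * ?g k" using r1 by (simp add: field_simps)
     have eq: "(h (X k w) (th k w) - \<pi>h (ths w)) - d k w + (?g (Suc k) - ?g k)
       = r / (1 - r) * ?g k + (?g (Suc k) - g (X (Suc k) w) (th k w)) + (\<pi>h (th k w) - \<pi>h (ths w))"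
      using G by (simp add: d_def poisson[OF x tK] q u_def)
     have "a k w = \<bar>?g (Suc k) - g (X (Suc k) w) (th k w)\<bar> + \<bar>\<pi>h (th k w) - \<pi>h (ths w)\<bar>" using True by (simp add: a_def)
     moreover have "\<bar>p + p' + p''\<bar> <= \<bar>p'\<bar> + \<bar>p''\<bar> + c" if "\<bar>p\<bar> <= c" for p p' p'' c :: real using that by linarith
     ultimately show ?thesis using rg unfolding eq by (simp only:)
    qed
    let ?D = "\<Sum>k<n. h (X k w) (th k w) - \<pi>h (ths w)"
    have eq: "(\<Sum>k<n. (h (X k w) (th k w) - \<pi>h (ths w)) - d k w + (?g (Suc k) - ?g k)) = ?D - (\<Sum>k<n. d k w) + (?g n - ?g 0)"
     by (simp only: sum.distrib sum_subtractf[of "%k. h (X k w) (th k w) - \<pi>h (ths w)"] sum_lessThan_telescope[of ?g])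
    have "\<bar>?D - (\<Sum>k<n. d k w) + (?g n - ?g 0)\<bar> <= (\<Sum>k<n. a k w + q r * ?v k)"
     unfolding eq[symmetric] by (rule order_trans[OF sum_abs sum_mono]) (rule pt)
    also have "... = (\<Sum>k<n. a k w) + q r * (\<Sum>k<n. ?v k)" by (simp only: sum.distrib sum_distrib_left)
    finally have "\<bar>?D\<bar> <= 2 * B + (\<bar>\<Sum>k<n. d k w\<bar> + (\<Sum>k<n. a k w)) + q r * (\<Sum>k<n. ?v k)"
     using gB[OF x tK, of n n] gB[OF x tK, of 0 0] by linarith
    then have "(1 / real n) * \<bar>?D\<bar> <= (1 / real n) * (2 * B + (\<bar>\<Sum>k<n. d k w\<bar> + (\<Sum>k<n. a k w)) + q r * (\<Sum>k<n. ?v k))"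
     by (rule mult_left_mono) simp
    also have "... = Z n w + Z' n w" by (simp add: Z_def Z'_def avgV_def distrib_left abs_mult)
    also have "... <= \<bar>Z n w\<bar> + \<bar>Z' n w\<bar>" by simp
    finally have fin: "\<bar>(1 / real n) * ?D\<bar> <= \<bar>Z n w\<bar> + \<bar>Z' n w\<bar>" by (simp add: abs_mult)
    have D: "(1 / real n) * ?D = (1 / real n) * (\<Sum>k<n. h (X k w) (th k w)) - \<pi>h (ths w)"
     using n by (simp add: sum_subtractf right_diff_distrib)
    show ?thesis using fin True unfolding D by (simp add: \<pi>h_def)
   qed simp
  qed
 qed
qed

end

section \<open>The central limit theorem on a localizing event\<close>

context prob_space begin

lemma null_in_prob_of_prob:
 assumes [measurable]: "!!n. Y n : meas M" and "(%n. prob {w : space M. Y n w \<noteq> 0}) ----> 0"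
 shows "null_in_prob Y"
proof (rule null_in_probI)
 fix eps :: real assume e: "0 < eps"
 have "EV n. prob {w : space M. Y n w \<noteq> 0} < eps" using assms(2) by (rule order_tendstoD) (rule e)
 then show "EV n. prob {w : space M. eps < \<bar>Y n w\<bar>} <= eps"
 proof eventually_elim
  case (elim n)
  have "prob {w : space M. eps < \<bar>Y n w\<bar>} <= prob {w : space M. Y n w \<noteq> 0}"
   using e by (intro finite_measure_mono) auto
  with elim show ?case by linarith
 qed
qed

lemma prob_gt_tendsto_0:
 assumes "null_in_prob Y" and [measurable]: "!!n. Y n : meas M" and e: "0 < e"
 shows "(%n. prob {w : space M. e < \<bar>Y n w\<bar>}) ----> 0"
proof (rule LIMSEQ_I)
 fix r :: real assume r: "0 < r"
 define \<eta> where "\<eta> = min e (r/2)"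
 have \<eta>: "0 < \<eta>" "\<eta> <= e" "\<eta> < r" using e r by (auto simp: \<eta>_def min_def)
 from null_in_probD[OF assms(1) \<eta>(1)] obtain N where N: "!!n. N <= n ==> prob {w : space M. \<eta> < \<bar>Y n w\<bar>} <= \<eta>"
  by (auto simp: eventually_sequentially)
 show "\<exists>no. \<forall>n\<ge>no. norm (prob {w : space M. e < \<bar>Y n w\<bar>} - 0) < r"
 proof (intro exI[of _ N] allI impI)
  fix n assume "N <= n"
  have "prob {w : space M. e < \<bar>Y n w\<bar>} <= prob {w : space M. \<eta> < \<bar>Y n w\<bar>}"
   using \<eta> by (intro finite_measure_mono) auto
  with N[OF \<open>N <= n\<close>] \<eta> show "norm (prob {w : space M. e < \<bar>Y n w\<bar>} - 0) < r" by simp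
 qed
qed

end

text \<open>
 Diminishing adaptation enters as the almost sure finiteness of a series on \<open>E\<close>, for measurable
 functions \<open>\<psi>\<close> below \<open>kernel_D\<close>, as \<open>kernel_D\<close> itself may fail to be measurable.
\<close>

locale localized_clt = localized_chain S \<Theta> P \<pi> \<alpha> V M F X th ths G E K L b0 c0
 for S :: "'a measure" and \<Theta> :: "'p::t2_space set" and P \<pi> \<alpha> V and M :: "'w measure" and F X th ths G E K L b0 c0 +
 fixes f :: "'a => real" and Bf \<beta> \<kappa> \<delta> \<rho> :: real
 assumes beta: "0 <= \<beta>" and f: "dominated \<beta> Bf f" and f_pi: "(LINT x|\<pi>. f x) = 0"
  and kd: "1 < \<kappa>" "\<kappa> < 2" "0 < \<delta>" "\<delta> < 1" "\<beta> + \<alpha> * \<kappa> < 1 / 2" "2 * \<beta> + \<alpha> * (\<kappa> + \<delta>) < 1 - \<alpha>"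
  and rho: "1 / 2 < \<rho>" "\<rho> <= 1 / (2 - \<delta>)"
  and diminishing: "!!b \<psi>. b : {0..1 - \<alpha>} ==> \<psi> : meas (S \<Otimes>\<^sub>M (param_space \<Theta> \<Otimes>\<^sub>M param_space \<Theta>)) ==>
   (!!x \<theta> \<theta>'. x : space S ==> \<theta> : K ==> \<theta>' : K ==> \<psi> (x, \<theta>, \<theta>') <= kernel_D S P V b \<theta> \<theta>' * ennreal (V x powr (2 * \<beta> + \<alpha> * (\<kappa> + \<delta>)))) ==>
   AE w in M. w : E --> (\<Sum>k. ennreal (real (k + 1) powr (\<rho> * (2 - \<delta>) - 1)) * \<psi> (X (Suc k) w, th (Suc k) w, th k w)) < \<infinity>"
begin

text \<open>
 The shift by 4 ensures that the values are at most \<open>1/2\<close>.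
\<close>

definition an :: "nat => real" where "an n = real (n + 4) powr (- \<rho>)"

lemma an: "0 < an n" "an n <= 1 / 2"
proof -
 show "0 < an n" by (simp add: an_def)
 have "an n <= real (n + 4) powr (- (1/2))" unfolding an_def using rho by (intro powr_mono) auto
 also have "... <= 4 powr (- (1/2))" by (intro powr_mono2') auto
 also have "... = 1 / 2" by (simp add: powr_minus powr_half_sqrt)
 finally show "an n <= 1 / 2" .
qed

lemma an1: "an n < 1" using an(2)[of n] by simp

lemma an_powr: "an n powr (- c) = real (n + 4) powr (\<rho> * c)"
 by (simp add: an_def powr_powr)

text \<open>
 \<open>p\<close> is the exponent of \<open>V\<close> in the assumption of diminishing adaptation, \<open>\<gamma>\<close> the exponent with which
 the resolvents of \<open>f\<close> are bounded uniformly in \<open>a\<close>.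
\<close>

definition p :: real where "p = 2 * \<beta> + \<alpha> * (\<kappa> + \<delta>)"
definition \<gamma> :: real where "\<gamma> = \<beta> + \<alpha> * \<kappa>"

lemma exponents: "0 < p" "p < 1 - \<alpha>" "0 < \<gamma>" "\<gamma> < 1 / 2" "\<gamma> <= 1 - \<alpha>" "\<beta> + \<gamma> <= p" "\<beta> <= \<gamma>" "0 <= \<beta> + \<gamma>"
  "\<beta> + \<alpha> * \<kappa> + \<alpha> <= 1" "\<gamma> <= p" "\<beta> <= 1 - \<alpha>" "\<gamma> : {0..1 - \<alpha>}"
proof -
 have pos: "0 < \<alpha> * \<kappa>" "0 < \<alpha> * \<delta>" using alpha kd by auto
 have dist: "\<alpha> * (\<kappa> + \<delta>) = \<alpha> * \<kappa> + \<alpha> * \<delta>" by (simp add: distrib_left)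
 note * = beta kd alpha pos dist
 show "0 < p" "p < 1 - \<alpha>" "0 < \<gamma>" "\<gamma> < 1 / 2" and g: "\<gamma> <= 1 - \<alpha>" and "\<beta> + \<gamma> <= p" "\<beta> <= \<gamma>" "0 <= \<beta> + \<gamma>"
  "\<beta> + \<alpha> * \<kappa> + \<alpha> <= 1" "\<gamma> <= p" "\<beta> <= 1 - \<alpha>"
  unfolding p_def \<gamma>_def using * by linarith+
 have "0 <= \<gamma>" unfolding \<gamma>_def using * by linarith
 with g show "\<gamma> : {0..1 - \<alpha>}" by simp
qed

definition res :: "real => 'a => 'p => real" where "res a x \<theta> = resolvent S P f a x \<theta>"

lemma res_joint: "(%z. res a (fst z) (snd z)) : meas (SP S \<Theta>)"
proof -
 have "(%z. f (fst z)) : meas (SP S \<Theta>)"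
  by (rule measurable_compose[OF measurable_fst dominatedD(1)[OF f]])
 from resolvent_joint_measurable[OF this] show ?thesis by (simp add: res_def)
qed

lemma f_bound: "x : space S ==> \<bar>f x\<bar> <= Bf * V x powr \<beta>" using dominatedD(3)[OF f] .
lemma Bf: "0 < Bf" using dominatedD(2)[OF f] .
lemma fm[measurable]: "f : meas S" using dominatedD(1)[OF f] .

text \<open>
 A decay of order \<open>\<kappa> > 1\<close> is summable without the geometric weights.
\<close>

lemma res_bound_ex: "\<exists>C1>0. \<forall>\<theta>\<in>K. \<forall>x\<in>space S. \<forall>a. 0 <= a --> a < 1 --> \<bar>res a x \<theta>\<bar> <= C1 * V x powr \<gamma> \<and>
  (LINT y|P \<theta> x. res a y \<theta>) = res a x \<theta> / (1 - a) - f x"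
proof -
 obtain c where "resolvent_bd K \<beta> (\<beta> + \<alpha> * \<kappa>) 0 c"
  by (rule resolvent_bd_exists[OF K beta, of \<kappa> 0]) (use kd exponents in auto)
 note c = resolvent_bdD[OF this]
 show ?thesis
 proof (intro exI[of _ "c * Bf"] conjI ballI allI impI)
  show "0 < c * Bf" using c(1) Bf by simp
  fix \<theta> x and a :: real assume h: "\<theta> : K" "x : space S" "0 <= a" "a < 1"
  have A: "(1 - a) ^ (j + 1) * real (j + 1) powr 0 <= 1" for j using h by (simp add: power_le_one mult_le_one)
  have "dominated (\<beta> + \<alpha> * \<kappa>) (c * 1 * Bf) (%x. resolvent S P f a x \<theta>)"
   by (rule c(2)[OF h(1) f f_pi h(3,4) _ A]) simp
  from dominatedD(3)[OF this h(2)] show "\<bar>res a x \<theta>\<bar> <= c * Bf * V x powr \<gamma>" by (simp add: res_def \<gamma>_def)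
  have "\<exists>t. summable t \<and> (\<forall>x\<in>space S. \<forall>j. \<bar>(1 - a) ^ (j + 1) * Pf \<theta> j f x\<bar> <= t j * V x powr (\<beta> + \<alpha> * \<kappa>))"
   by (rule c(3)[OF h(1) f f_pi h(3,4) _ A]) simp
  then obtain t where t: "summable t" "!!x j. x : space S ==> \<bar>(1 - a) ^ (j + 1) * Pf \<theta> j f x\<bar> <= t j * V x powr (\<beta> + \<alpha> * \<kappa>)" by blast
  have tT: "\<theta> : \<Theta>" using h K by auto
  show "(LINT y|P \<theta> x. res a y \<theta>) = res a x \<theta> / (1 - a) - f x"
   unfolding res_def using exponents by (intro resolvent_poisson[OF tT beta _ _ f h(3,4) t h(2)]) (auto simp: \<gamma>_def)
 qed
qed

definition C1 :: real where "C1 = (SOME C1. C1 > 0 \<and> (\<forall>\<theta>\<in>K. \<forall>x\<in>space S. \<forall>a. 0 <= a --> a < 1 --> \<bar>res a x \<theta>\<bar> <= C1 * V x powr \<gamma> \<and>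
  (LINT y|P \<theta> x. res a y \<theta>) = res a x \<theta> / (1 - a) - f x))"

lemma C1: "C1 > 0" and res_bound: "\<theta> : K ==> x : space S ==> 0 <= a ==> a < 1 ==> \<bar>res a x \<theta>\<bar> <= C1 * V x powr \<gamma>"
 and res_poisson: "\<theta> : K ==> x : space S ==> 0 <= a ==> a < 1 ==> (LINT y|P \<theta> x. res a y \<theta>) = res a x \<theta> / (1 - a) - f x"
 using someI_ex[OF res_bound_ex, folded C1_def] by blast+

definition PR :: "real => 'a => 'p => real" where "PR a x \<theta> = (LINT y|P \<theta> x. res a y \<theta>)"

lemma PR_joint: "(%z. PR a (fst z) (snd z)) : meas (SP S \<Theta>)"
 unfolding PR_def
proof (rule integral_measurable_kernel[OF _ measurable_prob_algebraD[OF P_joint]])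
 have "(%ww. (snd ww, snd (fst ww))) : measurable ((SP S \<Theta>) \<Otimes>\<^sub>M S) (SP S \<Theta>)" by measurable
 from measurable_compose[OF this res_joint] show "(%(z, y). res a y (snd z)) : meas ((SP S \<Theta>) \<Otimes>\<^sub>M S)"
  by (simp add: split_beta')
qed

definition C2 :: real where "C2 = 2 * C1 + Bf"

lemma C2: "0 < C2" "C1 <= C2" using C1 Bf by (auto simp: C2_def)

lemma PR_bound:
 assumes "\<theta> : K" "x : space S" "0 <= a" "a <= 1 / 2"
 shows "\<bar>PR a x \<theta>\<bar> <= C2 * V x powr \<gamma>"
proof -
 have "\<bar>PR a x \<theta>\<bar> <= \<bar>res a x \<theta>\<bar> / (1 - a) + \<bar>f x\<bar>"
  unfolding PR_def using res_poisson[of \<theta> x a] assms by (simp add: order_trans[OF abs_triangle_ineq4])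
 also have "\<bar>res a x \<theta>\<bar> / (1 - a) <= (C1 * V x powr \<gamma>) / (1 / 2)"
  using res_bound[of \<theta> x a] assms C1 by (intro frac_le) auto
 also have "\<bar>f x\<bar> <= Bf * V x powr \<gamma>"
  using f_bound[OF assms(2)] V_powr_mono[OF assms(2) exponents(7)] Bf by (meson mult_left_mono order_trans less_imp_le)
 finally show ?thesis by (simp add: C2_def algebra_simps)
qed

text \<open>
 A smaller power of \<open>V\<close> at the cost of a power of \<open>1 / a\<close>.
\<close>

lemma res_bound_tempered_ex:
 assumes e: "0 <= \<eta>" "\<eta> <= 1" "0 <= \<kappa>'" "1 < \<kappa>' + \<eta>" "\<beta> + \<alpha> * \<kappa>' + \<alpha> <= 1"
 obtains c where "0 < c" "!!\<theta> x a. \<theta> : K ==> x : space S ==> 0 < a ==> a < 1 ==> \<bar>res a x \<theta>\<bar> <= c * a powr (- \<eta>) * V x powr (\<beta> + \<alpha> * \<kappa>')"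
proof -
 obtain c where "resolvent_bd K \<beta> (\<beta> + \<alpha> * \<kappa>') \<eta> c"
  by (rule resolvent_bd_exists[OF K beta e(3,5,4)])
 note c = resolvent_bdD[OF this]
 have "\<bar>res a x \<theta>\<bar> <= c * Bf * a powr (- \<eta>) * V x powr (\<beta> + \<alpha> * \<kappa>')" if h: "\<theta> : K" "x : space S" "0 < a" "a < 1" for \<theta> x a
 proof -
  have "dominated (\<beta> + \<alpha> * \<kappa>') (c * a powr (- \<eta>) * Bf) (%x. resolvent S P f a x \<theta>)"
   by (rule c(2)[OF h(1) f f_pi _ h(4) _ power_le_powr_minus[OF h(3,4) e(1,2)]]) (use h in auto)
  from dominatedD(3)[OF this h(2)] show ?thesis by (simp add: res_def mult_ac)
 qed
 moreover have "0 < c * Bf" using c(1) Bf by simp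
 ultimately show ?thesis using that by blast
qed

lemma res_change_ex:
 assumes e: "0 <= \<eta>1" "\<eta>1 <= 1" "0 <= \<eta>2" "\<eta>2 <= 1" "0 <= \<kappa>1" "1 < \<kappa>1 + \<eta>1" "0 <= \<kappa>2" "1 < \<kappa>2 + \<eta>2" "\<beta> + \<alpha> * (\<kappa>1 + \<kappa>2) + \<alpha> <= 1"
 obtains c where "0 < c" "!!\<theta> \<theta>' x a. \<theta> : K ==> \<theta>' : K ==> x : space S ==> 0 < a ==> a < 1 ==>
   ennreal \<bar>res a x \<theta> - res a x \<theta>'\<bar> <= ennreal (c * a powr (- (\<eta>1 + \<eta>2))) * kernel_D S P V (\<beta> + \<alpha> * \<kappa>1) \<theta> \<theta>' * ennreal (V x powr (\<beta> + \<alpha> * (\<kappa>1 + \<kappa>2)))"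
proof -
 from resolvent_parameter_change[OF K beta e(5,7,9,6,8)] obtain c where c: "c > 0" and
  *: "\<forall>\<theta>\<in>K. \<forall>\<theta>'\<in>K. \<forall>u B a A1 A2. dominated \<beta> B u --> (LINT y|\<pi>. u y) = 0 --> 0 < a --> a < 1 --> 0 < A1 --> 0 < A2 -->
   (\<forall>j. (1 - a) ^ (j + 1) * real (j + 1) powr \<eta>1 <= A1) --> (\<forall>j. (1 - a) ^ (j + 1) * real (j + 1) powr \<eta>2 <= A2) -->
   (\<forall>x\<in>space S. ennreal \<bar>resolvent S P u a x \<theta> - resolvent S P u a x \<theta>'\<bar> <=
    ennreal (c * A1 * A2 * B) * kernel_D S P V (\<beta> + \<alpha> * \<kappa>1) \<theta> \<theta>' * ennreal (V x powr (\<beta> + \<alpha> * (\<kappa>1 + \<kappa>2))))"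
  by (elim exE conjE)
 have "ennreal \<bar>res a x \<theta> - res a x \<theta>'\<bar> <= ennreal (c * Bf * a powr (- (\<eta>1 + \<eta>2))) * kernel_D S P V (\<beta> + \<alpha> * \<kappa>1) \<theta> \<theta>' * ennreal (V x powr (\<beta> + \<alpha> * (\<kappa>1 + \<kappa>2)))"
  if h: "\<theta> : K" "\<theta>' : K" "x : space S" "0 < a" "a < 1" for \<theta> \<theta>' x a
 proof -
  have ap: "0 < a powr (- \<eta>1)" "0 < a powr (- \<eta>2)" using h by auto
  have "a powr (- \<eta>1) * a powr (- \<eta>2) = a powr (- (\<eta>1 + \<eta>2))" by (simp add: powr_add[symmetric])
  then have eq: "c * a powr (- \<eta>1) * a powr (- \<eta>2) * Bf = c * Bf * a powr (- (\<eta>1 + \<eta>2))" by (simp add: mult_ac)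
  show ?thesis
   using *[rule_format, OF h(1,2) f f_pi h(4,5) ap power_le_powr_minus[OF h(4,5) e(1,2)] power_le_powr_minus[OF h(4,5) e(3,4)] h(3)]
   unfolding res_def eq .
 qed
 moreover have "0 < c * Bf" using c Bf by simp
 ultimately show ?thesis using that by blast
qed

lemma E_K: "w : E ==> th k w : K" using E_G G_K by blast
lemma E_space: "w : E ==> w : space M" using sets.sets_into_space[OF E] by blast

text \<open>
 The supremum over \<open>n\<close> of the functions \<open>q n\<close>, each divided by its constant, is a measurable
 function that does not depend on \<open>n\<close> and is below the bound of diminishing adaptation. So its
 weighted series converges on \<open>E\<close>; the weights decrease, so that the first \<open>n\<close> terms without weights
 are at most the \<open>n\<close>-th inverse weight times a finite constant.
\<close>

lemma switch_null:
 fixes q :: "nat => 'a \<times> 'p \<times> 'p => real" and s :: "nat => real"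
 assumes q[measurable]: "!!n. q n : meas (S \<Otimes>\<^sub>M (param_space \<Theta> \<Otimes>\<^sub>M param_space \<Theta>))" and q0: "!!n z. 0 <= q n z"
  and b: "b : {0..1 - \<alpha>}" and c: "0 < c"
  and le: "!!n x \<theta> \<theta>'. x : space S ==> \<theta> : K ==> \<theta>' : K ==>
    ennreal (q n (x, \<theta>, \<theta>')) <= ennreal (c * an n powr (- \<eta>)) * kernel_D S P V b \<theta> \<theta>' * ennreal (V x powr p)"
  and s: "!!n. 0 <= s n" "(%n. s n * (an n powr (- \<eta>) * real n powr (1 - \<rho> * (2 - \<delta>)))) ----> 0"
 shows "null_in_prob (%n w. s n * (\<Sum>k<n. q n (X (Suc k) w, th (Suc k) w, th k w)) * ind E w)"
proof (rule null_in_prob_AE)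
 show "(%w. s n * (\<Sum>k<n. q n (X (Suc k) w, th (Suc k) w, th k w)) * ind E w) : meas M" for n
  by measurable
 define A where "A n = c * an n powr (- \<eta>)" for n
 have A: "0 < A n" for n using c an(1)[of n] by (simp add: A_def)
 define \<psi> where "\<psi> z = (SUP n. ennreal (1 / A n) * ennreal (q n z))" for z
 have [measurable]: "\<psi> : meas (S \<Otimes>\<^sub>M (param_space \<Theta> \<Otimes>\<^sub>M param_space \<Theta>))" unfolding \<psi>_def by measurable
 let ?w = "%k. real (k + 1) powr (\<rho> * (2 - \<delta>) - 1)"
 have e1: "\<rho> * (2 - \<delta>) <= 1" using rho kd by (simp add: field_simps)
 have "AE w in M. w : E --> (\<Sum>k. ennreal (?w k) * \<psi> (X (Suc k) w, th (Suc k) w, th k w)) < \<infinity>"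
 proof (rule diminishing[OF b])
  fix x \<theta> \<theta>' assume h: "x : space S" "\<theta> : K" "\<theta>' : K"
  show "\<psi> (x, \<theta>, \<theta>') <= kernel_D S P V b \<theta> \<theta>' * ennreal (V x powr (2 * \<beta> + \<alpha> * (\<kappa> + \<delta>)))"
   unfolding \<psi>_def
  proof (rule SUP_least)
   fix n
   have "ennreal (1 / A n) * ennreal (q n (x, \<theta>, \<theta>')) <= ennreal (1 / A n) * (ennreal (A n) * kernel_D S P V b \<theta> \<theta>' * ennreal (V x powr p))"
    using le[OF h, of n] by (intro mult_left_mono) (auto simp: A_def)
   also have "... = (ennreal (1 / A n) * ennreal (A n)) * (kernel_D S P V b \<theta> \<theta>' * ennreal (V x powr p))" by (simp only: mult.assoc)
   also have "ennreal (1 / A n) * ennreal (A n) = 1" using A[of n] by (simp add: ennreal_mult[symmetric])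
   finally show "ennreal (1 / A n) * ennreal (q n (x, \<theta>, \<theta>')) <= kernel_D S P V b \<theta> \<theta>' * ennreal (V x powr (2 * \<beta> + \<alpha> * (\<kappa> + \<delta>)))"
    by (simp add: p_def)
  qed
 qed measurable
 then show "AE w in M. (%n. s n * (\<Sum>k<n. q n (X (Suc k) w, th (Suc k) w, th k w)) * ind E w) ----> 0"
 proof eventually_elim
  case (elim w)
  show ?case
  proof (cases "w : E")
   case False then show ?thesis by simp
  next
   case True
   let ?z = "%k. (X (Suc k) w, th (Suc k) w, th k w)"
   define T where "T = enn2real (\<Sum>k. ennreal (?w k) * \<psi> (?z k))"
   have T: "(\<Sum>k. ennreal (?w k) * \<psi> (?z k)) = ennreal T" "0 <= T" using elim True by (auto simp: T_def less_top)
   have bound: "(\<Sum>k<n. q n (?z k)) <= A n * real n powr (1 - \<rho> * (2 - \<delta>)) * T" for n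
   proof -
    have "ennreal (\<Sum>k<n. ?w k * (q n (?z k) / A n)) = (\<Sum>k<n. ennreal (?w k) * (ennreal (1 / A n) * ennreal (q n (?z k))))"
     using q0 A[of n] by (subst sum_ennreal[symmetric]) (auto simp: ennreal_mult[symmetric])
    also have "... <= (\<Sum>k<n. ennreal (?w k) * \<psi> (?z k))"
     unfolding \<psi>_def by (intro sum_mono mult_left_mono SUP_upper) auto
    also have "... <= (\<Sum>k. ennreal (?w k) * \<psi> (?z k))" by (rule sum_le_suminf) auto
    finally have 1: "(\<Sum>k<n. ?w k * (q n (?z k) / A n)) <= T" unfolding T(1) using T(2) by simp
    have "(\<Sum>k<n. q n (?z k)) <= (\<Sum>k<n. A n * real n powr (1 - \<rho> * (2 - \<delta>)) * (?w k * (q n (?z k) / A n)))"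
    proof (rule sum_mono)
     fix k assume k: "k : {..<n}"
     have "1 = real (k + 1) powr (1 - \<rho> * (2 - \<delta>)) * ?w k" by (simp add: powr_add[symmetric])
     also have "... <= real n powr (1 - \<rho> * (2 - \<delta>)) * ?w k"
      using k e1 by (intro mult_right_mono powr_mono2) auto
     finally have "q n (?z k) * 1 <= q n (?z k) * (real n powr (1 - \<rho> * (2 - \<delta>)) * ?w k)" by (rule mult_left_mono) (rule q0)
     then show "q n (?z k) <= A n * real n powr (1 - \<rho> * (2 - \<delta>)) * (?w k * (q n (?z k) / A n))"
      using A[of n] by (simp add: mult_ac)
    qed
    also have "... = A n * real n powr (1 - \<rho> * (2 - \<delta>)) * (\<Sum>k<n. ?w k * (q n (?z k) / A n))" by (simp add: sum_distrib_left)
    also have "... <= A n * real n powr (1 - \<rho> * (2 - \<delta>)) * T" using 1 A[of n] by (intro mult_left_mono) auto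
    finally show ?thesis .
   qed
   show ?thesis
   proof (rule Lim_null_comparison)
    show "EV n. norm (s n * (\<Sum>k<n. q n (?z k)) * ind E w) <= (c * T) * (s n * (an n powr (- \<eta>) * real n powr (1 - \<rho> * (2 - \<delta>))))"
    proof (rule always_eventually, rule allI)
     fix n
     have "norm (s n * (\<Sum>k<n. q n (?z k)) * ind E w) = s n * (\<Sum>k<n. q n (?z k))"
      using True s(1) q0 by (simp add: abs_mult sum_nonneg)
     also have "... <= s n * (A n * real n powr (1 - \<rho> * (2 - \<delta>)) * T)" by (rule mult_left_mono[OF bound s(1)])
     finally show "norm (s n * (\<Sum>k<n. q n (?z k)) * ind E w) <= (c * T) * (s n * (an n powr (- \<eta>) * real n powr (1 - \<rho> * (2 - \<delta>))))"
      by (simp add: A_def mult_ac)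
    qed
    show "(%n. (c * T) * (s n * (an n powr (- \<eta>) * real n powr (1 - \<rho> * (2 - \<delta>))))) ----> 0"
     by (rule tendsto_mult_right_zero[OF s(2)])
   qed
  qed
 qed
qed

lemma powr_ratio_null: "c < 0 ==> (%n. real (n + 4) powr c) ----> 0"
 by (rule tendsto_neg_powr[OF _ filterlim_compose[OF filterlim_real_sequentially filterlim_add_const_nat_at_top]])

lemma real_n_powr_le: "0 <= c ==> real n powr c <= real (n + 4) powr c"
 by (intro powr_mono2) auto

lemma real_n_powr_minus_le:
 assumes "1 <= n" "0 <= c" shows "real n powr (- c) <= 5 powr c * real (n + 4) powr (- c)"
proof -
 have "real (n + 4) powr c <= (5 * real n) powr c" using assms by (intro powr_mono2) auto
 then have "real (n + 4) powr c <= 5 powr c * real n powr c" by (simp add: powr_mult)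
 then show ?thesis using assms by (simp add: powr_minus field_simps)
qed


lemma maxV_powr_null:
 assumes s: "0 < s" "s < 1" "s < c"
 shows "null_in_prob (%n w. real n powr (- c) * maxV n w powr s)"
proof -
 obtain C where C: "0 < C" "!!n. 1 <= n ==> (NNI w|M. ennreal (maxV n w powr s)) <= ennreal (C * real n powr s)"
  using maxV_moment[OF s(1,2)] by blast
 show ?thesis
 proof (rule null_in_prob_L1)
  fix n
  show "(NNI w|M. ennreal \<bar>real n powr (- c) * maxV n w powr s\<bar>) <= ennreal (C * real n powr (s - c))"
  proof (cases "n = 0")
   case False
   have "(NNI w|M. ennreal \<bar>real n powr (- c) * maxV n w powr s\<bar>) = (NNI w|M. ennreal (real n powr (- c)) * ennreal (maxV n w powr s))"
    by (intro nn_integral_cong) (simp add: ennreal_mult[symmetric] abs_mult)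
   also have "... = ennreal (real n powr (- c)) * (NNI w|M. ennreal (maxV n w powr s))" by (rule nn_integral_cmult) measurable
   also have "... <= ennreal (real n powr (- c)) * ennreal (C * real n powr s)" using False by (intro mult_left_mono C) auto
   also have "... = ennreal (C * (real n powr (- c) * real n powr s))" using C by (simp add: ennreal_mult[symmetric] mult_ac)
   also have "real n powr (- c) * real n powr s = real n powr (s - c)" by (simp add: powr_add[symmetric])
   finally show ?thesis .
  qed simp
  have "(%n. real n powr (s - c)) ----> 0" by (rule tendsto_neg_powr[OF _ filterlim_real_sequentially]) (use s in simp)
  then show "(%n. C * real n powr (s - c)) ----> 0" by (rule tendsto_mult_right_zero)
 qed measurable
qed

text \<open>
 Row \<open>n\<close> of the array belongs to the resolvent of parameter \<open>an n\<close>. The sums over \<open>k\<close> telescope up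
 to the change from \<open>gn n k\<close> to \<open>gg n (Suc k)\<close>, that is, from the old to the new parameter at the
 same state. The martingale differences \<open>Dk\<close> are switched off once localization is lost.
\<close>

definition gg :: "nat => nat => 'w => real" where "gg n k w = res (an n) (X k w) (th k w)"
definition gn :: "nat => nat => 'w => real" where "gn n k w = res (an n) (X (Suc k) w) (th k w)"
definition pp :: "nat => nat => 'w => real" where "pp n k w = PR (an n) (X k w) (th k w)"
definition sw :: "nat => nat => 'w => real" where "sw n k w = \<bar>(gg n (Suc k) w)^2 - (gn n k w)\<^sup>2\<bar>"
definition Dk :: "nat => nat => 'w => real" where "Dk n k w = ind (G k) w * (gn n k w - pp n k w)"

lemma gg_F: "gg n k : meas (F k)"
 using measurable_compose[OF XthF res_joint] by (simp add: gg_def[abs_def])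
lemma pp_F: "pp n k : meas (F k)"
 using measurable_compose[OF XthF PR_joint] by (simp add: pp_def[abs_def])
lemma gn_F: "gn n k : meas (F (Suc k))"
proof -
 have "(%w. (X (Suc k) w, th k w)) : measurable (F (Suc k)) (SP S \<Theta>)"
  by (rule measurable_Pair[OF X_F F_mono[OF _ th_F]]) simp
 from measurable_compose[OF this res_joint] show ?thesis by (simp add: gn_def[abs_def])
qed
lemma sw_F: "sw n k : meas (F (Suc k))"
 using gg_F[of n "Suc k"] gn_F[of n k] unfolding sw_def by measurable
lemma Dk_F: "Dk n k : meas (F (Suc k))"
proof -
 have [measurable]: "G k : sets (F (Suc k))" by (rule sets_F_mono[OF _ G_F]) simp
 have [measurable]: "pp n k : meas (F (Suc k))" by (rule F_mono[OF _ pp_F]) simp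
 note [measurable] = gn_F
 show ?thesis unfolding Dk_def by measurable
qed
lemma meas_M[measurable]: "gg n k : meas M" "pp n k : meas M" "gn n k : meas M" "sw n k : meas M" "Dk n k : meas M"
 using F_M[OF gg_F] F_M[OF pp_F] F_M[OF gn_F] F_M[OF sw_F] F_M[OF Dk_F] by auto
lemma sw_nonneg: "0 <= sw n k w" by (simp add: sw_def)

lemma G_space: "w : G k ==> w : space M" using sets.sets_into_space[OF G_M] by blast
lemma an_le: "0 <= an n" "an n < 1" "an n <= 1 / 2" using an[of n] by auto

lemma gg_bound: "w : G k ==> \<bar>gg n k w\<bar> <= C1 * V (X k w) powr \<gamma>"
 unfolding gg_def by (intro res_bound G_K X_space G_space an_le)
lemma gn_bound: "w : G k ==> \<bar>gn n k w\<bar> <= C1 * V (X (Suc k) w) powr \<gamma>"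
 unfolding gn_def by (intro res_bound G_K X_space G_space an_le)
lemma pp_bound: "w : G k ==> \<bar>pp n k w\<bar> <= C2 * V (X k w) powr \<gamma>"
 unfolding pp_def by (intro PR_bound G_K X_space G_space an_le)

lemma V_X_powr_le_maxV:
 assumes "w : G (k - 1)" "k <= n" "0 <= s"
 shows "V (X k w) powr s <= maxV n w powr s"
 using maxV_ge[OF assms(2,1)] V_ge_1[OF X_space[OF G_space[OF assms(1)]], of k] assms(3) by (intro powr_mono2) auto

lemma G_pred: "w : G k ==> w : G (k - 1)" using G_antimono[of "k - 1" k] by auto

lemma square_le_maxV:
 assumes "\<bar>y\<bar> <= c * v" "v <= maxV n w powr \<gamma>" "0 <= c" "0 <= v"
 shows "y^2 <= c\<^sup>2 * maxV n w powr (2 * \<gamma>)"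
proof -
 have "\<bar>y\<bar> <= c * maxV n w powr \<gamma>" using assms by (meson mult_left_mono order_trans)
 then have "\<bar>y\<bar>\<^sup>2 <= (c * maxV n w powr \<gamma>)^2" by (rule power_mono) simp
 also have "... = c^2 * (maxV n w powr \<gamma> * maxV n w powr \<gamma>)" by (simp add: power2_eq_square)
 also have "maxV n w powr \<gamma> * maxV n w powr \<gamma> = maxV n w powr (2 * \<gamma>)" by (simp add: powr_add[symmetric])
 finally show ?thesis by simp
qed

lemma gn_sq_max: "w : G k ==> k < n ==> (gn n k w)^2 <= C1\<^sup>2 * maxV n w powr (2 * \<gamma>)"
 using C1 exponents V_X_powr_le_maxV[of w "Suc k" n \<gamma>] by (intro square_le_maxV[OF gn_bound]) auto
lemma gg_sq_max: "w : G k ==> k <= n ==> (gg n k w)^2 <= C1\<^sup>2 * maxV n w powr (2 * \<gamma>)"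
 using C1 exponents V_X_powr_le_maxV[OF G_pred, of w k n \<gamma>] by (intro square_le_maxV[OF gg_bound]) auto
lemma pp_max: "w : G k ==> k <= n ==> \<bar>pp n k w\<bar> <= C2 * maxV n w powr \<gamma>"
 using C2 exponents V_X_powr_le_maxV[OF G_pred, of w k n \<gamma>] by (intro order_trans[OF pp_bound mult_left_mono]) auto
lemma Dk_max:
 assumes "k < n"
 shows "(Dk n k w)^2 <= (C1 + C2)^2 * maxV n w powr (2 * \<gamma>)"
proof (cases "w : G k")
 case True
 have "\<bar>gn n k w\<bar> <= C1 * maxV n w powr \<gamma>"
  using True assms C1 exponents V_X_powr_le_maxV[of w "Suc k" n \<gamma>] by (intro order_trans[OF gn_bound mult_left_mono]) auto
 then have "\<bar>Dk n k w\<bar> <= (C1 + C2) * maxV n w powr \<gamma>"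
  using pp_max[OF True, of n] assms True by (simp add: Dk_def distrib_right)
 then show ?thesis using C1 C2 by (intro square_le_maxV) auto
qed (simp add: Dk_def)

lemma VG_finite: "(NNI w|M. ind (G k) w * ennreal (V (X (Suc k) w))) < \<infinity>"
 and VG_finite': "(NNI w|M. ind (G k) w * ennreal (V (X k w))) < \<infinity>"
proof -
 have *: "(NNI w|M. ind (G k) w * ennreal (V (X (Suc k) w))) < \<infinity>" for k
  by (rule order.strict_trans1[OF order_trans[OF _ moment_sum_V[of k]]]) auto
 show "(NNI w|M. ind (G k) w * ennreal (V (X (Suc k) w))) < \<infinity>" by (rule *)
 show "(NNI w|M. ind (G k) w * ennreal (V (X k w))) < \<infinity>"
 proof (cases k)
  case 0
  have "(NNI w|M. ind (G 0) w * ennreal (V (X 0 w))) <= (NNI w|M. ennreal L)"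
   using V0 by (intro nn_integral_mono) (auto simp: indicator_def intro!: ennreal_leI)
  also have "... < \<infinity>" by (simp add: emeasure_space_1)
  finally show ?thesis using 0 by simp
 next
  case (Suc j)
  have "(NNI w|M. ind (G k) w * ennreal (V (X k w))) <= (NNI w|M. ind (G j) w * ennreal (V (X (Suc j) w)))"
   using G_dec[of j] Suc by (intro nn_integral_mono mult_right_mono) (auto simp: indicator_def)
  then show ?thesis using *[of j] by (rule order.strict_trans1)
 qed
qed

lemma Dk_square_integrable: "integrable M (%w. (Dk n k w)^2)"
proof (rule integrableI_nonneg)
 have pt: "ennreal ((Dk n k w)^2) <= ennreal (2 * C1^2) * (ind (G k) w * ennreal (V (X (Suc k) w))) + ennreal (2 * C2^2) * (ind (G k) w * ennreal (V (X k w)))"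
  if ww: "w : space M" for w
 proof (cases "w : G k")
  case True
  have sq: "y^2 <= c\<^sup>2 * V x" if "\<bar>y\<bar> <= c * V x powr \<gamma>" "x : space S" for y c x
  proof -
   have "\<bar>y\<bar>\<^sup>2 <= (c * V x powr \<gamma>)^2" by (rule power_mono) (use that in auto)
   also have "... = c^2 * V x powr (2 * \<gamma>)" by (simp add: power2_eq_square powr_add[symmetric])
   also have "... <= c\<^sup>2 * V x powr 1" using exponents by (intro mult_left_mono V_powr_mono that(2)) auto
   finally show ?thesis using V_ge_1[OF that(2)] by simp
  qed
  have "(Dk n k w)^2 <= 2 * (gn n k w)^2 + 2 * (pp n k w)^2"
   using True sum_squares_bound[of "gn n k w" "- pp n k w"] by (simp add: Dk_def power2_diff)
  also have "... <= 2 * (C1^2 * V (X (Suc k) w)) + 2 * (C2^2 * V (X k w))"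
   using sq[OF gn_bound[OF True] X_space[OF ww]] sq[OF pp_bound[OF True] X_space[OF ww]] by (intro add_mono mult_left_mono) auto
  finally show ?thesis using True V_ge_1[OF X_space[OF ww], of k] V_ge_1[OF X_space[OF ww], of "Suc k"]
   by (simp add: ennreal_mult[symmetric] ennreal_plus[symmetric] ennreal_leI mult.assoc del: ennreal_plus)
 qed (simp add: Dk_def)
 have "(NNI w|M. ennreal ((Dk n k w)^2)) <= (NNI w|M. ennreal (2 * C1^2) * (ind (G k) w * ennreal (V (X (Suc k) w))) + ennreal (2 * C2^2) * (ind (G k) w * ennreal (V (X k w))))"
  by (rule nn_integral_mono) (rule pt)
 also have "... = ennreal (2 * C1^2) * (NNI w|M. ind (G k) w * ennreal (V (X (Suc k) w))) + ennreal (2 * C2^2) * (NNI w|M. ind (G k) w * ennreal (V (X k w)))"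
  by (subst nn_integral_add) (auto simp: nn_integral_cmult)
 also have "... < \<infinity>" using VG_finite[of k] VG_finite'[of k] by (auto simp: ennreal_mult_less_top)
 finally show "(NNI w|M. ennreal ((Dk n k w)^2)) < \<infinity>" .
qed auto

lemma Dk_centred: "centred M (F k) (Dk n k)"
proof -
 let ?r = "%w. res (an n) (X (Suc k) w) (th k w)"
 have "centred M (F k) (%w. ind (G k) w * (?r w - (LINT y|P (th k w) (X k w). res (an n) y (th k w))))"
 proof (rule step_centred[OF res_joint])
  have "(NNI w|M. ind (G k) w * ennreal \<bar>?r w\<bar>) <= (NNI w|M. ennreal C1 * (ind (G k) w * ennreal (V (X (Suc k) w))))"
  proof (rule nn_integral_mono)
   fix w assume ww: "w : space M"
   show "ind (G k) w * ennreal \<bar>?r w\<bar> <= ennreal C1 * (ind (G k) w * ennreal (V (X (Suc k) w)))"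
   proof (cases "w : G k")
    case True
    have "\<bar>gn n k w\<bar> <= C1 * V (X (Suc k) w) powr 1"
     using exponents C1 by (intro order_trans[OF gn_bound[OF True]] mult_left_mono V_powr_mono X_space[OF ww]) auto
    then show ?thesis using True V_ge_1[OF X_space[OF ww], of "Suc k"] C1 by (simp add: gn_def ennreal_mult[symmetric] ennreal_leI)
   qed simp
  qed
  also have "... = ennreal C1 * (NNI w|M. ind (G k) w * ennreal (V (X (Suc k) w)))" by (rule nn_integral_cmult) measurable
  also have "... < \<infinity>" using VG_finite[of k] by (auto simp: ennreal_mult_less_top)
  finally show "(NNI w|M. ind (G k) w * ennreal \<bar>?r w\<bar>) < \<infinity>" .
 qed
 then show ?thesis by (simp add: Dk_def[abs_def] gn_def pp_def PR_def)
qed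

subsection \<open>Replacing the parameter by its predecessor\<close>

lemma switch_measurable: "(%z. res a (fst z) (fst (snd z))) : meas (S \<Otimes>\<^sub>M (param_space \<Theta> \<Otimes>\<^sub>M param_space \<Theta>))"
 "(%z. res a (fst z) (snd (snd z))) : meas (S \<Otimes>\<^sub>M (param_space \<Theta> \<Otimes>\<^sub>M param_space \<Theta>))"
proof -
 have "(%z. (fst z, fst (snd z))) : measurable (S \<Otimes>\<^sub>M (param_space \<Theta> \<Otimes>\<^sub>M param_space \<Theta>)) (SP S \<Theta>)" by measurable
 from measurable_compose[OF this res_joint] show "(%z. res a (fst z) (fst (snd z))) : meas (S \<Otimes>\<^sub>M (param_space \<Theta> \<Otimes>\<^sub>M param_space \<Theta>))" by simp
 have "(%z. (fst z, snd (snd z))) : measurable (S \<Otimes>\<^sub>M (param_space \<Theta> \<Otimes>\<^sub>M param_space \<Theta>)) (SP S \<Theta>)" by measurable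
 from measurable_compose[OF this res_joint] show "(%z. res a (fst z) (snd (snd z))) : meas (S \<Otimes>\<^sub>M (param_space \<Theta> \<Otimes>\<^sub>M param_space \<Theta>))" by simp
qed

lemma switch_scale:
 assumes "\<rho> * \<eta> < \<rho> * (2 - \<delta>) - 1 + c" "0 <= c"
 shows "(%n. real n powr (- c) * (an n powr (- \<eta>) * real n powr (1 - \<rho> * (2 - \<delta>)))) ----> 0"
proof (rule Lim_null_comparison)
 have e1: "\<rho> * (2 - \<delta>) <= 1" using rho kd by (simp add: field_simps)
 show "EV n. norm (real n powr (- c) * (an n powr (- \<eta>) * real n powr (1 - \<rho> * (2 - \<delta>)))) <= 5 powr c * real (n + 4) powr (- c + (\<rho> * \<eta> + (1 - \<rho> * (2 - \<delta>))))"
 proof (rule eventually_sequentiallyI[of 1])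
  fix n :: nat assume n: "1 <= n"
  have "real n powr (- c) * (an n powr (- \<eta>) * real n powr (1 - \<rho> * (2 - \<delta>)))
    <= (5 powr c * real (n + 4) powr (- c)) * (real (n + 4) powr (\<rho> * \<eta>) * real (n + 4) powr (1 - \<rho> * (2 - \<delta>)))"
   unfolding an_powr using real_n_powr_minus_le[OF n assms(2)] e1 by (intro mult_mono real_n_powr_le) auto
  also have "... = 5 powr c * real (n + 4) powr (- c + (\<rho> * \<eta> + (1 - \<rho> * (2 - \<delta>))))"
   by (simp only: powr_add[symmetric] mult.assoc)
  finally show "norm (real n powr (- c) * (an n powr (- \<eta>) * real n powr (1 - \<rho> * (2 - \<delta>)))) <= 5 powr c * real (n + 4) powr (- c + (\<rho> * \<eta> + (1 - \<rho> * (2 - \<delta>))))"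
   by simp
 qed
 show "(%n. 5 powr c * real (n + 4) powr (- c + (\<rho> * \<eta> + (1 - \<rho> * (2 - \<delta>))))) ----> 0"
  by (rule tendsto_mult_right_zero[OF powr_ratio_null]) (use assms in simp)
qed

text \<open>
 The midpoint of an interval that is nonempty since \<open>\<rho> > 1/2\<close>: above \<open>1 - \<delta>\<close> the resolvent is
 bounded with the decay \<open>\<delta>\<close> only; below \<open>2 - \<delta> - 1 / (2 * \<rho>)\<close> the factor \<open>an n\<close> to the power \<open>-\<eta>0\<close>
 leaves the parameter changes \<open>o(\<surd>n)\<close>.
\<close>

definition \<eta>0 :: real where "\<eta>0 = ((1 - \<delta>) + (2 - \<delta> - 1 / (2 * \<rho>))) / 2"

lemma \<eta>0: "1 < \<delta> + \<eta>0" "0 <= \<eta>0" "\<eta>0 < 1" "\<rho> * \<eta>0 < \<rho> * (2 - \<delta>) - 1 + 1/2"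
proof -
 have a: "1 / (2 * \<rho>) < 1" using rho by (simp add: field_simps)
 have "\<rho> * (2 - \<delta>) <= 1" using rho kd by (simp add: field_simps)
 then have b: "1 - \<delta> / 2 <= 1 / (2 * \<rho>)" using rho by (simp add: field_simps)
 define q where "q = 1 / (2 * \<rho>)"
 have e: "2 * \<eta>0 = 3 - 2 * \<delta> - q" by (simp add: \<eta>0_def q_def)
 note * = a[folded q_def] b[folded q_def] kd(3,4) e
 show "1 < \<delta> + \<eta>0" using * by linarith
 show "0 <= \<eta>0" using * by linarith
 show "\<eta>0 < 1" using * by linarith
 have "\<eta>0 < 2 - \<delta> - 1 / (2 * \<rho>)" using a by (simp add: \<eta>0_def)
 then have "\<rho> * \<eta>0 < \<rho> * (2 - \<delta> - 1 / (2 * \<rho>))" using rho by (intro mult_strict_left_mono) auto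
 also have "... = \<rho> * (2 - \<delta>) - 1 + 1/2" using rho by (simp add: field_simps)
 finally show "\<rho> * \<eta>0 < \<rho> * (2 - \<delta>) - 1 + 1/2" .
qed

lemma res_change_simple:
 obtains c where "0 < c" "!!\<theta> \<theta>' x a. \<theta> : K ==> \<theta>' : K ==> x : space S ==> 0 < a ==> a < 1 ==>
   ennreal \<bar>res a x \<theta> - res a x \<theta>'\<bar> <= ennreal (c * a powr (- \<eta>0)) * kernel_D S P V \<gamma> \<theta> \<theta>' * ennreal (V x powr (\<beta> + \<alpha> * (\<kappa> + \<delta>)))"
proof -
 have pre: "0 <= (0::real)" "(0::real) <= 1" "0 <= \<eta>0" "\<eta>0 <= 1" "0 <= \<kappa>" "1 < \<kappa> + 0" "0 <= \<delta>" "1 < \<delta> + \<eta>0"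
   "\<beta> + \<alpha> * (\<kappa> + \<delta>) + \<alpha> <= 1" using \<eta>0 kd beta by auto
 obtain c where "0 < c" "!!\<theta> \<theta>' x a. \<theta> : K ==> \<theta>' : K ==> x : space S ==> 0 < a ==> a < 1 ==>
   ennreal \<bar>res a x \<theta> - res a x \<theta>'\<bar> <= ennreal (c * a powr (- (0 + \<eta>0))) * kernel_D S P V (\<beta> + \<alpha> * \<kappa>) \<theta> \<theta>' * ennreal (V x powr (\<beta> + \<alpha> * (\<kappa> + \<delta>)))"
  using res_change_ex[OF pre] by blast
 then show ?thesis using that by (simp add: \<gamma>_def)
qed

lemma switch_linear_null:
 "null_in_prob (%n w. real n powr (- (1/2)) * (\<Sum>k<n. \<bar>gg n (Suc k) w - gn n k w\<bar>) * ind E w)"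
proof -
 obtain c where c: "0 < c" "!!\<theta> \<theta>' x a. \<theta> : K ==> \<theta>' : K ==> x : space S ==> 0 < a ==> a < 1 ==>
   ennreal \<bar>res a x \<theta> - res a x \<theta>'\<bar> <= ennreal (c * a powr (- \<eta>0)) * kernel_D S P V \<gamma> \<theta> \<theta>' * ennreal (V x powr (\<beta> + \<alpha> * (\<kappa> + \<delta>)))"
  by (rule res_change_simple) blast
 have "null_in_prob (%n w. real n powr (- (1/2)) * (\<Sum>k<n. (%z. \<bar>res (an n) (fst z) (fst (snd z)) - res (an n) (fst z) (snd (snd z))\<bar>) (X (Suc k) w, th (Suc k) w, th k w)) * ind E w)"
 proof (rule switch_null[OF _ _ exponents(12) c(1), where \<eta>=\<eta>0])
  fix n x \<theta> \<theta>' assume h: "x : space S" "\<theta> : K" "\<theta>' : K"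
  have "V x powr (\<beta> + \<alpha> * (\<kappa> + \<delta>)) <= V x powr p" using beta by (intro V_powr_mono[OF h(1)]) (simp add: p_def)
  then show "ennreal \<bar>res (an n) (fst (x, \<theta>, \<theta>')) (fst (snd (x, \<theta>, \<theta>'))) - res (an n) (fst (x, \<theta>, \<theta>')) (snd (snd (x, \<theta>, \<theta>')))\<bar> <= ennreal (c * an n powr (- \<eta>0)) * kernel_D S P V \<gamma> \<theta> \<theta>' * ennreal (V x powr p)"
   using c(2)[OF h(2,3,1) an(1) an1, of n] by (simp del: ennreal_mult) (meson mult_left_mono order_trans zero_le ennreal_leI)
 next
  show "(%n. real n powr (- (1/2)) * (an n powr (- \<eta>0) * real n powr (1 - \<rho> * (2 - \<delta>)))) ----> 0"
   by (rule switch_scale) (use \<eta>0 in auto)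
 qed (use switch_measurable in measurable)
 then show ?thesis by (simp add: gg_def gn_def)
qed

text \<open>
 A change of a squared resolvent is a bound for a resolvent times a bound for a change, which
 consists of two resolvents. The available decay \<open>\<kappa> + \<delta>\<close> is divided evenly among the three, so that
 the product grows with exponent \<open>p\<close>; \<open>\<eta>3\<close> is the least power of \<open>1 / a\<close> that works for this decay,
 up to a margin, and three of them stay below \<open>2 - \<delta>\<close>.
\<close>

definition \<kappa>3 :: real where "\<kappa>3 = (\<kappa> + \<delta>) / 3"
definition \<eta>3 :: real where "\<eta>3 = (2 - \<delta> - (\<kappa> - 1) / 2) / 3"

lemma third: "1 < \<kappa>3 + \<eta>3" "0 <= \<kappa>3" "0 <= \<eta>3" "\<eta>3 <= 1" "\<beta> + \<alpha> * (\<kappa>3 + \<kappa>3) + \<alpha> <= 1" "\<beta> + \<alpha> * \<kappa>3 + \<alpha> <= 1"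
  "\<beta> + \<alpha> * \<kappa>3 : {0..1 - \<alpha>}" "(\<beta> + \<alpha> * \<kappa>3) + (\<beta> + \<alpha> * (\<kappa>3 + \<kappa>3)) = p" "\<rho> * (3 * \<eta>3) < \<rho> * (2 - \<delta>) - 1 + 1"
proof -
 have e: "3 * \<kappa>3 = \<kappa> + \<delta>" "6 * \<eta>3 = 5 - 2 * \<delta> - \<kappa>" by (simp_all add: \<kappa>3_def \<eta>3_def field_simps)
 show "1 < \<kappa>3 + \<eta>3" using kd(1-4) e by linarith
 show k: "0 <= \<kappa>3" using kd(1-4) e by linarith
 show "0 <= \<eta>3" using kd(1-4) e by linarith
 show "\<eta>3 <= 1" using kd(1-4) e by linarith
 have "\<kappa> + \<delta> = 3 * \<kappa>3" by (simp add: \<kappa>3_def)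
 then show p3: "(\<beta> + \<alpha> * \<kappa>3) + (\<beta> + \<alpha> * (\<kappa>3 + \<kappa>3)) = p" by (simp add: p_def algebra_simps)
 have a: "0 <= \<alpha> * \<kappa>3" using alpha k by simp
 have d: "\<alpha> * (\<kappa>3 + \<kappa>3) = \<alpha> * \<kappa>3 + \<alpha> * \<kappa>3" by (simp add: distrib_left)
 show "\<beta> + \<alpha> * (\<kappa>3 + \<kappa>3) + \<alpha> <= 1" "\<beta> + \<alpha> * \<kappa>3 + \<alpha> <= 1"
  using p3 exponents(2) beta a unfolding d by linarith+
 have i: "\<beta> + \<alpha> * \<kappa>3 <= 1 - \<alpha>" using p3 exponents(2) beta a unfolding d by linarith
 have "0 <= \<beta> + \<alpha> * \<kappa>3" using beta a by linarith
 with i show "\<beta> + \<alpha> * \<kappa>3 : {0..1 - \<alpha>}" by simp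
 have "3 * \<eta>3 = (2 - \<delta>) - (\<kappa> - 1) / 2" by (simp add: \<eta>3_def)
 then have "\<rho> * (3 * \<eta>3) = \<rho> * (2 - \<delta>) - \<rho> * ((\<kappa> - 1) / 2)" by (simp only: right_diff_distrib)
 moreover have "0 < \<rho> * ((\<kappa> - 1) / 2)" using rho kd by simp
 ultimately show "\<rho> * (3 * \<eta>3) < \<rho> * (2 - \<delta>) - 1 + 1" by linarith
qed

lemma switch_square_null:
 "null_in_prob (%n w. real n powr (- 1) * (\<Sum>k<n. sw n k w) * ind E w)"
proof -
 obtain c where c: "0 < c" "!!\<theta> \<theta>' x a. \<theta> : K ==> \<theta>' : K ==> x : space S ==> 0 < a ==> a < 1 ==>
   ennreal \<bar>res a x \<theta> - res a x \<theta>'\<bar> <= ennreal (c * a powr (- (\<eta>3 + \<eta>3))) * kernel_D S P V (\<beta> + \<alpha> * \<kappa>3) \<theta> \<theta>' * ennreal (V x powr (\<beta> + \<alpha> * (\<kappa>3 + \<kappa>3)))"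
  using res_change_ex[OF third(3,4,3,4,2,1,2,1,5)] by blast
 obtain c' where c': "0 < c'" "!!\<theta> x a. \<theta> : K ==> x : space S ==> 0 < a ==> a < 1 ==> \<bar>res a x \<theta>\<bar> <= c' * a powr (- \<eta>3) * V x powr (\<beta> + \<alpha> * \<kappa>3)"
  using res_bound_tempered_ex[OF third(3,4,2,1,6)] by blast
 have cc: "0 < 2 * c' * c" using c c' by simp
 have "null_in_prob (%n w. real n powr (- 1) * (\<Sum>k<n. (%z. \<bar>(res (an n) (fst z) (fst (snd z)))^2 - (res (an n) (fst z) (snd (snd z)))\<^sup>2\<bar>) (X (Suc k) w, th (Suc k) w, th k w)) * ind E w)"
 proof (rule switch_null[OF _ _ third(7) cc, where \<eta>="3 * \<eta>3"])
  fix n x \<theta> \<theta>' assume h: "x : space S" "\<theta> : K" "\<theta>' : K"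
  let ?u = "res (an n) x \<theta>" and ?v = "res (an n) x \<theta>'" and ?b = "c' * an n powr (- \<eta>3) * V x powr (\<beta> + \<alpha> * \<kappa>3)"
  have "\<bar>?u\<^sup>2 - ?v^2\<bar> = \<bar>?u + ?v\<bar> * \<bar>?u - ?v\<bar>" by (simp add: power2_eq_square square_diff_square_factored abs_mult)
  also have "... <= (2 * ?b) * \<bar>?u - ?v\<bar>"
   using c'(2)[OF h(2,1) an(1) an1, of n] c'(2)[OF h(3,1) an(1) an1, of n] by (intro mult_right_mono) auto
  finally have "ennreal \<bar>?u\<^sup>2 - ?v^2\<bar> <= ennreal (2 * ?b) * ennreal \<bar>?u - ?v\<bar>"
   using c'(1) by (subst ennreal_mult[symmetric]) (auto intro: ennreal_leI)
  also have "... <= ennreal (2 * ?b) * (ennreal (c * an n powr (- (\<eta>3 + \<eta>3))) * kernel_D S P V (\<beta> + \<alpha> * \<kappa>3) \<theta> \<theta>' * ennreal (V x powr (\<beta> + \<alpha> * (\<kappa>3 + \<kappa>3))))"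
   by (rule mult_left_mono[OF c(2)[OF h(2,3,1) an(1) an1]]) simp
  also have "... = (ennreal (2 * c' * an n powr (- \<eta>3)) * ennreal (c * an n powr (- (\<eta>3 + \<eta>3)))) * kernel_D S P V (\<beta> + \<alpha> * \<kappa>3) \<theta> \<theta>' * (ennreal (V x powr (\<beta> + \<alpha> * \<kappa>3)) * ennreal (V x powr (\<beta> + \<alpha> * (\<kappa>3 + \<kappa>3))))"
  proof -
   have "ennreal (2 * ?b) = ennreal (2 * c' * an n powr (- \<eta>3)) * ennreal (V x powr (\<beta> + \<alpha> * \<kappa>3))"
    using c'(1) by (subst ennreal_mult[symmetric]) (auto simp: mult_ac)
   then show ?thesis by (simp only: mult_ac)
  qed
  also have "ennreal (2 * c' * an n powr (- \<eta>3)) * ennreal (c * an n powr (- (\<eta>3 + \<eta>3))) = ennreal (2 * c' * c * an n powr (- (3 * \<eta>3)))"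
  proof -
   have "an n powr (- \<eta>3) * an n powr (- (\<eta>3 + \<eta>3)) = an n powr (- (3 * \<eta>3))" by (simp add: powr_add[symmetric])
   then have "2 * c' * an n powr (- \<eta>3) * (c * an n powr (- (\<eta>3 + \<eta>3))) = 2 * c' * c * an n powr (- (3 * \<eta>3))" by (simp add: mult_ac)
   then show ?thesis using c(1) c'(1) by (subst ennreal_mult[symmetric]) auto
  qed
  also have "ennreal (V x powr (\<beta> + \<alpha> * \<kappa>3)) * ennreal (V x powr (\<beta> + \<alpha> * (\<kappa>3 + \<kappa>3))) = ennreal (V x powr p)"
  proof -
   have "V x powr (\<beta> + \<alpha> * \<kappa>3) * V x powr (\<beta> + \<alpha> * (\<kappa>3 + \<kappa>3)) = V x powr p"
    by (simp only: powr_add[symmetric] third(8))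
   then show ?thesis by (subst ennreal_mult[symmetric]) auto
  qed
  finally show "ennreal \<bar>(res (an n) (fst (x, \<theta>, \<theta>')) (fst (snd (x, \<theta>, \<theta>'))))^2 - (res (an n) (fst (x, \<theta>, \<theta>')) (snd (snd (x, \<theta>, \<theta>'))))\<^sup>2\<bar> <= ennreal (2 * c' * c * an n powr (- (3 * \<eta>3))) * kernel_D S P V (\<beta> + \<alpha> * \<kappa>3) \<theta> \<theta>' * ennreal (V x powr p)"
   by simp
 next
  show "(%n. real n powr (- 1) * (an n powr (- (3 * \<eta>3)) * real n powr (1 - \<rho> * (2 - \<delta>)))) ----> 0"
   by (rule switch_scale) (use third in auto)
 qed (use switch_measurable in measurable)
 then show ?thesis by (simp add: gg_def gn_def sw_def)
qed

subsection \<open>The energy of the martingale up to a stopping time\<close>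

text \<open>
 By the Poisson equation the difference is at most a product of \<open>f\<close> and \<open>g\<close>, in which the exponents
 of \<open>V\<close> add up to less than \<open>1 - \<alpha>\<close>, whereas each of the two squares may grow faster.
\<close>

lemma gg_pp_le:
 assumes ww: "w : G k"
 shows "(gg n k w)^2 - (pp n k w)\<^sup>2 <= 4 * Bf * C1 * V (X k w) powr (1 - \<alpha>)"
proof -
 have x: "X k w : space S" by (rule X_space[OF G_space[OF ww]])
 let ?a = "an n" and ?g = "gg n k w" and ?f = "f (X k w)"
 have p: "pp n k w = ?g / (1 - ?a) - ?f"
  unfolding pp_def PR_def gg_def by (rule res_poisson[OF G_K[OF ww] x an_le(1,2)])
 have a: "0 < 1 - ?a" "1 / (1 - ?a) <= 2" "1 <= 1 / (1 - ?a)" using an[of n] by (auto simp: field_simps)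
 have "?g^2 <= (?g / (1 - ?a))^2"
 proof -
  have "\<bar>?g\<bar> * 1 <= \<bar>?g\<bar> * (1 / (1 - ?a))" using a by (intro mult_left_mono) auto
  then have "\<bar>?g\<bar> <= \<bar>?g / (1 - ?a)\<bar>" using a by simp
  then show ?thesis by (simp only: abs_le_square_iff)
 qed
 moreover have "(pp n k w)^2 = (?g / (1 - ?a))^2 - 2 * (?f * ?g * (1 / (1 - ?a))) + ?f^2"
  unfolding p by (simp add: power2_diff mult_ac)
 moreover have "0 <= ?f\<^sup>2" by simp
 ultimately have "?g^2 - (pp n k w)\<^sup>2 <= 2 * (?f * ?g * (1 / (1 - ?a)))" by linarith
 also have "... <= 2 * (\<bar>?f\<bar> * \<bar>?g\<bar> * 2)"
 proof -
  have "?f * ?g * (1 / (1 - ?a)) <= \<bar>?f * ?g\<bar> * (1 / (1 - ?a))" using a by (intro mult_right_mono) auto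
  also have "... <= \<bar>?f * ?g\<bar> * 2" using a by (intro mult_left_mono) auto
  finally show ?thesis by (simp add: abs_mult)
 qed
 also have "\<bar>?f\<bar> * \<bar>?g\<bar> <= (Bf * V (X k w) powr \<beta>) * (C1 * V (X k w) powr \<gamma>)"
  using f_bound[OF x] gg_bound[OF ww] Bf C1 by (intro mult_mono) auto
 also have "(Bf * V (X k w) powr \<beta>) * (C1 * V (X k w) powr \<gamma>) = Bf * C1 * V (X k w) powr (\<beta> + \<gamma>)"
  by (simp add: powr_add)
 also have "... <= Bf * C1 * V (X k w) powr (1 - \<alpha>)"
  using Bf C1 exponents by (intro mult_left_mono V_powr_mono x) auto
 finally show ?thesis by simp
qed

text \<open>
 On \<open>B k\<close> the left-hand summands are \<open>gn\<^sup>2 - pp\<^sup>2\<close>. Replacing \<open>gn n k\<close> by \<open>gg n (Suc k)\<close> costs \<open>sw\<close>,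
 and the sum of \<open>gg\<^sup>2 - pp\<^sup>2\<close> is controlled by the preceding lemma; where \<open>B\<close> is left, one square
 remains unmatched and is bounded by the maximum.
\<close>

lemma energy_pointwise:
 fixes B :: "nat => 'w set"
 assumes BG: "!!k. B k \<subseteq> G k" and dec: "!!k. B (Suc k) \<subseteq> B k"
  and sb: "!!k. w : B k ==> (\<Sum>j<k. sw n j w) <= real n"
 shows "(\<Sum>k<n. ind (B k) w * (Dk n k w)^2) + 2 * (\<Sum>k<n. ind (B k) w * pp n k w * Dk n k w)
  <= 4 * Bf * C1 * (\<Sum>k<n. ind (G k) w * V (X k w) powr (1 - \<alpha>)) + real n + 2 * (C1^2 * maxV n w powr (2 * \<gamma>))"
proof -
 let ?m = "C1^2 * maxV n w powr (2 * \<gamma>)"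
 define i where "i k = indicat_real (B k) w" for k
 have m0: "0 <= ?m" by simp
 have i01: "0 <= i k" "i k <= 1" for k by (auto simp: i_def)
 have id: "i (Suc k) <= i k" for k using dec[of k] by (auto simp: i_def indicator_def)
 have 1: "i k * (Dk n k w)^2 + 2 * (i k * pp n k w * Dk n k w) = i k * (gn n k w)^2 - i k * (pp n k w)^2" for k
  using BG[of k] by (auto simp: i_def Dk_def indicator_def power2_eq_square algebra_simps)
 have 2: "i k * (gn n k w)^2 <= i (Suc k) * (gg n (Suc k) w)^2 + i (Suc k) * sw n k w + (i k - i (Suc k)) * ?m" if k: "k < n" for k
 proof (cases "w : B (Suc k)")
  case True
  then have "w : B k" using dec by blast
  with True show ?thesis by (simp add: i_def sw_def)
 next
  case False
  then show ?thesis using gn_sq_max[of w k n] BG[of k] k by (auto simp: i_def indicator_def)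
 qed
 have sws: "(\<Sum>k<N. i (Suc k) * sw n k w) <= real n" for N
 proof (induction N)
  case (Suc N)
  show ?case
  proof (cases "w : B (Suc N)")
   case True
   have "(\<Sum>k<Suc N. i (Suc k) * sw n k w) <= (\<Sum>k<Suc N. sw n k w)"
    using i01 sw_nonneg by (intro sum_mono) (simp add: mult_left_le_one_le)
   also have "... <= real n" by (rule sb[OF True])
   finally show ?thesis .
  qed (use Suc in \<open>simp add: i_def\<close>)
 qed simp
 have tel: "(\<Sum>k<n. (i k - i (Suc k)) * ?m) <= ?m"
 proof -
  have "(\<Sum>k<n. (i k - i (Suc k))) = i 0 - i n" by (induction n) auto
  then have "(\<Sum>k<n. (i k - i (Suc k)) * ?m) = (i 0 - i n) * ?m" by (simp add: sum_distrib_right[symmetric])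
  also have "... <= 1 * ?m" using i01[of 0] i01[of n] by (intro mult_right_mono) auto
  finally show ?thesis by simp
 qed
 have shift: "(\<Sum>k<n. i (Suc k) * (gg n (Suc k) w)^2) <= (\<Sum>k<n. i k * (gg n k w)^2) + ?m"
 proof -
  have "(\<Sum>k<n. i (Suc k) * (gg n (Suc k) w)^2) = (\<Sum>k<n. i k * (gg n k w)^2) - i 0 * (gg n 0 w)^2 + i n * (gg n n w)^2"
  proof -
   have "(\<Sum>k<n. u (Suc k)) = (\<Sum>k<n. u k) - u 0 + u n" for u :: "nat => real" by (induction n) auto
   from this[of "%k. i k * (gg n k w)^2"] show ?thesis .
  qed
  moreover have "i n * (gg n n w)^2 <= ?m" using gg_sq_max[of w n n] BG[of n] by (auto simp: i_def indicator_def)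
  moreover have "0 <= i 0 * (gg n 0 w)^2" using i01 by simp
  ultimately show ?thesis by linarith
 qed
 have fin: "i k * (gg n k w)^2 - i k * (pp n k w)^2 <= 4 * Bf * C1 * (ind (G k) w * V (X k w) powr (1 - \<alpha>))" for k
 proof (cases "w : B k")
  case True
  then show ?thesis using gg_pp_le[of w k n] BG[of k] by (auto simp: i_def)
 next
  case False
  then show ?thesis using Bf C1 by (simp add: i_def)
 qed
 have "(\<Sum>k<n. i k * (Dk n k w)^2) + 2 * (\<Sum>k<n. i k * pp n k w * Dk n k w)
   = (\<Sum>k<n. i k * (Dk n k w)^2 + 2 * (i k * pp n k w * Dk n k w))"
  by (simp only: sum.distrib sum_distrib_left)
 also have "... = (\<Sum>k<n. i k * (gn n k w)^2) - (\<Sum>k<n. i k * (pp n k w)^2)"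
  by (simp only: 1 sum_subtractf)
 finally have a1: "(\<Sum>k<n. i k * (Dk n k w)^2) + 2 * (\<Sum>k<n. i k * pp n k w * Dk n k w)
   = (\<Sum>k<n. i k * (gn n k w)^2) - (\<Sum>k<n. i k * (pp n k w)^2)" .
 have "(\<Sum>k<n. i k * (gn n k w)^2) <= (\<Sum>k<n. i (Suc k) * (gg n (Suc k) w)^2 + i (Suc k) * sw n k w + (i k - i (Suc k)) * ?m)"
  by (rule sum_mono) (use 2 in auto)
 also have "... = (\<Sum>k<n. i (Suc k) * (gg n (Suc k) w)^2) + (\<Sum>k<n. i (Suc k) * sw n k w) + (\<Sum>k<n. (i k - i (Suc k)) * ?m)"
  by (simp only: sum.distrib)
 finally have a2: "(\<Sum>k<n. i k * (gn n k w)^2) <= (\<Sum>k<n. i (Suc k) * (gg n (Suc k) w)^2) + (\<Sum>k<n. i (Suc k) * sw n k w) + (\<Sum>k<n. (i k - i (Suc k)) * ?m)" .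
 have a3: "(\<Sum>k<n. i k * (gg n k w)^2) - (\<Sum>k<n. i k * (pp n k w)^2) <= 4 * Bf * C1 * (\<Sum>k<n. ind (G k) w * V (X k w) powr (1 - \<alpha>))"
  unfolding sum_subtractf[symmetric] sum_distrib_left by (rule sum_mono) (rule fin)
 have "(\<Sum>k<n. i k * (Dk n k w)^2) + 2 * (\<Sum>k<n. i k * pp n k w * Dk n k w)
   <= 4 * Bf * C1 * (\<Sum>k<n. ind (G k) w * V (X k w) powr (1 - \<alpha>)) + real n + 2 * ?m"
  using a1 a2 a3 shift sws[of n] tel by linarith
 then show ?thesis by (simp add: i_def)
qed

definition CM :: real where
 "CM = (SOME C. 0 < C \<and> (\<forall>n\<ge>1. (NNI w|M. ennreal (maxV n w powr (2 * \<gamma>))) <= ennreal (C * real n powr (2 * \<gamma>))))"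

lemma CM: "0 < CM" "1 <= n ==> (NNI w|M. ennreal (maxV n w powr (2 * \<gamma>))) <= ennreal (CM * real n powr (2 * \<gamma>))"
proof -
 obtain C where "0 < C" "!!n. 1 <= n ==> (NNI w|M. ennreal (maxV n w powr (2 * \<gamma>))) <= ennreal (C * real n powr (2 * \<gamma>))"
  using maxV_moment[of "2 * \<gamma>"] exponents by auto
 then have "\<exists>C. 0 < C \<and> (\<forall>n\<ge>1. (NNI w|M. ennreal (maxV n w powr (2 * \<gamma>))) <= ennreal (C * real n powr (2 * \<gamma>)))" by blast
 from someI_ex[OF this, folded CM_def] show "0 < CM" "1 <= n ==> (NNI w|M. ennreal (maxV n w powr (2 * \<gamma>))) <= ennreal (CM * real n powr (2 * \<gamma>))" by auto
qed

definition CE :: real where "CE = 4 * Bf * C1 * CV + 1 + 2 * C1^2 * CM"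

lemma CE_pos: "0 < CE" using Bf C1 CV_pos CM(1) by (auto simp: CE_def intro!: add_pos_pos add_nonneg_pos)

text \<open>
 In the mean the cross term vanishes, since \<open>pp\<close> is bounded on \<open>B k\<close>; what remains is linear in \<open>n\<close>
 by the moment bounds for \<open>avgV\<close> and \<open>maxV\<close>.
\<close>

lemma stopped_energy:
 fixes B :: "nat => 'w set"
 assumes BF: "!!k. B k : sets (F k)" and BG: "!!k. B k \<subseteq> G k" and dec: "!!k. B (Suc k) \<subseteq> B k"
  and sb: "!!k w. w : B k ==> (\<Sum>j<k. sw n j w) <= real n" and pb: "!!k w. w : B k ==> \<bar>pp n k w\<bar> <= c" and n: "1 <= n"
 shows "(\<Sum>k<n. \<integral>w. ind (B k) w * (Dk n k w)^2 \<partial>M) <= CE * real n"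
proof -
 have BM[measurable]: "B k : sets M" for k by (rule sets_F_M[OF BF])
 have i1: "integrable M (%w. ind (B k) w * (Dk n k w)^2)" for k
  by (rule Bochner_Integration.integrable_bound[OF Dk_square_integrable[of n k]]) (auto simp: indicator_def)
 have pd: "integrable M (%w. (ind (B k) w * pp n k w) * Dk n k w)" for k
 proof (rule Bochner_Integration.integrable_bound)
  show "integrable M (%w. \<bar>c\<bar> * Dk n k w)" using Dk_centred[of k n] by (auto simp: centred_def)
  show "AE w in M. norm (indicat_real (B k) w * pp n k w * Dk n k w) <= norm (\<bar>c\<bar> * Dk n k w)"
  proof (rule AE_I2)
   fix w
   have "\<bar>indicat_real (B k) w * pp n k w\<bar> <= \<bar>c\<bar>" using pb[of w k] by (auto simp: indicator_def)
   then show "norm (indicat_real (B k) w * pp n k w * Dk n k w) <= norm (\<bar>c\<bar> * Dk n k w)"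
    unfolding norm_mult real_norm_def[of "Dk n k w"] by (intro mult_right_mono) (auto simp: abs_mult)
  qed
 qed measurable
 have pd0: "(LINT w|M. (ind (B k) w * pp n k w) * Dk n k w) = 0" for k
 proof (rule centred_mult[OF subF Dk_centred _ pd])
  show "(%w. indicat_real (B k) w * pp n k w) : meas (F k)" using BF[of k] pp_F[of n k] by measurable
 qed
 have avi: "integrable M (avgV n)"
 proof (rule integrableI_nonneg)
  show "(NNI w|M. ennreal (avgV n w)) < \<infinity>" by (rule order.strict_trans1[OF avgV_moment]) simp
 qed (use avgV_nonneg in auto)
 have av: "(LINT w|M. avgV n w) <= CV"
 proof -
  have "ennreal (LINT w|M. avgV n w) <= ennreal CV"
   using avgV_moment[of n] avi avgV_nonneg by (subst nn_integral_eq_integral[symmetric]) auto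
  then show ?thesis using CV_pos by (simp add: ennreal_le_iff)
 qed
 have mxi: "integrable M (%w. maxV n w powr (2 * \<gamma>))"
 proof (rule integrableI_nonneg)
  show "(NNI w|M. ennreal (maxV n w powr (2 * \<gamma>))) < \<infinity>" by (rule order.strict_trans1[OF CM(2)[OF n]]) simp
 qed auto
 have mx: "(LINT w|M. maxV n w powr (2 * \<gamma>)) <= CM * real n"
 proof -
  have "ennreal (LINT w|M. maxV n w powr (2 * \<gamma>)) <= ennreal (CM * real n powr (2 * \<gamma>))"
   using CM(2)[OF n] mxi by (subst nn_integral_eq_integral[symmetric]) auto
  then have "(LINT w|M. maxV n w powr (2 * \<gamma>)) <= CM * real n powr (2 * \<gamma>)" using CM(1) by (simp add: ennreal_le_iff)
  also have "... <= CM * real n powr 1" using CM(1) n exponents by (intro mult_left_mono powr_mono) auto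
  finally show ?thesis by simp
 qed
 have "(\<Sum>k<n. \<integral>w. ind (B k) w * (Dk n k w)^2 \<partial>M)
   = (LINT w|M. (\<Sum>k<n. ind (B k) w * (Dk n k w)^2) + 2 * (\<Sum>k<n. ind (B k) w * pp n k w * Dk n k w))"
 proof -
  have "(LINT w|M. (\<Sum>k<n. ind (B k) w * (Dk n k w)^2) + 2 * (\<Sum>k<n. ind (B k) w * pp n k w * Dk n k w))
   = (LINT w|M. (\<Sum>k<n. ind (B k) w * (Dk n k w)^2)) + (LINT w|M. 2 * (\<Sum>k<n. ind (B k) w * pp n k w * Dk n k w))"
   by (intro Bochner_Integration.integral_add Bochner_Integration.integrable_sum integrable_mult_right i1 pd)
  also have "(LINT w|M. (\<Sum>k<n. ind (B k) w * (Dk n k w)^2)) = (\<Sum>k<n. \<integral>w. ind (B k) w * (Dk n k w)^2 \<partial>M)"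
   by (rule Bochner_Integration.integral_sum) (rule i1)
  also have "(LINT w|M. 2 * (\<Sum>k<n. ind (B k) w * pp n k w * Dk n k w)) = 2 * (LINT w|M. (\<Sum>k<n. ind (B k) w * pp n k w * Dk n k w))"
   by (rule integral_mult_right_zero)
  also have "(LINT w|M. (\<Sum>k<n. ind (B k) w * pp n k w * Dk n k w)) = (\<Sum>k<n. \<integral>w. ind (B k) w * pp n k w * Dk n k w \<partial>M)"
   by (rule Bochner_Integration.integral_sum) (rule pd)
  also have "... = 0" by (simp only: pd0 sum.neutral_const)
  finally show ?thesis by simp
 qed
 also have "... <= (LINT w|M. 4 * Bf * C1 * (real n * avgV n w) + real n + 2 * (C1^2 * maxV n w powr (2 * \<gamma>)))"
 proof (rule integral_mono)
  fix w
  have "(\<Sum>k<n. ind (G k) w * V (X k w) powr (1 - \<alpha>)) = real n * avgV n w" using n by (simp add: avgV_def)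
  then show "(\<Sum>k<n. indicat_real (B k) w * (Dk n k w)^2) + 2 * (\<Sum>k<n. indicat_real (B k) w * pp n k w * Dk n k w)
   <= 4 * Bf * C1 * (real n * avgV n w) + real n + 2 * (C1^2 * maxV n w powr (2 * \<gamma>))"
   using energy_pointwise[of B w n] BG dec sb by simp
 next
  show "integrable M (%w. (\<Sum>k<n. indicat_real (B k) w * (Dk n k w)^2) + 2 * (\<Sum>k<n. indicat_real (B k) w * pp n k w * Dk n k w))"
   using i1 pd by (intro Bochner_Integration.integrable_add Bochner_Integration.integrable_sum integrable_mult_right) auto
  show "integrable M (%w. 4 * Bf * C1 * (real n * avgV n w) + real n + 2 * (C1^2 * maxV n w powr (2 * \<gamma>)))"
   using avi mxi by (intro Bochner_Integration.integrable_add integrable_mult_right integrable_const) auto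
 qed
 also have "... = 4 * Bf * C1 * (real n * (LINT w|M. avgV n w)) + real n + 2 * (C1^2 * (LINT w|M. maxV n w powr (2 * \<gamma>)))"
  using avi mxi by (simp add: prob_space)
 also have "... <= 4 * Bf * C1 * (real n * CV) + real n + 2 * (C1^2 * (CM * real n))"
  using av mx Bf C1 by (intro add_mono mult_left_mono) auto
 also have "... = CE * real n" by (simp add: CE_def algebra_simps)
 finally show ?thesis .
qed


text \<open>
 The sum is stopped when \<open>\<bar>pp\<bar>\<close> exceeds \<open>\<upsilon> * sqrt n\<close> or the sum of \<open>sw\<close> exceeds \<open>n\<close>; on \<open>E\<close> the
 probability of this tends to zero. By orthogonality, the second moment of the stopped sum is at
 most \<open>\<upsilon>\<^sup>2 * n\<close> times the stopped energy, hence that of its average at most \<open>\<upsilon>\<^sup>2 * CE\<close>. The choice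
 of \<open>\<upsilon>\<close> makes this \<open>eps ^ 3\<close>, as Chebyshev's inequality requires.
\<close>

lemma cross_term_null:
 "null_in_prob (%n w. (1 / real n) * (\<Sum>k<n. pp n k w * Dk n k w) * ind E w)"
proof (rule null_in_prob_split)
 fix eps :: real assume e: "0 < eps"
 define \<upsilon> where "\<upsilon> = sqrt (eps^3 / CE)"
 have \<upsilon>: "0 < \<upsilon>" "\<upsilon>\<^sup>2 * CE = eps^3" using e CE_pos by (auto simp: \<upsilon>_def)
 define B where "B n k = {w : G k. (\<forall>j\<le>k. \<bar>pp n j w\<bar> <= \<upsilon> * sqrt (real n)) \<and> (\<Sum>j<k. sw n j w) <= real n}" for n k
 have BF: "B n k : sets (F k)" for n k
 proof -
  have [measurable]: "pp n j : meas (F k)" if "j : {..k}" for j by (rule F_mono[OF _ pp_F]) (use that in auto)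
  have [measurable]: "sw n j : meas (F k)" if "j : {..<k}" for j by (rule F_mono[OF _ sw_F]) (use that in auto)
  have m: "{w : space (F k). (\<forall>j\<in>{..k}. \<bar>pp n j w\<bar> <= \<upsilon> * sqrt (real n)) \<and> (\<Sum>j<k. sw n j w) <= real n} : sets (F k)" by measurable
  have eq: "B n k = G k \<inter> {w : space (F k). (\<forall>j\<in>{..k}. \<bar>pp n j w\<bar> <= \<upsilon> * sqrt (real n)) \<and> (\<Sum>j<k. sw n j w) <= real n}"
   using sets.sets_into_space[OF G_F, of k] by (auto simp: B_def)
  show ?thesis unfolding eq by (rule sets.Int[OF G_F m])
 qed
 have BG: "B n k \<subseteq> G k" for n k by (auto simp: B_def)
 have dec: "B n (Suc k) \<subseteq> B n k" for n k
 proof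
  fix w assume ww: "w : B n (Suc k)"
  then have "w : G k" using G_dec[of k] by (auto simp: B_def)
  moreover have "(\<Sum>j<k. sw n j w) <= real n" using ww sw_nonneg[of n k w] by (simp add: B_def)
  ultimately show "w : B n k" using ww by (simp add: B_def)
 qed
 have dec': "j <= k ==> B n k \<subseteq> B n j" for n j k using lift_Suc_antimono_le[of "B n", OF dec] .
 have BM[measurable]: "B n k : sets M" for n k by (rule sets_F_M[OF BF])
 define bad where "bad n = E - B n n" for n
 have [measurable]: "bad n : sets M" for n unfolding bad_def by measurable
 define Z where "Z n w = ind (bad n) w * ((1 / real n) * (\<Sum>k<n. pp n k w * Dk n k w))" for n w
 define d where "d n k w = ind (B n k) w * pp n k w * Dk n k w" for n k w
 define Z' where "Z' n w = (1 / real n) * (\<Sum>k<n. d n k w)" for n w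
 have [measurable]: "d n k : meas M" for n k unfolding d_def by measurable
 show "\<exists>Z Z'. (\<forall>n. Z n : meas M) \<and> (\<forall>n. Z' n : meas M) \<and>
   null_in_prob Z \<and> (EV n. prob {w : space M. eps < \<bar>Z' n w\<bar>} <= eps) \<and>
   (EV n. AE w in M. \<bar>(1 / real n) * (\<Sum>k<n. pp n k w * Dk n k w) * ind E w\<bar> <= \<bar>Z n w\<bar> + \<bar>Z' n w\<bar>)"
 proof (rule exI[of _ Z], rule exI[of _ Z'], intro conjI allI)
  show Zm: "Z n : meas M" "Z' n : meas M" for n unfolding Z_def Z'_def by measurable
  show "null_in_prob Z"
  proof (rule null_in_prob_of_prob[OF Zm(1)])
   let ?A1 = "%n. {w : space M. \<upsilon> / C2 < \<bar>real n powr (- (1/2)) * maxV n w powr \<gamma>\<bar>}"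
   let ?A2 = "%n. {w : space M. 1/2 < \<bar>real n powr (- 1) * (\<Sum>k<n. sw n k w) * ind E w\<bar>}"
   have t1: "(%n. prob (?A1 n)) ----> 0"
    using exponents \<upsilon> C2 by (intro prob_gt_tendsto_0 maxV_powr_null) auto
   have t2: "(%n. prob (?A2 n)) ----> 0"
    by (intro prob_gt_tendsto_0 switch_square_null) auto
   show "(%n. prob {w : space M. Z n w \<noteq> 0}) ----> 0"
   proof (rule Lim_null_comparison)
    show "(%n. prob (?A1 n) + prob (?A2 n)) ----> 0" using tendsto_add[OF t1 t2] by simp
    show "EV n. norm (prob {w : space M. Z n w \<noteq> 0}) <= prob (?A1 n) + prob (?A2 n)"
    proof (rule eventually_sequentiallyI[of 1])
     fix n :: nat assume n: "1 <= n"
     have "{w : space M. Z n w \<noteq> 0} \<subseteq> ?A1 n \<union> ?A2 n"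
     proof
      fix w assume "w : {w : space M. Z n w \<noteq> 0}"
      then have ww: "w : space M" "w : E" "w \<notin> B n n" by (auto simp: Z_def bad_def indicator_def split: if_splits)
      show "w : ?A1 n \<union> ?A2 n"
      proof (rule ccontr)
       assume nA: "w \<notin> ?A1 n \<union> ?A2 n"
       have "real n powr (- (1/2)) * maxV n w powr \<gamma> <= \<upsilon> / C2" using nA ww by auto
       then have mx: "C2 * maxV n w powr \<gamma> <= \<upsilon> * sqrt (real n)"
        using n C2 by (simp add: powr_minus powr_half_sqrt field_simps)
       have "\<bar>pp n j w\<bar> <= \<upsilon> * sqrt (real n)" if "j <= n" for j
        using pp_max[of w j n] E_G[of j] ww(2) that mx by (meson order_trans subsetD)
       moreover have "(\<Sum>k<n. sw n k w) <= real n"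
       proof -
        define s where "s = (\<Sum>k<n. sw n k w)"
        have "\<bar>real n powr (- 1) * s * ind E w\<bar> <= 1/2" using nA ww by (auto simp: s_def)
        moreover have "real n powr (- 1) * s * ind E w = s / real n" using ww(2) n by (simp add: powr_minus divide_inverse mult.commute)
        ultimately have "s / real n <= 1/2" by linarith
        then have "s <= real n" using n by (simp add: field_simps)
        then show ?thesis by (simp add: s_def)
       qed
       ultimately have "w : B n n" using E_G[of n] ww(2) by (auto simp: B_def)
       with ww show False by simp
      qed
     qed
     then have "prob {w : space M. Z n w \<noteq> 0} <= prob (?A1 n \<union> ?A2 n)" by (intro finite_measure_mono) auto
     also have "... <= prob (?A1 n) + prob (?A2 n)" by (rule measure_Un_le) auto
     finally show "norm (prob {w : space M. Z n w \<noteq> 0}) <= prob (?A1 n) + prob (?A2 n)" by simp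
    qed
   qed
  qed
  show "EV n. prob {w : space M. eps < \<bar>Z' n w\<bar>} <= eps"
  proof (rule eventually_sequentiallyI[of 1])
   fix n :: nat assume n: "1 <= n"
   have pb: "\<bar>ind (B n k) w * pp n k w\<bar> <= \<upsilon> * sqrt (real n)" for k w
    using \<upsilon> by (auto simp: B_def indicator_def)
   have dF: "d n k : meas (F (Suc k))" for k
   proof -
    have [measurable]: "B n k : sets (F (Suc k))" by (rule sets_F_mono[OF _ BF]) simp
    have [measurable]: "pp n k : meas (F (Suc k))" by (rule F_mono[OF _ pp_F]) simp
    note [measurable] = Dk_F
    show ?thesis unfolding d_def by measurable
   qed
   have Di: "integrable M (Dk n k)" for k using Dk_centred[of k n] by (simp add: centred_def)
   have dC: "centred M (F k) (d n k)" for k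
    unfolding centred_def
   proof (intro conjI ballI)
    have int: "integrable M (%w. (ind A w * (ind (B n k) w * pp n k w)) * Dk n k w)" if [measurable]: "A : sets M" for A
    proof (rule Bochner_Integration.integrable_bound)
     show "integrable M (%w. (\<upsilon> * sqrt (real n)) * Dk n k w)" using Di by auto
     show "AE w in M. norm ((indicat_real A w * (indicat_real (B n k) w * pp n k w)) * Dk n k w) <= norm ((\<upsilon> * sqrt (real n)) * Dk n k w)"
     proof (rule AE_I2)
      fix w
      have "\<bar>indicat_real A w * (indicat_real (B n k) w * pp n k w)\<bar> <= \<bar>\<upsilon> * sqrt (real n)\<bar>"
       using pb[of k w] by (auto simp: indicator_def split: if_splits)
      then show "norm ((indicat_real A w * (indicat_real (B n k) w * pp n k w)) * Dk n k w) <= norm ((\<upsilon> * sqrt (real n)) * Dk n k w)"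
       unfolding real_norm_def abs_mult[of _ "Dk n k w"] by (rule mult_right_mono) simp
     qed
    qed measurable
    have "(%w. (ind (B n k) w * (ind (B n k) w * pp n k w)) * Dk n k w) = d n k"
     by (auto simp: d_def fun_eq_iff indicator_def)
    then show "integrable M (d n k)" using int[OF BM, of n k] by simp
    fix A assume A: "A : sets (F k)"
    have "(LINT w|M. (ind A w * (ind (B n k) w * pp n k w)) * Dk n k w) = 0"
    proof (rule centred_mult[OF subF Dk_centred _ int[OF sets_F_M[OF A]]])
     show "(%w. indicat_real A w * (indicat_real (B n k) w * pp n k w)) : meas (F k)"
      using A BF[of n k] pp_F[of n k] by measurable
    qed
    then show "(LINT w|M. indicat_real A w * d n k w) = 0" by (simp add: d_def mult.assoc)
   qed
   let ?I = "%k. \<integral>w. ind (B n k) w * (Dk n k w)^2 \<partial>M"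
   have Ii: "integrable M (%w. ind (B n k) w * (Dk n k w)^2)" for k
    by (rule Bochner_Integration.integrable_bound[OF Dk_square_integrable[of n k]]) (auto simp: indicator_def)
   have "(NNI w|M. ennreal ((\<Sum>k<n. d n k w)^2)) <= ennreal (\<Sum>k<n. \<upsilon>\<^sup>2 * real n * ?I k)"
   proof (rule centred_sum_second_moment[where F=F, OF subF monoF dF dC])
    fix k
    have "(NNI w|M. ennreal ((d n k w)^2)) <= (NNI w|M. ennreal (\<upsilon>\<^sup>2 * real n * (ind (B n k) w * (Dk n k w)^2)))"
    proof (intro nn_integral_mono ennreal_leI)
     fix w
     have "\<bar>ind (B n k) w * pp n k w\<bar>\<^sup>2 <= (\<upsilon> * sqrt (real n))^2" by (rule power_mono[OF pb]) simp
     then have p2: "(ind (B n k) w * pp n k w)^2 <= \<upsilon>\<^sup>2 * real n" by (simp add: power_mult_distrib)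
     have "(d n k w)^2 = (ind (B n k) w * pp n k w)^2 * (ind (B n k) w * (Dk n k w)^2)"
      by (auto simp: d_def indicator_def power_mult_distrib)
     also have "... <= (\<upsilon>\<^sup>2 * real n) * (ind (B n k) w * (Dk n k w)^2)" by (rule mult_right_mono[OF p2]) simp
     finally show "(d n k w)^2 <= \<upsilon>\<^sup>2 * real n * (ind (B n k) w * (Dk n k w)^2)" .
    qed
    also have "... = ennreal (LINT w|M. \<upsilon>\<^sup>2 * real n * (ind (B n k) w * (Dk n k w)^2))"
     using Ii by (intro nn_integral_eq_integral integrable_mult_right) auto
    also have "(LINT w|M. \<upsilon>\<^sup>2 * real n * (ind (B n k) w * (Dk n k w)^2)) = \<upsilon>\<^sup>2 * real n * ?I k"
     by (rule integral_mult_right_zero)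
    finally show "(NNI w|M. ennreal ((d n k w)^2)) <= ennreal (\<upsilon>\<^sup>2 * real n * ?I k)" .
   qed simp
   also have "... <= ennreal (\<upsilon>\<^sup>2 * real n * (CE * real n))"
   proof (rule ennreal_leI)
    have "(\<Sum>k<n. ?I k) <= CE * real n"
     by (rule stopped_energy[OF BF BG dec _ _ n]) (auto simp: B_def)
    then show "(\<Sum>k<n. \<upsilon>\<^sup>2 * real n * ?I k) <= \<upsilon>\<^sup>2 * real n * (CE * real n)"
     unfolding sum_distrib_left[symmetric] by (rule mult_left_mono) simp
   qed
   finally have sm: "(NNI w|M. ennreal ((\<Sum>k<n. d n k w)^2)) <= ennreal (\<upsilon>\<^sup>2 * real n * (CE * real n))" .
   have "(NNI w|M. ennreal \<bar>(Z' n w)^2\<bar>) = (NNI w|M. ennreal ((1 / real n)^2) * ennreal ((\<Sum>k<n. d n k w)^2))"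
    by (intro nn_integral_cong) (simp add: Z'_def ennreal_mult[symmetric] power_divide)
   also have "... = ennreal ((1 / real n)^2) * (NNI w|M. ennreal ((\<Sum>k<n. d n k w)^2))" by (rule nn_integral_cmult) measurable
   also have "... <= ennreal ((1 / real n)^2) * ennreal (\<upsilon>\<^sup>2 * real n * (CE * real n))" by (rule mult_left_mono[OF sm]) simp
   also have "... = ennreal (eps^3)"
   proof -
    have "(1 / real n)^2 * (\<upsilon>\<^sup>2 * real n * (CE * real n)) = \<upsilon>\<^sup>2 * CE" using n by (simp add: power2_eq_square)
    then show ?thesis using \<upsilon> CE_pos by (subst ennreal_mult[symmetric]) auto
   qed
   finally have "prob {w : space M. eps\<^sup>2 < \<bar>(Z' n w)^2\<bar>} <= eps^3 / eps\<^sup>2"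
    using e Zm(2)[of n] by (intro prob_le_of_nn_integral) auto
   also have "eps^3 / eps\<^sup>2 = eps" using e by (simp add: power3_eq_cube power2_eq_square)
   also have "{w : space M. eps\<^sup>2 < \<bar>(Z' n w)^2\<bar>} = {w : space M. eps < \<bar>Z' n w\<bar>}"
   proof -
    have "eps\<^sup>2 < \<bar>y\<^sup>2\<bar> \<longleftrightarrow> eps < \<bar>y\<bar>" for y :: real
    proof -
     have "\<bar>y\<bar>\<^sup>2 <= eps\<^sup>2 \<longleftrightarrow> \<bar>y\<bar> <= eps" using e by (intro power_mono_iff) auto
     then show ?thesis by auto
    qed
    then show ?thesis by blast
   qed
   finally show "prob {w : space M. eps < \<bar>Z' n w\<bar>} <= eps" .
  qed
  show "EV n. AE w in M. \<bar>(1 / real n) * (\<Sum>k<n. pp n k w * Dk n k w) * ind E w\<bar> <= \<bar>Z n w\<bar> + \<bar>Z' n w\<bar>"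
  proof (rule always_eventually, rule allI, rule AE_I2)
   fix n w assume ww: "w : space M"
   show "\<bar>(1 / real n) * (\<Sum>k<n. pp n k w * Dk n k w) * ind E w\<bar> <= \<bar>Z n w\<bar> + \<bar>Z' n w\<bar>"
   proof (cases "w : E \<and> w : B n n")
    case True
    have "(\<Sum>k<n. d n k w) = (\<Sum>k<n. pp n k w * Dk n k w)"
    proof (rule sum.cong[OF refl])
     fix k assume "k : {..<n}"
     then have "w : B n k" using dec'[of k n n] True by auto
     then show "d n k w = pp n k w * Dk n k w" by (simp add: d_def)
    qed
    then show ?thesis using True by (simp add: Z'_def)
   next
    case False
    then show ?thesis by (cases "w : E") (auto simp: Z_def bad_def)
   qed
  qed
 qed
qed


subsection \<open>The limiting variance\<close>

text \<open>
 By the Poisson equation, \<open>hh a\<close> is the difference of \<open>(g / (1 - a))\<^sup>2\<close> and \<open>(P g)\<^sup>2\<close>. Its averages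
 are therefore those of the conditional variances of \<open>Dk\<close>, up to small and telescoping terms.
\<close>

definition hh :: "real => 'a => 'p => real" where "hh a x \<theta> = 2 * f x * res a x \<theta> / (1 - a) - (f x)\<^sup>2"
definition sig :: "'p => real" where "sig \<theta> = (LINT x|\<pi>. hh 0 x \<theta>)"

lemma hh_joint: "(%z. hh a (fst z) (snd z)) : meas (SP S \<Theta>)"
 unfolding hh_def using res_joint by measurable

lemma sig_measurable[measurable]: "sig : meas (param_space \<Theta>)"
 unfolding sig_def by (rule pi_integral_measurable[OF hh_joint])

lemma hh_bound:
 assumes "\<theta> : K" "x : space S" "0 <= a" "a <= 1 / 2"
 shows "\<bar>hh a x \<theta>\<bar> <= (4 * Bf * C1 + Bf^2) * V x powr (\<beta> + \<gamma>)"
proof -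
 let ?v = "V x powr (\<beta> + \<gamma>)"
 have v: "V x powr \<beta> * V x powr \<gamma> = ?v" by (simp add: powr_add)
 have f1: "\<bar>f x\<bar> <= Bf * V x powr \<beta>" by (rule f_bound[OF assms(2)])
 have "\<bar>f x\<bar> * \<bar>res a x \<theta>\<bar> <= (Bf * V x powr \<beta>) * (C1 * V x powr \<gamma>)"
  using f1 res_bound[of \<theta> x a] assms Bf C1 by (intro mult_mono) auto
 also have "... = Bf * C1 * ?v" unfolding v[symmetric] by (simp only: mult_ac)
 finally have fr: "\<bar>f x\<bar> * \<bar>res a x \<theta>\<bar> <= Bf * C1 * ?v" .
 have "\<bar>2 * f x * res a x \<theta> / (1 - a)\<bar> = 2 * (\<bar>f x\<bar> * \<bar>res a x \<theta>\<bar>) / (1 - a)" using assms by (simp add: abs_mult)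
 also have "... <= 2 * (Bf * C1 * ?v) / (1 / 2)" using assms fr Bf C1 by (intro frac_le) auto
 finally have 1: "\<bar>2 * f x * res a x \<theta> / (1 - a)\<bar> <= 4 * Bf * C1 * ?v" by simp
 have "\<bar>f x\<bar> * \<bar>f x\<bar> <= (Bf * V x powr \<beta>) * (Bf * V x powr \<gamma>)"
 proof (rule mult_mono[OF f1])
  show "\<bar>f x\<bar> <= Bf * V x powr \<gamma>"
   using f1 V_powr_mono[OF assms(2) exponents(7)] Bf by (meson mult_left_mono order_trans less_imp_le)
 qed (use Bf in auto)
 also have "... = Bf^2 * ?v" unfolding v[symmetric] power2_eq_square by (simp only: mult_ac)
 finally have 2: "(f x)^2 <= Bf\<^sup>2 * ?v" by (simp add: power2_eq_square)
 have "\<bar>hh a x \<theta>\<bar> <= \<bar>2 * f x * res a x \<theta> / (1 - a)\<bar> + (f x)^2"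
  unfolding hh_def by (rule order_trans[OF abs_triangle_ineq4]) simp
 then have "\<bar>hh a x \<theta>\<bar> <= 4 * Bf * C1 * ?v + Bf^2 * ?v" using 1 2 by linarith
 then show ?thesis by (simp only: distrib_right)
qed

definition \<eta>1 :: real where "\<eta>1 = min 1 ((\<kappa> - 1) / 2)"
lemma \<eta>1: "0 < \<eta>1" "\<eta>1 <= 1" "1 < \<kappa> - \<eta>1"
proof -
 have "\<eta>1 <= (\<kappa> - 1) / 2" unfolding \<eta>1_def by (rule min.cobounded2)
 then have "2 * \<eta>1 <= \<kappa> - 1" by simp
 then show "1 < \<kappa> - \<eta>1" using kd(1) by linarith
qed (use kd(1) in \<open>auto simp: \<eta>1_def\<close>)

lemma hh_near_zero:
 obtains c where "0 < c" "!!\<theta> x a. \<theta> : K ==> x : space S ==> 0 < a ==> a <= 1 / 2 ==>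
   \<bar>hh a x \<theta> - hh 0 x \<theta>\<bar> <= c * a powr \<eta>1 * V x powr (1 - \<alpha>)"
proof -
 have "\<exists>c>0. \<forall>\<theta>\<in>K. \<forall>u B a. dominated \<beta> B u --> (LINT y|\<pi>. u y) = 0 --> 0 < a --> a < 1 -->
  (\<forall>x\<in>space S. \<bar>resolvent S P u 0 x \<theta> - resolvent S P u a x \<theta>\<bar> <= c * a powr \<eta>1 * B * V x powr (\<beta> + \<alpha> * \<kappa>))"
  by (rule resolvent_near_zero[OF K beta exponents(9) \<eta>1(3) _ \<eta>1(2)]) (use \<eta>1 in simp)
 then obtain c where c: "0 < c" "\<forall>\<theta>\<in>K. \<forall>u B a. dominated \<beta> B u --> (LINT y|\<pi>. u y) = 0 --> 0 < a --> a < 1 -->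
  (\<forall>x\<in>space S. \<bar>resolvent S P u 0 x \<theta> - resolvent S P u a x \<theta>\<bar> <= c * a powr \<eta>1 * B * V x powr (\<beta> + \<alpha> * \<kappa>))"
  by (elim exE conjE)
 have "\<bar>hh a x \<theta> - hh 0 x \<theta>\<bar> <= (2 * Bf * (2 * C1 + c * Bf)) * a powr \<eta>1 * V x powr (1 - \<alpha>)"
  if h: "\<theta> : K" "x : space S" "0 < a" "a <= 1 / 2" for \<theta> x a
 proof -
  let ?w = "a powr \<eta>1 * V x powr \<gamma>"
  have a1: "a < 1" using h by simp
  have d: "\<bar>res a x \<theta> - res 0 x \<theta>\<bar> <= c * Bf * ?w"
   using c(2)[rule_format, OF h(1) f f_pi h(3) a1 h(2)] by (simp add: res_def \<gamma>_def abs_minus_commute mult_ac)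
  have r: "\<bar>res a x \<theta>\<bar> <= C1 * V x powr \<gamma>" by (rule res_bound) (use h in auto)
  have aa: "a <= a powr \<eta>1" using powr_mono'[of \<eta>1 1 a] \<eta>1 h by simp
  have e: "res a x \<theta> / (1 - a) - res 0 x \<theta> = (a / (1 - a)) * res a x \<theta> + (res a x \<theta> - res 0 x \<theta>)"
   using a1 by (simp add: field_simps)
  have "a / (1 - a) <= a / (1 / 2)" using h by (intro divide_left_mono) auto
  then have "\<bar>a / (1 - a)\<bar> <= 2 * a powr \<eta>1" using aa h by simp
  then have "\<bar>(a / (1 - a)) * res a x \<theta>\<bar> <= (2 * a powr \<eta>1) * (C1 * V x powr \<gamma>)"
   unfolding abs_mult using r by (intro mult_mono) auto
  then have "\<bar>(a / (1 - a)) * res a x \<theta>\<bar> <= 2 * C1 * ?w" by (simp add: mult_ac)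
  then have "\<bar>res a x \<theta> / (1 - a) - res 0 x \<theta>\<bar> <= 2 * C1 * ?w + c * Bf * ?w"
   unfolding e using d by linarith
  then have m: "\<bar>res a x \<theta> / (1 - a) - res 0 x \<theta>\<bar> <= (2 * C1 + c * Bf) * ?w" by (simp only: distrib_right)
  have "\<bar>hh a x \<theta> - hh 0 x \<theta>\<bar> = 2 * \<bar>f x\<bar> * \<bar>res a x \<theta> / (1 - a) - res 0 x \<theta>\<bar>"
  proof -
   have "hh a x \<theta> - hh 0 x \<theta> = 2 * f x * (res a x \<theta> / (1 - a) - res 0 x \<theta>)"
    by (simp add: hh_def right_diff_distrib)
   then show ?thesis by (simp add: abs_mult)
  qed
  also have "... <= 2 * (Bf * V x powr \<beta>) * ((2 * C1 + c * Bf) * ?w)"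
   using f_bound[OF h(2)] m Bf by (intro mult_mono) auto
  also have "... = (2 * Bf * (2 * C1 + c * Bf)) * a powr \<eta>1 * (V x powr \<beta> * V x powr \<gamma>)" by (simp only: mult_ac)
  also have "... <= (2 * Bf * (2 * C1 + c * Bf)) * a powr \<eta>1 * V x powr (1 - \<alpha>)"
   unfolding powr_add[symmetric] using exponents Bf C1 c(1) by (intro mult_left_mono V_powr_mono h(2)) auto
  finally show ?thesis .
 qed
 moreover have "0 < 2 * Bf * (2 * C1 + c * Bf)" using Bf C1 c(1) by (intro mult_pos_pos add_pos_pos) auto
 ultimately show ?thesis using that by blast
qed

lemma an_null: "0 < c ==> (%n. an n powr c) ----> 0"
 using powr_ratio_null[of "- (\<rho> * c)"] rho by (simp add: an_def powr_powr)

lemma an_antimono: "m <= n ==> an n <= an m"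
 unfolding an_def using rho by (intro powr_mono2') auto

text \<open>
 Neither is \<open>hh\<close> bounded nor is its parameter fixed. It is replaced by its value for a fixed
 \<open>a = an m\<close>, restricted to \<open>V \<le> l\<close>, for which the law of large numbers holds. For \<open>m\<close> large the
 error is a small multiple of \<open>V\<close> to the power \<open>1 - \<alpha>\<close>, uniformly in \<open>n \<ge> m\<close>, and so are its
 averages and its \<open>\<pi>\<close>-mean.
\<close>

lemma hh_average_null:
 "null_in_prob (%n w. ((1 / real n) * (\<Sum>k<n. hh (an n) (X k w) (th k w)) - sig (ths w)) * ind E w)"
proof (rule null_in_prob_split)
 fix eps :: real assume e: "0 < eps"
 obtain c where c: "0 < c" "!!\<theta> x a. \<theta> : K ==> x : space S ==> 0 < a ==> a <= 1 / 2 ==>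
   \<bar>hh a x \<theta> - hh 0 x \<theta>\<bar> <= c * a powr \<eta>1 * V x powr (1 - \<alpha>)" by (rule hh_near_zero) blast
 obtain c' where c': "0 < c'" "!!\<theta> \<theta>' x a. \<theta> : K ==> \<theta>' : K ==> x : space S ==> 0 < a ==> a < 1 ==>
   ennreal \<bar>res a x \<theta> - res a x \<theta>'\<bar> <= ennreal (c' * a powr (- \<eta>0)) * kernel_D S P V \<gamma> \<theta> \<theta>' * ennreal (V x powr (\<beta> + \<alpha> * (\<kappa> + \<delta>)))"
  by (rule res_change_simple) blast
 define C where "C = 4 * Bf * C1 + Bf^2"
 have C: "0 < C" using Bf C1 by (auto simp: C_def intro!: add_pos_pos)
 define s where "s = 1 - \<alpha> - (\<beta> + \<gamma>)"
 have s: "0 < s" using exponents by (simp add: s_def)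
 define m\<pi> where "m\<pi> = enn2real (NNI y|\<pi>. ennreal (V y powr (1 - \<alpha>)))"
 have m0: "0 <= m\<pi>" by (simp add: m\<pi>_def)
 define q where "q = eps\<^sup>2 / (CV + m\<pi>)"
 have q: "0 < q" using e CV_pos m0 by (simp add: q_def add_pos_nonneg)
 \<comment> \<open>a bound for the error of the replacement: the change of the parameter from an n to an m, and the truncation\<close>
 define er where "er m = 2 * c * an m powr \<eta>1 + C * real (m + 4) powr (- s)" for m
 have "er ----> 2 * c * 0 + C * 0"
  unfolding er_def by (intro tendsto_intros an_null powr_ratio_null) (use \<eta>1 s in auto)
 then have "EV m. er m < q" using q by (intro order_tendstoD) auto
 then obtain m where m: "er m <= q" by (auto simp: eventually_sequentially intro: less_imp_le)
 define a where "a = an m"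
 define l where "l = real (m + 4)"
 have a: "0 < a" "a <= 1 / 2" "a < 1" using an[of m] by (auto simp: a_def)
 have l: "1 <= l" by (simp add: l_def)
 define h where "h x \<theta> = ind {x : space S. V x <= l} x * hh a x \<theta>" for x \<theta>
 have hj: "(%z. h (fst z) (snd z)) : meas (SP S \<Theta>)"
  unfolding h_def using hh_joint by measurable
 have Vl: "V x powr r <= l" if "x : space S" "V x <= l" "r <= 1" for x r
  using V_powr_mono[OF that(1,3)] V_ge_1[OF that(1)] that(2) by simp
 have hb: "\<bar>h x \<theta>\<bar> <= C * l" if "x : space S" "\<theta> : K" for x \<theta>
 proof (cases "V x <= l")
  case True
  have "\<bar>hh a x \<theta>\<bar> <= C * V x powr (\<beta> + \<gamma>)" unfolding C_def by (rule hh_bound) (use that a in auto)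
  also have "... <= C * l" using C exponents alpha by (intro mult_left_mono Vl that True) auto
  finally show ?thesis using True that by (simp add: h_def)
 qed (use C l in \<open>simp add: h_def\<close>)
 define Hc where "Hc = (4 * Bf * l) * (c' * a powr (- \<eta>0)) * l"
 have Hc: "0 < Hc" using Bf l c'(1) a by (simp add: Hc_def)
 have cont: "ennreal \<bar>h x \<theta> - h x \<theta>'\<bar> <= ennreal Hc * kernel_D S P V \<gamma> \<theta> \<theta>'" if t: "x : space S" "\<theta> : K" "\<theta>' : K" for x \<theta> \<theta>'
 proof (cases "V x <= l")
  case True
  let ?d = "\<bar>res a x \<theta> - res a x \<theta>'\<bar>"
  have "\<bar>h x \<theta> - h x \<theta>'\<bar> = 2 * \<bar>f x\<bar> * ?d / (1 - a)"
  proof -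
   have "h x \<theta> - h x \<theta>' = 2 * f x * (res a x \<theta> - res a x \<theta>') / (1 - a)"
    using True t by (simp add: h_def hh_def diff_divide_distrib right_diff_distrib)
   then show ?thesis using a by (simp add: abs_mult)
  qed
  also have "... <= (2 * (Bf * l) * ?d) / (1 / 2)"
  proof (intro frac_le mult_right_mono mult_left_mono)
   have "\<bar>f x\<bar> <= Bf * V x powr \<beta>" by (rule f_bound[OF t(1)])
   also have "... <= Bf * l" using Bf exponents alpha by (intro mult_left_mono Vl t True) auto
   finally show "\<bar>f x\<bar> <= Bf * l" .
  qed (use a Bf l in auto)
  finally have "\<bar>h x \<theta> - h x \<theta>'\<bar> <= (4 * Bf * l) * ?d" by simp
  then have "ennreal \<bar>h x \<theta> - h x \<theta>'\<bar> <= ennreal (4 * Bf * l) * ennreal ?d"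
   using Bf l by (subst ennreal_mult[symmetric]) (auto intro: ennreal_leI)
  also have "... <= ennreal (4 * Bf * l) * (ennreal (c' * a powr (- \<eta>0)) * kernel_D S P V \<gamma> \<theta> \<theta>' * ennreal l)"
  proof (intro mult_left_mono order_trans[OF c'(2)[OF t(2,3,1) a(1,3)]] ennreal_leI)
   show "V x powr (\<beta> + \<alpha> * (\<kappa> + \<delta>)) <= l" using kd beta alpha by (intro Vl t True) auto
  qed auto
  also have "... = (ennreal (4 * Bf * l) * ennreal (c' * a powr (- \<eta>0)) * ennreal l) * kernel_D S P V \<gamma> \<theta> \<theta>'"
   by (simp only: mult_ac)
  also have "ennreal (4 * Bf * l) * ennreal (c' * a powr (- \<eta>0)) * ennreal l = ennreal Hc"
   using Bf l c'(1) by (simp add: Hc_def ennreal_mult[symmetric])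
  finally show ?thesis .
 qed (use t in \<open>simp add: h_def\<close>)
 have hp: "(%\<theta>. LINT y|\<pi>. h y \<theta>) : meas (param_space \<Theta>)" by (rule pi_integral_measurable[OF hj])
 define Z where "Z n w = ((1 / real n) * (\<Sum>k<n. h (X k w) (th k w)) - (LINT y|\<pi>. h y (ths w))) * ind E w" for n w
 define Z' where "Z' n w = q * (avgV n w + m\<pi>)" for n w
 have hX[measurable]: "(%w. h (X k w) (th k w)) : meas M" for k
  using measurable_compose[OF measurable_Pair[OF X_M th_M] hj] by simp
 have Zm[measurable]: "Z n : meas M" for n
 proof -
  have [measurable]: "(%w. LINT y|\<pi>. h y (ths w)) : meas M" by (rule measurable_compose[OF ths hp])
  show ?thesis unfolding Z_def by measurable
 qed
 have Z'm[measurable]: "Z' n : meas M" for n unfolding Z'_def by measurable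
 have Zn: "null_in_prob Z"
  unfolding Z_def by (rule lln_bounded[OF hj _ hb exponents(12) Hc cont]) (use C l in auto)
 have trunc: "\<bar>h x \<theta> - hh a x \<theta>\<bar> <= C * l powr (- s) * V x powr (1 - \<alpha>)" if t: "x : space S" "\<theta> : K" for x \<theta>
 proof (cases "V x <= l")
  case False
  have "V x powr (- s) <= l powr (- s)" using False l s by (intro powr_mono2') auto
  have "\<bar>hh a x \<theta>\<bar> <= C * V x powr (\<beta> + \<gamma>)" unfolding C_def by (rule hh_bound) (use t a in auto)
  also have "V x powr (\<beta> + \<gamma>) = V x powr (- s) * V x powr (1 - \<alpha>)" by (simp add: s_def powr_add[symmetric])
  also have "C * (V x powr (- s) * V x powr (1 - \<alpha>)) <= C * (l powr (- s) * V x powr (1 - \<alpha>))"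
   using C \<open>V x powr (- s) <= l powr (- s)\<close> by (intro mult_left_mono mult_right_mono) auto
  finally show ?thesis using False by (simp add: h_def mult.assoc)
 qed (use t C in \<open>simp add: h_def\<close>)
 have erq: "c * a powr \<eta>1 + (c * a powr \<eta>1 + C * l powr (- s)) <= q"
  using m by (simp add: er_def a_def l_def)
 have ca: "0 <= c * a powr \<eta>1" using c by simp
 show "\<exists>Z Z'. (\<forall>n. Z n : meas M) \<and> (\<forall>n. Z' n : meas M) \<and>
   null_in_prob Z \<and> (EV n. prob {w : space M. eps < \<bar>Z' n w\<bar>} <= eps) \<and>
   (EV n. AE w in M. \<bar>((1 / real n) * (\<Sum>k<n. hh (an n) (X k w) (th k w)) - sig (ths w)) * ind E w\<bar> <= \<bar>Z n w\<bar> + \<bar>Z' n w\<bar>)"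
 proof (rule exI[of _ Z], rule exI[of _ Z'], intro conjI allI Zm Z'm Zn)
  show "EV n. prob {w : space M. eps < \<bar>Z' n w\<bar>} <= eps"
  proof (rule always_eventually, rule allI)
   fix n
   have "(NNI w|M. ennreal \<bar>Z' n w\<bar>) = (NNI w|M. ennreal q * (ennreal (avgV n w) + ennreal m\<pi>))"
    using q m0 avgV_nonneg by (intro nn_integral_cong) (simp add: Z'_def ennreal_mult[symmetric] ennreal_plus[symmetric] del: ennreal_plus)
   also have "... = ennreal q * ((NNI w|M. ennreal (avgV n w)) + ennreal m\<pi>)"
    by (subst nn_integral_cmult, measurable, subst nn_integral_add) (auto simp: emeasure_space_1)
   also have "... <= ennreal q * (ennreal CV + ennreal m\<pi>)"
    by (intro mult_left_mono add_right_mono avgV_moment) simp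
   also have "... = ennreal (q * (CV + m\<pi>))"
    using q CV_pos m0 by (simp add: ennreal_mult[symmetric] ennreal_plus[symmetric] del: ennreal_plus)
   also have "q * (CV + m\<pi>) = eps\<^sup>2" using CV_pos m0 by (simp add: q_def)
   finally have "prob {w : space M. eps < \<bar>Z' n w\<bar>} <= eps\<^sup>2 / eps"
    by (intro prob_le_of_nn_integral e) auto
   then show "prob {w : space M. eps < \<bar>Z' n w\<bar>} <= eps" using e by (simp add: power2_eq_square)
  qed
  show "EV n. AE w in M. \<bar>((1 / real n) * (\<Sum>k<n. hh (an n) (X k w) (th k w)) - sig (ths w)) * ind E w\<bar> <= \<bar>Z n w\<bar> + \<bar>Z' n w\<bar>"
  proof (rule eventually_sequentiallyI[of m], rule AE_I2)
   fix n w assume n: "m <= n" and ww: "w : space M"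
   show "\<bar>((1 / real n) * (\<Sum>k<n. hh (an n) (X k w) (th k w)) - sig (ths w)) * ind E w\<bar> <= \<bar>Z n w\<bar> + \<bar>Z' n w\<bar>"
   proof (cases "w : E")
    case True
    have aq: "c * an n powr \<eta>1 <= c * a powr \<eta>1"
     using c(1) an_antimono[OF n] an(1)[of n] \<eta>1 unfolding a_def by (intro mult_left_mono powr_mono2) auto
    have pt: "\<bar>hh (an n) (X k w) (th k w) - h (X k w) (th k w)\<bar> <= q * (ind (G k) w * V (X k w) powr (1 - \<alpha>))" for k
    proof -
     let ?v = "V (X k w) powr (1 - \<alpha>)"
     note x = X_space[OF ww, of k] and t = E_K[OF True, of k]
     have "\<bar>hh (an n) (X k w) (th k w) - hh 0 (X k w) (th k w)\<bar> <= (c * an n powr \<eta>1) * ?v"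
      by (rule c(2)[OF t x an])
     also have "... <= (c * a powr \<eta>1) * ?v" by (rule mult_right_mono[OF aq]) simp
     finally have 1: "\<bar>hh (an n) (X k w) (th k w) - hh 0 (X k w) (th k w)\<bar> <= (c * a powr \<eta>1) * ?v" .
     note 2 = c(2)[OF t x a(1,2)] and 3 = trunc[OF x t]
     have "\<bar>hh (an n) (X k w) (th k w) - h (X k w) (th k w)\<bar> <= c * a powr \<eta>1 * ?v + (c * a powr \<eta>1 * ?v + C * l powr (- s) * ?v)"
      using 1 2 3 by linarith
     also have "... = (c * a powr \<eta>1 + (c * a powr \<eta>1 + C * l powr (- s))) * ?v" by (simp only: distrib_right)
     also have "... <= q * ?v" by (rule mult_right_mono[OF erq]) simp
     finally show ?thesis using True E_G[of k] by auto
    qed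
    have A: "\<bar>(1 / real n) * (\<Sum>k<n. hh (an n) (X k w) (th k w)) - (1 / real n) * (\<Sum>k<n. h (X k w) (th k w))\<bar> <= q * avgV n w"
    proof -
     have "\<bar>(\<Sum>k<n. hh (an n) (X k w) (th k w)) - (\<Sum>k<n. h (X k w) (th k w))\<bar> <= (\<Sum>k<n. q * (ind (G k) w * V (X k w) powr (1 - \<alpha>)))"
      unfolding sum_subtractf[symmetric] by (rule order_trans[OF sum_abs sum_mono[OF pt]])
     also have "... = q * (\<Sum>k<n. ind (G k) w * V (X k w) powr (1 - \<alpha>))" by (rule sum_distrib_left[symmetric])
     finally have "(1 / real n) * \<bar>(\<Sum>k<n. hh (an n) (X k w) (th k w)) - (\<Sum>k<n. h (X k w) (th k w))\<bar>
       <= (1 / real n) * (q * (\<Sum>k<n. ind (G k) w * V (X k w) powr (1 - \<alpha>)))" by (rule mult_left_mono) simp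
     moreover have "(1 / real n) * (q * (\<Sum>k<n. ind (G k) w * V (X k w) powr (1 - \<alpha>))) = q * avgV n w"
      unfolding avgV_def by (rule mult.left_commute)
     moreover have "\<bar>(1 / real n) * (\<Sum>k<n. hh (an n) (X k w) (th k w)) - (1 / real n) * (\<Sum>k<n. h (X k w) (th k w))\<bar>
       = (1 / real n) * \<bar>(\<Sum>k<n. hh (an n) (X k w) (th k w)) - (\<Sum>k<n. h (X k w) (th k w))\<bar>"
      unfolding right_diff_distrib[symmetric] abs_mult by simp
     ultimately show ?thesis by simp
    qed
    have B: "\<bar>(LINT y|\<pi>. h y (ths w)) - sig (ths w)\<bar> <= q * m\<pi>"
    proof -
     note t = E_ths[OF True]
     note tT = ths_space[OF ww]
     have pm: "(%y. (y, ths w)) : measurable S (SP S \<Theta>)" using tT by (intro measurable_Pair2') (simp add: space_param_space)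
     have d1: "dominated (1 - \<alpha>) (C * l) (%y. h y (ths w))"
      unfolding dominated_def
     proof (intro conjI ballI)
      show "(%y. h y (ths w)) : meas S" using measurable_compose[OF pm hj] by simp
      fix y assume y: "y : space S"
      have "\<bar>h y (ths w)\<bar> <= C * l * 1" using hb[OF y t] by simp
      also have "... <= C * l * V y powr (1 - \<alpha>)" using C l alpha by (intro mult_left_mono V_powr_ge_1 y) auto
      finally show "\<bar>h y (ths w)\<bar> <= C * l * V y powr (1 - \<alpha>)" .
     qed (use C l in auto)
     have d2: "dominated (1 - \<alpha>) C (%y. hh 0 y (ths w))"
      unfolding dominated_def
     proof (intro conjI ballI)
      show "(%y. hh 0 y (ths w)) : meas S" using measurable_compose[OF pm hh_joint] by simp
      fix y assume y: "y : space S"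
      have "\<bar>hh 0 y (ths w)\<bar> <= C * V y powr (\<beta> + \<gamma>)" unfolding C_def by (rule hh_bound[OF t y]) auto
      also have "... <= C * V y powr (1 - \<alpha>)" using C exponents by (intro mult_left_mono V_powr_mono y) auto
      finally show "\<bar>hh 0 y (ths w)\<bar> <= C * V y powr (1 - \<alpha>)" .
     qed (use C in auto)
     have a0: "0 <= 1 - \<alpha>" using alpha by simp
     note i1 = dominated_integrable_pi[OF d1 a0 order_refl] and i2 = dominated_integrable_pi[OF d2 a0 order_refl]
     have d3: "dominated (1 - \<alpha>) 1 (%y. V y powr (1 - \<alpha>))" by (auto simp: dominated_def)
     note i3 = dominated_integrable_pi[OF d3 a0 order_refl]
     have mp: "(LINT y|\<pi>. V y powr (1 - \<alpha>)) = m\<pi>"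
      unfolding m\<pi>_def using i3 by (subst nn_integral_eq_integral) auto
     have "\<bar>(LINT y|\<pi>. h y (ths w)) - sig (ths w)\<bar> = \<bar>\<integral>y. h y (ths w) - hh 0 y (ths w) \<partial>\<pi>\<bar>"
      unfolding sig_def by (simp only: Bochner_Integration.integral_diff[OF i1 i2])
     also have "... <= (LINT y|\<pi>. \<bar>h y (ths w) - hh 0 y (ths w)\<bar>)" by (rule integral_abs_bound)
     also have "... <= (LINT y|\<pi>. q * V y powr (1 - \<alpha>))"
     proof (rule integral_mono)
      show "integrable \<pi> (%y. \<bar>h y (ths w) - hh 0 y (ths w)\<bar>)" using i1 i2 by auto
      show "integrable \<pi> (%y. q * V y powr (1 - \<alpha>))" using i3 by auto
      fix y assume "y : space \<pi>"
      then have y: "y : space S" using sets_eq_imp_space_eq[OF sets_pi] by simp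
      let ?v = "V y powr (1 - \<alpha>)"
      have "0 <= c * a powr \<eta>1 * ?v" using ca by simp
      then have "\<bar>h y (ths w) - hh 0 y (ths w)\<bar> <= c * a powr \<eta>1 * ?v + (c * a powr \<eta>1 * ?v + C * l powr (- s) * ?v)"
       using c(2)[OF t y a(1,2)] trunc[OF y t] by linarith
      also have "... = (c * a powr \<eta>1 + (c * a powr \<eta>1 + C * l powr (- s))) * ?v" by (simp only: distrib_right)
      also have "... <= q * ?v" by (rule mult_right_mono[OF erq]) simp
      finally show "\<bar>h y (ths w) - hh 0 y (ths w)\<bar> <= q * ?v" .
     qed
     also have "... = q * m\<pi>" using mp by simp
     finally show ?thesis .
    qed
    have z: "Z n w = (1 / real n) * (\<Sum>k<n. h (X k w) (th k w)) - (LINT y|\<pi>. h y (ths w))" using True by (simp add: Z_def)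
    have z': "\<bar>Z' n w\<bar> = q * avgV n w + q * m\<pi>" using q m0 avgV_nonneg[of n w] by (simp add: Z'_def abs_mult distrib_left)
    have "\<bar>(1 / real n) * (\<Sum>k<n. hh (an n) (X k w) (th k w)) - sig (ths w)\<bar> <= \<bar>Z n w\<bar> + \<bar>Z' n w\<bar>"
     unfolding z z' using A B by linarith
    then show ?thesis using True by simp
   qed simp
  qed
 qed
qed


lemma null_in_prob_avgV:
 assumes "!!n. 0 <= c n" "c ----> 0"
 shows "null_in_prob (%n w. c n * avgV n w)"
proof (rule null_in_prob_L1)
 fix n
 have "(NNI w|M. ennreal \<bar>c n * avgV n w\<bar>) = (NNI w|M. ennreal (c n) * ennreal (avgV n w))"
  using assms(1) avgV_nonneg by (intro nn_integral_cong) (simp add: ennreal_mult[symmetric])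
 also have "... = ennreal (c n) * (NNI w|M. ennreal (avgV n w))" by (rule nn_integral_cmult) measurable
 also have "... <= ennreal (c n) * ennreal CV" by (rule mult_left_mono[OF avgV_moment]) simp
 also have "... = ennreal (c n * CV)" using assms(1) CV_pos by (simp add: ennreal_mult[symmetric])
 finally show "(NNI w|M. ennreal \<bar>c n * avgV n w\<bar>) <= ennreal (c n * CV)" .
 show "(%n. c n * CV) ----> 0" by (rule tendsto_mult_left_zero[OF assms(2)])
qed measurable

lemma sum_shift: "(\<Sum>k<n. u (Suc k)) = (\<Sum>k<n. u k) - u 0 + (u n :: real)"
 by (induction n) auto

text \<open>
 The product of the uniform and of the tempered bound, with exponents of \<open>V\<close> adding up to
 \<open>p < 1 - \<alpha>\<close>; the uniform bound alone would give \<open>2 * \<gamma>\<close>, which may be larger.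
\<close>

lemma gg_square_tempered:
 obtains c where "0 < c" "!!w n k. w : G k ==> (gg n k w)^2 <= c * an n powr (- \<eta>0) * V (X k w) powr (1 - \<alpha>)"
proof -
 have pre: "0 <= \<eta>0" "\<eta>0 <= 1" "0 <= \<delta>" "1 < \<delta> + \<eta>0" "\<beta> + \<alpha> * \<delta> + \<alpha> <= 1"
 proof -
  have "0 <= \<alpha> * \<kappa>" using alpha kd by simp
  moreover have "\<alpha> * (\<kappa> + \<delta>) = \<alpha> * \<kappa> + \<alpha> * \<delta>" by (rule distrib_left)
  ultimately show "\<beta> + \<alpha> * \<delta> + \<alpha> <= 1" using kd(6) beta by linarith
 qed (use \<eta>0 kd in auto)
 obtain c' where c': "0 < c'" "!!\<theta> x a. \<theta> : K ==> x : space S ==> 0 < a ==> a < 1 ==> \<bar>res a x \<theta>\<bar> <= c' * a powr (- \<eta>0) * V x powr (\<beta> + \<alpha> * \<delta>)"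
  using res_bound_tempered_ex[OF pre] by blast
 have "(gg n k w)^2 <= (c' * C1) * an n powr (- \<eta>0) * V (X k w) powr (1 - \<alpha>)" if ww: "w : G k" for w n k
 proof -
  let ?x = "X k w"
  have x: "?x : space S" by (rule X_space[OF G_space[OF ww]])
  have "\<bar>gg n k w\<bar> * \<bar>gg n k w\<bar> <= (c' * an n powr (- \<eta>0) * V ?x powr (\<beta> + \<alpha> * \<delta>)) * (C1 * V ?x powr \<gamma>)"
   using c'(2)[OF G_K[OF ww] x an(1) an1] gg_bound[OF ww, of n] c'(1) by (intro mult_mono) (auto simp: gg_def)
  also have "... = (c' * C1) * an n powr (- \<eta>0) * (V ?x powr (\<beta> + \<alpha> * \<delta>) * V ?x powr \<gamma>)" by (simp only: mult_ac)
  also have "V ?x powr (\<beta> + \<alpha> * \<delta>) * V ?x powr \<gamma> = V ?x powr p"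
  proof -
   have "\<beta> + \<alpha> * \<delta> + \<gamma> = p" by (simp add: p_def \<gamma>_def algebra_simps)
   then show ?thesis by (simp only: powr_add[symmetric])
  qed
  also have "(c' * C1) * an n powr (- \<eta>0) * V ?x powr p <= (c' * C1) * an n powr (- \<eta>0) * V ?x powr (1 - \<alpha>)"
   using c'(1) C1 exponents by (intro mult_left_mono V_powr_mono x) auto
  finally show ?thesis by (simp add: power2_eq_square abs_mult[symmetric])
 qed
 moreover have "0 < c' * C1" using c'(1) C1 by simp
 ultimately show ?thesis using that by blast
qed

subsection \<open>Convergence of the quadratic variation\<close>

lemma quadratic_variation_identity:
 assumes ww: "w : E"
 shows "(\<Sum>k<n. (Dk n k w)^2) = (\<Sum>k<n. hh (an n) (X k w) (th k w))
   - (\<Sum>k<n. (gg n k w)^2 * (1 / (1 - an n)^2 - 1)) - (gg n 0 w)\<^sup>2 + (gg n n w)^2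
   - (\<Sum>k<n. (gg n (Suc k) w)^2 - (gn n k w)\<^sup>2) - 2 * (\<Sum>k<n. pp n k w * Dk n k w)"
proof -
 have G: "w : G k" for k using ww E_G by blast
 have pt: "(Dk n k w)^2 = hh (an n) (X k w) (th k w) - (gg n k w)\<^sup>2 * (1 / (1 - an n)^2 - 1)
   + ((gg n (Suc k) w)^2 - (gg n k w)\<^sup>2) - ((gg n (Suc k) w)^2 - (gn n k w)\<^sup>2) - 2 * (pp n k w * Dk n k w)" for k
 proof -
  have D: "Dk n k w = gn n k w - pp n k w" using G by (simp add: Dk_def)
  have p: "pp n k w = gg n k w / (1 - an n) - f (X k w)"
   unfolding pp_def PR_def gg_def by (rule res_poisson[OF G_K[OF G] X_space[OF G_space[OF G]] an_le(1,2)])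
  have h: "hh (an n) (X k w) (th k w) = 2 * f (X k w) * gg n k w / (1 - an n) - (f (X k w))\<^sup>2" by (simp add: hh_def gg_def)
  have "(pp n k w)^2 = (gg n k w)^2 * (1 / (1 - an n)^2) - hh (an n) (X k w) (th k w)"
   unfolding p h by (simp add: power2_diff power_divide mult_ac)
  then show ?thesis unfolding D by (simp add: power2_eq_square algebra_simps)
 qed
 have "(\<Sum>k<n. (gg n (Suc k) w)^2 - (gg n k w)\<^sup>2) = (gg n n w)^2 - (gg n 0 w)\<^sup>2"
  unfolding sum_subtractf using sum_shift[of "%k. (gg n k w)^2" n] by simp
 then show ?thesis
  by (simp only: pt sum_subtractf[of _ "%k. 2 * (pp n k w * Dk n k w)"] sum.distrib sum_distrib_left[symmetric]
   sum_subtractf[of _ "%k. (gg n (Suc k) w)^2 - (gn n k w)\<^sup>2"] sum_subtractf[of "%k. hh (an n) (X k w) (th k w)"])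
qed

text \<open>
 The terms of the identity one by one. The second one is of order \<open>an n\<close> to the power \<open>1 - \<eta>0\<close> times
 \<open>avgV\<close>, and the boundary terms are \<open>o(n)\<close> because \<open>2 * \<gamma> < 1\<close>.
\<close>

lemma quadratic_variation_null:
 "null_in_prob (%n w. ((1 / real n) * (\<Sum>k<n. (Dk n k w)^2) - sig (ths w)) * ind E w)"
proof -
 obtain c where c: "0 < c" "!!w n k. w : G k ==> (gg n k w)^2 <= c * an n powr (- \<eta>0) * V (X k w) powr (1 - \<alpha>)"
  by (rule gg_square_tempered) blast
 define Y1 where "Y1 n w = \<bar>((1 / real n) * (\<Sum>k<n. hh (an n) (X k w) (th k w)) - sig (ths w)) * ind E w\<bar>" for n w
 define Y2 where "Y2 n w = (8 * c * an n powr (1 - \<eta>0)) * avgV n w" for n w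
 define Y3 where "Y3 n w = (2 * C1^2) * (real n powr (- 1) * maxV n w powr (2 * \<gamma>))" for n w
 define Y4 where "Y4 n w = real n powr (- 1) * (\<Sum>k<n. sw n k w) * ind E w" for n w
 define Y5 where "Y5 n w = 2 * \<bar>(1 / real n) * (\<Sum>k<n. pp n k w * Dk n k w) * ind E w\<bar>" for n w
 have hX[measurable]: "(%w. hh a (X k w) (th k w)) : meas M" for a k
  using measurable_compose[OF measurable_Pair[OF X_M th_M] hh_joint] by simp
 have [measurable]: "Y1 n : meas M" "Y2 n : meas M" "Y3 n : meas M" "Y4 n : meas M" "Y5 n : meas M" for n
  unfolding Y1_def Y2_def Y3_def Y4_def Y5_def by measurable
 have n1: "null_in_prob Y1"
  by (rule null_in_prob_dominated[OF _ hh_average_null, of 1]) (auto simp: Y1_def)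
 have n2: "null_in_prob Y2"
  unfolding Y2_def
 proof (rule null_in_prob_avgV)
  show "(%n. 8 * c * an n powr (1 - \<eta>0)) ----> 0" by (intro tendsto_mult_right_zero an_null) (use \<eta>0 in simp)
 qed (use c in simp)
 have n3: "null_in_prob Y3"
  unfolding Y3_def by (intro null_in_prob_cmult maxV_powr_null) (use exponents in auto)
 have n4: "null_in_prob Y4" unfolding Y4_def by (rule switch_square_null)
 have n5: "null_in_prob Y5"
  by (rule null_in_prob_dominated[OF _ cross_term_null, of 2]) (auto simp: Y5_def)
 have all: "null_in_prob (%n w. Y1 n w + (Y2 n w + (Y3 n w + (Y4 n w + Y5 n w))))"
  by (intro null_in_prob_add n1 n2 n3 n4 n5) measurable
 show ?thesis
 proof (rule null_in_prob_dominated[OF _ all, of 1])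
  show "EV n. AE w in M. \<bar>((1 / real n) * (\<Sum>k<n. (Dk n k w)^2) - sig (ths w)) * ind E w\<bar> <= 1 * \<bar>Y1 n w + (Y2 n w + (Y3 n w + (Y4 n w + Y5 n w)))\<bar>"
  proof (rule eventually_sequentiallyI[of 1], rule AE_I2)
   fix n w assume n: "1 <= (n::nat)" and ww: "w : space M"
   have pos4: "0 <= Y4 n w" unfolding Y4_def by (intro mult_nonneg_nonneg sum_nonneg sw_nonneg) auto
   have pos: "0 <= Y1 n w" "0 <= Y2 n w" "0 <= Y3 n w" "0 <= Y5 n w"
    using c avgV_nonneg[of n w] by (auto simp: Y1_def Y2_def Y3_def Y5_def)
   note pos = pos pos4
   show "\<bar>((1 / real n) * (\<Sum>k<n. (Dk n k w)^2) - sig (ths w)) * ind E w\<bar> <= 1 * \<bar>Y1 n w + (Y2 n w + (Y3 n w + (Y4 n w + Y5 n w)))\<bar>"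
   proof (cases "w : E")
    case True
    have G: "w : G k" for k using True E_G by blast
    have r: "real n powr (- 1) = 1 / real n" using n by (simp add: powr_minus divide_inverse)
    define r1 where "r1 = 1 / real n"
    have r1: "0 <= r1" by (simp add: r1_def)
    define A where "A = (\<Sum>k<n. hh (an n) (X k w) (th k w))"
    define B where "B = (\<Sum>k<n. (gg n k w)^2 * (1 / (1 - an n)^2 - 1))"
    define T where "T = (gg n n w)^2 - (gg n 0 w)\<^sup>2"
    define Sw where "Sw = (\<Sum>k<n. (gg n (Suc k) w)^2 - (gn n k w)\<^sup>2)"
    define Cr where "Cr = (\<Sum>k<n. pp n k w * Dk n k w)"
    define Q where "Q = (\<Sum>k<n. (Dk n k w)^2)"
    have Q: "Q = A - B + T - Sw - 2 * Cr"
     unfolding Q_def A_def B_def T_def Sw_def Cr_def using quadratic_variation_identity[OF True, of n] by linarith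
    have "r1 * Q = r1 * A - r1 * B + r1 * T - r1 * Sw - 2 * (r1 * Cr)"
     unfolding Q by (simp only: right_diff_distrib distrib_left mult.left_commute[of r1 2])
    moreover have "\<bar>r1 * A - sig (ths w)\<bar> = Y1 n w" using True by (simp add: Y1_def A_def r1_def)
    moreover have "\<bar>r1 * B\<bar> <= Y2 n w"
    proof -
     let ?a = "an n"
     have a8: "\<bar>1 / (1 - ?a)^2 - 1\<bar> <= 8 * ?a"
     proof -
      have a: "0 < ?a" "?a <= 1/2" by (rule an)+
      have "(1/2)^2 <= (1 - ?a)^2" by (rule power_mono) (use a in auto)
      then have d: "1 / 4 <= (1 - ?a)^2" by (simp add: power2_eq_square)
      then have d0: "0 < (1 - ?a)^2" by linarith
      have "1 / (1 - ?a)^2 - 1 = (2 * ?a - ?a^2) / (1 - ?a)^2"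
       using d0 by (simp add: field_simps power2_eq_square)
      moreover have "0 <= (2 * ?a - ?a^2) / (1 - ?a)^2" using a d0 by (simp add: power2_eq_square mult_left_le_one_le)
      moreover have "(2 * ?a - ?a^2) / (1 - ?a)^2 <= (2 * ?a) / (1 / 4)"
       using a d by (intro frac_le) auto
      ultimately show ?thesis by simp
     qed
     have "\<bar>B\<bar> <= (\<Sum>k<n. (8 * c * ?a powr (1 - \<eta>0)) * (ind (G k) w * V (X k w) powr (1 - \<alpha>)))"
      unfolding B_def
     proof (rule order_trans[OF sum_abs sum_mono])
      fix k
      have "\<bar>(gg n k w)^2 * (1 / (1 - ?a)^2 - 1)\<bar> = (gg n k w)^2 * \<bar>1 / (1 - ?a)^2 - 1\<bar>" by (simp add: abs_mult)
      also have "... <= (c * ?a powr (- \<eta>0) * V (X k w) powr (1 - \<alpha>)) * (8 * ?a)"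
       using c(1) by (intro mult_mono c(2)[OF G] a8) auto
      also have "... = 8 * c * (?a powr 1 * ?a powr (- \<eta>0)) * V (X k w) powr (1 - \<alpha>)" using an(1)[of n] by (simp add: mult_ac)
      also have "?a powr 1 * ?a powr (- \<eta>0) = ?a powr (1 - \<eta>0)" by (simp only: powr_add[symmetric]) simp
      finally show "\<bar>(gg n k w)^2 * (1 / (1 - ?a)^2 - 1)\<bar> <= (8 * c * ?a powr (1 - \<eta>0)) * (ind (G k) w * V (X k w) powr (1 - \<alpha>))"
       using G by simp
     qed
     also have "... = (8 * c * ?a powr (1 - \<eta>0)) * (\<Sum>k<n. ind (G k) w * V (X k w) powr (1 - \<alpha>))" by (rule sum_distrib_left[symmetric])
     finally have "r1 * \<bar>B\<bar> <= r1 * ((8 * c * ?a powr (1 - \<eta>0)) * (\<Sum>k<n. ind (G k) w * V (X k w) powr (1 - \<alpha>)))" by (rule mult_left_mono) (rule r1)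
     also have "... = Y2 n w" unfolding Y2_def avgV_def r1_def by (rule mult.left_commute)
     finally show ?thesis using r1 by (simp add: abs_mult)
    qed
    moreover have "\<bar>r1 * T\<bar> <= Y3 n w"
    proof -
     have "\<bar>T\<bar> <= 2 * (C1^2 * maxV n w powr (2 * \<gamma>))"
      using gg_sq_max[OF G[of 0], of n] gg_sq_max[OF G[of n], of n] unfolding T_def
      using zero_le_power2[of "gg n 0 w"] zero_le_power2[of "gg n n w"] by linarith
     then have "r1 * \<bar>T\<bar> <= r1 * (2 * (C1^2 * maxV n w powr (2 * \<gamma>)))" by (rule mult_left_mono) (rule r1)
     also have "... = Y3 n w" unfolding Y3_def r r1_def by (simp only: mult_ac)
     finally show ?thesis using r1 by (simp add: abs_mult)
    qed
    moreover have "\<bar>r1 * Sw\<bar> <= Y4 n w"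
    proof -
     have "\<bar>Sw\<bar> <= (\<Sum>k<n. sw n k w)" unfolding Sw_def sw_def by (rule sum_abs)
     then have "r1 * \<bar>Sw\<bar> <= r1 * (\<Sum>k<n. sw n k w)" by (rule mult_left_mono) (rule r1)
     also have "... = Y4 n w" using True unfolding Y4_def r r1_def by simp
     finally show ?thesis using r1 by (simp add: abs_mult)
    qed
    moreover have "2 * \<bar>r1 * Cr\<bar> = Y5 n w" using True by (simp add: Y5_def Cr_def r1_def)
    ultimately have "\<bar>r1 * Q - sig (ths w)\<bar> <= Y1 n w + (Y2 n w + (Y3 n w + (Y4 n w + Y5 n w)))" by linarith
    then show ?thesis using True pos by (simp add: Q_def r1_def)
   qed simp
  qed
 qed auto
qed

lemma Dk_average_measurable[measurable]: "(%w. ((1 / real n) * (\<Sum>k<n. (Dk n k w)^2) - sig (ths w)) * ind E w) : meas M"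
 by measurable

text \<open>
 A limit of averages of squares.
\<close>

lemma sig_nonneg: "AE w in M. w : E --> 0 <= sig (ths w)"
proof -
 let ?Y = "%n w. ((1 / real n) * (\<Sum>k<n. (Dk n k w)^2) - sig (ths w)) * ind E w"
 let ?A = "%m. {w : space M. w : E \<and> sig (ths w) < - (1 / real (Suc m))}"
 have "AE w in M. w \<notin> ?A m" for m
 proof -
  have t: "(%n. prob {w : space M. 1 / real (Suc m) < \<bar>?Y n w\<bar>}) ----> 0"
   by (rule prob_gt_tendsto_0[OF quadratic_variation_null]) auto
  have "prob (?A m) <= prob {w : space M. 1 / real (Suc m) < \<bar>?Y n w\<bar>}" for n
  proof (rule finite_measure_mono)
   show "?A m \<subseteq> {w : space M. 1 / real (Suc m) < \<bar>?Y n w\<bar>}"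
   proof
    fix w assume ww: "w : ?A m"
    have "0 <= (1 / real n) * (\<Sum>k<n. (Dk n k w)^2)" by (intro mult_nonneg_nonneg sum_nonneg) auto
    moreover have "sig (ths w) < - (1 / real (Suc m))" using ww by blast
    ultimately have "1 / real (Suc m) < \<bar>(1 / real n) * (\<Sum>k<n. (Dk n k w)^2) - sig (ths w)\<bar>" by linarith
    then show "w : {w : space M. 1 / real (Suc m) < \<bar>?Y n w\<bar>}" using ww by simp
   qed
  qed measurable
  then have "prob (?A m) <= 0" by (intro LIMSEQ_le_const[OF t]) auto
  then have "prob (?A m) = 0" using measure_nonneg[of M "?A m"] by linarith
  then show ?thesis by (subst AE_iff_measurable[where N="?A m"]) (auto simp: emeasure_eq_measure)
 qed
 then have "AE w in M. \<forall>m. w \<notin> ?A m" by (subst AE_all_countable) (rule allI)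
 then show ?thesis
 proof eventually_elim
  case (elim w)
  show ?case
  proof (rule impI, rule ccontr)
   assume ww: "w : E" and "\<not> 0 <= sig (ths w)"
   then have "0 < - sig (ths w)" by simp
   then obtain m where "1 / real (Suc m) < - sig (ths w)" using nat_approx_posE by blast
   then have "w : ?A m" using ww E_space by auto
   with elim show False by blast
  qed
 qed
qed

subsection \<open>The martingale approximation\<close>

text \<open>
 The Poisson equation leaves three errors: \<open>an n\<close> times a sum of resolvents, of order
 \<open>n * an n = o(\<surd>n)\<close>; boundary terms, which are \<open>o(\<surd>n)\<close> because \<open>\<gamma> < 1/2\<close>; and the changes of the
 parameter.
\<close>

lemma martingale_approximation_null:
 "null_in_prob (%n w. real n powr (- (1/2)) * ((\<Sum>k<n. f (X k w)) - (\<Sum>k<n. Dk n k w)) * ind E w)"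
proof -
 define c where "c n = 2 * C1 * (real n powr (1/2) * an n)" for n
 define Y1 where "Y1 n w = c n * avgV n w" for n w
 define Y2 where "Y2 n w = (2 * C1) * (real n powr (- (1/2)) * maxV n w powr \<gamma>)" for n w
 define Y3 where "Y3 n w = real n powr (- (1/2)) * (\<Sum>k<n. \<bar>gg n (Suc k) w - gn n k w\<bar>) * ind E w" for n w
 have [measurable]: "Y1 n : meas M" "Y2 n : meas M" "Y3 n : meas M" for n
  unfolding Y1_def Y2_def Y3_def by measurable
 have c0: "0 <= c n" for n using C1 an(1)[of n] by (simp add: c_def)
 have n1: "null_in_prob Y1"
  unfolding Y1_def
 proof (rule null_in_prob_avgV[OF c0])
  show "c ----> 0"
  proof (rule Lim_null_comparison)
   show "(%n. (2 * C1) * real (n + 4) powr (1/2 - \<rho>)) ----> 0"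
    by (intro tendsto_mult_right_zero powr_ratio_null) (use rho in simp)
   show "EV n. norm (c n) <= (2 * C1) * real (n + 4) powr (1/2 - \<rho>)"
   proof (rule always_eventually, rule allI)
    fix n
    have "real n powr (1/2) * an n <= real (n + 4) powr (1/2) * real (n + 4) powr (- \<rho>)"
     unfolding an_def by (intro mult_right_mono real_n_powr_le) auto
    also have "... = real (n + 4) powr (1/2 - \<rho>)" by (simp only: powr_add[symmetric]) simp
    finally have "2 * C1 * (real n powr (1/2) * an n) <= (2 * C1) * real (n + 4) powr (1/2 - \<rho>)" using C1 by (intro mult_left_mono) auto
    then show "norm (c n) <= (2 * C1) * real (n + 4) powr (1/2 - \<rho>)" using c0[of n] by (simp add: c_def)
   qed
  qed
 qed
 have n2: "null_in_prob Y2" unfolding Y2_def by (intro null_in_prob_cmult maxV_powr_null) (use exponents in auto)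
 have n3: "null_in_prob Y3" unfolding Y3_def by (rule switch_linear_null)
 have all: "null_in_prob (%n w. Y1 n w + (Y2 n w + Y3 n w))"
  by (intro null_in_prob_add n1 n2 n3) measurable
 show ?thesis
 proof (rule null_in_prob_dominated[OF _ all, of 1])
  show "EV n. AE w in M. \<bar>real n powr (- (1/2)) * ((\<Sum>k<n. f (X k w)) - (\<Sum>k<n. Dk n k w)) * ind E w\<bar> <= 1 * \<bar>Y1 n w + (Y2 n w + Y3 n w)\<bar>"
  proof (rule eventually_sequentiallyI[of 1], rule AE_I2)
   fix n w assume n: "1 <= (n::nat)" and ww: "w : space M"
   show "\<bar>real n powr (- (1/2)) * ((\<Sum>k<n. f (X k w)) - (\<Sum>k<n. Dk n k w)) * ind E w\<bar> <= 1 * \<bar>Y1 n w + (Y2 n w + Y3 n w)\<bar>"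
   proof (cases "w : E")
    case True
    have G: "w : G k" for k using True E_G by blast
    let ?a = "an n"
    define r where "r = real n powr (- (1/2))"
    have r: "0 <= r" by (simp add: r_def)
    define A where "A = (\<Sum>k<n. (?a / (1 - ?a)) * gg n k w)"
    define Sw where "Sw = (\<Sum>k<n. gg n (Suc k) w - gn n k w)"
    have pt: "f (X k w) - Dk n k w = (?a / (1 - ?a)) * gg n k w - (gg n (Suc k) w - gg n k w) + (gg n (Suc k) w - gn n k w)" for k
    proof -
     have D: "Dk n k w = gn n k w - pp n k w" using G by (simp add: Dk_def)
     have p: "pp n k w = gg n k w / (1 - ?a) - f (X k w)"
      unfolding pp_def PR_def gg_def by (rule res_poisson[OF G_K[OF G] X_space[OF G_space[OF G]] an_le(1,2)])
     have "gg n k w / (1 - ?a) = (?a / (1 - ?a)) * gg n k w + gg n k w" using an1[of n] by (simp add: field_simps)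
     then show ?thesis unfolding D p by linarith
    qed
    have "(\<Sum>k<n. f (X k w)) - (\<Sum>k<n. Dk n k w) = A - (\<Sum>k<n. gg n (Suc k) w - gg n k w) + Sw"
     unfolding A_def Sw_def sum_subtractf[symmetric] sum.distrib[symmetric] pt ..
    also have "(\<Sum>k<n. gg n (Suc k) w - gg n k w) = gg n n w - gg n 0 w"
     unfolding sum_subtractf using sum_shift[of "%k. gg n k w" n] by simp
    finally have eq: "(\<Sum>k<n. f (X k w)) - (\<Sum>k<n. Dk n k w) = A - (gg n n w - gg n 0 w) + Sw" .
    have bA: "r * \<bar>A\<bar> <= Y1 n w"
    proof -
     have a2: "\<bar>?a / (1 - ?a)\<bar> <= 2 * ?a"
     proof -
      have "?a / (1 - ?a) <= ?a / (1 / 2)" using an[of n] by (intro divide_left_mono) auto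
      then have 1: "?a / (1 - ?a) <= 2 * ?a" by simp
      have "0 <= ?a / (1 - ?a)" using an[of n] by simp
      with 1 show ?thesis by (simp only: abs_of_nonneg)
     qed
     have "\<bar>A\<bar> <= (\<Sum>k<n. (2 * C1 * ?a) * (ind (G k) w * V (X k w) powr (1 - \<alpha>)))"
      unfolding A_def
     proof (rule order_trans[OF sum_abs sum_mono])
      fix k
      have "\<bar>gg n k w\<bar> <= C1 * V (X k w) powr (1 - \<alpha>)"
       using C1 exponents by (intro order_trans[OF gg_bound[OF G] mult_left_mono] V_powr_mono X_space ww) auto
      then have "\<bar>?a / (1 - ?a)\<bar> * \<bar>gg n k w\<bar> <= (2 * ?a) * (C1 * V (X k w) powr (1 - \<alpha>))"
       using an(1)[of n] by (intro mult_mono a2) auto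
      then show "\<bar>(?a / (1 - ?a)) * gg n k w\<bar> <= (2 * C1 * ?a) * (ind (G k) w * V (X k w) powr (1 - \<alpha>))"
       using G by (simp add: abs_mult mult_ac)
     qed
     also have "... = (2 * C1 * ?a) * (\<Sum>k<n. ind (G k) w * V (X k w) powr (1 - \<alpha>))" by (rule sum_distrib_left[symmetric])
     finally have "r * \<bar>A\<bar> <= r * ((2 * C1 * ?a) * (\<Sum>k<n. ind (G k) w * V (X k w) powr (1 - \<alpha>)))" by (rule mult_left_mono) (rule r)
     also have "... = Y1 n w"
     proof -
      have rr: "r = real n powr (1/2) * (1 / real n)"
      proof -
       have "real n powr (1/2) * real n powr (- 1) = r" unfolding r_def by (simp only: powr_add[symmetric]) simp
       moreover have "real n powr (- 1) = 1 / real n" using n by (simp add: powr_minus divide_inverse)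
       ultimately show ?thesis by (simp only:)
      qed
      define s where "s = (\<Sum>k<n. indicat_real (G k) w * V (X k w) powr (1 - \<alpha>))"
      have "r * ((2 * C1 * ?a) * s) = c n * ((1 / real n) * s)" unfolding c_def rr by simp
      then show ?thesis by (simp add: Y1_def avgV_def s_def)
     qed
     finally show ?thesis .
    qed
    have bT: "r * \<bar>gg n n w - gg n 0 w\<bar> <= Y2 n w"
    proof -
     have m: "\<bar>gg n k w\<bar> <= C1 * maxV n w powr \<gamma>" if "k <= n" for k
      using C1 exponents V_X_powr_le_maxV[OF G that, of \<gamma>] by (intro order_trans[OF gg_bound[OF G] mult_left_mono]) auto
     have "\<bar>gg n n w - gg n 0 w\<bar> <= 2 * C1 * maxV n w powr \<gamma>" using m[of n] m[of 0] by simp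
     then have "r * \<bar>gg n n w - gg n 0 w\<bar> <= r * (2 * C1 * maxV n w powr \<gamma>)" by (rule mult_left_mono) (rule r)
     also have "... = Y2 n w" unfolding Y2_def r_def by (simp only: mult_ac)
     finally show ?thesis .
    qed
    have bS: "r * \<bar>Sw\<bar> <= Y3 n w"
    proof -
     have "r * \<bar>Sw\<bar> <= r * (\<Sum>k<n. \<bar>gg n (Suc k) w - gn n k w\<bar>)"
      unfolding Sw_def by (rule mult_left_mono[OF _ r]) (rule sum_abs)
     then show ?thesis using True by (simp add: Y3_def r_def)
    qed
    have "\<bar>r * ((\<Sum>k<n. f (X k w)) - (\<Sum>k<n. Dk n k w))\<bar> = r * \<bar>A - (gg n n w - gg n 0 w) + Sw\<bar>"
     unfolding eq abs_mult using r by simp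
    also have "... <= r * (\<bar>A\<bar> + (\<bar>gg n n w - gg n 0 w\<bar> + \<bar>Sw\<bar>))" by (rule mult_left_mono[OF _ r]) linarith
    also have "... <= Y1 n w + (Y2 n w + Y3 n w)" unfolding distrib_left using bA bT bS by linarith
    also have "... <= \<bar>Y1 n w + (Y2 n w + Y3 n w)\<bar>" by (rule abs_ge_self)
    finally show ?thesis using True by (simp add: r_def)
   qed simp
  qed
 qed auto
qed

lemma f_X_bound:
 assumes "w : E" "k <= n"
 shows "\<bar>f (X k w)\<bar> <= Bf * maxV n w powr \<gamma>"
proof -
 have G: "w : G j" for j using assms E_G by blast
 have "\<bar>f (X k w)\<bar> <= Bf * V (X k w) powr \<beta>" by (rule f_bound[OF X_space[OF E_space[OF assms(1)]]])
 also have "... <= Bf * V (X k w) powr \<gamma>"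
  using Bf exponents by (intro mult_left_mono V_powr_mono X_space E_space assms) auto
 also have "... <= Bf * maxV n w powr \<gamma>"
  using Bf exponents by (intro mult_left_mono V_X_powr_le_maxV G assms) auto
 finally show ?thesis .
qed

text \<open>
 Finitely many terms at either end do not matter: this lets the localized chain start at a later
 time than the original one.
\<close>

lemma shifted_sum_null:
 assumes U[measurable]: "U : meas M"
 shows "null_in_prob (%n w. real n powr (- (1/2)) * ((U w + (\<Sum>k<n - m. f (X k w))) - (\<Sum>k<n. f (X k w))) * ind E w)"
proof -
 define Y1 where "Y1 n w = real n powr (- (1/2)) * \<bar>U w\<bar>" for n w
 define Y2 where "Y2 n w = (real m * Bf) * (real n powr (- (1/2)) * maxV n w powr \<gamma>)" for n w
 have [measurable]: "Y1 n : meas M" "Y2 n : meas M" for n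
  unfolding Y1_def Y2_def by measurable
 have n1: "null_in_prob Y1"
 proof (rule null_in_prob_AE)
  have "(%n. real n powr (- (1/2))) ----> 0" by (rule tendsto_neg_powr[OF _ filterlim_real_sequentially]) simp
  then show "AE w in M. (%n. Y1 n w) ----> 0" unfolding Y1_def by (intro AE_I2 tendsto_mult_left_zero)
 qed measurable
 have n2: "null_in_prob Y2" unfolding Y2_def by (intro null_in_prob_cmult maxV_powr_null) (use exponents in auto)
 have all: "null_in_prob (%n w. Y1 n w + Y2 n w)" by (intro null_in_prob_add n1 n2) measurable
 show ?thesis
 proof (rule null_in_prob_dominated[OF _ all, of 1])
  show "EV n. AE w in M. \<bar>real n powr (- (1/2)) * ((U w + (\<Sum>k<n - m. f (X k w))) - (\<Sum>k<n. f (X k w))) * ind E w\<bar> <= 1 * \<bar>Y1 n w + Y2 n w\<bar>"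
  proof (rule always_eventually, rule allI, rule AE_I2)
   fix n w
   show "\<bar>real n powr (- (1/2)) * ((U w + (\<Sum>k<n - m. f (X k w))) - (\<Sum>k<n. f (X k w))) * ind E w\<bar> <= 1 * \<bar>Y1 n w + Y2 n w\<bar>"
   proof (cases "w : E")
    case True
    let ?r = "real n powr (- (1/2))"
    have s: "(\<Sum>k<n. f (X k w)) = (\<Sum>k<n - m. f (X k w)) + (\<Sum>k=n - m..<n. f (X k w))"
     by (rule sum_lessThan_split) simp
    have "\<bar>\<Sum>k=n - m..<n. f (X k w)\<bar> <= (\<Sum>k=n - m..<n. Bf * maxV n w powr \<gamma>)"
     by (rule order_trans[OF sum_abs sum_mono]) (rule f_X_bound[OF True], auto)
    also have "... = real (n - (n - m)) * (Bf * maxV n w powr \<gamma>)" by simp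
    also have "... <= real m * (Bf * maxV n w powr \<gamma>)" using Bf by (intro mult_right_mono) auto
    finally have "\<bar>U w - (\<Sum>k=n - m..<n. f (X k w))\<bar> <= \<bar>U w\<bar> + real m * (Bf * maxV n w powr \<gamma>)" by linarith
    then have "?r * \<bar>U w - (\<Sum>k=n - m..<n. f (X k w))\<bar> <= ?r * (\<bar>U w\<bar> + real m * (Bf * maxV n w powr \<gamma>))" by (rule mult_left_mono) simp
    also have "... = Y1 n w + Y2 n w" unfolding Y1_def Y2_def by (simp only: distrib_left mult_ac)
    also have "... <= \<bar>Y1 n w + Y2 n w\<bar>" by (rule abs_ge_self)
    finally have "?r * \<bar>U w - (\<Sum>k=n - m..<n. f (X k w))\<bar> <= \<bar>Y1 n w + Y2 n w\<bar>" .
    moreover have e: "(U w + (\<Sum>k<n - m. f (X k w))) - (\<Sum>k<n. f (X k w)) = U w - (\<Sum>k=n - m..<n. f (X k w))" unfolding s by linarith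
    ultimately show ?thesis unfolding e using True by (simp add: abs_mult)
   qed simp
  qed
 qed auto
qed

end

lemma (in prob_space) characteristic_function_perturbation:
 assumes [measurable]: "!!n. Y n : meas M" "!!n. W n : meas M" and E[measurable]: "E : events"
  and null: "null_in_prob (%n w. (Y n w - W n w) * ind E w)" and e: "0 < eps"
 shows "EV n. norm ((LINT w|M. exp (\<i> * cor (t * Y n w))) - (LINT w|M. exp (\<i> * cor (t * W n w))))
   <= 2 * (1 - prob E) + eps"
proof -
 define \<eta> where "\<eta> = eps / (2 + \<bar>t\<bar>)"
 have \<eta>: "0 < \<eta>" "(2 + \<bar>t\<bar>) * \<eta> = eps" using e by (auto simp: \<eta>_def)
 from null_in_probD[OF null \<eta>(1)] show ?thesis
 proof eventually_elim
  case (elim n)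
  let ?A = "{w : space M. \<eta> < \<bar>(Y n w - W n w) * ind E w\<bar>}"
  let ?y = "%w. exp (\<i> * cor (t * Y n w))" and ?w = "%w. exp (\<i> * cor (t * W n w))"
  have n1: "norm (exp (\<i> * cor u)) = 1" for u by simp
  have i: "integrable M ?y" "integrable M ?w"
   by (rule integrable_const_bound[where B=1]; simp)+
  have pt: "norm (?y w - ?w w) <= 2 * ind (space M - E) w + (2 * ind ?A w + \<bar>t\<bar> * \<eta>)" if ww: "w : space M" for w
  proof (cases "w : E \<and> w \<notin> ?A")
   case True
   then have "\<bar>Y n w - W n w\<bar> <= \<eta>" using ww by auto
   then have "\<bar>t\<bar> * \<bar>Y n w - W n w\<bar> <= \<bar>t\<bar> * \<eta>" by (rule mult_left_mono) simp
   moreover have "norm (?y w - ?w w) <= \<bar>t * Y n w - t * W n w\<bar>" by (rule norm_iexp_diff_le)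
   moreover have "\<bar>t * Y n w - t * W n w\<bar> = \<bar>t\<bar> * \<bar>Y n w - W n w\<bar>" by (simp only: right_diff_distrib[symmetric] abs_mult)
   ultimately have "norm (?y w - ?w w) <= \<bar>t\<bar> * \<eta>" by linarith
   moreover have "0 <= 2 * indicat_real (space M - E) w + 2 * indicat_real ?A w" by simp
   ultimately show ?thesis by linarith
  next
   case False
   have "norm (?y w - ?w w) <= 2" using norm_triangle_ineq4[of "?y w" "?w w"] unfolding n1 by linarith
   moreover have "2 <= 2 * indicat_real (space M - E) w + 2 * indicat_real ?A w" using False ww by (auto simp: indicator_def)
   moreover have "0 <= \<bar>t\<bar> * \<eta>" using \<eta>(1) by simp
   ultimately show ?thesis by linarith
  qed
  have "norm ((LINT w|M. ?y w) - (LINT w|M. ?w w)) = norm (LINT w|M. ?y w - ?w w)"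
   by (simp only: Bochner_Integration.integral_diff[OF i])
  also have "... <= (LINT w|M. norm (?y w - ?w w))" by (rule integral_norm_bound)
  also have "... <= (LINT w|M. 2 * ind (space M - E) w + (2 * ind ?A w + \<bar>t\<bar> * \<eta>))"
  proof (rule integral_mono)
   show "integrable M (%w. norm (?y w - ?w w))" using i by auto
  qed (use pt in \<open>auto simp: emeasure_eq_measure\<close>)
  also have "... = 2 * prob (space M - E) + (2 * prob ?A + \<bar>t\<bar> * \<eta>)"
  proof -
   have "(LINT w|M. 2 * ind (space M - E) w + (2 * ind ?A w + \<bar>t\<bar> * \<eta>))
    = (LINT w|M. 2 * ind (space M - E) w) + ((LINT w|M. 2 * ind ?A w) + (LINT w|M. \<bar>t\<bar> * \<eta>))"
    by (subst Bochner_Integration.integral_add, (auto simp: emeasure_eq_measure)[2], subst Bochner_Integration.integral_add)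
      (auto simp: emeasure_eq_measure)
   then show ?thesis by (simp add: prob_space)
  qed
  also have "prob (space M - E) = 1 - prob E" by (rule prob_compl[OF E])
  also have "2 * (1 - prob E) + (2 * prob ?A + \<bar>t\<bar> * \<eta>) <= 2 * (1 - prob E) + eps"
   using elim \<eta>(2) unfolding distrib_right by linarith
  finally show ?case .
 qed
qed

context localized_clt begin

theorem clt_on_event:
 assumes U[measurable]: "U : meas M" and s2[measurable]: "s2 : meas M"
  and s2_nonneg: "!!w. w : space M ==> 0 <= s2 w" and s2_E: "AE w in M. w : E --> s2 w = sig (ths w)" and e: "0 < eps"
 shows "EV n. norm ((LINT w|M. exp (\<i> * cor (t * (real n powr (- (1/2)) * (U w + (\<Sum>k<n - m. f (X k w)))))))
   - cor (LINT w|M. exp (- t\<^sup>2 * s2 w / 2))) <= 6 * sqrt (1 - prob E) + eps"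
proof -
 define d where "d n k w = real n powr (- (1/2)) * Dk n k w" for n k w
 define R where "R n w = (C1 + C2)^2 * (real n powr (- 1) * maxV n w powr (2 * \<gamma>))" for n w
 have rr: "(real n powr (- (1/2)))^2 = real n powr (- 1)" for n
  unfolding power2_eq_square by (simp add: powr_add[symmetric])
 have "EV n. norm ((LINT w|M. exp (\<i> * cor (t * (\<Sum>k<n. d n k w))))
   - cor (LINT w|M. exp (- t\<^sup>2 * s2 w / 2))) <= 4 * sqrt (1 - prob E) + eps / 2"
 proof (rule mcleish_clt_on_event[where F=F and R=R])
  show "subalgebra M (F k)" for k by (rule subF)
  show "sets (F k) \<subseteq> sets (F (Suc k))" for k by (rule monoF)
  show "d n k : meas (F (Suc k))" for n k unfolding d_def using Dk_F by measurable
  show "centred M (F k) (d n k)" for n k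
  proof -
   have D: "integrable M (Dk n k)" "!!A. A : sets (F k) ==> (LINT w|M. ind A w * Dk n k w) = 0"
    using Dk_centred[of k n] by (auto simp: centred_def)
   have "(LINT w|M. ind A w * d n k w) = 0" if "A : sets (F k)" for A
   proof -
    have "(LINT w|M. ind A w * d n k w) = (LINT w|M. real n powr (- (1/2)) * (ind A w * Dk n k w))"
     by (intro Bochner_Integration.integral_cong) (auto simp: d_def)
    also have "... = real n powr (- (1/2)) * (LINT w|M. ind A w * Dk n k w)" by (rule integral_mult_right_zero)
    finally show ?thesis using D(2)[OF that] by simp
   qed
   moreover have "integrable M (d n k)" unfolding d_def using D(1) by auto
   ultimately show ?thesis by (simp add: centred_def)
  qed
  show "(d n k w)^2 <= R n w" if "k < n" for n k w
  proof -
   have "(d n k w)^2 = real n powr (- 1) * (Dk n k w)^2" by (simp only: d_def power_mult_distrib rr)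
   also have "... <= real n powr (- 1) * ((C1 + C2)^2 * maxV n w powr (2 * \<gamma>))" by (rule mult_left_mono[OF Dk_max[OF that]]) simp
   also have "... = R n w" unfolding R_def by (simp only: mult_ac)
   finally show ?thesis .
  qed
  show "0 <= R n w" for n w by (simp add: R_def)
  show "R n : meas M" for n unfolding R_def by measurable
  show "(NNI w|M. ennreal (R n w)) <= ennreal ((C1 + C2)^2 * CM * real n powr (2 * \<gamma> - 1))" for n
  proof (cases "n = 0")
   case False
   have "(NNI w|M. ennreal (R n w)) = (NNI w|M. ennreal ((C1 + C2)^2 * real n powr (- 1)) * ennreal (maxV n w powr (2 * \<gamma>)))"
    by (intro nn_integral_cong) (simp add: R_def ennreal_mult[symmetric] mult.assoc)
   also have "... = ennreal ((C1 + C2)^2 * real n powr (- 1)) * (NNI w|M. ennreal (maxV n w powr (2 * \<gamma>)))" by (rule nn_integral_cmult) measurable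
   also have "... <= ennreal ((C1 + C2)^2 * real n powr (- 1)) * ennreal (CM * real n powr (2 * \<gamma>))" using False by (intro mult_left_mono CM) auto
   also have "... = ennreal ((C1 + C2)^2 * CM * (real n powr (2 * \<gamma>) * real n powr (- 1)))" using CM(1) by (subst ennreal_mult[symmetric]) (auto simp: mult_ac)
   also have "real n powr (2 * \<gamma>) * real n powr (- 1) = real n powr (2 * \<gamma> - 1)" by (simp only: powr_add[symmetric]) simp
   finally show ?thesis .
  qed (simp add: R_def)
  show "(%n. (C1 + C2)^2 * CM * real n powr (2 * \<gamma> - 1)) ----> 0"
   by (intro tendsto_mult_right_zero tendsto_neg_powr[OF _ filterlim_real_sequentially]) (use exponents in simp)
  show "null_in_prob (%n w. ((\<Sum>k<n. (d n k w)^2) - s2 w) * ind E w)"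
  proof (rule null_in_prob_dominated[OF _ quadratic_variation_null, of 1])
   show "EV n. AE w in M. \<bar>((\<Sum>k<n. (d n k w)^2) - s2 w) * ind E w\<bar>
    <= 1 * \<bar>((1 / real n) * (\<Sum>k<n. (Dk n k w)^2) - sig (ths w)) * ind E w\<bar>"
   proof (rule eventually_sequentiallyI[of 1])
    fix n :: nat assume n: "1 <= n"
    from s2_E show "AE w in M. \<bar>((\<Sum>k<n. (d n k w)^2) - s2 w) * ind E w\<bar>
     <= 1 * \<bar>((1 / real n) * (\<Sum>k<n. (Dk n k w)^2) - sig (ths w)) * ind E w\<bar>"
    proof eventually_elim
     case (elim w)
     have "(\<Sum>k<n. (d n k w)^2) = (1 / real n) * (\<Sum>k<n. (Dk n k w)^2)"
      unfolding sum_distrib_left d_def power_mult_distrib rr using n by (simp add: powr_minus divide_inverse)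
     then show ?case using elim by (cases "w : E") auto
    qed
   qed
  qed auto
 qed (use e s2_nonneg in auto)
 moreover
 have "EV n. norm ((LINT w|M. exp (\<i> * cor (t * (real n powr (- (1/2)) * (U w + (\<Sum>k<n - m. f (X k w)))))))
   - (LINT w|M. exp (\<i> * cor (t * (\<Sum>k<n. d n k w))))) <= 2 * (1 - prob E) + eps / 2"
 proof (rule characteristic_function_perturbation)
  have [measurable]: "(%w. f (X k w)) : meas M" for k by (rule measurable_compose[OF X_M fm])
  show "(%w. real n powr (- (1/2)) * (U w + (\<Sum>k<n - m. f (X k w)))) : meas M" for n by measurable
  show "(%w. \<Sum>k<n. d n k w) : meas M" for n unfolding d_def by measurable
  have all: "null_in_prob (%n w. real n powr (- (1/2)) * ((U w + (\<Sum>k<n - m. f (X k w))) - (\<Sum>k<n. f (X k w))) * ind E w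
    + real n powr (- (1/2)) * ((\<Sum>k<n. f (X k w)) - (\<Sum>k<n. Dk n k w)) * ind E w)"
   by (intro null_in_prob_add shifted_sum_null martingale_approximation_null) measurable
  have eq: "(real n powr (- (1/2)) * (U w + (\<Sum>k<n - m. f (X k w))) - (\<Sum>k<n. d n k w)) * ind E w
   = real n powr (- (1/2)) * ((U w + (\<Sum>k<n - m. f (X k w))) - (\<Sum>k<n. f (X k w))) * ind E w
    + real n powr (- (1/2)) * ((\<Sum>k<n. f (X k w)) - (\<Sum>k<n. Dk n k w)) * ind E w" for n w
   unfolding d_def sum_distrib_left[symmetric] by (simp only: right_diff_distrib left_diff_distrib)
  show "null_in_prob (%n w. (real n powr (- (1/2)) * (U w + (\<Sum>k<n - m. f (X k w))) - (\<Sum>k<n. d n k w)) * ind E w)"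
   unfolding eq by (rule all)
 qed (use e in auto)
 ultimately show ?thesis
 proof eventually_elim
  case (elim n)
  have p: "0 <= 1 - prob E" "1 - prob E <= 1" by auto
  have "1 - prob E <= sqrt (1 - prob E)"
  proof (rule real_le_rsqrt)
   show "(1 - prob E)^2 <= 1 - prob E" using p by (simp add: power2_eq_square mult_left_le_one_le)
  qed
  then show ?case using elim norm_triangle_ineq[of "(LINT w|M. exp (\<i> * cor (t * (real n powr (- (1/2)) * (U w + (\<Sum>k<n - m. f (X k w)))))))
   - (LINT w|M. exp (\<i> * cor (t * (\<Sum>k<n. d n k w))))" "(LINT w|M. exp (\<i> * cor (t * (\<Sum>k<n. d n k w))))
   - cor (LINT w|M. exp (- t\<^sup>2 * s2 w / 2))"]
   by simp
 qed
qed

end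

section \<open>The Markov property of a chain given by its law\<close>

locale markov_process = prob_space M for M :: "'w measure" +
 fixes S :: "'s measure" and Q :: "nat => 's => 's measure" and z :: 's and Z :: "nat => 'w => 's"
 assumes Q: "!!n. Q n : measurable S (prob_algebra S)" and z: "z : space S" and chain: "is_markov_chain M S Q z Z"
begin

sublocale IT: Ionescu_Tulcea "chain_step S Q z" "%_. S"
 by (rule Ionescu_Tulcea_chain_step[OF Q z])

abbreviation (input) "path_space n \<equiv> PiM {0..<n} (%_. S)"

text \<open>
 The path before time \<open>n\<close>, as an element of the product space on which the Ionescu-Tulcea
 construction defines the law of the first \<open>n\<close> states.
\<close>

definition history :: "nat => 'w => nat => 's" where "history n w = restrict (%i. Z i w) {0..<n}"

definition filt :: "nat => 'w measure" where "filt n = vimage_algebra (space M) (history (Suc n)) (path_space (Suc n))"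

lemma Z_M[measurable]: "Z n : measurable M S" using chain by (simp add: is_markov_chain_def)

lemma history_M[measurable]: "history n : measurable M (path_space n)"
 unfolding history_def by (rule measurable_restrict) simp

lemma sets_filt: "A : sets (filt n) \<longleftrightarrow> (\<exists>B\<in>sets (path_space (Suc n)). A = history (Suc n) -` B \<inter> space M)"
 using measurable_space[OF history_M] by (auto simp: filt_def sets_vimage_algebra2[OF Pi_I])

lemma space_filt[simp]: "space (filt n) = space M" by (simp add: filt_def)

lemma subalgebra_filt: "subalgebra M (filt n)"
 unfolding subalgebra_def using sets_filt measurable_sets[OF history_M] by auto

lemma history_filt: "history (Suc n) : measurable (filt n) (path_space (Suc n))"
 unfolding filt_def by (rule measurable_vimage_algebra1) (use measurable_space[OF history_M] in auto)

lemma filt_mono: "sets (filt n) \<subseteq> sets (filt (Suc n))"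
proof
 fix A assume "A : sets (filt n)"
 then obtain B where B: "B : sets (path_space (Suc n))" "A = history (Suc n) -` B \<inter> space M" by (auto simp: sets_filt)
 have r: "(%ww. restrict ww {0..<Suc n}) : measurable (path_space (Suc (Suc n))) (path_space (Suc n))"
  by (rule measurable_restrict_subset) auto
 have "history (Suc n) -` B \<inter> space M = history (Suc (Suc n)) -` ((%ww. restrict ww {0..<Suc n}) -` B \<inter> space (path_space (Suc (Suc n)))) \<inter> space M"
 proof -
  have "restrict (history (Suc (Suc n)) w) {0..<Suc n} = history (Suc n) w" for w by (auto simp: history_def restrict_def fun_eq_iff)
  then show ?thesis using measurable_space[OF history_M, of _ "Suc (Suc n)"] by auto
 qed
 then show "A : sets (filt (Suc n))" unfolding sets_filt B(2) using measurable_sets[OF r B(1)] by blast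
qed

lemma Z_filt: "Z n : measurable (filt n) S"
proof -
 have "(%w. history (Suc n) w n) : measurable (filt n) S"
  by (rule measurable_compose[OF history_filt measurable_component_singleton]) simp
 then show ?thesis by (simp add: history_def)
qed

lemma distr_history: "distr M (path_space n) (history n) = IT.C 0 n (%_. undefined)"
proof (rule measure_eqI)
 have u: "(%_::nat. undefined) : space (path_space 0)" by (auto simp: space_PiM PiE_iff extensional_def)
 show "sets (distr M (path_space n) (history n)) = sets (IT.C 0 n (%_. undefined))" using IT.sets_C[OF u, of n] by simp
 fix A assume "A : sets (distr M (path_space n) (history n))"
 then have A[measurable]: "A : sets (path_space n)" by simp
 have e: "prod_emb UNIV (%_. S) {0..<n} A : sets (PiM UNIV (%_. S))" by (rule measurable_prod_emb[OF subset_UNIV A])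
 have m: "(%w i. Z i w) : measurable M (PiM UNIV (%_. S))" by (rule measurable_PiM_single') (auto simp: measurable_space[OF Z_M])
 have "emeasure (distr M (path_space n) (history n)) A = emeasure M (history n -` A \<inter> space M)" by (simp add: emeasure_distr)
 also have "history n -` A \<inter> space M = (%w i. Z i w) -` prod_emb UNIV (%_. S) {0..<n} A \<inter> space M"
  using measurable_space[OF Z_M] by (auto simp: prod_emb_iff history_def)
 also have "emeasure M ... = emeasure (distr M (PiM UNIV (%_. S)) (%w i. Z i w)) (prod_emb UNIV (%_. S) {0..<n} A)"
  by (rule emeasure_distr[symmetric, OF m e])
 also have "... = emeasure (IT.C 0 n (%_. undefined)) A"
  using chain emeasure_chain_law[OF Q z A] by (simp add: is_markov_chain_def)
 finally show "emeasure (distr M (path_space n) (history n)) A = emeasure (IT.C 0 n (%_. undefined)) A" .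
qed

lemma nn_integral_history_Suc:
 assumes g[measurable]: "g : meas (path_space (Suc n))"
 shows "(NNI w|M. g (history (Suc n) w)) = (NNI w|M. (NNI y|chain_step S Q z n (history n w). g ((history n w)(n := y))))"
proof -
 have u: "(%_::nat. undefined) : space (path_space 0)" by (auto simp: space_PiM PiE_iff extensional_def)
 have m: "(%ww. NNI x|IT.eP n ww. g x) : meas (path_space n)"
  by (rule measurable_compose[OF IT.measurable_eP nn_integral_measurable_subprob_algebra]) simp
 have "(NNI w|M. g (history (Suc n) w)) = (NNI ww|distr M (path_space (Suc n)) (history (Suc n)). g ww)"
  by (simp add: nn_integral_distr)
 also have "... = (NNI ww|(IT.C 0 n (%_. undefined) \<bind> IT.eP n). g ww)" by (simp add: distr_history)
 also have "... = (NNI ww|IT.C 0 n (%_. undefined). (NNI x|IT.eP n ww. g x))"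
 proof (rule nn_integral_bind[OF g])
  show "IT.eP n : measurable (IT.C 0 n (%_. undefined)) (subprob_algebra (path_space (Suc n)))"
   using IT.measurable_eP[of n] IT.sets_C[OF u, of n] by (simp cong: measurable_cong_sets)
 qed
 also have "... = (NNI ww|distr M (path_space n) (history n). (NNI x|IT.eP n ww. g x))" by (simp only: distr_history)
 also have "... = (NNI w|M. (NNI x|IT.eP n (history n w). g x))" by (rule nn_integral_distr[OF history_M]) (use m in simp)
 also have "... = (NNI w|M. (NNI y|chain_step S Q z n (history n w). g ((history n w)(n := y))))"
  by (intro nn_integral_cong IT.nn_integral_eP measurable_space[OF history_M] g)
 finally show ?thesis .
qed

lemma nn_integral_initial:
 assumes u[measurable]: "u : meas S"
 shows "(NNI w|M. u (Z 0 w)) = u z"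
proof -
 have [measurable]: "(%ww. ww 0) : measurable (path_space (Suc 0)) S" by (rule measurable_component_singleton) simp
 have "(%ww. u (ww 0)) : meas (path_space (Suc 0))" by measurable
 from nn_integral_history_Suc[OF this] show ?thesis
  using z by (simp add: history_def chain_step_def nn_integral_return emeasure_space_1)
qed

lemma markov:
 assumes A: "A : sets (filt n)" and h[measurable]: "h : meas (S \<Otimes>\<^sub>M S)"
 shows "(NNI w|M. ind A w * h (Z n w, Z (Suc n) w)) = (NNI w|M. ind A w * (NNI y|Q n (Z n w). h (Z n w, y)))"
proof -
 obtain A' where A'[measurable]: "A' : sets (path_space (Suc n))" and Aeq: "A = history (Suc n) -` A' \<inter> space M" using A by (auto simp: sets_filt)
 let ?g = "%ww. ind A' (restrict ww {0..<Suc n}) * h (ww n, ww (Suc n))"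
 have g: "?g : meas (path_space (Suc (Suc n)))"
 proof -
  have [measurable]: "(%ww. restrict ww {0..<Suc n}) : measurable (path_space (Suc (Suc n))) (path_space (Suc n))"
   by (rule measurable_restrict_subset) auto
  have [measurable]: "(%ww. ww (Suc n)) : measurable (path_space (Suc (Suc n))) S" "(%ww. ww n) : measurable (path_space (Suc (Suc n))) S"
   by (rule measurable_component_singleton, simp)+
  show ?thesis by measurable
 qed
 have r: "restrict (history (Suc (Suc n)) w) {0..<Suc n} = history (Suc n) w" "restrict ((history (Suc n) w)(Suc n := y)) {0..<Suc n} = history (Suc n) w"
  "history (Suc (Suc n)) w (Suc n) = Z (Suc n) w" "history (Suc (Suc n)) w n = Z n w" "history (Suc n) w n = Z n w" for w y
  by (auto simp: history_def restrict_def fun_eq_iff)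
 have i: "ind A' (history (Suc n) w) = (ind A w :: ennreal)" if "w : space M" for w using that by (auto simp: Aeq indicator_def)
 have "(NNI w|M. ind A w * h (Z n w, Z (Suc n) w)) = (NNI w|M. ?g (history (Suc (Suc n)) w))"
  unfolding r by (intro nn_integral_cong) (simp add: i)
 also have "... = (NNI w|M. (NNI y|chain_step S Q z (Suc n) (history (Suc n) w). ?g ((history (Suc n) w)(Suc n := y))))"
  by (rule nn_integral_history_Suc[OF g])
 also have "... = (NNI w|M. ind A w * (NNI y|Q n (Z n w). h (Z n w, y)))"
 proof (rule nn_integral_cong)
  fix w assume ww: "w : space M"
  have Zn: "Z n w : space S" by (rule measurable_space[OF Z_M ww])
  have s: "sets (Q n (Z n w)) = sets S" using measurable_space[OF Q Zn] by (simp add: space_prob_algebra)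
  have "(%y. h (Z n w, y)) : meas (Q n (Z n w))"
   using measurable_compose[OF measurable_Pair1'[OF Zn] h] by (simp cong: measurable_cong_sets add: s)
  then show "(NNI y|chain_step S Q z (Suc n) (history (Suc n) w). ?g ((history (Suc n) w)(Suc n := y))) = ind A w * (NNI y|Q n (Z n w). h (Z n w, y))"
   unfolding r chain_step_def using ww by (simp add: r i nn_integral_cmult)
 qed
 finally show ?thesis .
qed

end

lemma chain_law_markov_process:
 assumes "!!n. Q n : measurable S (prob_algebra S)" and "z : space S"
 shows "markov_process (chain_law S Q z) S Q z (%n ww. ww n)"
proof -
 interpret prob_space "chain_law S Q z" by (rule prob_space_chain_law[OF assms])
 have "(%ww. ww n) : measurable (chain_law S Q z) S" for n
  using measurable_component_singleton[of n UNIV "%_. S"] by (simp add: sets_chain_law[OF assms] cong: measurable_cong_sets)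
 moreover have "distr (chain_law S Q z) (PiM UNIV (%_. S)) (%ww n. ww n) = chain_law S Q z"
  by (rule distr_id2) (rule sets_chain_law[OF assms, symmetric])
 ultimately show ?thesis
  by (intro markov_process.intro markov_process_axioms.intro assms) (auto simp: is_markov_chain_def prob_space_axioms)
qed

section \<open>Costs accumulated before leaving a set\<close>

text \<open>
 The expected cost of the last of the \<open>r + 1\<close> steps made from \<open>y\<close> at time \<open>m\<close>, if all the states
 reached are in \<open>J\<close>.
\<close>

primrec killed_cost :: "(nat => 'y => 'y measure) => 'y set => ('y \<times> 'y => ennreal) => nat => nat => 'y => ennreal" where
 "killed_cost Q J \<phi> 0 m y = (NNI z|Q m y. ind J z * \<phi> (y, z))"
| "killed_cost Q J \<phi> (Suc r) m y = (NNI z|Q m y. ind J z * killed_cost Q J \<phi> r (Suc m) z)"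

lemma killed_cost_measurable:
 assumes Q: "!!n. Q n : measurable N (prob_algebra N)" and J[measurable]: "J : sets N" and \<phi>[measurable]: "\<phi> : meas (N \<Otimes>\<^sub>M N)"
 shows "killed_cost Q J \<phi> r m : meas N"
proof (induction r arbitrary: m)
 case 0
 have "(%y. NNI z|Q m y. ind J z * \<phi> (y, z)) : meas N"
  by (rule nn_integral_measurable_subprob_algebra2[OF _ measurable_prob_algebraD[OF Q]]) measurable
 then show ?case by (simp add: fun_eq_iff[THEN iffD2, of "killed_cost Q J \<phi> 0 m"] cong: measurable_cong)
next
 case (Suc r)
 note [measurable] = Suc
 have "(%y. NNI z|Q m y. ind J z * killed_cost Q J \<phi> r (Suc m) z) : meas N"
  by (rule nn_integral_measurable_subprob_algebra2[OF _ measurable_prob_algebraD[OF Q]]) measurable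
 then show ?case by (simp cong: measurable_cong)
qed

text \<open>
 Any process that moves by \<open>Q\<close> and is observed as long as it is in \<open>J\<close> has this expected cost. It
 applies to the re-projection free process and to the excursions of the adaptive chain, and so
 identifies their costs.
\<close>

lemma killed_cost_nn_integral:
 fixes F :: "nat => 'w measure" and Y :: "nat => 'w => 'y"
 assumes Q: "!!n. Q n : measurable N (prob_algebra N)" and J: "J : sets N" and \<phi>: "\<phi> : meas (N \<Otimes>\<^sub>M N)"
  and F: "!!m. sets (F m) \<subseteq> sets (F (Suc m))" and A: "!!m. A m : sets (F m)" "!!m. A (Suc m) \<subseteq> A m"
  and step: "!!m g A'. g : meas (N \<Otimes>\<^sub>M N) ==> A' : sets (F m) ==> A' \<subseteq> A m ==>
   (NNI w|M. ind (A' \<inter> A (Suc m)) w * g (Y m w, Y (Suc m) w))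
   = (NNI w|M. ind A' w * (NNI z|Q m (Y m w). ind J z * g (Y m w, z)))"
 shows "A' : sets (F m) ==> A' \<subseteq> A m ==>
  (NNI w|M. ind (A' \<inter> A (Suc (m + r))) w * \<phi> (Y (m + r) w, Y (Suc (m + r)) w))
  = (NNI w|M. ind A' w * killed_cost Q J \<phi> r m (Y m w))"
proof (induction r arbitrary: m A')
 case 0
 then show ?case using step[OF \<phi>, of A' m] by simp
next
 case (Suc r)
 have sub: "A (Suc (Suc m + r)) \<subseteq> A (Suc m)" using lift_Suc_antimono_le[of A, OF A(2)] by simp
 have g: "(%(y, z). killed_cost Q J \<phi> r (Suc m) z) : meas (N \<Otimes>\<^sub>M N)"
  using killed_cost_measurable[OF Q J \<phi>, where r=r and m="Suc m"] by measurable
 have "(NNI w|M. ind (A' \<inter> A (Suc (m + Suc r))) w * \<phi> (Y (m + Suc r) w, Y (Suc (m + Suc r)) w))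
   = (NNI w|M. ind ((A' \<inter> A (Suc m)) \<inter> A (Suc (Suc m + r))) w * \<phi> (Y (Suc m + r) w, Y (Suc (Suc m + r)) w))"
  using sub by (intro nn_integral_cong) (auto simp: indicator_def)
 also have "... = (NNI w|M. ind (A' \<inter> A (Suc m)) w * killed_cost Q J \<phi> r (Suc m) (Y (Suc m) w))"
 proof (rule Suc.IH)
  show "A' \<inter> A (Suc m) : sets (F (Suc m))" using Suc.prems(1) F[of m] A(1)[of "Suc m"] by auto
 qed simp
 also have "... = (NNI w|M. ind A' w * killed_cost Q J \<phi> (Suc r) m (Y m w))"
  using step[OF g Suc.prems] by simp
 finally show ?case .
qed

section \<open>The adaptive chain\<close>

locale adaptive_chain = prob_space M for M :: "'w measure" +
 fixes S :: "'a measure" and \<Theta> :: "'p::t2_space set" and P :: "'p => 'a => 'a measure" and K :: "nat => 'p set"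
  and X0 :: "'a set" and \<Theta>0 :: "'p set" and proj :: "'a \<times> 'p => 'a \<times> 'p" and R :: "nat => 'a \<times> 'p => ('a \<times> 'p) measure"
  and X :: "nat => 'w => 'a" and th :: "nat => 'w => 'p" and \<nu> \<xi> :: "nat => 'w => nat" and x0 :: 'a and \<theta>0 :: 'p
 assumes K: "!!n. compact (K n)" "!!n. K n \<subseteq> \<Theta>"
  and X0_Theta0: "X0 \<times> \<Theta>0 : sets (SP S \<Theta>)"
  and proj: "proj : measurable (SP S \<Theta>) (restrict_space (SP S \<Theta>) (X0 \<times> \<Theta>0))"
  and R: "!!n. R n : measurable (SP S \<Theta>) (prob_algebra (SP S \<Theta>))"
  and marginal_R: "!!n x \<theta> A. x : space S ==> \<theta> : \<Theta> ==> A : sets S ==> emeasure (R n (x, \<theta>)) (A \<times> \<Theta>) = emeasure (P \<theta> x) A"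
  and init: "(x0, \<theta>0) : X0 \<times> \<Theta>0"
  and chain: "is_markov_chain M (adaptive_space S \<Theta>) (%_. adaptive_kernel S \<Theta> K proj R) (x0, \<theta>0, 0, 0)
   (%n w. (X n w, th n w, \<nu> n w, \<xi> n w))"
begin

abbreviation "N \<equiv> SP S \<Theta>"
abbreviation "AS \<equiv> adaptive_space S \<Theta>"
abbreviation "AK \<equiv> adaptive_kernel S \<Theta> K proj R"

lemma closed_K: "closed (K n)" using K(1) by (rule compact_imp_closed)

lemma K_sets[measurable]: "K n : sets (param_space \<Theta>)"
 using K(2)[of n] closed_K[of n] borel_closed unfolding param_space_def by (auto simp: sets_restrict_space image_iff)

lemma proj_N[measurable]: "proj : measurable N N"
 using proj by (simp add: measurable_restrict_space2_iff)

lemma proj_range: "y : space N ==> proj y : X0 \<times> \<Theta>0"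
 using measurable_space[OF proj] by (auto simp: space_restrict_space)

lemma AK[measurable]: "AK : measurable AS (prob_algebra AS)"
 by (rule measurable_adaptive_kernel[OF K(2) closed_K proj R])

lemma start: "(x0, \<theta>0) : space N" using init sets.sets_into_space[OF X0_Theta0] by blast

lemma space_AS: "space AS = space S \<times> \<Theta> \<times> UNIV \<times> UNIV"
 by (simp add: adaptive_space_def space_pair_measure)

sublocale mp: markov_process M AS "%_. AK" "(x0, \<theta>0, 0, 0)" "%n w. (X n w, th n w, \<nu> n w, \<xi> n w)"
 using start by unfold_locales (auto simp: space_AS space_pair_measure intro: AK chain)

abbreviation "Z n w \<equiv> (X n w, th n w, \<nu> n w, \<xi> n w)"
abbreviation "F \<equiv> mp.filt"

lemma AS_measurable[measurable]:
 "fst : measurable AS S" "(%y. fst (snd y)) : measurable AS (param_space \<Theta>)"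
 "(%y. fst (snd (snd y))) : measurable AS (count_space UNIV)" "(%y. snd (snd (snd y))) : measurable AS (count_space UNIV)"
 unfolding adaptive_space_def by measurable

lemma coordinates_filt:
 "X n : measurable (F n) S" "th n : measurable (F n) (param_space \<Theta>)" "\<nu> n : measurable (F n) (count_space UNIV)" "\<xi> n : measurable (F n) (count_space UNIV)"
 using measurable_compose[OF mp.Z_filt AS_measurable(1)] measurable_compose[OF mp.Z_filt AS_measurable(2)]
  measurable_compose[OF mp.Z_filt AS_measurable(3)] measurable_compose[OF mp.Z_filt AS_measurable(4)] by simp_all

lemma coordinates_M[measurable]:
 "X n : measurable M S" "th n : measurable M (param_space \<Theta>)" "\<nu> n : measurable M (count_space UNIV)" "\<xi> n : measurable M (count_space UNIV)"
 using coordinates_filt[of n] by (auto intro: measurable_from_subalg[OF mp.subalgebra_filt])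

lemma coordinates_space: "w : space M ==> X n w : space S" "w : space M ==> th n w : \<Theta>"
 using measurable_space[OF coordinates_M(1)] measurable_space[OF coordinates_M(2)] by auto

lemma filt_le: "m <= n ==> f : measurable (F m) B ==> f : measurable (F n) B"
 by (rule subalgebra_sets_mono[where F=F, OF mp.subalgebra_filt mp.filt_mono])

lemma nn_integral_AK:
 assumes y: "x : space S" "\<theta> : \<Theta>" and h[measurable]: "h : meas AS"
 shows "(NNI y|AK (x, \<theta>, v, s). h y) = (NNI z|R (v + s) (if s = 0 then proj (x, \<theta>) else (x, \<theta>)). h (if snd z : K v then (fst z, snd z, v, s + 1) else (fst z, snd z, v + 1, 0)))"
proof -
 let ?y = "if s = 0 then proj (x, \<theta>) else (x, \<theta>)"
 have "(x, \<theta>) : space N" using y by (simp add: space_pair_measure)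
 then have "?y : space N" using measurable_space[OF proj_N] by auto
 then have sR: "sets (R (v + s) ?y) = sets N" using measurable_space[OF R] by (auto simp: space_prob_algebra)
 have "(%z. if snd z : K v then (fst z, snd z, v, s + 1) else (fst z, snd z, v + 1, 0)) : measurable N AS"
  unfolding adaptive_space_def by measurable
 then have m: "(%z. if snd z : K v then (fst z, snd z, v, s + 1) else (fst z, snd z, v + 1, 0)) : measurable (R (v + s) ?y) AS"
  by (simp cong: measurable_cong_sets add: sR)
 show ?thesis
  unfolding adaptive_kernel_def prod.case
  by (simp only: split_beta', rule nn_integral_distr[OF m]) simp
qed

lemma transition:
 "AE w in M. (\<nu> (Suc n) w = \<nu> n w \<and> \<xi> (Suc n) w = Suc (\<xi> n w)) \<or> (\<nu> (Suc n) w = Suc (\<nu> n w) \<and> \<xi> (Suc n) w = 0)"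
proof -
 define h :: "('a \<times> 'p \<times> nat \<times> nat) \<times> ('a \<times> 'p \<times> nat \<times> nat) => ennreal" where
  "h ww = (if (fst (snd (snd (snd ww))) = fst (snd (snd (fst ww))) \<and> snd (snd (snd (snd ww))) = Suc (snd (snd (snd (fst ww)))))
    \<or> (fst (snd (snd (snd ww))) = Suc (fst (snd (snd (fst ww)))) \<and> snd (snd (snd (snd ww))) = 0) then 0 else 1)" for ww
 have hm: "h : meas (AS \<Otimes>\<^sub>M AS)"
 proof -
  note c = AS_measurable(3,4)
  have "(%ww. ((fst (snd (snd (fst ww))), snd (snd (snd (fst ww)))), (fst (snd (snd (snd ww))), snd (snd (snd (snd ww)))))) : measurable (AS \<Otimes>\<^sub>M AS)
   ((count_space UNIV \<Otimes>\<^sub>M count_space UNIV) \<Otimes>\<^sub>M (count_space UNIV \<Otimes>\<^sub>M count_space UNIV))"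
   by (intro measurable_Pair measurable_compose[OF measurable_fst] measurable_compose[OF measurable_snd] c)
  then have m: "(%ww. ((fst (snd (snd (fst ww))), snd (snd (snd (fst ww)))), (fst (snd (snd (snd ww))), snd (snd (snd (snd ww)))))) : measurable (AS \<Otimes>\<^sub>M AS)
   (count_space (UNIV :: ((nat \<times> nat) \<times> (nat \<times> nat)) set))" by (simp add: pair_measure_countable)
  have "(%((v, s), (v', s')). if (v' = v \<and> s' = Suc s) \<or> (v' = Suc v \<and> s' = 0) then 0 else 1 :: ennreal) : meas (count_space (UNIV :: ((nat \<times> nat) \<times> (nat \<times> nat)) set))" by simp
  from measurable_compose[OF m this] show ?thesis by (simp add: h_def[abs_def] split_beta')
 qed
 have "(NNI w|M. ind (space M) w * h (Z n w, Z (Suc n) w)) = (NNI w|M. ind (space M) w * (NNI y|AK (Z n w). h (Z n w, y)))"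
  by (rule mp.markov[OF _ hm]) (use sets.top[of "F n"] in simp)
 also have "... = (NNI w|M. 0)"
 proof (rule nn_integral_cong)
  fix w assume ww: "w : space M"
  have "(%y. h (Z n w, y)) : meas AS" by (rule measurable_compose[OF measurable_Pair1'[OF measurable_space[OF mp.Z_M ww]] hm])
  note AK = nn_integral_AK[OF coordinates_space[OF ww] this]
  have "h (Z n w, if snd z : K (\<nu> n w) then (fst z, snd z, \<nu> n w, \<xi> n w + 1) else (fst z, snd z, \<nu> n w + 1, 0)) = 0" for z
   by (simp add: h_def)
  then have "(NNI y|AK (Z n w). h (Z n w, y)) = 0" unfolding AK by simp
  then show "ind (space M) w * (NNI y|AK (Z n w). h (Z n w, y)) = 0" by simp
 qed
 finally have 0: "(NNI w|M. ind (space M) w * h (Z n w, Z (Suc n) w)) = 0" by simp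
 have m: "(%w. ind (space M) w * h (Z n w, Z (Suc n) w)) : meas M"
  using measurable_compose[OF measurable_Pair[OF mp.Z_M[of n] mp.Z_M[of "Suc n"]] hm] by measurable
 have "AE w in M. ind (space M) w * h (Z n w, Z (Suc n) w) = 0" using 0 unfolding nn_integral_0_iff_AE[OF m] .
 then show ?thesis using AE_space
 proof eventually_elim
  case (elim w)
  then show ?case by (simp add: h_def split: if_splits)
 qed
qed

lemma transitions: "AE w in M. \<forall>n. (\<nu> (Suc n) w = \<nu> n w \<and> \<xi> (Suc n) w = Suc (\<xi> n w)) \<or> (\<nu> (Suc n) w = Suc (\<nu> n w) \<and> \<xi> (Suc n) w = 0)"
 by (subst AE_all_countable) (intro allI transition)

lemma initial_xi: "AE w in M. \<xi> 0 w = 0"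
proof -
 define u :: "'a \<times> 'p \<times> nat \<times> nat => ennreal" where "u y = (if snd (snd (snd y)) = 0 then 0 else 1)" for y
 have um: "u : meas AS"
  using measurable_compose[OF AS_measurable(4), of "%k. if k = 0 then 0 else 1" borel] by (simp add: u_def[abs_def])
 have "(NNI w|M. u (Z 0 w)) = 0" unfolding mp.nn_integral_initial[OF um] by (simp add: u_def)
 moreover have "(%w. u (Z 0 w)) : meas M" by (rule measurable_compose[OF mp.Z_M um])
 ultimately have "AE w in M. u (Z 0 w) = 0" by (simp add: nn_integral_0_iff_AE)
 then show ?thesis by eventually_elim (simp add: u_def split: if_splits)
qed

text \<open>
 Each return of \<open>\<xi>\<close> to zero raises \<open>\<nu>\<close>.
\<close>

lemma reprojections_finite:
 assumes "AE w in M. bdd_above (range (%n. \<nu> n w))"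
 shows "AE w in M. \<exists>m. \<forall>n\<ge>m. 0 < \<xi> n w"
 using assms transitions
proof eventually_elim
 case (elim w)
 note tr = elim(2)[rule_format]
 have mono: "\<nu> m w <= \<nu> n w" if "m <= n" for m n
  by (rule lift_Suc_mono_le[of "%n. \<nu> n w", OF _ that]) (use tr in \<open>metis le_SucI order_refl\<close>)
 show ?case
 proof (rule ccontr)
  assume "\<not> ?case"
  then have io: "\<exists>n\<ge>m. \<xi> n w = 0" for m by auto
  have "\<exists>n. b <= \<nu> n w" for b
  proof (induction b)
   case (Suc b)
   then obtain n where n: "b <= \<nu> n w" by blast
   obtain m where m: "Suc n <= m" "\<xi> m w = 0" using io by blast
   then obtain k where k: "m = Suc k" by (cases m) auto
   then have "\<nu> m w = Suc (\<nu> k w)" using tr[of k] m by auto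
   then show ?case using mono[of n k] m k n by (intro exI[of _ m]) auto
  qed simp
  moreover obtain b where "!!n. \<nu> n w <= b" using elim(1) by (auto simp: bdd_above_def)
  ultimately show False using not_less_eq_eq by (metis order_trans)
 qed
qed

lemma last_reprojection:
 assumes tr: "\<forall>n. (\<nu> (Suc n) w = \<nu> n w \<and> \<xi> (Suc n) w = Suc (\<xi> n w)) \<or> (\<nu> (Suc n) w = Suc (\<nu> n w) \<and> \<xi> (Suc n) w = 0)"
  and 0: "\<xi> 0 w = 0" and m: "\<forall>n\<ge>m. 0 < \<xi> n w"
 obtains j where "j < m" "!!i. \<nu> (j + i) w = \<nu> j w \<and> \<xi> (j + i) w = i"
proof -
 define j where "j = Max {n. n <= m \<and> \<xi> n w = 0}"
 have fin: "finite {n. n <= m \<and> \<xi> n w = 0}" by simp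
 have "j : {n. n <= m \<and> \<xi> n w = 0}" unfolding j_def using 0 by (intro Max_in) auto
 then have j: "j <= m" "\<xi> j w = 0" by auto
 then have "j < m" using m by (metis le_neq_implies_less less_irrefl order_refl)
 have pos: "0 < \<xi> n w" if "j < n" for n
 proof (rule ccontr)
  assume "\<not> 0 < \<xi> n w"
  then have "\<xi> n w = 0" by simp
  moreover from this have "n <= m" using m by (metis less_irrefl nat_le_linear)
  ultimately have "n <= j" unfolding j_def by (intro Max_ge fin) auto
  with that show False by simp
 qed
 have "\<nu> (j + i) w = \<nu> j w \<and> \<xi> (j + i) w = i" for i
 proof (induction i)
  case (Suc i)
  then show ?case using tr[rule_format, of "j + i"] pos[of "j + Suc i"] by auto
 qed (use j in simp)
 with \<open>j < m\<close> show ?thesis using that by blast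
qed

lemma first_marginal:
 assumes P: "!!\<theta>. \<theta> : \<Theta> ==> P \<theta> : measurable S (prob_algebra S)" and z: "(x, \<theta>) : space N"
 shows "distr (R n (x, \<theta>)) S fst = P \<theta> x" and "fst : measurable (R n (x, \<theta>)) S"
proof -
 have zS: "x : space S" "\<theta> : \<Theta>" using z by (auto simp: space_pair_measure)
 have sR: "sets (R n (x, \<theta>)) = sets N" using measurable_space[OF R z] by (simp add: space_prob_algebra)
 show fm: "fst : measurable (R n (x, \<theta>)) S" using measurable_fst[of S "param_space \<Theta>"] by (simp cong: measurable_cong_sets add: sR)
 show "distr (R n (x, \<theta>)) S fst = P \<theta> x"
 proof (rule measure_eqI)
  show "sets (distr (R n (x, \<theta>)) S fst) = sets (P \<theta> x)" using measurable_space[OF P[OF zS(2)] zS(1)] by (simp add: space_prob_algebra)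
  fix A assume "A : sets (distr (R n (x, \<theta>)) S fst)"
  then have A: "A : sets S" by simp
  have "fst -` A \<inter> space (R n (x, \<theta>)) = A \<times> \<Theta>"
   using sets_eq_imp_space_eq[OF sR] sets.sets_into_space[OF A] by (auto simp: space_pair_measure)
  then show "emeasure (distr (R n (x, \<theta>)) S fst) A = emeasure (P \<theta> x) A"
   using marginal_R[OF zS A, of n] by (simp add: emeasure_distr[OF fm A])
 qed
qed

text \<open>
 The kernel \<open>R 0\<close> is jointly measurable, and \<open>P\<close> is its first marginal.
\<close>

lemma P_joint:
 assumes P: "!!\<theta>. \<theta> : \<Theta> ==> P \<theta> : measurable S (prob_algebra S)"
 shows "(%z. P (snd z) (fst z)) : measurable N (prob_algebra S)"
proof -
 have "(%z. distr (R 0 z) S fst) : measurable N (prob_algebra S)" by (rule measurable_distr_prob_space2[OF R]) measurable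
 moreover have "distr (R 0 z) S fst = P (snd z) (fst z)" if "z : space N" for z using first_marginal(1)[OF P, of "fst z" "snd z" 0] that by simp
 ultimately show ?thesis by (simp cong: measurable_cong)
qed

text \<open>
 The projection acts only when \<open>\<xi> = 0\<close>; otherwise the next state has law \<open>P (th n w) (X n w)\<close>.
\<close>

lemma X_marginal:
 assumes P: "!!\<theta>. \<theta> : \<Theta> ==> P \<theta> : measurable S (prob_algebra S)"
  and A: "A : sets (F n)" "!!w. w : A ==> 0 < \<xi> n w" and h[measurable]: "h : meas (N \<Otimes>\<^sub>M S)"
 shows "(NNI w|M. ind A w * h ((X n w, th n w), X (Suc n) w))
  = (NNI w|M. ind A w * (NNI y|P (th n w) (X n w). h ((X n w, th n w), y)))"
proof -
 have hm: "(%ww. h ((fst (fst ww), fst (snd (fst ww))), fst (snd ww))) : meas (AS \<Otimes>\<^sub>M AS)" by measurable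
 have "(NNI w|M. ind A w * h ((X n w, th n w), X (Suc n) w)) = (NNI w|M. ind A w * (NNI y|AK (Z n w). h ((X n w, th n w), fst y)))"
  using mp.markov[OF A(1) hm] by simp
 also have "... = (NNI w|M. ind A w * (NNI y|P (th n w) (X n w). h ((X n w, th n w), y)))"
 proof (rule nn_integral_cong)
  fix w assume ww: "w : space M"
  show "ind A w * (NNI y|AK (Z n w). h ((X n w, th n w), fst y)) = ind A w * (NNI y|P (th n w) (X n w). h ((X n w, th n w), y))"
  proof (cases "w : A")
   case True
   let ?y = "(X n w, th n w)"
   have y: "?y : space N" using coordinates_space[OF ww] by (simp add: space_pair_measure)
   have hS: "(%x. h (?y, x)) : meas S" by (rule measurable_compose[OF measurable_Pair1'[OF y] h])
   have "(NNI y|AK (Z n w). h (?y, fst y)) = (NNI z|R (\<nu> n w + \<xi> n w) ?y. h (?y, fst z))"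
    using A(2)[OF True] measurable_compose[OF AS_measurable(1) hS]
    by (subst nn_integral_AK[OF coordinates_space[OF ww]]) (auto intro!: nn_integral_cong simp: if_distrib[of fst] cong: if_cong)
   also have "... = (NNI x|distr (R (\<nu> n w + \<xi> n w) ?y) S fst. h (?y, x))"
    by (rule nn_integral_distr[OF first_marginal(2)[OF P y], symmetric]) (use hS in simp_all)
   also have "... = (NNI x|P (th n w) (X n w). h (?y, x))" by (simp only: first_marginal(1)[OF P y])
   finally show ?thesis by simp
  qed simp
 qed
 finally show ?thesis .
qed

subsection \<open>Excursions between two re-projections\<close>

definition J :: "nat => ('a \<times> 'p) set" where "J l = space S \<times> K l"

lemma J[measurable]: "J l : sets N" unfolding J_def by measurable

definition excursion_cost :: "(('a \<times> 'p) \<times> ('a \<times> 'p) => ennreal) => nat => nat => 'a \<times> 'p => ennreal" where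
 "excursion_cost \<phi> l r = killed_cost (%m. R (l + m)) (J l) \<phi> r 0"

lemma excursion_cost_measurable[measurable]: "\<phi> : meas (N \<Otimes>\<^sub>M N) ==> excursion_cost \<phi> l r : meas N"
 unfolding excursion_cost_def by (rule killed_cost_measurable[OF R J])

lemma excursion_cost_chain_law:
 assumes \<phi>[measurable]: "\<phi> : meas (N \<Otimes>\<^sub>M N)" and y: "y : space N"
 shows "excursion_cost \<phi> l r y = (NNI ww|chain_law N (%n. R (l + n)) y. ind {ww. \<forall>i. 1 <= i \<and> i <= Suc r --> ww i : J l} ww * \<phi> (ww r, ww (Suc r)))"
proof -
 let ?L = "chain_law N (%n. R (l + n)) y"
 interpret L: markov_process ?L N "%n. R (l + n)" y "%n ww. ww n" by (rule chain_law_markov_process[OF R y])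
 define A where "A m = {ww : space ?L. \<forall>i\<in>{1..m}. ww i : J l}" for m
 have A: "A m : sets (L.filt m)" for m
 proof -
  have [measurable]: "(%ww. ww i) : measurable (L.filt m) N" if "i : {1..m}" for i
   using L.subalgebra_sets_mono[where F=L.filt, OF L.subalgebra_filt L.filt_mono _ L.Z_filt, of i m] that by auto
  have "{ww : space (L.filt m). \<forall>i\<in>{1..m}. ww i : J l} : sets (L.filt m)" by measurable
  then show ?thesis by (simp add: A_def)
 qed
 have "(NNI ww|?L. ind {ww. \<forall>i. 1 <= i \<and> i <= Suc r --> ww i : J l} ww * \<phi> (ww r, ww (Suc r)))
  = (NNI ww|?L. ind (space ?L \<inter> A (Suc (0 + r))) ww * \<phi> ((%n ww. ww n) (0 + r) ww, (%n ww. ww n) (Suc (0 + r)) ww))"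
  by (intro nn_integral_cong) (auto simp: A_def indicator_def)
 also have "(NNI ww|?L. ind (space ?L \<inter> A (Suc (0 + r))) ww * \<phi> ((%n ww. ww n) (0 + r) ww, (%n ww. ww n) (Suc (0 + r)) ww))
  = (NNI ww|?L. ind (space ?L) ww * killed_cost (%m. R (l + m)) (J l) \<phi> r 0 ((%n ww. ww n) 0 ww))"
 proof (rule killed_cost_nn_integral[where F=L.filt and A=A, OF R J \<phi> L.filt_mono A])
  show "A (Suc m) \<subseteq> A m" for m by (auto simp: A_def)
  show "space ?L : sets (L.filt 0)" using sets.top[of "L.filt 0"] by simp
  show "space ?L \<subseteq> A 0" by (auto simp: A_def)
  fix m A' and g :: "('a \<times> 'p) \<times> ('a \<times> 'p) => ennreal" assume g[measurable]: "g : meas (N \<Otimes>\<^sub>M N)" and A': "A' : sets (L.filt m)" "A' \<subseteq> A m"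
  have "(NNI ww|?L. ind (A' \<inter> A (Suc m)) ww * g (ww m, ww (Suc m))) = (NNI ww|?L. ind A' ww * (%z. ind (J l) (snd z) * g z) (ww m, ww (Suc m)))"
  proof (rule nn_integral_cong)
   fix ww
   have "ww : A (Suc m) \<longleftrightarrow> ww (Suc m) : J l" if "ww : A'"
    using A'(2) that by (auto simp: A_def atLeastAtMostSuc_conv)
   then show "ind (A' \<inter> A (Suc m)) ww * g (ww m, ww (Suc m)) = ind A' ww * (%z. ind (J l) (snd z) * g z) (ww m, ww (Suc m))"
    by (cases "ww : A'") (auto simp: indicator_def)
  qed
  also have "... = (NNI ww|?L. ind A' ww * (NNI z|R (l + m) (ww m). (%z. ind (J l) (snd z) * g z) (ww m, z)))"
   by (rule L.markov[OF A'(1)]) measurable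
  finally show "(NNI ww|?L. ind (A' \<inter> A (Suc m)) ww * g (ww m, ww (Suc m))) = (NNI ww|?L. ind A' ww * (NNI z|R (l + m) (ww m). ind (J l) z * g (ww m, z)))" by simp
 qed
 also have "... = (NNI ww|?L. excursion_cost \<phi> l r (ww 0))"
  by (intro nn_integral_cong) (simp add: excursion_cost_def)
 also have "... = excursion_cost \<phi> l r y" by (rule L.nn_integral_initial) measurable
 finally show ?thesis by (rule sym)
qed

text \<open>
 \<open>A m\<close> says that an excursion with \<open>\<nu> = l\<close> starts at time \<open>j\<close>, after projection in \<open>B\<close>, and that no
 re-projection occurs in the \<open>m\<close> steps since. Then \<open>\<xi> = m\<close> at time \<open>j + m\<close>, so that the next step
 uses \<open>R (l + m)\<close> and \<open>\<xi>\<close> increases precisely if the new parameter is in \<open>K l\<close>. The projection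
 changes the state only at the start.
\<close>

lemma excursion_cost_adaptive:
 fixes j l :: nat
 assumes \<phi>[measurable]: "\<phi> : meas (N \<Otimes>\<^sub>M N)" and B[measurable]: "B : sets N"
 defines "Y m w \<equiv> if m = 0 then proj (X j w, th j w) else (X (j + m) w, th (j + m) w)"
 defines "A m \<equiv> {w : space M. Y 0 w : B \<and> (\<forall>i\<in>{..m}. \<nu> (j + i) w = l \<and> \<xi> (j + i) w = i)}"
 shows "(NNI w|M. ind (A (Suc r)) w * \<phi> (Y r w, Y (Suc r) w)) = (NNI w|M. ind (A 0) w * excursion_cost \<phi> l r (Y 0 w))"
proof -
 have YF: "Y m : measurable (F (j + m)) N" for m
 proof -
  have "(%w. (X (j + m) w, th (j + m) w)) : measurable (F (j + m)) N" by (rule measurable_Pair[OF coordinates_filt(1,2)])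
  moreover from measurable_compose[OF this proj_N] have "(%w. proj (X (j + m) w, th (j + m) w)) : measurable (F (j + m)) N" .
  ultimately show ?thesis unfolding Y_def by (cases "m = 0") simp_all
 qed
 have AF: "A m : sets (F (j + m))" for m
 proof -
  have [measurable]: "Y 0 : measurable (F (j + m)) N" by (rule filt_le[OF _ YF]) simp
  have [measurable]: "\<nu> (j + i) : measurable (F (j + m)) (count_space UNIV)" "\<xi> (j + i) : measurable (F (j + m)) (count_space UNIV)" if "i : {..m}" for i
   using that by (auto intro: filt_le[OF _ coordinates_filt(3)] filt_le[OF _ coordinates_filt(4)])
  have "{w : space (F (j + m)). Y 0 w : B \<and> (\<forall>i\<in>{..m}. \<nu> (j + i) w = l \<and> \<xi> (j + i) w = i)} : sets (F (j + m))" by measurable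
  then show ?thesis by (simp add: A_def)
 qed
 have Adec: "A (Suc m) \<subseteq> A m" for m by (auto simp: A_def)
 have "(NNI w|M. ind (A 0 \<inter> A (Suc (0 + r))) w * \<phi> (Y (0 + r) w, Y (Suc (0 + r)) w))
  = (NNI w|M. ind (A 0) w * killed_cost (%m. R (l + m)) (J l) \<phi> r 0 (Y 0 w))"
 proof (rule killed_cost_nn_integral[where F="%m. F (j + m)" and A=A, OF R J \<phi> _ AF])
  show "sets (F (j + m)) \<subseteq> sets (F (j + Suc m))" for m using mp.filt_mono[of "j + m"] by simp
  show "A (Suc m) \<subseteq> A m" for m by (rule Adec)
  show "A 0 : sets (F (j + 0))" by (rule AF)
  fix m A' and g :: "('a \<times> 'p) \<times> ('a \<times> 'p) => ennreal" assume g[measurable]: "g : meas (N \<Otimes>\<^sub>M N)" and A': "A' : sets (F (j + m))" "A' \<subseteq> A m"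
  define y0 where "y0 z = (if m = 0 then proj (fst z, fst (snd z)) else (fst z, fst (snd z)))" for z :: "'a \<times> 'p \<times> nat \<times> nat"
  have y0[measurable]: "y0 : measurable AS N" unfolding y0_def by (cases "m = 0") simp_all
  have Yy: "Y m w = y0 (Z (j + m) w)" for w by (simp add: Y_def y0_def)
  define h where "h ww = ind {(l, Suc m)} (snd (snd (snd ww))) * g (fst ww, (fst (snd ww), fst (snd (snd ww))))" for ww :: "('a \<times> 'p) \<times> ('a \<times> 'p \<times> nat \<times> nat)"
  have hm[measurable]: "h : meas (N \<Otimes>\<^sub>M AS)"
  proof -
   have "(%ww. snd (snd (snd ww))) : measurable (N \<Otimes>\<^sub>M AS) (count_space UNIV \<Otimes>\<^sub>M count_space UNIV)" unfolding adaptive_space_def by measurable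
   then have [measurable]: "(%ww. snd (snd (snd ww))) : measurable (N \<Otimes>\<^sub>M AS) (count_space (UNIV :: (nat \<times> nat) set))" by (simp add: pair_measure_countable)
   have [measurable]: "{(l, Suc m)} : sets (count_space (UNIV :: (nat \<times> nat) set))" by simp
   have "(%ww. (fst ww, (fst (snd ww), fst (snd (snd ww))))) : measurable (N \<Otimes>\<^sub>M AS) (N \<Otimes>\<^sub>M N)" by measurable
   from measurable_compose[OF this g] show ?thesis unfolding h_def by measurable
  qed
  have "(NNI w|M. ind (A' \<inter> A (Suc m)) w * g (Y m w, Y (Suc m) w)) = (NNI w|M. ind A' w * h (Y m w, Z (Suc (j + m)) w))"
  proof (rule nn_integral_cong)
   fix w assume ww: "w : space M"
   have "w : A (Suc m) \<longleftrightarrow> (\<nu> (Suc (j + m)) w, \<xi> (Suc (j + m)) w) = (l, Suc m)" if "w : A'"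
   proof -
    have "w : A m" using that A' by auto
    then show ?thesis using ww by (auto simp: A_def atMost_Suc)
   qed
   moreover have "Y (Suc m) w = (X (Suc (j + m)) w, th (Suc (j + m)) w)" by (simp add: Y_def)
   ultimately show "ind (A' \<inter> A (Suc m)) w * g (Y m w, Y (Suc m) w) = ind A' w * h (Y m w, Z (Suc (j + m)) w)"
    by (cases "w : A'") (simp_all add: h_def indicator_def)
  qed
  also have "... = (NNI w|M. ind A' w * (NNI y|AK (Z (j + m) w). h (Y m w, y)))"
   unfolding Yy using mp.markov[OF A'(1), of "%ww. h (y0 (fst ww), snd ww)"] by simp
  also have "... = (NNI w|M. ind A' w * (NNI z|R (l + m) (Y m w). ind (J l) z * g (Y m w, z)))"
  proof (rule nn_integral_cong)
   fix w assume ww: "w : space M"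
   show "ind A' w * (NNI y|AK (Z (j + m) w). h (Y m w, y)) = ind A' w * (NNI z|R (l + m) (Y m w). ind (J l) z * g (Y m w, z))"
   proof (cases "w : A'")
    case True
    then have "w : A m" using A' by auto
    then have nx: "\<nu> (j + m) w = l" "\<xi> (j + m) w = m" by (auto simp: A_def)
    have Ym: "(if m = 0 then proj (X (j + m) w, th (j + m) w) else (X (j + m) w, th (j + m) w)) = Y m w" by (simp add: Y_def)
    have Ys: "Y m w : space N"
     using measurable_space[OF measurable_from_subalg[OF mp.subalgebra_filt YF] ww] .
    have "sets (R (l + m) (Y m w)) = sets N" using measurable_space[OF R Ys, of "l + m"] by (simp add: space_prob_algebra)
    then have sR: "space (R (l + m) (Y m w)) = space N" by (rule sets_eq_imp_space_eq)
    have "(%y. h (Y m w, y)) : meas AS" by (rule measurable_compose[OF measurable_Pair1'[OF Ys] hm])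
    then have "(NNI y|AK (Z (j + m) w). h (Y m w, y)) = (NNI z|R (l + m) (Y m w). ind (J l) z * g (Y m w, z))"
     unfolding nx by (subst nn_integral_AK[OF coordinates_space[OF ww]], assumption, unfold Ym)
      (auto intro!: nn_integral_cong simp: h_def J_def indicator_def sR space_pair_measure)
    then show ?thesis by simp
   qed simp
  qed
  finally show "(NNI w|M. ind (A' \<inter> A (Suc m)) w * g (Y m w, Y (Suc m) w)) = (NNI w|M. ind A' w * (NNI z|R (l + m) (Y m w). ind (J l) z * g (Y m w, z)))" .
 qed simp
 moreover have "A 0 \<inter> A (Suc r) = A (Suc r)" using lift_Suc_antimono_le[of A 0 "Suc r", OF Adec] by auto
 ultimately show ?thesis by (simp add: excursion_cost_def)
qed


lemma suminf_ennreal_shift_le: "(\<Sum>k. u (k + d)) <= (\<Sum>k. u k :: ennreal)"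
 using suminf_offset[of u d] by (simp add: le_iff_add add.commute[of _ "sum u {..<d}"])

text \<open>
 The expected cost of an excursion is finite for each starting point, but it may be unbounded over
 them. So the starting points are divided into the levels \<open>B l q\<close>, on each of which the expectation
 is finite. The first step is left out of the conclusion because it starts from the projected state.
\<close>

lemma excursion_series_finite:
 assumes \<phi>[measurable]: "\<phi> : meas (N \<Otimes>\<^sub>M N)"
  and fin: "!!y l. y : X0 \<times> \<Theta>0 ==> (\<Sum>r. c r * excursion_cost \<phi> l r y) < \<infinity>"
 shows "AE w in M. \<forall>j l. (\<forall>i. \<nu> (j + i) w = l \<and> \<xi> (j + i) w = i) -->
  (\<Sum>r. c (Suc r) * \<phi> ((X (j + Suc r) w, th (j + Suc r) w), (X (j + Suc (Suc r)) w, th (j + Suc (Suc r)) w))) < \<infinity>"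
proof -
 define H where "H l y = (\<Sum>r. c r * excursion_cost \<phi> l r y)" for l y
 have Hm[measurable]: "H l : meas N" for l unfolding H_def by measurable
 define Y where "Y j m w = (if m = 0 then proj (X j w, th j w) else (X (j + m) w, th (j + m) w))" for j m w
 define B where "B l q = {y : space N. H l y <= of_nat q}" for l q :: nat
 have [measurable]: "B l q : sets N" for l q unfolding B_def by measurable
 define A where "A j l q m = {w : space M. Y j 0 w : B l q \<and> (\<forall>i\<in>{..m}. \<nu> (j + i) w = l \<and> \<xi> (j + i) w = i)}" for j l q m
 have Ym[measurable]: "Y j m : measurable M N" for j m unfolding Y_def by (cases "m = 0") simp_all
 have [measurable]: "A j l q m : sets M" for j l q m unfolding A_def by measurable
 have "AE w in M. (\<Sum>r. c r * (ind (A j l q (Suc r)) w * \<phi> (Y j r w, Y j (Suc r) w))) \<noteq> \<infinity>" for j l q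
 proof (rule nn_integral_PInf_AE)
  show "(%w. \<Sum>r. c r * (ind (A j l q (Suc r)) w * \<phi> (Y j r w, Y j (Suc r) w))) : meas M" by measurable
  have "(NNI w|M. (\<Sum>r. c r * (ind (A j l q (Suc r)) w * \<phi> (Y j r w, Y j (Suc r) w))))
    = (\<Sum>r. c r * (NNI w|M. ind (A j l q (Suc r)) w * \<phi> (Y j r w, Y j (Suc r) w)))"
   by (subst nn_integral_suminf) (measurable, simp add: nn_integral_cmult)
  also have "... = (\<Sum>r. c r * (NNI w|M. ind (A j l q 0) w * excursion_cost \<phi> l r (Y j 0 w)))"
  proof (rule suminf_cong)
   fix r
   have "(NNI w|M. ind (A j l q (Suc r)) w * \<phi> (Y j r w, Y j (Suc r) w)) = (NNI w|M. ind (A j l q 0) w * excursion_cost \<phi> l r (Y j 0 w))"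
    unfolding A_def Y_def by (rule excursion_cost_adaptive[OF \<phi>]) measurable
   then show "c r * (NNI w|M. ind (A j l q (Suc r)) w * \<phi> (Y j r w, Y j (Suc r) w)) = c r * (NNI w|M. ind (A j l q 0) w * excursion_cost \<phi> l r (Y j 0 w))" by simp
  qed
  also have "... = (NNI w|M. (\<Sum>r. c r * (ind (A j l q 0) w * excursion_cost \<phi> l r (Y j 0 w))))"
   by (subst nn_integral_suminf) (measurable, simp add: nn_integral_cmult)
  also have "... <= (NNI w|M. of_nat q)"
  proof (rule nn_integral_mono)
   fix w
   show "(\<Sum>r. c r * (ind (A j l q 0) w * excursion_cost \<phi> l r (Y j 0 w))) <= of_nat q"
    by (cases "w : A j l q 0") (simp_all add: A_def B_def H_def)
  qed
  also have "... < \<infinity>" by (simp add: emeasure_space_1 of_nat_less_top)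
  finally show "(NNI w|M. (\<Sum>r. c r * (ind (A j l q (Suc r)) w * \<phi> (Y j r w, Y j (Suc r) w)))) \<noteq> \<infinity>" by simp
 qed
 then have "AE w in M. \<forall>j l q. (\<Sum>r. c r * (ind (A j l q (Suc r)) w * \<phi> (Y j r w, Y j (Suc r) w))) \<noteq> \<infinity>"
  by (simp add: AE_all_countable)
 then show ?thesis using AE_space
 proof eventually_elim
  case (elim w)
  show ?case
  proof (intro allI impI)
   fix j l assume stay: "\<forall>i. \<nu> (j + i) w = l \<and> \<xi> (j + i) w = i"
   have "(X j w, th j w) : space N" using coordinates_space[OF elim(2)] by (simp add: space_pair_measure)
   then have "Y j 0 w : X0 \<times> \<Theta>0" and YN: "Y j 0 w : space N"
    using proj_range measurable_space[OF proj_N] by (auto simp: Y_def)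
   then have "H l (Y j 0 w) < \<infinity>" unfolding H_def by (intro fin)
   then obtain q :: nat where "H l (Y j 0 w) < of_nat q" using ennreal_Ex_less_of_nat by auto
   then have "w : A j l q (Suc r)" for r using stay YN elim(2) by (auto simp: A_def B_def)
   then have "(\<Sum>r. c r * \<phi> (Y j r w, Y j (Suc r) w)) < \<infinity>" using elim(1)[rule_format, of j l q] by (simp add: less_top)
   from order.strict_trans1[OF suminf_ennreal_shift_le[of "%r. c r * \<phi> (Y j r w, Y j (Suc r) w)" 1] this]
   show "(\<Sum>r. c (Suc r) * \<phi> ((X (j + Suc r) w, th (j + Suc r) w), (X (j + Suc (Suc r)) w, th (j + Suc (Suc r)) w))) < \<infinity>"
    by (simp add: Y_def)
  qed
 qed
qed

text \<open>
 The right-hand integrand need not be measurable; the integral is nevertheless monotone, and the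
 summation is carried out on the left, where everything is measurable.
\<close>

lemma excursion_cost_series:
 fixes e s :: real and W :: "'a => ennreal" and D :: "'p => 'p => ennreal"
 assumes \<phi>[measurable]: "\<phi> : meas (N \<Otimes>\<^sub>M N)" and y: "y : space N"
  and le: "!!y z. y : space N ==> z : space N ==> \<phi> (y, z) <= D (snd z) (snd y) * W (fst z)"
 shows "(\<Sum>r. ennreal (real (Suc r) powr s) * excursion_cost \<phi> l r y)
  <= (NNI ww|chain_law N (%n. R (l + n)) y. (\<Sum>k. ind {k. 1 <= k \<and> enat k < exit_time (K l) ww} k * ennreal (real k powr s) * D (snd (ww k)) (snd (ww (k - 1))) * W (fst (ww k))))"
proof -
 let ?L = "chain_law N (%n. R (l + n)) y"
 interpret L: markov_process ?L N "%n. R (l + n)" y "%n ww. ww n" by (rule chain_law_markov_process[OF R y])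
 have [measurable]: "(%ww. ww n) : measurable ?L N" for n by (rule L.Z_M)
 let ?i = "%r. ind {ww. \<forall>i. 1 <= i \<and> i <= Suc r --> ww i : J l} :: (nat => 'a \<times> 'p) => ennreal"
 have im[measurable]: "?i r : meas ?L" for r
 proof -
  have "{ww : space ?L. \<forall>i\<in>{1..Suc r}. ww i : J l} : sets ?L" by measurable
  then have "(ind {ww : space ?L. \<forall>i\<in>{1..Suc r}. ww i : J l} :: _ => ennreal) : meas ?L" by simp
  then show ?thesis by (rule measurable_cong[THEN iffD1, rotated]) (auto simp: indicator_def)
 qed
 have "(\<Sum>r. ennreal (real (Suc r) powr s) * excursion_cost \<phi> l r y)
  = (\<Sum>r. ennreal (real (Suc r) powr s) * (NNI ww|?L. ?i r ww * \<phi> (ww r, ww (Suc r))))"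
  by (simp only: excursion_cost_chain_law[OF \<phi> y])
 also have "... = (NNI ww|?L. (\<Sum>r. ennreal (real (Suc r) powr s) * (?i r ww * \<phi> (ww r, ww (Suc r)))))"
  by (subst nn_integral_suminf) (measurable, simp add: nn_integral_cmult)
 also have "... <= (NNI ww|?L. (\<Sum>k. ind {k. 1 <= k \<and> enat k < exit_time (K l) ww} k * ennreal (real k powr s) * D (snd (ww k)) (snd (ww (k - 1))) * W (fst (ww k))))"
 proof (rule nn_integral_mono)
  fix ww assume ww: "ww : space ?L"
  have wN: "ww n : space N" for n using measurable_space[OF L.Z_M ww] .
  let ?T = "%k. ind {k. 1 <= k \<and> enat k < exit_time (K l) ww} k * ennreal (real k powr s) * D (snd (ww k)) (snd (ww (k - 1))) * W (fst (ww k))"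
  have "(\<Sum>r. ennreal (real (Suc r) powr s) * (?i r ww * \<phi> (ww r, ww (Suc r)))) <= (\<Sum>r. ?T (r + 1))"
  proof (intro suminf_le)
   fix r
   show "ennreal (real (Suc r) powr s) * (?i r ww * \<phi> (ww r, ww (Suc r))) <= ?T (r + 1)"
   proof (cases "\<forall>i. 1 <= i \<and> i <= Suc r --> ww i : J l")
    case True
    have "enat (Suc (Suc r)) <= exit_time (K l) ww"
     unfolding exit_time_def
    proof (rule INF_greatest)
     fix k assume "k : {k. 1 <= k \<and> snd (ww k) \<notin> K l}"
     then have "\<not> k <= Suc r" using True by (auto simp: J_def)
     then show "enat (Suc (Suc r)) <= enat k" by simp
    qed
    then have "enat (Suc r) < exit_time (K l) ww" by (rule order.strict_trans2[rotated]) simp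
    then have "?T (r + 1) = ennreal (real (Suc r) powr s) * (D (snd (ww (Suc r))) (snd (ww r)) * W (fst (ww (Suc r))))" by (simp add: mult.assoc)
    moreover have "?i r ww = 1" using True by simp
    ultimately show ?thesis using le[OF wN wN, of r "Suc r"] by (simp add: mult_left_mono)
   next
    case False
    then have "?i r ww = 0" by simp
    then show ?thesis by (simp only: mult_zero_left mult_zero_right zero_le)
   qed
  qed auto
  also have "... <= (\<Sum>k. ?T k)" by (rule suminf_ennreal_shift_le)
  finally show "(\<Sum>r. ennreal (real (Suc r) powr s) * (?i r ww * \<phi> (ww r, ww (Suc r)))) <= (\<Sum>k. ?T k)" .
 qed
 finally show ?thesis .
qed

text \<open>
 After its last re-projection, at a time \<open>j < m\<close>, the path is an excursion. Passing from the time
 since \<open>j\<close> to the time since \<open>m\<close> changes the weights by a bounded factor.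
\<close>

lemma diminishing_adaptation_series:
 fixes s :: real and D :: "'p => 'p => ennreal" and W :: "'a => ennreal"
 assumes s: "s <= 0" and C: "compact C" "C \<subseteq> \<Theta>" and \<psi>[measurable]: "\<psi> : meas (S \<Otimes>\<^sub>M (param_space \<Theta> \<Otimes>\<^sub>M param_space \<Theta>))"
  and le: "!!x \<theta> \<theta>'. x : space S ==> \<theta> : C ==> \<theta>' : C ==> \<psi> (x, \<theta>, \<theta>') <= D \<theta> \<theta>' * W x"
  and fin: "!!x \<theta> l. (x, \<theta>) : X0 \<times> \<Theta>0 ==>
   (NNI ww|chain_law N (%n. R (l + n)) (x, \<theta>). (\<Sum>k. ind {k. 1 <= k \<and> enat k < exit_time (K l) ww} k * ennreal (real k powr s) * D (snd (ww k)) (snd (ww (k - 1))) * W (fst (ww k)))) < \<infinity>"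
 shows "AE w in M. (\<forall>n. th n w : C) \<and> (\<forall>n\<ge>m. 0 < \<xi> n w) -->
  (\<Sum>k. ennreal (real (k + 1) powr s) * \<psi> (X (m + Suc k) w, th (m + Suc k) w, th (m + k) w)) < \<infinity>"
proof -
 have Cs[measurable]: "C : sets (param_space \<Theta>)"
  using C compact_imp_closed[OF C(1)] borel_closed unfolding param_space_def by (auto simp: sets_restrict_space image_iff)
 define \<phi> where "\<phi> ww = \<psi> (fst (snd ww), snd (snd ww), snd (fst ww)) * (ind C (snd (snd ww)) * ind C (snd (fst ww)))" for ww :: "('a \<times> 'p) \<times> ('a \<times> 'p)"
 have \<phi>m: "\<phi> : meas (N \<Otimes>\<^sub>M N)"
 proof -
  have "(%ww. (fst (snd ww), snd (snd ww), snd (fst ww))) : measurable (N \<Otimes>\<^sub>M N) (S \<Otimes>\<^sub>M (param_space \<Theta> \<Otimes>\<^sub>M param_space \<Theta>))" by measurable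
  from measurable_compose[OF this \<psi>] show ?thesis unfolding \<phi>_def by measurable
 qed
 have \<phi>_le: "\<phi> (y, z) <= D (snd z) (snd y) * W (fst z)" if "y : space N" "z : space N" for y z
  using le[of "fst z" "snd z" "snd y"] that by (auto simp: \<phi>_def indicator_def space_pair_measure)
 let ?c = "%r. ennreal (real (Suc r) powr s)"
 have fin2: "(\<Sum>r. ?c r * excursion_cost \<phi> l r y) < \<infinity>" if y: "y : X0 \<times> \<Theta>0" for y l
 proof -
  have yN: "y : space N" using y sets.sets_into_space[OF X0_Theta0] by blast
  have "(fst y, snd y) : X0 \<times> \<Theta>0" using y by simp
  from order.strict_trans1[OF excursion_cost_series[OF \<phi>m yN \<phi>_le] fin[OF this, unfolded prod.collapse]] show ?thesis .
 qed
 have "AE w in M. \<forall>j l. (\<forall>i. \<nu> (j + i) w = l \<and> \<xi> (j + i) w = i) -->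
  (\<Sum>r. ?c (Suc r) * \<phi> ((X (j + Suc r) w, th (j + Suc r) w), (X (j + Suc (Suc r)) w, th (j + Suc (Suc r)) w))) < \<infinity>"
  by (rule excursion_series_finite[where c="?c", OF \<phi>m fin2])
 from this transitions initial_xi show ?thesis
 proof eventually_elim
  case (elim w)
  show ?case
  proof (intro impI, elim conjE)
   assume thC: "\<forall>n. th n w : C" and xi: "\<forall>n\<ge>m. 0 < \<xi> n w"
   obtain j where j: "j < m" "!!i. \<nu> (j + i) w = \<nu> j w \<and> \<xi> (j + i) w = i"
    using last_reprojection[OF elim(2,3) xi] by blast
   define d where "d = m - Suc j"
   have jd: "j + Suc (k + d) = m + k" "j + Suc (Suc (k + d)) = m + Suc k" for k using j(1) by (auto simp: d_def)
   let ?u = "%n. \<psi> (X (Suc n) w, th (Suc n) w, th n w)"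
   have "(\<Sum>r. ?c (Suc r) * ?u (j + Suc r)) < \<infinity>"
    using elim(1)[rule_format, of j "\<nu> j w", OF j(2)] thC by (simp add: \<phi>_def)
   then have "(\<Sum>k. ?c (Suc (k + d)) * ?u (j + Suc (k + d))) < \<infinity>"
    by (rule order.strict_trans1[OF suminf_ennreal_shift_le[of "%r. ?c (Suc r) * ?u (j + Suc r)" d]])
   then have fin': "(\<Sum>k. ?c (Suc (k + d)) * ?u (m + k)) < \<infinity>" unfolding jd .
   define ww where "ww = real (d + 2) powr (- s)"
   have wt: "real (k + 1) powr s <= ww * real (Suc (Suc (k + d))) powr s" for k
   proof -
    have "real (Suc (Suc (k + d))) <= real (d + 2) * real (k + 1)" by (simp add: algebra_simps)
    then have "(real (d + 2) * real (k + 1)) powr s <= real (Suc (Suc (k + d))) powr s" using s by (intro powr_mono2') auto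
    then have "ww * (real (d + 2) powr s * real (k + 1) powr s) <= ww * real (Suc (Suc (k + d))) powr s"
     unfolding powr_mult by (rule mult_left_mono) (simp add: ww_def)
    moreover have "ww * real (d + 2) powr s = 1" unfolding ww_def by (simp only: powr_add[symmetric]) simp
    ultimately show ?thesis by (simp add: mult.assoc[symmetric])
   qed
   have "(\<Sum>k. ennreal (real (k + 1) powr s) * ?u (m + k)) <= (\<Sum>k. ennreal ww * (?c (Suc (k + d)) * ?u (m + k)))"
   proof (intro suminf_le)
    fix k
    have "ennreal (real (k + 1) powr s) <= ennreal ww * ?c (Suc (k + d))"
     using wt[of k] by (subst ennreal_mult[symmetric]) (auto simp: ww_def intro: ennreal_leI)
    then show "ennreal (real (k + 1) powr s) * ?u (m + k) <= ennreal ww * (?c (Suc (k + d)) * ?u (m + k))"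
     unfolding mult.assoc[symmetric] by (rule mult_right_mono) simp
   qed auto
   also have "... = ennreal ww * (\<Sum>k. ?c (Suc (k + d)) * ?u (m + k))" by simp
   also have "... < \<infinity>" using fin' by (simp add: ennreal_mult_less_top)
   finally show "(\<Sum>k. ennreal (real (k + 1) powr s) * \<psi> (X (m + Suc k) w, th (m + Suc k) w, th (m + k) w)) < \<infinity>" by simp
  qed
 qed
qed

end

section \<open>Gaussian mixtures\<close>

text \<open>
 The law of \<open>sqrt (s2) * Z\<close> with a standard normal \<open>Z\<close> independent of \<open>s2\<close>.
\<close>

lemma (in prob_space) gaussian_mixture:
 fixes s2 :: "'a => real"
 assumes s2[measurable]: "s2 : meas M" and nn: "!!w. w : space M ==> 0 <= s2 w"
 obtains \<mu> where "real_distribution \<mu>" "!!t. char \<mu> t = cor (LINT w|M. exp (- (s2 w / 2) * t^2))"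
proof -
 let ?N = "std_normal_distribution"
 interpret N: prob_space ?N by (rule real_dist_normal_dist[THEN real_distribution.axioms(1)])
 interpret MN: pair_prob_space M ?N ..
 define g where "g = (%ww. sqrt (s2 (fst ww)) * (snd ww :: real))"
 have [measurable]: "snd : meas (M \<Otimes>\<^sub>M ?N)" by simp
 have gm[measurable]: "g : meas (M \<Otimes>\<^sub>M ?N)" unfolding g_def by measurable
 define \<mu> where "\<mu> = distr (M \<Otimes>\<^sub>M ?N) borel g"
 have "real_distribution \<mu>" unfolding \<mu>_def by (rule MN.P.real_distribution_distr[OF gm])
 moreover have "char \<mu> t = cor (LINT w|M. exp (- (s2 w / 2) * t^2))" for t
 proof -
  have em: "(%x. exp (\<i> * cor (t * x))) : meas borel" by measurable
  have "char \<mu> t = (LINT ww|(M \<Otimes>\<^sub>M ?N). exp (\<i> * cor (t * g ww)))"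
   unfolding char_def \<mu>_def by (subst integral_distr[OF gm em]) simp
  also have "... = (LINT w|M. (LINT x|?N. exp (\<i> * cor (t * g (w, x)))))"
  proof (rule MN.integral_fst'[symmetric])
   show "integrable (M \<Otimes>\<^sub>M ?N) (%ww. exp (\<i> * cor (t * g ww)))"
    by (rule MN.P.integrable_const_bound[where B=1]) auto
  qed
  also have "... = (LINT w|M. cor (exp (- (s2 w / 2) * t^2)))"
  proof (rule Bochner_Integration.integral_cong[OF refl])
   fix w assume ww: "w : space M"
   have "(LINT x|?N. exp (\<i> * cor (t * g (w, x)))) = char ?N (t * sqrt (s2 w))"
    unfolding char_def by (simp add: g_def mult.assoc)
   also have "... = cor (exp (- (s2 w / 2) * t^2))"
    using nn[OF ww] by (simp add: char_std_normal_distribution power_mult_distrib mult.commute)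
   finally show "(LINT x|?N. exp (\<i> * cor (t * g (w, x)))) = cor (exp (- (s2 w / 2) * t^2))" .
  qed
  also have "... = cor (LINT w|M. exp (- (s2 w / 2) * t^2))" by (rule integral_complex_of_real)
  finally show ?thesis .
 qed
 ultimately show ?thesis using that by blast
qed

section \<open>The central limit theorem for the adaptive chain\<close>

locale adaptive_clt = adaptive_chain M S \<Theta> P K X0 \<Theta>0 proj R X th \<nu> \<xi> x0 \<theta>0 + ergodic_kernels S \<Theta> P \<pi> \<alpha> V
 for M :: "'w measure" and S :: "'a measure" and \<Theta> :: "'p::euclidean_space set" and P :: "'p => 'a => 'a measure" and K :: "nat => 'p set"
  and X0 :: "'a set" and \<Theta>0 :: "'p set" and proj R X th \<nu> \<xi> x0 \<theta>0 \<pi> \<alpha> V +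
 fixes th_star :: "'w => 'p" and f :: "'a => real" and Bf \<beta> \<kappa> \<delta> \<rho> :: real
 assumes open_Theta: "open \<Theta>"
  and drift: "!!C. compact C ==> C \<subseteq> \<Theta> ==> \<exists>b>0. \<exists>c>0. \<forall>x\<in>space S. \<forall>\<theta>\<in>C.
   (NNI y|P \<theta> x. ennreal (V y)) <= ennreal (V x - c * V x powr (1 - \<alpha>) + b)"
  and reprojections: "AE w in M. bdd_above (range (%n. \<nu> n w))"
  and th_star[measurable]: "th_star : measurable M (param_space \<Theta>)"
  and th_converges: "AE w in M. (\<exists>C. compact C \<and> C \<subseteq> \<Theta> \<and> (\<forall>n. th n w : C)) \<and>
   (\<forall>\<beta>'\<in>{0..1 - \<alpha>}. (%n. kernel_D S P V \<beta>' (th n w) (th_star w)) ----> 0)"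
  and beta: "0 <= \<beta>" and f: "dominated \<beta> Bf f" and f_pi: "(LINT x|\<pi>. f x) = 0"
  and kd: "1 < \<kappa>" "\<kappa> < 2" "0 < \<delta>" "\<delta> < 1" "\<beta> + \<alpha> * \<kappa> < 1 / 2" "2 * \<beta> + \<alpha> * (\<kappa> + \<delta>) < 1 - \<alpha>"
  and rho: "1 / 2 < \<rho>" "\<rho> <= 1 / (2 - \<delta>)"
  and diminishing: "!!x \<theta> b l. (x, \<theta>) : X0 \<times> \<Theta>0 ==> b : {0..1 - \<alpha>} ==>
   (NNI ww|chain_law N (%n. R (l + n)) (x, \<theta>). (\<Sum>k. ind {k. 1 <= k \<and> enat k < exit_time (K l) ww} k *
         ennreal (real k powr (\<rho> * (2 - \<delta>) - 1)) *
         kernel_D S P V b (snd (ww k)) (snd (ww (k - 1))) *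
         ennreal (V (fst (ww k)) powr (2 * \<beta> + \<alpha> * (\<kappa> + \<delta>))))) < \<infinity>"
begin

definition asymptotic_variance :: "'p => real" where
 "asymptotic_variance \<theta> = (LINT x|\<pi>. 2 * f x * resolvent S P f 0 x \<theta> - (f x)\<^sup>2)"

text \<open>
 The event \<open>E\<close> of the localized chain started at time \<open>m\<close>; the following \<open>good_until\<close> gives its
 events \<open>G\<close>, the part of this that is known at time \<open>m + n\<close>. That \<open>\<xi> > 0\<close> excludes re-projections.
\<close>

definition good :: "nat => 'p set => real => 'w set" where
 "good m C L = {w : space M. (\<forall>n. th n w : C) \<and> th_star w : C \<and> (\<forall>n\<ge>m. 0 < \<xi> n w) \<and> V (X m w) <= L}"

definition good_until :: "nat => 'p set => real => nat => 'w set" where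
 "good_until m C L n = {w : space M. (\<forall>i\<in>{m..m + n}. th i w : C \<and> 0 < \<xi> i w) \<and> V (X m w) <= L}"

lemma compact_sets: "compact C ==> C \<subseteq> \<Theta> ==> C : sets (param_space \<Theta>)"
 using compact_imp_closed[of C] borel_closed unfolding param_space_def by (auto simp: sets_restrict_space image_iff)

lemma good_sets:
 assumes C: "compact C" "C \<subseteq> \<Theta>"
 shows "good m C L : events" and "good_until m C L n : sets (F (m + n))"
proof -
 note [measurable] = compact_sets[OF C]
 show "good m C L : events" unfolding good_def by measurable
 have [measurable]: "th i : measurable (F (m + n)) (param_space \<Theta>)" "\<xi> i : measurable (F (m + n)) (count_space UNIV)" if "i : {m..m + n}" for i
  using that by (auto intro: filt_le[OF _ coordinates_filt(2)] filt_le[OF _ coordinates_filt(4)])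
 have [measurable]: "X m : measurable (F (m + n)) S" by (rule filt_le[OF _ coordinates_filt(1)]) simp
 have "{w : space (F (m + n)). (\<forall>i\<in>{m..m + n}. th i w : C \<and> 0 < \<xi> i w) \<and> V (X m w) <= L} : sets (F (m + n))" by measurable
 then show "good_until m C L n : sets (F (m + n))" by (simp add: good_until_def)
qed

lemma localized:
 assumes C: "compact C" "C \<subseteq> \<Theta>" and L: "0 < L"
 obtains b0 c0 where "localized_clt S \<Theta> P \<pi> \<alpha> V M (%n. F (m + n)) (%n. X (m + n)) (%n. th (m + n)) th_star
  (good_until m C L) (good m C L) C L b0 c0 f Bf \<beta> \<kappa> \<delta> \<rho>"
proof -
 obtain b0 c0 where d: "0 < b0" "0 < c0" "!!x \<theta>. x : space S ==> \<theta> : C ==>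
   (NNI y|P \<theta> x. ennreal (V y)) <= ennreal (V x - c0 * V x powr (1 - \<alpha>) + b0)" using drift[OF C] by metis
 have "localized_chain S \<Theta> P \<pi> \<alpha> V M (%n. F (m + n)) (%n. X (m + n)) (%n. th (m + n)) th_star
  (good_until m C L) (good m C L) C L b0 c0"
 proof (unfold_locales)
  show "subalgebra M (F (m + n))" for n by (rule mp.subalgebra_filt)
  show "sets (F (m + n)) \<subseteq> sets (F (m + Suc n))" for n using mp.filt_mono[of "m + n"] by simp
  show "X (m + n) : measurable (F (m + n)) S" "th (m + n) : measurable (F (m + n)) (param_space \<Theta>)" for n by (rule coordinates_filt)+
  show "good_until m C L n : sets (F (m + n))" for n by (rule good_sets[OF C])
  show "good_until m C L (Suc n) \<subseteq> good_until m C L n" for n by (auto simp: good_until_def)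
  show "th (m + n) w : C" if "w : good_until m C L n" for n w using that by (auto simp: good_until_def)
  show "V (X (m + 0) w) <= L" if "w : good_until m C L 0" for w using that by (auto simp: good_until_def)
  show "(NNI w|M. ind A w * h ((X (m + n) w, th (m + n) w), X (m + Suc n) w))
   = (NNI w|M. ind A w * (NNI y|P (th (m + n) w) (X (m + n) w). h ((X (m + n) w, th (m + n) w), y)))"
   if "A : sets (F (m + n))" "A \<subseteq> good_until m C L n" "h : meas (N \<Otimes>\<^sub>M S)" for n A h
   using X_marginal[OF kernel that(1) _ that(3)] that(2) by (force simp: good_until_def)
  show "good m C L : events" by (rule good_sets[OF C])
  show "good m C L \<subseteq> good_until m C L n" for n by (auto simp: good_def good_until_def)
  show "th_star w : C" if "w : good m C L" for w using that by (simp add: good_def)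
  show "AE w in M. w : good m C L --> (\<forall>\<beta>'\<in>{0..1 - \<alpha>}. (%n. kernel_D S P V \<beta>' (th (m + n) w) (th_star w)) ----> 0)"
   using th_converges
  proof eventually_elim
   case (elim w)
   then have "(%n. kernel_D S P V b (th (n + m) w) (th_star w)) ----> 0" if "b : {0..1 - \<alpha>}" for b
    using that by (intro LIMSEQ_ignore_initial_segment) auto
   then show ?case by (simp add: add.commute)
  qed
 qed (use d C L in auto)
 moreover have "localized_clt_axioms S \<Theta> P \<pi> \<alpha> V M (%n. X (m + n)) (%n. th (m + n)) (good m C L) C f Bf \<beta> \<kappa> \<delta> \<rho>"
 proof
  fix b \<psi> assume b: "b : {0..1 - \<alpha>}" and \<psi>: "\<psi> : meas (S \<Otimes>\<^sub>M (param_space \<Theta> \<Otimes>\<^sub>M param_space \<Theta>))"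
   and le: "!!x \<theta> \<theta>'. x : space S ==> \<theta> : C ==> \<theta>' : C ==> \<psi> (x, \<theta>, \<theta>') <= kernel_D S P V b \<theta> \<theta>' * ennreal (V x powr (2 * \<beta> + \<alpha> * (\<kappa> + \<delta>)))"
  have s: "\<rho> * (2 - \<delta>) - 1 <= 0" using rho kd by (simp add: field_simps)
  have "AE w in M. (\<forall>n. th n w : C) \<and> (\<forall>n\<ge>m. 0 < \<xi> n w) -->
   (\<Sum>k. ennreal (real (k + 1) powr (\<rho> * (2 - \<delta>) - 1)) * \<psi> (X (m + Suc k) w, th (m + Suc k) w, th (m + k) w)) < \<infinity>"
   by (rule diminishing_adaptation_series[OF s C \<psi> le diminishing[OF _ b]])
  then show "AE w in M. w : good m C L --> (\<Sum>k. ennreal (real (k + 1) powr (\<rho> * (2 - \<delta>) - 1)) * \<psi> (X (m + Suc k) w, th (m + Suc k) w, th (m + k) w)) < \<infinity>"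
   by eventually_elim (auto simp: good_def)
 qed (use beta f f_pi kd rho in auto)
 ultimately show ?thesis using that by (auto simp: localized_clt_def)
qed

text \<open>
 Almost every path stays in some member of a compact exhaustion of \<open>\<Theta>\<close>, is re-projected finitely
 often, and has a finite value \<open>V (X m)\<close>.
\<close>

lemma good_events_exhaust:
 assumes e: "0 < eps"
 obtains m C L where "compact C" "C \<subseteq> \<Theta>" "0 < L" "1 - prob (good m C L) <= eps" "1 <= m"
proof -
 obtain Cs :: "nat => 'p set" where Cs: "!!n. compact (Cs n)" "!!n. Cs n \<subseteq> \<Theta>" "\<Union>(range Cs) = \<Theta>"
  "!!C. compact C ==> C \<subseteq> \<Theta> ==> \<exists>N. \<forall>n\<ge>N. C \<subseteq> Cs n"
  by (rule open_Union_compact_subsets[OF open_Theta]) blast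
 note [measurable] = compact_sets[OF Cs(1,2)]
 define A where "A n = {w : space M. \<not> ((\<forall>i. th i w : Cs n) \<and> th_star w : Cs n \<and> (\<forall>i\<ge>Suc n. 0 < \<xi> i w))}" for n
 have [measurable]: "A n : events" for n unfolding A_def by measurable
 have "(%n. prob (A n)) ----> 0"
 proof (rule prob_tendsto_0_if_eventually_not)
  from th_converges reprojections_finite[OF reprojections] AE_space
  show "AE w in M. EV n. w \<notin> A n"
  proof eventually_elim
   case (elim w)
   then obtain C where C: "compact C" "C \<subseteq> \<Theta>" "!!n. th n w : C" by blast
   obtain n1 where n1: "!!n. n1 <= n ==> C \<subseteq> Cs n" using Cs(4)[OF C(1,2)] by blast
   have "th_star w : \<Theta>" using measurable_space[OF th_star elim(3)] by simp
   then obtain n2 where n2: "!!n. n2 <= n ==> {th_star w} \<subseteq> Cs n" using Cs(4)[of "{th_star w}"] by auto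
   obtain n3 where n3: "!!n. n3 <= n ==> 0 < \<xi> n w" using elim(2) by blast
   show ?case
   proof (rule eventually_sequentiallyI[of "max n1 (max n2 n3)"])
    fix n assume "max n1 (max n2 n3) <= n"
    then show "w \<notin> A n" using n1[of n] n2[of n] n3 C(3) by (auto simp: A_def)
   qed
  qed
 qed measurable
 then have "EV n. prob (A n) < eps / 2" using e by (intro order_tendstoD) auto
 then obtain n where n: "prob (A n) < eps / 2" by (auto simp: eventually_sequentially)
 have "(%l. prob {w : space M. real l < V (X (Suc n) w)}) ----> 0"
 proof (rule prob_tendsto_0_if_eventually_not)
  show "AE w in M. EV l. w \<notin> {w : space M. real l < V (X (Suc n) w)}"
  proof (rule AE_I2)
   fix w
   obtain l :: nat where l: "V (X (Suc n) w) <= real l" using real_arch_simple by blast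
   show "EV l. w \<notin> {w : space M. real l < V (X (Suc n) w)}"
    by (rule eventually_sequentiallyI[of l]) (use l in auto)
  qed
 qed measurable
 then have "EV l. prob {w : space M. real l < V (X (Suc n) w)} < eps / 2" using e by (intro order_tendstoD) auto
 then obtain l where l: "1 <= l" "prob {w : space M. real l < V (X (Suc n) w)} < eps / 2"
  by (auto simp: eventually_sequentially) (metis nat_le_linear)
 have gm: "good (Suc n) (Cs n) (real l) : events" by (rule good_sets[OF Cs(1,2)])
 have "1 - prob (good (Suc n) (Cs n) (real l)) = prob (space M - good (Suc n) (Cs n) (real l))" by (rule prob_compl[OF gm, symmetric])
 also have "... <= prob (A n \<union> {w : space M. real l < V (X (Suc n) w)})"
  by (rule finite_measure_mono) (auto simp: good_def A_def)
 also have "... <= prob (A n) + prob {w : space M. real l < V (X (Suc n) w)}" by (rule measure_Un_le) measurable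
 finally have "1 - prob (good (Suc n) (Cs n) (real l)) <= eps" using n l by linarith
 then show ?thesis using that[of "Cs n" "real l" "Suc n"] Cs l by auto
qed

lemma localized_sig:
 assumes "localized_clt S \<Theta> P \<pi> \<alpha> V M F' X' th' ths G E C L b0 c0 f Bf \<beta> \<kappa> \<delta> \<rho>"
 shows "localized_clt.sig S P \<pi> f \<theta> = asymptotic_variance \<theta>"
proof -
 interpret lc: localized_clt S \<Theta> P \<pi> \<alpha> V M F' X' th' ths G E C L b0 c0 f Bf \<beta> \<kappa> \<delta> \<rho> by (rule assms)
 show ?thesis by (simp add: lc.sig_def lc.hh_def lc.res_def asymptotic_variance_def)
qed

lemma asymptotic_variance_measurable: "(%w. asymptotic_variance (th_star w)) : meas M"
proof -
 obtain m C L where g: "compact C" "C \<subseteq> \<Theta>" "0 < L" "1 - prob (good m C L) <= 1" by (rule good_events_exhaust[of 1]) auto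
 obtain b0 c0 where lc: "localized_clt S \<Theta> P \<pi> \<alpha> V M (%n. F (m + n)) (%n. X (m + n)) (%n. th (m + n)) th_star
  (good_until m C L) (good m C L) C L b0 c0 f Bf \<beta> \<kappa> \<delta> \<rho>" by (rule localized[OF g(1-3)])
 from measurable_compose[OF th_star localized_clt.sig_measurable[OF lc]] show ?thesis by (simp add: localized_sig[OF lc])
qed

text \<open>
 It is nonnegative on each good event, and these exhaust the space.
\<close>

lemma asymptotic_variance_nonneg: "AE w in M. 0 <= asymptotic_variance (th_star w)"
proof -
 note [measurable] = asymptotic_variance_measurable
 let ?A = "{w : space M. asymptotic_variance (th_star w) < 0}"
 have "prob ?A <= eps" if e: "0 < eps" for eps
 proof -
  obtain m C L where g: "compact C" "C \<subseteq> \<Theta>" "0 < L" "1 - prob (good m C L) <= eps" by (rule good_events_exhaust[OF e])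
  obtain b0 c0 where lc: "localized_clt S \<Theta> P \<pi> \<alpha> V M (%n. F (m + n)) (%n. X (m + n)) (%n. th (m + n)) th_star
   (good_until m C L) (good m C L) C L b0 c0 f Bf \<beta> \<kappa> \<delta> \<rho>" by (rule localized[OF g(1-3)])
  have gm[measurable]: "good m C L : events" by (rule good_sets[OF g(1,2)])
  from localized_clt.sig_nonneg[OF lc] have "AE w in M. w : ?A --> w : space M - good m C L"
   by eventually_elim (auto simp: localized_sig[OF lc])
  then have "prob ?A <= prob (space M - good m C L)" by (intro finite_measure_mono_AE) auto
  also have "... = 1 - prob (good m C L)" by (rule prob_compl[OF gm])
  finally show ?thesis using g(4) by linarith
 qed
 then have "prob ?A <= 0" by (rule field_le_epsilon[of "prob ?A" 0, simplified])
 then have "prob ?A = 0" using measure_nonneg[of M ?A] by linarith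
 then have "AE w in M. w \<notin> ?A" by (subst AE_iff_measurable[where N="?A"]) (auto simp: emeasure_eq_measure)
 then show ?thesis using AE_space by eventually_elim auto
qed

text \<open>
 On a good event the limit theorem for the localized chain has an error controlled by the
 probability of the complement, which is arbitrarily small.
\<close>

lemma characteristic_function_limit:
 "(%n. LINT w|M. exp (\<i> * cor (t * (real n powr (- (1/2)) * (\<Sum>k=1..n. f (X k w))))))
  ----> cor (LINT w|M. exp (- t\<^sup>2 * max 0 (asymptotic_variance (th_star w)) / 2))"
proof (rule LIMSEQ_I)
 fix r :: real assume r: "0 < r"
 \<comment> \<open>the total error is 6 * sqrt eps + r / 13 = 7 * r / 13\<close>
 define eps where "eps = (r / 13)^2"
 have e: "0 < eps" using r by (simp add: eps_def)
 obtain m' C L where g: "compact C" "C \<subseteq> \<Theta>" "0 < L" "1 - prob (good m' C L) <= eps" "1 <= m'" by (rule good_events_exhaust[OF e])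
 \<comment> \<open>the sums start with index 1, so U collects the indices before m'\<close>
 obtain m where m: "m' = Suc m" using g(5) by (cases m') auto
 obtain b0 c0 where lc: "localized_clt S \<Theta> P \<pi> \<alpha> V M (%n. F (m' + n)) (%n. X (m' + n)) (%n. th (m' + n)) th_star
   (good_until m' C L) (good m' C L) C L b0 c0 f Bf \<beta> \<kappa> \<delta> \<rho>" by (rule localized[OF g(1-3)])
 note [measurable] = asymptotic_variance_measurable dominatedD(1)[OF f]
 let ?I = "%n. \<integral>w. exp (\<i> * cor (t * (real n powr (- (1/2)) * (\<Sum>k=1..n. f (X k w))))) \<partial>M"
 let ?l = "cor (LINT w|M. exp (- t\<^sup>2 * max 0 (asymptotic_variance (th_star w)) / 2))"
 define U where "U w = (\<Sum>k=1..m. f (X k w))" for w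
 have "EV n. norm ((LINT w|M. exp (\<i> * cor (t * (real n powr (- (1/2)) * (U w + (\<Sum>k<n - m. f (X (m' + k) w))))))) - ?l)
   <= 6 * sqrt (1 - prob (good m' C L)) + r / 13"
 proof (rule localized_clt.clt_on_event[OF lc])
  show "U : meas M" unfolding U_def by measurable
  show "AE w in M. w : good m' C L --> max 0 (asymptotic_variance (th_star w)) = localized_clt.sig S P \<pi> f (th_star w)"
   using asymptotic_variance_nonneg by eventually_elim (simp add: localized_sig[OF lc])
 qed (use r in auto)
 then obtain n0 where n0: "!!n. n0 <= n ==> norm ((LINT w|M. exp (\<i> * cor (t * (real n powr (- (1/2)) * (U w + (\<Sum>k<n - m. f (X (m' + k) w))))))) - ?l)
   <= 6 * sqrt (1 - prob (good m' C L)) + r / 13" by (auto simp: eventually_sequentially)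
 have sq: "sqrt (1 - prob (good m' C L)) <= r / 13"
 proof -
  have "sqrt (1 - prob (good m' C L)) <= sqrt eps" using g(4) by (rule real_sqrt_le_mono)
  then show ?thesis using r by (simp add: eps_def)
 qed
 show "\<exists>no. \<forall>n\<ge>no. norm (?I n - ?l) < r"
 proof (intro exI[of _ "max n0 m"] allI impI)
  fix n assume n: "max n0 m <= n"
  have "U w + (\<Sum>k<n - m. f (X (m' + k) w)) = (\<Sum>k=1..n. f (X k w))" for w
  proof -
   have "(\<Sum>k=1..n. f (X k w)) = U w + (\<Sum>k=Suc m..n. f (X k w))"
    unfolding U_def using n sum.ub_add_nat[of 1 m "%k. f (X k w)" "n - m"] by simp
   also have "(\<Sum>k=Suc m..n. f (X k w)) = (\<Sum>k<n - m. f (X (m' + k) w))"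
    by (rule sum.reindex_bij_witness[of _ "%k. m' + k" "%k. k - m'"]) (auto simp: m)
   finally show ?thesis by simp
  qed
  then have "norm (?I n - ?l) <= 6 * sqrt (1 - prob (good m' C L)) + r / 13" using n0[of n] n by simp
  also have "... < r" using sq r by linarith
  finally show "norm (?I n - ?l) < r" .
 qed
qed

theorem clt:
 "\<exists>\<sigma>2. \<sigma>2 : meas M \<and> (\<forall>w\<in>space M. 0 <= \<sigma>2 w) \<and>
  (\<exists>\<mu>Z. real_distribution \<mu>Z \<and>
    (\<forall>t. char \<mu>Z t = cor (LINT w|M. exp (- (\<sigma>2 w / 2) * t^2))) \<and>
    weak_conv_m (%n. distr M borel (%w. real n powr (- 1 / 2) * (\<Sum>k=1..n. f (X k w)))) \<mu>Z) \<and>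
  (AE w in M. \<sigma>2 w = asymptotic_variance (th_star w))"
proof -
 note [measurable] = asymptotic_variance_measurable dominatedD(1)[OF f]
 \<comment> \<open>the formula is nonnegative almost surely only\<close>
 define \<sigma>2 where "\<sigma>2 w = max 0 (asymptotic_variance (th_star w))" for w
 have [measurable]: "\<sigma>2 : meas M" unfolding \<sigma>2_def by measurable
 have nn: "0 <= \<sigma>2 w" for w by (simp add: \<sigma>2_def)
 obtain \<mu> where \<mu>: "real_distribution \<mu>" "!!t. char \<mu> t = cor (LINT w|M. exp (- (\<sigma>2 w / 2) * t^2))"
  using gaussian_mixture[of \<sigma>2] nn by auto
 have Tm: "(%w. real n powr (- 1 / 2) * (\<Sum>k=1..n. f (X k w))) : meas M" for n by measurable
 have "weak_conv_m (%n. distr M borel (%w. real n powr (- 1 / 2) * (\<Sum>k=1..n. f (X k w)))) \<mu>"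
 proof (rule levy_continuity[OF real_distribution_distr[OF Tm] \<mu>(1)])
  fix t
  have em: "(%x. exp (\<i> * cor (t * x))) : meas borel" by measurable
  have "char (distr M borel (%w. real n powr (- 1 / 2) * (\<Sum>k=1..n. f (X k w)))) t
   = (LINT w|M. exp (\<i> * cor (t * (real n powr (- (1/2)) * (\<Sum>k=1..n. f (X k w))))))" for n
   unfolding char_def by (subst integral_distr[OF Tm em]) simp
  moreover have "char \<mu> t = cor (LINT w|M. exp (- t\<^sup>2 * max 0 (asymptotic_variance (th_star w)) / 2))"
   unfolding \<mu>(2) \<sigma>2_def by (simp add: mult.commute)
  ultimately show "(%n. char (distr M borel (%w. real n powr (- 1 / 2) * (\<Sum>k=1..n. f (X k w)))) t) ----> char \<mu> t"
   using characteristic_function_limit[of t] by simp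
 qed
 moreover have "AE w in M. \<sigma>2 w = asymptotic_variance (th_star w)"
  using asymptotic_variance_nonneg by eventually_elim (simp add: \<sigma>2_def)
 ultimately show ?thesis using \<mu> nn by (intro exI[of _ \<sigma>2] conjI exI[of _ \<mu>]) auto
qed

end

theorem theorem2p3:
  fixes S :: "'a measure" and \<Theta> :: "(real ^ 'q) set"
    and P :: "real ^ 'q \<Rightarrow> 'a \<Rightarrow> 'a measure" and \<pi> :: "'a measure"
    and K :: "nat \<Rightarrow> (real ^ 'q) set"
    and X0 :: "'a set" and \<Theta>0 :: "(real ^ 'q) set"
    and proj :: "'a \<times> (real ^ 'q) \<Rightarrow> 'a \<times> (real ^ 'q)"
    and R :: "nat \<Rightarrow> 'a \<times> (real ^ 'q) \<Rightarrow> ('a \<times> (real ^ 'q)) measure"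
    and M :: "'w measure" and X :: "nat \<Rightarrow> 'w \<Rightarrow> 'a" and th :: "nat \<Rightarrow> 'w \<Rightarrow> real ^ 'q"
    and \<nu> \<xi> :: "nat \<Rightarrow> 'w \<Rightarrow> nat" and x0 :: 'a and \<theta>0 :: "real ^ 'q"
    and \<alpha> \<beta> \<kappa> \<delta> \<rho> :: real and V f :: "'a \<Rightarrow> real" and th_star :: "'w \<Rightarrow> real ^ 'q"
    and a :: "nat \<Rightarrow> real"
  assumes countably_generated: "countably_generated S"
    and open_Theta: "open \<Theta>"
    and kernel_P: "\<And>\<theta>. \<theta> \<in> \<Theta> \<Longrightarrow> P \<theta> \<in> measurable S (prob_algebra S)"
    and measurable_P: "\<And>x A. x \<in> space S \<Longrightarrow> A \<in> sets S \<Longrightarrow>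
      (\<lambda>\<theta>. emeasure (P \<theta> x) A) \<in> borel_measurable (param_space \<Theta>)"
    and prob_pi: "prob_space \<pi>" "sets \<pi> = sets S"
    and invariant_pi: "\<And>\<theta>. \<theta> \<in> \<Theta> \<Longrightarrow> bind \<pi> (P \<theta>) = \<pi>"
    and K: "\<And>n. K n \<noteq> {}" "\<And>n. compact (K n)" "\<And>n. K n \<subseteq> \<Theta>" "\<And>n. K n \<subseteq> K (Suc n)"
    and X0_Theta0: "X0 \<times> \<Theta>0 \<in> sets (S \<Otimes>\<^sub>M param_space \<Theta>)"
    and proj_measurable: "proj \<in> measurable (S \<Otimes>\<^sub>M param_space \<Theta>)
      (restrict_space (S \<Otimes>\<^sub>M param_space \<Theta>) (X0 \<times> \<Theta>0))"
    and proj_id: "\<And>z. z \<in> X0 \<times> \<Theta>0 \<Longrightarrow> proj z = z"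
    and kernel_R: "\<And>n. R n \<in> measurable (S \<Otimes>\<^sub>M param_space \<Theta>)
      (prob_algebra (S \<Otimes>\<^sub>M param_space \<Theta>))"
    and marginal_R: "\<And>n x \<theta> A. x \<in> space S \<Longrightarrow> \<theta> \<in> \<Theta> \<Longrightarrow> A \<in> sets S \<Longrightarrow>
      emeasure (R n (x, \<theta>)) (A \<times> \<Theta>) = emeasure (P \<theta> x) A"
    and init: "(x0, \<theta>0) \<in> X0 \<times> \<Theta>0"
    and prob_M: "prob_space M"
    and adaptive_chain: "is_markov_chain M (adaptive_space S \<Theta>)
      (\<lambda>_. adaptive_kernel S \<Theta> K proj R) (x0, \<theta>0, 0, 0)
      (\<lambda>n \<omega>. (X n \<omega>, th n \<omega>, \<nu> n \<omega>, \<xi> n \<omega>))"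
    and alpha: "0 < \<alpha>" "\<alpha> < 1 / 2"
    and V: "V \<in> borel_measurable S" "\<And>x. x \<in> space S \<Longrightarrow> 1 \<le> V x" "bdd_above (V ` X0)"
    and drift: "\<And>C. compact C \<Longrightarrow> C \<subseteq> \<Theta> \<Longrightarrow> \<exists>b>0. \<exists>c>0. \<forall>x\<in>space S. \<forall>\<theta>\<in>C.
      (\<integral>\<^sup>+y. ennreal (V y) \<partial>P \<theta> x) \<le> ennreal (V x - c * V x powr (1 - \<alpha>) + b)"
    and ergodic: "\<And>C \<beta>' \<kappa>'. compact C \<Longrightarrow> C \<subseteq> \<Theta> \<Longrightarrow> \<beta>' \<in> {0..1 - \<alpha>} \<Longrightarrow>
      \<kappa>' \<in> {0..(1 - \<beta>') / \<alpha> - 1} \<Longrightarrow> \<exists>B. \<forall>n. \<forall>x\<in>space S. \<forall>\<theta>\<in>C.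
      ennreal (real (n + 1) powr \<kappa>') *
        wdist S (\<lambda>y. V y powr \<beta>') (kernel_pow S (P \<theta>) n x) \<pi>
      \<le> ennreal (B * V x powr (\<beta>' + \<alpha> * \<kappa>'))"
    and reprojections: "AE \<omega> in M. bdd_above (range (\<lambda>n. \<nu> n \<omega>))"
    and th_star_measurable: "th_star \<in> measurable M (param_space \<Theta>)"
    and th_converges: "AE \<omega> in M. (\<exists>C. compact C \<and> C \<subseteq> \<Theta> \<and> (\<forall>n. th n \<omega> \<in> C)) \<and>
      (\<forall>\<beta>'\<in>{0..1 - \<alpha>}. (\<lambda>n. kernel_D S P V \<beta>' (th n \<omega>) (th_star \<omega>)) \<longlonglongrightarrow> 0)"
    and beta: "0 \<le> \<beta>" "\<beta> < 1 / 2 - \<alpha>"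
    and f: "f \<in> LW S (\<lambda>x. V x powr \<beta>)" "(\<integral>x. f x \<partial>\<pi>) = 0"
    and kappa_delta: "1 < \<kappa>" "0 < \<delta>" "\<delta> < 1" "2 * \<beta> + \<alpha> * (\<kappa> + \<delta>) < 1 - \<alpha>"
    and rho: "1 / 2 < \<rho>" "\<rho> \<le> 1 / (2 - \<delta>)"
    and a: "\<And>n. 0 < a n" "\<And>n. a n \<le> 1 / 2" "\<exists>c>0. \<forall>n\<ge>1. a n = c * real n powr (- \<rho>)"
    and diminishing: "\<And>x \<theta> b l. (x, \<theta>) \<in> X0 \<times> \<Theta>0 \<Longrightarrow> b \<in> {0..1 - \<alpha>} \<Longrightarrow>
      (\<integral>\<^sup>+w. (\<Sum>k. indicator {k. 1 \<le> k \<and> enat k < exit_time (K l) w} k *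
                 ennreal (real k powr (- 1 + \<rho> * (2 - \<delta>))) *
                 kernel_D S P V b (snd (w k)) (snd (w (k - 1))) *
                 ennreal (V (fst (w k)) powr (2 * \<beta> + \<alpha> * (\<kappa> + \<delta>))))
         \<partial>chain_law (S \<Otimes>\<^sub>M param_space \<Theta>) (\<lambda>n. R (l + n)) (x, \<theta>)) < \<infinity>"
    and lln: "\<And>\<epsilon>. 0 < \<epsilon> \<Longrightarrow>
      (\<lambda>n. measure M {\<omega> \<in> space M. \<epsilon> <
         \<bar>1 / real n * (\<Sum>k=1..n. (resolvent S P f (a n) (X k \<omega>) (th (k - 1) \<omega>))\<^sup>2
            - (\<integral>z. (resolvent S P f (a n) z (th (k - 1) \<omega>))\<^sup>2 \<partial>P (th (k - 1) \<omega>) (X k \<omega>)))\<bar>})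
      \<longlonglongrightarrow> 0"
  shows "\<exists>\<sigma>2 :: 'w \<Rightarrow> real. \<sigma>2 \<in> borel_measurable M \<and> (\<forall>\<omega>\<in>space M. 0 \<le> \<sigma>2 \<omega>) \<and>
    (\<exists>\<mu>Z. real_distribution \<mu>Z \<and>
       (\<forall>t. char \<mu>Z t = complex_of_real (\<integral>\<omega>. exp (- (\<sigma>2 \<omega> / 2) * t\<^sup>2) \<partial>M)) \<and>
       weak_conv_m (\<lambda>n. distr M borel (\<lambda>\<omega>. real n powr (- 1 / 2) * (\<Sum>k=1..n. f (X k \<omega>)))) \<mu>Z) \<and>
    (AE \<omega> in M. \<sigma>2 \<omega> =
       (\<integral>x. 2 * f x * resolvent S P f 0 x (th_star \<omega>) - (f x)\<^sup>2 \<partial>\<pi>))"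
proof -
 obtain Bf where "0 < Bf" and Bf: "!!x. x : space S ==> \<bar>f x\<bar> <= Bf * V x powr \<beta>"
 proof -
  define ww where "ww = wnorm S (%x. V x powr \<beta>) f"
  have ww: "ww < \<infinity>" using f(1) by (simp add: LW_def ww_def)
  \<comment> \<open>one is added because the constants of dominated functions are positive\<close>
  have "\<bar>f x\<bar> <= (enn2real ww + 1) * V x powr \<beta>" if x: "x : space S" for x
  proof -
   have v: "0 < V x powr \<beta>" using V(2)[OF x] by simp
   have "ennreal (\<bar>f x\<bar> / V x powr \<beta>) <= ww" unfolding ww_def wnorm_def using x by (intro SUP_upper)
   also have "ww = ennreal (enn2real ww)" using ww by simp
   finally have "\<bar>f x\<bar> / V x powr \<beta> <= enn2real ww" by (simp add: ennreal_le_iff)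
   then have "\<bar>f x\<bar> <= enn2real ww * V x powr \<beta>" using v by (simp add: pos_divide_le_eq)
   also have "... <= (enn2real ww + 1) * V x powr \<beta>" using v by (intro mult_right_mono) auto
   finally show ?thesis .
  qed
  moreover have "0 < enn2real ww + 1" using enn2real_nonneg[of ww] by linarith
  ultimately show ?thesis using that by blast
 qed
 \<comment> \<open>decreasing \<kappa> weakens the hypotheses on it; since \<beta> + \<alpha> < 1/2, it can be chosen above 1 with \<beta> + \<alpha> * \<kappa>' < 1/2\<close>
 define \<kappa>' where "\<kappa>' = min \<kappa> (min (3/2) (1 + (1/2 - \<alpha> - \<beta>) / (2 * \<alpha>)))"
 have k': "1 < \<kappa>'" "\<kappa>' <= \<kappa>" "\<kappa>' < 2"
  using kappa_delta(1) beta alpha by (auto simp: \<kappa>'_def)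
 have k5: "\<beta> + \<alpha> * \<kappa>' < 1 / 2"
 proof -
  have "\<alpha> * \<kappa>' <= \<alpha> * (1 + (1/2 - \<alpha> - \<beta>) / (2 * \<alpha>))"
   unfolding \<kappa>'_def using alpha by (intro mult_left_mono) auto
  also have "... = \<alpha> + (1/2 - \<alpha> - \<beta>) / 2" using alpha by (simp add: field_simps)
  finally show ?thesis using beta by (simp add: field_simps)
 qed
 have kp: "2 * \<beta> + \<alpha> * (\<kappa>' + \<delta>) <= 2 * \<beta> + \<alpha> * (\<kappa> + \<delta>)" using k'(2) alpha by simp
 interpret ac: adaptive_chain M S \<Theta> P K X0 \<Theta>0 proj R X th \<nu> \<xi> x0 \<theta>0
  by (intro adaptive_chain.intro adaptive_chain_axioms.intro prob_M K X0_Theta0 proj_measurable kernel_R marginal_R init adaptive_chain)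
 have start: "x0 : space S" "\<theta>0 : \<Theta>" using ac.start by (auto simp: space_pair_measure)
 interpret ek: ergodic_kernels S \<Theta> P \<pi> \<alpha> V
 proof (rule ergodic_kernels.intro)
  show "(%z. P (snd z) (fst z)) : measurable (SP S \<Theta>) (prob_algebra S)" by (rule ac.P_joint[OF kernel_P])
  show "\<Theta> \<noteq> {}" "space S \<noteq> {}" using start by auto
 qed (fact prob_pi invariant_pi alpha V ergodic)+
 interpret adaptive_clt M S \<Theta> P K X0 \<Theta>0 proj R X th \<nu> \<xi> x0 \<theta>0 \<pi> \<alpha> V th_star f Bf \<beta> \<kappa>' \<delta> \<rho>
 proof unfold_locales
  show "ek.dominated \<beta> Bf f" using f \<open>0 < Bf\<close> Bf by (simp add: ek.dominated_def LW_def)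
  fix x \<theta> b l assume h: "(x, \<theta>) : X0 \<times> \<Theta>0" "b : {0..1 - \<alpha>}"
  let ?L = "chain_law (SP S \<Theta>) (%n. R (l + n)) (x, \<theta>)"
  have y: "(x, \<theta>) : space (SP S \<Theta>)" using h(1) sets.sets_into_space[OF X0_Theta0] by blast
  interpret L: markov_process ?L "SP S \<Theta>" "%n. R (l + n)" "(x, \<theta>)" "%n ww. ww n"
   by (rule chain_law_markov_process[OF kernel_R y])
  let ?t = "%q ww k. ind {k. 1 <= k \<and> enat k < exit_time (K l) ww} k * ennreal (real k powr (\<rho> * (2 - \<delta>) - 1)) *
   kernel_D S P V b (snd (ww k)) (snd (ww (k - 1))) * ennreal (V (fst (ww k)) powr q)"
  have "(NNI ww|?L. (\<Sum>k. ?t (2 * \<beta> + \<alpha> * (\<kappa>' + \<delta>)) ww k)) <= (NNI ww|?L. (\<Sum>k. ?t (2 * \<beta> + \<alpha> * (\<kappa> + \<delta>)) ww k))"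
  proof (intro nn_integral_mono suminf_le mult_left_mono ennreal_leI ek.V_powr_mono kp)
   fix ww k assume "ww : space ?L"
   from measurable_space[OF L.Z_M[of k] this] show "fst (ww k) : space S" by (simp add: space_pair_measure mem_Times_iff)
  qed auto
  also have "... < \<infinity>" using diminishing[OF h] by (simp add: add.commute[of "- 1"])
  finally show "(NNI ww|?L. (\<Sum>k. ?t (2 * \<beta> + \<alpha> * (\<kappa>' + \<delta>)) ww k)) < \<infinity>" .
 qed (use open_Theta drift reprojections th_star_measurable th_converges beta f kappa_delta rho k' k5 kp in auto)
 from clt show ?thesis unfolding asymptotic_variance_def .
qed

end
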